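(* There is a deterministic algorithm that, given a positive integer $u$ and a multiset $S$ of integers, all lying in $\{1,\dots,u\}$, with $n'$ distinct values and total sum $\sigma$ (counting multiplicities), computes the set $\Sigma_{\le u}(S)=\{\sum_{t\in T} t : T\subseteq S\}\cap\{0,1,\dots,u\}$ of all subset sums of $S$ up to $u$ in time \[O\!\left(\min\left\{\sqrt{n'}\,u\log^{5/2} u,\; u^{4/3}\log^2 u,\; \sigma\log\sigma\log(n'\log u)\right\}\right).\]
   Context: For a multiset $S$, a sub-multiset $T\subseteq S$ uses each value at most as many times as it occurs in $S$, and $\sum_{t\in T}t$ counts multiplicities. The empty sub-multiset has sum $0$. *)

theory Defs
  imports Complex_Main "HOL-Library.Multiset"
begin

definition subset_sums_upto :: "nat \<Rightarrow> nat multiset \<Rightarrow> nat set" where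
  "subset_sums_upto u S = {sum_mset T | T. T \<subseteq># S} \<inter> {0..u}"

text \<open>
  Machine model: a word RAM with finitely many registers per program (instructions name
  registers by constants) and a random access memory, with unit cost per instruction.
  Control flow is structured (conditionals and loops testing \<open><\<close> on two registers).
  The parameter \<open>W\<close> of the semantics is the word capacity: every value ever written must be
  less than \<open>W\<close>.  An instruction producing a larger value has no transition, so an execution
  that overflows does not count as a terminating one.  Addresses are register contents and are
  thereby bounded as well.
\<close>

type_synonym reg = nat

text \<open>\<open>Sub\<close> is truncated subtraction and division by zero yields zero, as on type nat.\<close>

datatype arith = Add | Sub | Mul | Div

fun arith_op :: "arith \<Rightarrow> nat \<Rightarrow> nat \<Rightarrow> nat" where
  "arith_op Add x y = x + y"
| "arith_op Sub x y = x - y"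
| "arith_op Mul x y = x * y"
| "arith_op Div x y = x div y"

datatype com =
    Skip
  | Const reg nat
  | Op arith reg reg reg
  | Load reg reg
  | Store reg reg
  | Seq com com
  | IfLess reg reg com com
  | WhileLess reg reg com

type_synonym state = "(reg \<Rightarrow> nat) \<times> (nat \<Rightarrow> nat)"

text \<open>\<open>exec W c s t s'\<close>: started in \<open>s\<close>, the program \<open>c\<close> halts in \<open>s'\<close> after \<open>t\<close> steps.\<close>

inductive exec :: "nat \<Rightarrow> com \<Rightarrow> state \<Rightarrow> nat \<Rightarrow> state \<Rightarrow> bool" for W :: nat where
  Skip: "exec W Skip s 1 s"
| Const: "n < W \<Longrightarrow> exec W (Const d n) (R, M) 1 (R(d := n), M)"
| Op: "arith_op f (R a) (R b) < W \<Longrightarrow>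
    exec W (Op f d a b) (R, M) 1 (R(d := arith_op f (R a) (R b)), M)"
| Load: "M (R a) < W \<Longrightarrow> exec W (Load d a) (R, M) 1 (R(d := M (R a)), M)"
| Store: "R a < W \<Longrightarrow> R b < W \<Longrightarrow> exec W (Store a b) (R, M) 1 (R, M(R a := R b))"
| Seq: "exec W c1 s t1 s' \<Longrightarrow> exec W c2 s' t2 s'' \<Longrightarrow> exec W (Seq c1 c2) s (t1 + t2) s''"
| IfTrue: "R a < R b \<Longrightarrow> exec W c1 (R, M) t s' \<Longrightarrow>
    exec W (IfLess a b c1 c2) (R, M) (t + 1) s'"
| IfFalse: "\<not> R a < R b \<Longrightarrow> exec W c2 (R, M) t s' \<Longrightarrow>
    exec W (IfLess a b c1 c2) (R, M) (t + 1) s'"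
| WhileTrue: "R a < R b \<Longrightarrow> exec W c (R, M) t1 s' \<Longrightarrow>
    exec W (WhileLess a b c) s' t2 s'' \<Longrightarrow>
    exec W (WhileLess a b c) (R, M) (t1 + t2 + 1) s''"
| WhileFalse: "\<not> R a < R b \<Longrightarrow> exec W (WhileLess a b c) (R, M) 1 (R, M)"

inductive_cases SkipE: "exec W Skip s t s'"
  and ConstE: "exec W (Const d n) s t s'"
  and OpE: "exec W (Op f d a b) s t s'"
  and LoadE: "exec W (Load d a) s t s'"
  and StoreE: "exec W (Store a b) s t s'"
  and SeqE: "exec W (Seq c1 c2) s t s'"
  and IfLessE: "exec W (IfLess a b c1 c2) s t s'"
  and WhileLessE: "exec W (WhileLess a b c) s t s'"

lemma exec_deterministic:
  assumes "exec W c s t s'" "exec W c s u s''"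
  shows "t = u \<and> s' = s''"
  using assms
proof (induction arbitrary: u s'' rule: exec.induct)
  case (Skip s)
  then show ?case by (auto elim: SkipE)
next
  case (Const n d R M)
  from Const.prems show ?case by (rule ConstE) auto
next
  case (Op f R a b d M)
  from Op.prems show ?case by (rule OpE) auto
next
  case (Load M R a d)
  from Load.prems show ?case by (rule LoadE) auto
next
  case (Store R a b M)
  from Store.prems show ?case by (rule StoreE) auto
next
  case (Seq c1 s t1 s' c2 t2 s2)
  from Seq.prems obtain v1 v2 r where
    v: "exec W c1 s v1 r" "exec W c2 r v2 s''" "u = v1 + v2"
    by (rule SeqE)
  have 1: "t1 = v1 \<and> s' = r" by (rule Seq.IH(1)[OF v(1)])
  with v(2) have "exec W c2 s' v2 s''" by (simp only:)
  from Seq.IH(2)[OF this] 1 v(3) show ?case by (simp only:)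
next
  case (IfTrue R a b c1 M t s' c2)
  from IfTrue.prems IfTrue.hyps(1) obtain v where
    v: "exec W c1 (R, M) v s''" "u = v + 1"
    by (auto elim: IfLessE)
  from IfTrue.IH[OF v(1)] v(2) show ?case by (simp only:)
next
  case (IfFalse R a b c2 M t s' c1)
  from IfFalse.prems IfFalse.hyps(1) obtain v where
    v: "exec W c2 (R, M) v s''" "u = v + 1"
    by (auto elim: IfLessE)
  from IfFalse.IH[OF v(1)] v(2) show ?case by (simp only:)
next
  case (WhileTrue R a b c M t1 s' t2 s2)
  from WhileTrue.prems obtain v1 v2 r where
    v: "exec W c (R, M) v1 r" "exec W (WhileLess a b c) r v2 s''" "u = v1 + v2 + 1"
    by (rule WhileLessE) (use WhileTrue.hyps(1) in simp_all)
  have 1: "t1 = v1 \<and> s' = r" by (rule WhileTrue.IH(1)[OF v(1)])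
  with v(2) have "exec W (WhileLess a b c) s' v2 s''" by (simp only:)
  from WhileTrue.IH(2)[OF this] 1 v(3) show ?case by (simp only:)
next
  case (WhileFalse R a b c M)
  from WhileFalse.prems show ?case
    by (rule WhileLessE) (use WhileFalse.hyps in auto)
qed

lemma exec_mono:
  assumes "exec W c s t s'" "W \<le> W'"
  shows "exec W' c s t s'"
  using assms
proof (induction rule: exec.induct)
  case (Seq c1 s t1 s' c2 t2 s'')
  show ?case by (rule exec.Seq[OF Seq.IH]) (use Seq.prems in simp_all)
next
  case (IfTrue R a b c1 M t s' c2)
  show ?case by (rule exec.IfTrue) (use IfTrue in simp_all)
next
  case (IfFalse R a b c2 M t s' c1)
  show ?case by (rule exec.IfFalse) (use IfFalse in simp_all)
next
  case (WhileTrue R a b c M t1 s' t2 s'')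
  show ?case by (rule exec.WhileTrue[OF WhileTrue.hyps(1) WhileTrue.IH]) (use WhileTrue.prems in simp_all)
next
  case (Skip s)
  show ?case by (rule exec.Skip)
next
  case (Const n d R M)
  then show ?case by (intro exec.Const) simp
next
  case (Op f R a b d M)
  then show ?case by (intro exec.Op) simp
next
  case (Load M R a d)
  then show ?case by (intro exec.Load) simp
next
  case (Store R a b M)
  then show ?case by (intro exec.Store) simp_all
next
  case (WhileFalse R a b c M)
  then show ?case by (intro exec.WhileFalse)
qed

text \<open>
  A multiset is presented by listing, in any order, each of its distinct values together with
  its multiplicity.
\<close>

definition represents :: "(nat \<times> nat) list \<Rightarrow> nat multiset \<Rightarrow> bool" where
  "represents ps S \<longleftrightarrow>
    distinct ps \<and> set ps = {(x, count S x) | x. x \<in># S}"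

text \<open>
  Initially register 0 holds \<open>u\<close>, register 1 the number of listed pairs, and the memory holds
  the pairs consecutively from address 0; everything else is 0.
\<close>

definition initial_state :: "nat \<Rightarrow> (nat \<times> nat) list \<Rightarrow> state" where
  "initial_state u ps =
    ((\<lambda>_. 0)(0 := u, 1 := length ps),
     (\<lambda>i. if i < 2 * length ps
          then (if even i then fst (ps ! (i div 2)) else snd (ps ! (i div 2)))
          else 0))"

text \<open>
  On termination a set is output as a repetition-free list in memory: register 0 holds its
  length and register 1 its start address.
\<close>

definition outputs_set :: "state \<Rightarrow> nat set \<Rightarrow> bool" where
  "outputs_set s A \<longleftrightarrow>
    (case s of (R, M) \<Rightarrow>
      let xs = map M [R 1 ..< R 1 + R 0] in distinct xs \<and> set xs = A)"

text \<open>
  Capacity \<open>(u + \<sigma> + 2) ^ k\<close> means words of \<open>O(log (u + \<sigma>))\<close> bits; in particular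
  \<open>u\<close> and all multiplicities fit in one word.
\<close>

definition word_capacity :: "nat \<Rightarrow> nat \<Rightarrow> nat multiset \<Rightarrow> nat" where
  "word_capacity k u S = (u + sum_mset S + 2) ^ k"

text \<open>
  All logarithms are to base 2.  The bound vanishes in some degenerate cases (no elements,
  \<open>u = 1\<close>, \<open>\<sigma> = 1\<close>, or \<open>u = 2\<close> with a single distinct value), which is why running times
  are compared with 1 plus the bound.  For \<open>u = 1\<close> the argument of the outermost logarithm in
  the third term is 0, where \<open>log 2 0 = 0\<close>.
\<close>

definition time_bound :: "nat \<Rightarrow> nat multiset \<Rightarrow> real" where
  "time_bound u S =
    (let n' = real (card (set_mset S));
         \<sigma> = real (sum_mset S)
     in Min {sqrt n' * real u * log 2 (real u) powr (5/2),
             real u powr (4/3) * (log 2 (real u))\<^sup>2,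
             \<sigma> * log 2 \<sigma> * log 2 (n' * log 2 (real u))})"

end

theory Submission
  imports Defs
begin

text \<open>
  Carrying \<open>q\<close> pairs of equal values \<open>v\<close> over to \<open>q\<close> copies of \<open>2 * v\<close> leaves every
  multiplicity at most two without changing the subset sums, and multiplies the number of distinct
  values by at most the bit length of \<open>u\<close>; let \<open>m\<close> be the resulting number of values.  Sets of sums
  are bit vectors, and two of them are combined by one convolution, done by a fast Fourier transform
  on fixed-point complex numbers: all exact results are integers bounded by the vector length, so
  \<open>O(log u)\<close> bits of precision suffice.

  Fix a power of two \<open>r\<close>.  The values below \<open>r\<close> are merged pairwise in a tree, whose levels have
  total length \<open>O(r * min m r)\<close>.  Of the values in \<open>{x..<2 * x}\<close> with \<open>x \<ge> r\<close> at most \<open>u div x\<close>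
  occur in a sum up to \<open>u\<close>.  Recording the number \<open>c\<close> of summands together with the excess of the sum
  over \<open>c * a\<close>, where \<open>a\<close> is the least value of the block, keeps the excess below
  \<open>(u div x) * h\<close> for a block of \<open>h\<close> consecutive values, so that each level of the tree over this
  interval has total length \<open>O(x * (u div x)\<^sup>2) = O(u\<^sup>2 / x)\<close>.  The sum over all \<open>x\<close> is geometric, and the
  cost is \<open>O(u\<^sup>2 / r * (log u)\<^sup>2)\<close> as soon as \<open>r * min m r = O(u\<^sup>2 / r)\<close>.  The least \<open>r\<close> with
  \<open>u\<^sup>2 \<le> r\<^sup>2 * m\<close> and \<open>u\<^sup>2 \<le> r\<^sup>3\<close> gives the first two bounds.  Treating all values as small costs
  \<open>O(\<sigma> * log \<sigma> * log m)\<close>, because the total length is then governed by \<open>\<sigma>\<close>; the program does so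
  whenever this is cheaper.
\<close>

section \<open>A structured language and its compilation\<close>

text \<open>With \<open>m\<close> of order \<open>n' * log u\<close>, the two inequalities on
  \<open>r\<close> say that \<open>r\<close> is at least \<open>u / sqrt m\<close> and at least
  \<open>u powr (2/3)\<close>, so \<open>u\<^sup>2 / r\<close> is at most \<open>u * sqrt m\<close>
  and at most \<open>u powr (4/3)\<close>. The factor \<open>sqrt (log u)\<close> inside
  \<open>sqrt m\<close> turns the squared logarithm into the power 5/2. The third bound contains
  \<open>u\<close> only in its inner logarithm. Therefore all sums are computed with
  \<open>max 1 (min u \<sigma>)\<close> in place of \<open>u\<close>, which makes the logarithm of
  the transform length \<open>O(log \<sigma>)\<close>; the depth of the merging tree supplies the
  other factor, \<open>log m\<close>. The machine offers naturals with truncated subtraction and no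
  roots of unity, which shapes the numerical part: complex numbers carry an offset, every
  intermediate result needs a proof that it stays in range, and the roots come from integer square
  roots. Errors grow by a constant factor per transform level, hence polynomially in the length, and
  a scale polynomial in the length absorbs them. Exponents and constants are chosen generously, not
  tightly.\<close>

datatype ex = Rg nat | Nm nat | Bin arith ex ex | Ld ex

primrec ev :: "ex \<Rightarrow> (nat \<Rightarrow> nat) \<Rightarrow> (nat \<Rightarrow> nat) \<Rightarrow> nat" where
  "ev (Rg r) R M = R r"
| "ev (Nm n) R M = n"
| "ev (Bin f a b) R M = arith_op f (ev a R M) (ev b R M)"
| "ev (Ld a) R M = M (ev a R M)"

abbreviation ex_add (infixl "[+]" 65) where "a [+] b \<equiv> Bin Add a b"
abbreviation ex_sub (infixl "[-]" 65) where "a [-] b \<equiv> Bin Sub a b"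
abbreviation ex_mul (infixl "[*]" 70) where "a [*] b \<equiv> Bin Mul a b"
abbreviation ex_div (infixl "[div]" 70) where "a [div] b \<equiv> Bin Div a b"

datatype st = Asg nat ex | Sto ex ex | Sq st st | Cond ex ex st st | Wh ex ex st

text \<open>The parameter \<open>G\<close> bounds stored values only; intermediate values of expressions are
  unrestricted here and get bounded by a power of \<open>G\<close> on compilation.\<close>

inductive run :: "nat \<Rightarrow> st \<Rightarrow> state \<Rightarrow> nat \<Rightarrow> state \<Rightarrow> bool" for G where
  run_Asg: "ev e R M < G \<Longrightarrow> run G (Asg d e) (R, M) 1 (R(d := ev e R M), M)"
| run_Sto: "ev a R M < G \<Longrightarrow> ev e R M < G \<Longrightarrow>
    run G (Sto a e) (R, M) 1 (R, M(ev a R M := ev e R M))"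
| run_Sq: "run G c1 s t1 s' \<Longrightarrow> run G c2 s' t2 s'' \<Longrightarrow> run G (Sq c1 c2) s (t1 + t2) s''"
| run_CondT: "ev a R M < ev b R M \<Longrightarrow> run G c1 (R, M) t s' \<Longrightarrow>
    run G (Cond a b c1 c2) (R, M) (t + 1) s'"
| run_CondF: "\<not> ev a R M < ev b R M \<Longrightarrow> run G c2 (R, M) t s' \<Longrightarrow>
    run G (Cond a b c1 c2) (R, M) (t + 1) s'"
| run_WhT: "ev a R M < ev b R M \<Longrightarrow> run G c (R, M) t1 s' \<Longrightarrow> run G (Wh a b c) s' t2 s'' \<Longrightarrow>
    run G (Wh a b c) (R, M) (t1 + t2 + 1) s''"
| run_WhF: "\<not> ev a R M < ev b R M \<Longrightarrow> run G (Wh a b c) (R, M) 1 (R, M)"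

inductive_cases run_AsgE: "run G (Asg d e) s t s'"
  and run_StoE: "run G (Sto a e) s t s'"
  and run_SqE: "run G (Sq c1 c2) s t s'"
  and run_CondE: "run G (Cond a b c1 c2) s t s'"

text \<open>The last argument is the time already spent, so \<open>Q\<close> sees absolute time and
  sequential composition needs no addition of costs. Demanding an existing run makes this total
  correctness.\<close>

definition wp :: "nat \<Rightarrow> st \<Rightarrow> ((nat \<Rightarrow> nat) \<Rightarrow> (nat \<Rightarrow> nat) \<Rightarrow> nat \<Rightarrow> bool)
    \<Rightarrow> (nat \<Rightarrow> nat) \<Rightarrow> (nat \<Rightarrow> nat) \<Rightarrow> nat \<Rightarrow> bool" where
  "wp G c Q R M t \<longleftrightarrow> (\<exists>t' R' M'. run G c (R, M) t' (R', M') \<and> Q R' M' (t + t'))"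

lemma wp_mono:
  assumes "wp G c Q R M t" "\<And>R' M' t'. Q R' M' t' \<Longrightarrow> Q' R' M' t'"
  shows "wp G c Q' R M t"
  using assms unfolding wp_def by blast

lemma wp_Asg: "wp G (Asg d e) Q R M t \<longleftrightarrow> ev e R M < G \<and> Q (R(d := ev e R M)) M (t + 1)"
proof
  assume "ev e R M < G \<and> Q (R(d := ev e R M)) M (t + 1)"
  then show "wp G (Asg d e) Q R M t" unfolding wp_def by (blast intro: run_Asg)
qed (auto simp: wp_def elim: run_AsgE)

lemma wp_Sto: "wp G (Sto a e) Q R M t \<longleftrightarrow>
    ev a R M < G \<and> ev e R M < G \<and> Q R (M(ev a R M := ev e R M)) (t + 1)"
proof
  assume "ev a R M < G \<and> ev e R M < G \<and> Q R (M(ev a R M := ev e R M)) (t + 1)"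
  then show "wp G (Sto a e) Q R M t" unfolding wp_def by (blast intro: run_Sto)
qed (auto simp: wp_def elim: run_StoE)

lemma wp_Sq: "wp G (Sq c1 c2) Q R M t \<longleftrightarrow> wp G c1 (wp G c2 Q) R M t"
proof
  assume "wp G (Sq c1 c2) Q R M t"
  then obtain t' R' M' where *: "run G (Sq c1 c2) (R, M) t' (R', M')" "Q R' M' (t + t')"
    unfolding wp_def by blast
  from *(1) obtain t1 s t2 where "run G c1 (R, M) t1 s" "run G c2 s t2 (R', M')" "t' = t1 + t2"
    by (rule run_SqE)
  with *(2) show "wp G c1 (wp G c2 Q) R M t"
    unfolding wp_def by (cases s) (metis add.assoc)
next
  assume "wp G c1 (wp G c2 Q) R M t"
  then obtain t1 R1 M1 t2 R2 M2 where "run G c1 (R, M) t1 (R1, M1)"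
    "run G c2 (R1, M1) t2 (R2, M2)" "Q R2 M2 (t + t1 + t2)"
    unfolding wp_def by blast
  then show "wp G (Sq c1 c2) Q R M t"
    unfolding wp_def by (metis run_Sq add.assoc)
qed

lemma wp_Cond: "wp G (Cond a b c1 c2) Q R M t \<longleftrightarrow>
    (if ev a R M < ev b R M then wp G c1 Q R M (t + 1) else wp G c2 Q R M (t + 1))"
proof
  assume "wp G (Cond a b c1 c2) Q R M t"
  then obtain t' R' M' where *: "run G (Cond a b c1 c2) (R, M) t' (R', M')" "Q R' M' (t + t')"
    unfolding wp_def by blast
  from *(1) show "if ev a R M < ev b R M then wp G c1 Q R M (t + 1) else wp G c2 Q R M (t + 1)"
    by (rule run_CondE) (use *(2) in \<open>auto simp: wp_def add_ac\<close>)
next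
  assume *: "if ev a R M < ev b R M then wp G c1 Q R M (t + 1) else wp G c2 Q R M (t + 1)"
  show "wp G (Cond a b c1 c2) Q R M t"
  proof (cases "ev a R M < ev b R M")
    case True
    with * obtain t' R' M' where "run G c1 (R, M) t' (R', M')" "Q R' M' (t + 1 + t')"
      unfolding wp_def by auto
    with run_CondT[OF True this(1)] show ?thesis
      unfolding wp_def by (metis add.assoc add.commute)
  next
    case False
    with * obtain t' R' M' where "run G c2 (R, M) t' (R', M')" "Q R' M' (t + 1 + t')"
      unfolding wp_def by auto
    with run_CondF[OF False this(1)] show ?thesis
      unfolding wp_def by (metis add.assoc add.commute)
  qed
qed

lemmas wp_simps = wp_Asg wp_Sto wp_Sq wp_Cond

text \<open>Termination comes from the natural-number variant \<open>f\<close> alone; the running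
  time is an ordinary part of the invariant \<open>I\<close>. Each test, including the failing one,
  costs one step.\<close>

lemma wp_Wh:
  fixes f :: "(nat \<Rightarrow> nat) \<Rightarrow> (nat \<Rightarrow> nat) \<Rightarrow> nat"
  assumes "I R M t"
    and step: "\<And>R M t. I R M t \<Longrightarrow> ev a R M < ev b R M \<Longrightarrow>
      wp G c (\<lambda>R' M' t'. I R' M' t' \<and> f R' M' < f R M) R M (t + 1)"
    and exit: "\<And>R M t. I R M t \<Longrightarrow> \<not> ev a R M < ev b R M \<Longrightarrow> Q R M (t + 1)"
  shows "wp G (Wh a b c) Q R M t"
  using assms(1)
proof (induction "f R M" arbitrary: R M t rule: less_induct)
  case less
  show ?case
  proof (cases "ev a R M < ev b R M")
    case True
    obtain t1 R1 M1 where 1: "run G c (R, M) t1 (R1, M1)" "I R1 M1 (t + 1 + t1)"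
      "f R1 M1 < f R M"
      using step[OF less.prems True] unfolding wp_def by blast
    from less.hyps[OF 1(3,2)] obtain t2 R2 M2 where
      2: "run G (Wh a b c) (R1, M1) t2 (R2, M2)" "Q R2 M2 (t + 1 + t1 + t2)"
      unfolding wp_def by blast
    from run_WhT[OF True 1(1) 2(1)] 2(2) show ?thesis
      unfolding wp_def by (metis add.assoc add.commute)
  next
    case False
    with run_WhF[OF False] exit[OF less.prems False] show ?thesis
      unfolding wp_def by blast
  qed
qed

definition For :: "nat \<Rightarrow> ex \<Rightarrow> st \<Rightarrow> st" where
  "For i e c = Sq (Asg i (Nm 0)) (Wh (Rg i) e (Sq c (Asg i (Rg i [+] Nm 1))))"

text \<open>The invariant is indexed by the iteration number and must fix both the counter and the
  value of the bound expression, which is re-evaluated in every test. An iteration costs two steps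
  beyond its body: the test and the increment.\<close>

lemma wp_For:
  assumes "0 < G" and n: "n < G" and init: "I 0 (R(i := 0)) M (t + 1)"
    and IR: "\<And>j R M t. I j R M t \<Longrightarrow> R i = j \<and> ev e R M = n"
    and step: "\<And>j R M t. I j R M t \<Longrightarrow> j < n \<Longrightarrow> R i = j \<Longrightarrow>
      wp G c (\<lambda>R' M' t'. R' i = j \<and> I (Suc j) (R'(i := Suc j)) M' (t' + 1)) R M (t + 1)"
    and fin: "\<And>R M t. I n R M t \<Longrightarrow> Q R M (t + 1)"
  shows "wp G (For i e c) Q R M t"
proof -
  have "wp G (Wh (Rg i) e (Sq c (Asg i (Rg i [+] Nm 1)))) Q (R(i := 0)) M (t + 1)"
  proof (rule wp_Wh[where I = "\<lambda>R M t. \<exists>j\<le>n. I j R M t" and f = "\<lambda>R M. n - R i"])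
    show "\<exists>j\<le>n. I j (R(i := 0)) M (t + 1)" using init by blast
  next
    fix R M t
    assume *: "\<exists>j\<le>n. I j R M t" "ev (Rg i) R M < ev e R M"
    then obtain j where j: "I j R M t" by blast
    with IR[OF j] * have "j < n" "R i = j" by auto
    show "wp G (Sq c (Asg i (Rg i [+] Nm 1)))
        (\<lambda>R' M' t'. (\<exists>j\<le>n. I j R' M' t') \<and> n - R' i < n - R i) R M (t + 1)"
      unfolding wp_Sq
      by (rule wp_mono[OF step[OF j \<open>j < n\<close> \<open>R i = j\<close>]])
        (use \<open>j < n\<close> \<open>R i = j\<close> n in \<open>auto simp: wp_simps intro!: exI[of _ "Suc j"]\<close>)
  next
    fix R M t
    assume *: "\<exists>j\<le>n. I j R M t" "\<not> ev (Rg i) R M < ev e R M"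
    then obtain j where j: "I j R M t" "j \<le> n" by blast
    with IR[OF j(1)] * have "j = n" by auto
    with fin j show "Q R M (t + 1)" by blast
  qed
  then show ?thesis using \<open>0 < G\<close> by (simp add: For_def wp_simps)
qed

section \<open>Compilation of expressions and statements to the RAM\<close>

definition temp :: nat where "temp = 1000"

text \<open>There is no move instruction, so the value is added to a zeroed scratch register.
  \<open>temp + 1\<close> is free once an expression has been evaluated into
  \<open>temp\<close>.\<close>

definition copy_reg :: "nat \<Rightarrow> nat \<Rightarrow> com" where
  "copy_reg d a = Seq (Const (temp + 1) 0) (Op Add d a (temp + 1))"

text \<open>Registers from \<open>d\<close> upwards form an evaluation stack: the left value waits
  in \<open>d\<close> while the right one is computed above it.\<close>

primrec cex :: "ex \<Rightarrow> nat \<Rightarrow> com" where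
  "cex (Rg r) d = Seq (Const d 0) (Op Add d r d)"
| "cex (Nm n) d = Const d n"
| "cex (Bin f a b) d = Seq (cex a d) (Seq (cex b (d + 1)) (Op f d d (d + 1)))"
| "cex (Ld a) d = Seq (cex a d) (Load d d)"

primrec cex_time :: "ex \<Rightarrow> nat" where
  "cex_time (Rg r) = 2"
| "cex_time (Nm n) = 1"
| "cex_time (Bin f a b) = cex_time a + cex_time b + 1"
| "cex_time (Ld a) = cex_time a + 1"

text \<open>Exponent of the size bound: an expression over leaves below \<open>G\<close> stays below
  \<open>G ^ leaves e\<close>, because for two bounds of at least 2 the result of every operation is
  below their product.\<close>

primrec leaves :: "ex \<Rightarrow> nat" where
  "leaves (Rg r) = 1"
| "leaves (Nm n) = 1"
| "leaves (Bin f a b) = leaves a + leaves b"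
| "leaves (Ld a) = leaves a"

primrec wf_ex :: "ex \<Rightarrow> bool" where
  "wf_ex (Rg r) = (r < temp)"
| "wf_ex (Nm n) = (n < 100)"
| "wf_ex (Bin f a b) = (wf_ex a \<and> wf_ex b)"
| "wf_ex (Ld a) = wf_ex a"

lemma leaves_pos: "leaves e > 0"
  by (induction e) auto

text \<open>\<open>R\<close> is the abstract register file and \<open>R1\<close> the concrete one;
  they agree only below \<open>temp\<close>, since scratch registers hold leftovers. Preservation of
  everything below \<open>d\<close> is what protects the stacked values in the induction.\<close>

lemma cex_correct:
  assumes "wf_ex e" "temp \<le> d" "2 \<le> G" "100 \<le> G" "G ^ leaves e \<le> W"
    and "\<And>r. r < temp \<Longrightarrow> R r < G" "\<And>a. M a < G"
    and "\<And>r. r < temp \<Longrightarrow> R1 r = R r"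
  shows "ev e R M < G ^ leaves e \<and> (\<exists>R2. exec W (cex e d) (R1, M) (cex_time e) (R2, M)
      \<and> R2 d = ev e R M \<and> (\<forall>r<d. R2 r = R1 r))"
  using assms
proof (induction e arbitrary: d R1)
  case (Rg r)
  have "exec W (cex (Rg r) d) (R1, M) (1 + 1)
      ((R1(d := 0))(d := arith_op Add ((R1(d := 0)) r) ((R1(d := 0)) d)), M)"
    unfolding cex.simps
    by (rule exec.Seq, rule exec.Const, use Rg in simp, rule exec.Op)
      (use Rg in \<open>auto intro: less_le_trans\<close>)
  then show ?case using Rg by (auto simp: numeral_2_eq_2 intro!: exI[of _ "R1(d := R r)"])
next
  case (Nm n)
  have "exec W (cex (Nm n) d) (R1, M) 1 (R1(d := n), M)"
    unfolding cex.simps by (rule exec.Const) (use Nm in auto)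
  then show ?case using Nm by (auto intro!: exI)
next
  case (Ld a)
  have "\<exists>R2. exec W (cex a d) (R1, M) (cex_time a) (R2, M) \<and> R2 d = ev a R M \<and> (\<forall>r<d. R2 r = R1 r)"
    using Ld.IH[of d R1] Ld.prems by simp
  then obtain R2 where R2: "exec W (cex a d) (R1, M) (cex_time a) (R2, M)"
    "R2 d = ev a R M" "\<forall>r<d. R2 r = R1 r" by blast
  have p: "G \<le> G ^ leaves a" using Ld leaves_pos[of a] by (simp add: self_le_power)
  have "exec W (cex (Ld a) d) (R1, M) (cex_time a + 1) (R2(d := M (R2 d)), M)"
    unfolding cex.simps
    by (rule exec.Seq[OF R2(1)], rule exec.Load)
      (metis Ld.prems(5,7) p leaves.simps(4) less_le_trans)
  moreover have "M (ev a R M) < G ^ leaves a" using Ld.prems(7) p by (rule less_le_trans)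
  ultimately show ?case using Ld.prems R2 by (auto intro!: exI)
next
  case (Bin f a b)
  have le: "G ^ leaves a \<le> G ^ (leaves a + leaves b)" "G ^ leaves b \<le> G ^ (leaves a + leaves b)"
    using Bin.prems by (auto intro!: power_increasing)
  then have le: "G ^ leaves a \<le> W" "G ^ leaves b \<le> W" using Bin.prems(5) by simp_all
  have "ev a R M < G ^ leaves a \<and> (\<exists>R2. exec W (cex a d) (R1, M) (cex_time a) (R2, M)
      \<and> R2 d = ev a R M \<and> (\<forall>r<d. R2 r = R1 r))"
    by (rule Bin.IH(1)[OF _ _ Bin.prems(3,4) le(1)]) (use Bin.prems in auto)
  then obtain R2 where a: "ev a R M < G ^ leaves a" and
    R2: "exec W (cex a d) (R1, M) (cex_time a) (R2, M)" "R2 d = ev a R M" "\<forall>r<d. R2 r = R1 r"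
    by blast
  have "ev b R M < G ^ leaves b \<and> (\<exists>R3. exec W (cex b (d + 1)) (R2, M) (cex_time b) (R3, M)
      \<and> R3 (d + 1) = ev b R M \<and> (\<forall>r<d+1. R3 r = R2 r))"
    by (rule Bin.IH(2)[OF _ _ Bin.prems(3,4) le(2)]) (use Bin.prems R2 in auto)
  then obtain R3 where b: "ev b R M < G ^ leaves b" and
    R3: "exec W (cex b (d + 1)) (R2, M) (cex_time b) (R3, M)" "R3 (d + 1) = ev b R M"
      "\<forall>r<d+1. R3 r = R2 r"
    by blast
  define p q where "p = G ^ leaves a" "q = G ^ leaves b"
  have pq: "2 \<le> p" "2 \<le> q" "ev a R M < p" "ev b R M < q"
    using a b Bin.prems(3) leaves_pos[of a] leaves_pos[of b] self_le_power[of G "leaves a"]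
      self_le_power[of G "leaves b"] unfolding p_q_def by auto
  have "arith_op f (ev a R M) (ev b R M) < p * q"
  proof (cases f)
    case Add
    have "p + q \<le> p * q"
    proof -
      obtain p' q' where "p = p' + 2" "q = q' + 2"
        using pq(1,2) by (metis add.commute le_iff_add)
      then show ?thesis by (simp add: algebra_simps)
    qed
    then show ?thesis using pq Add by simp
  next
    case Sub
    have "p * 1 \<le> p * q" by (rule mult_left_mono) (use pq in auto)
    then have "p \<le> p * q" by simp
    moreover have "ev a R M - ev b R M \<le> ev a R M" by simp
    ultimately show ?thesis using pq Sub by (simp only: arith_op.simps)
  next
    case Mul
    then show ?thesis using pq by (auto intro: mult_strict_mono')
  next
    case Div
    have "p * 1 \<le> p * q" by (rule mult_left_mono) (use pq in auto)
    then have "p \<le> p * q" by simp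
    moreover have "ev a R M div ev b R M \<le> ev a R M" by simp
    ultimately show ?thesis using pq Div by (simp only: arith_op.simps)
  qed
  then have f: "arith_op f (ev a R M) (ev b R M) < G ^ leaves (Bin f a b)"
    by (simp add: p_q_def power_add)
  have "exec W (cex (Bin f a b) d) (R1, M) (cex_time a + (cex_time b + 1))
      (R3(d := arith_op f (R3 d) (R3 (d + 1))), M)"
    unfolding cex.simps
    by (rule exec.Seq[OF R2(1)], rule exec.Seq[OF R3(1)], rule exec.Op)
      (use f Bin.prems(5) R2 R3 in auto)
  then show ?case using f R2 R3 by (auto intro!: exI simp: add.assoc)
qed

text \<open>The RAM loop compares two registers, so the code evaluating both sides runs once before
  the loop and again at the end of every pass.\<close>

primrec cst :: "st \<Rightarrow> com" where
  "cst (Asg d e) = Seq (cex e temp) (copy_reg d temp)"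
| "cst (Sto a e) = Seq (cex a temp) (Seq (cex e (temp + 1)) (Store temp (temp + 1)))"
| "cst (Sq a b) = Seq (cst a) (cst b)"
| "cst (Cond a b c d) = Seq (cex a temp) (Seq (cex b (temp + 1))
    (IfLess temp (temp + 1) (cst c) (cst d)))"
| "cst (Wh a b c) = Seq (Seq (cex a temp) (cex b (temp + 1)))
    (WhileLess temp (temp + 1) (Seq (cst c) (Seq (cex a temp) (cex b (temp + 1)))))"

primrec cst_time :: "st \<Rightarrow> nat" where
  "cst_time (Asg d e) = cex_time e + 2"
| "cst_time (Sto a e) = cex_time a + cex_time e + 1"
| "cst_time (Sq a b) = cst_time a + cst_time b"
| "cst_time (Cond a b c d) = cex_time a + cex_time b + cst_time c + cst_time d + 1"
| "cst_time (Wh a b c) = cex_time a + cex_time b + cst_time c + 1"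

primrec wf_st :: "st \<Rightarrow> bool" where
  "wf_st (Asg d e) = (d < temp \<and> wf_ex e)"
| "wf_st (Sto a e) = (wf_ex a \<and> wf_ex e)"
| "wf_st (Sq a b) = (wf_st a \<and> wf_st b)"
| "wf_st (Cond a b c d) = (wf_ex a \<and> wf_ex b \<and> wf_st c \<and> wf_st d)"
| "wf_st (Wh a b c) = (wf_ex a \<and> wf_ex b \<and> wf_st c)"

primrec width :: "st \<Rightarrow> nat" where
  "width (Asg d e) = leaves e"
| "width (Sto a e) = max (leaves a) (leaves e)"
| "width (Sq a b) = max (width a) (width b)"
| "width (Cond a b c d) = max (max (leaves a) (leaves b)) (max (width c) (width d))"
| "width (Wh a b c) = max (max (leaves a) (leaves b)) (width c)"

lemma width_pos: "0 < width c"
  by (induction c) (auto simp: leaves_pos less_max_iff_disj)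

lemma power_le_mono_exp:
  fixes G W :: nat
  assumes "G ^ w \<le> W" "2 \<le> G" "a \<le> w"
  shows "G ^ a \<le> W"
  using power_increasing[of a w G] assms by linarith

text \<open>The factor \<open>cst_time c\<close> is a constant of the program: an abstract step
  unfolds to boundedly many instructions. The bound \<open>G\<close> on stored values is carried
  along because \<open>cex_correct\<close> needs it at every step of the run.\<close>

lemma cst_correct:
  assumes "run G c s t s'" "wf_st c" "2 \<le> G" "100 \<le> G" "G ^ width c \<le> W"
    and "\<And>r. r < temp \<Longrightarrow> fst s r < G" "\<And>a. snd s a < G"
    and "\<And>r. r < temp \<Longrightarrow> R1 r = fst s r"
  shows "\<exists>R2 t2. exec W (cst c) (R1, snd s) t2 (R2, snd s') \<and> t2 \<le> cst_time c * t
      \<and> (\<forall>r<temp. R2 r = fst s' r) \<and> (\<forall>r<temp. fst s' r < G) \<and> (\<forall>a. snd s' a < G)"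
  using assms
proof (induction arbitrary: R1 rule: run.induct)
  case (run_Asg e R M d)
  obtain R2 where e: "exec W (cex e temp) (R1, M) (cex_time e) (R2, M)"
      "R2 temp = ev e R M" "\<forall>r<temp. R2 r = R1 r"
    using cex_correct[of e temp G W R M R1] run_Asg by auto
  have GW: "G \<le> W" using run_Asg.prems self_le_power[of G "width (Asg d e)"]
      width_pos[of "Asg d e"] by linarith
  let ?R3 = "R2(temp + 1 := 0)"
  have "exec W (copy_reg d temp) (R2, M) (1 + 1)
      (?R3(d := arith_op Add (?R3 temp) (?R3 (temp + 1))), M)"
    unfolding copy_reg_def
    by (rule exec.Seq[OF exec.Const], use GW run_Asg.prems in simp, rule exec.Op)
      (use GW run_Asg e in auto)
  from exec.Seq[OF e(1) this] show ?case
    using e run_Asg by (auto intro!: exI simp: fun_upd_def)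
next
  case (run_Sto a R M e)
  have le: "G ^ leaves a \<le> W" "G ^ leaves e \<le> W"
    using run_Sto.prems(2) by (auto intro!: power_le_mono_exp[OF run_Sto.prems(4)])
  obtain R2 where a: "exec W (cex a temp) (R1, M) (cex_time a) (R2, M)"
      "R2 temp = ev a R M" "\<forall>r<temp. R2 r = R1 r"
    using cex_correct[of a temp G W R M R1] run_Sto le by auto
  obtain R3 where e: "exec W (cex e (temp + 1)) (R2, M) (cex_time e) (R3, M)"
      "R3 (temp + 1) = ev e R M" "\<forall>r<temp+1. R3 r = R2 r"
    using cex_correct[of e "temp + 1" G W R M R2] run_Sto le a by auto
  have GW: "G \<le> W" using run_Sto.prems self_le_power[of G "width (Sto a e)"]
      width_pos[of "Sto a e"] by linarith
  have "exec W (Store temp (temp + 1)) (R3, M) 1 (R3, M(R3 temp := R3 (temp + 1)))"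
    by (rule exec.Store) (use run_Sto e a GW in auto)
  from exec.Seq[OF a(1) exec.Seq[OF e(1) this]]
  have "exec W (cst (Sto a e)) (R1, M) (cex_time a + cex_time e + 1) (R3, M(ev a R M := ev e R M))"
    using e a by (simp add: add.assoc)
  then show ?case using e a run_Sto unfolding fun_upd_def
    by (intro exI[of _ R3] exI[of _ "cex_time a + cex_time e + 1"]) auto
next
  case (run_Sq c1 s t1 s' c2 t2 s'')
  have le: "G ^ width c1 \<le> W" "G ^ width c2 \<le> W"
    using run_Sq.prems(2) by (auto intro!: power_le_mono_exp[OF run_Sq.prems(4)])
  have wf: "wf_st c1" "wf_st c2" using run_Sq.prems by auto
  obtain R2 t2' where 1: "exec W (cst c1) (R1, snd s) t2' (R2, snd s')" "t2' \<le> cst_time c1 * t1"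
      "\<forall>r<temp. R2 r = fst s' r" "\<forall>r<temp. fst s' r < G" "\<forall>a. snd s' a < G"
    using run_Sq.IH(1)[of R1, OF wf(1) run_Sq.prems(2,3) le(1)] run_Sq.prems by blast
  obtain R3 t3' where 2: "exec W (cst c2) (R2, snd s') t3' (R3, snd s'')" "t3' \<le> cst_time c2 * t2"
      "\<forall>r<temp. R3 r = fst s'' r" "\<forall>r<temp. fst s'' r < G" "\<forall>a. snd s'' a < G"
    using run_Sq.IH(2)[of R2, OF wf(2) run_Sq.prems(2,3) le(2)] 1 by blast
  have "t2' + t3' \<le> cst_time (Sq c1 c2) * (t1 + t2)"
    using 1(2) 2(2) by (simp add: algebra_simps)
  then show ?case using exec.Seq[OF 1(1) 2(1)] 2 by (auto intro!: exI)
next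
  case (run_CondT a R M b c1 t s' c2)
  let ?c = "Cond a b c1 c2"
  have le: "G ^ leaves a \<le> W" "G ^ leaves b \<le> W" "G ^ width c1 \<le> W"
    using run_CondT.prems(2) by (auto intro!: power_le_mono_exp[OF run_CondT.prems(4)])
  obtain R2 where a: "exec W (cex a temp) (R1, M) (cex_time a) (R2, M)"
      "R2 temp = ev a R M" "\<forall>r<temp. R2 r = R1 r"
    using cex_correct[of a temp G W R M R1] run_CondT le by auto
  obtain R3 where b: "exec W (cex b (temp + 1)) (R2, M) (cex_time b) (R3, M)"
      "R3 (temp + 1) = ev b R M" "\<forall>r<temp+1. R3 r = R2 r"
    using cex_correct[of b "temp + 1" G W R M R2] run_CondT le a by auto
  obtain R4 t4 where c: "exec W (cst c1) (R3, M) t4 (R4, snd s')" "t4 \<le> cst_time c1 * t"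
      "\<forall>r<temp. R4 r = fst s' r" "\<forall>r<temp. fst s' r < G" "\<forall>a. snd s' a < G"
    using run_CondT.IH[of R3] le a b run_CondT.prems by auto
  have "exec W (IfLess temp (temp + 1) (cst c1) (cst c2)) (R3, M) (t4 + 1) (R4, snd s')"
    by (rule exec.IfTrue) (use a b c run_CondT in auto)
  from exec.Seq[OF a(1) exec.Seq[OF b(1) this]]
  have "exec W (cst ?c) (R1, M) (cex_time a + (cex_time b + (t4 + 1))) (R4, snd s')" by simp
  moreover have "cex_time a + (cex_time b + (t4 + 1)) \<le> cst_time ?c * (t + 1)"
    using c(2) by (simp add: algebra_simps)
  ultimately show ?case using c by (simp only: snd_conv) blast
next
  case (run_CondF a R M b c2 t s' c1)
  let ?c = "Cond a b c1 c2"
  have le: "G ^ leaves a \<le> W" "G ^ leaves b \<le> W" "G ^ width c2 \<le> W"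
    using run_CondF.prems(2) by (auto intro!: power_le_mono_exp[OF run_CondF.prems(4)])
  obtain R2 where a: "exec W (cex a temp) (R1, M) (cex_time a) (R2, M)"
      "R2 temp = ev a R M" "\<forall>r<temp. R2 r = R1 r"
    using cex_correct[of a temp G W R M R1] run_CondF le by auto
  obtain R3 where b: "exec W (cex b (temp + 1)) (R2, M) (cex_time b) (R3, M)"
      "R3 (temp + 1) = ev b R M" "\<forall>r<temp+1. R3 r = R2 r"
    using cex_correct[of b "temp + 1" G W R M R2] run_CondF le a by auto
  obtain R4 t4 where c: "exec W (cst c2) (R3, M) t4 (R4, snd s')" "t4 \<le> cst_time c2 * t"
      "\<forall>r<temp. R4 r = fst s' r" "\<forall>r<temp. fst s' r < G" "\<forall>a. snd s' a < G"
    using run_CondF.IH[of R3] le a b run_CondF.prems by auto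
  have "exec W (IfLess temp (temp + 1) (cst c1) (cst c2)) (R3, M) (t4 + 1) (R4, snd s')"
    by (rule exec.IfFalse) (use a b c run_CondF in auto)
  from exec.Seq[OF a(1) exec.Seq[OF b(1) this]]
  have "exec W (cst ?c) (R1, M) (cex_time a + (cex_time b + (t4 + 1))) (R4, snd s')" by simp
  moreover have "cex_time a + (cex_time b + (t4 + 1)) \<le> cst_time ?c * (t + 1)"
    using c(2) by (simp add: algebra_simps)
  ultimately show ?case using c by (simp only: snd_conv) blast
next
  case (run_WhT a R M b c t1 s' t2 s'')
  let ?c = "Wh a b c"
  have le: "G ^ leaves a \<le> W" "G ^ leaves b \<le> W" "G ^ width c \<le> W"
    using run_WhT.prems(2) by (auto intro!: power_le_mono_exp[OF run_WhT.prems(4)])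
  obtain R2 where a: "exec W (cex a temp) (R1, M) (cex_time a) (R2, M)"
      "R2 temp = ev a R M" "\<forall>r<temp. R2 r = R1 r"
    using cex_correct[of a temp G W R M R1] run_WhT le by auto
  obtain R3 where b: "exec W (cex b (temp + 1)) (R2, M) (cex_time b) (R3, M)"
      "R3 (temp + 1) = ev b R M" "\<forall>r<temp+1. R3 r = R2 r"
    using cex_correct[of b "temp + 1" G W R M R2] run_WhT le a by auto
  obtain R4 t4 where c: "exec W (cst c) (R3, M) t4 (R4, snd s')" "t4 \<le> cst_time c * t1"
      "\<forall>r<temp. R4 r = fst s' r" "\<forall>r<temp. fst s' r < G" "\<forall>a. snd s' a < G"
    using run_WhT.IH(1)[of R3] le a b run_WhT.prems by auto
  obtain R5 t5 where w: "exec W (cst ?c) (R4, snd s') t5 (R5, snd s'')" "t5 \<le> cst_time ?c * t2"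
      "\<forall>r<temp. R5 r = fst s'' r" "\<forall>r<temp. fst s'' r < G" "\<forall>a. snd s'' a < G"
    using run_WhT.IH(2)[of R4] c run_WhT.prems by blast
  \<comment> \<open>The compiled code of the remaining iterations begins with a fresh evaluation of
    the tests. That prefix is split off and counted as the end of the current pass, where the
    compiled loop body has it.\<close>
  let ?pre = "Seq (cex a temp) (cex b (temp + 1))"
  from w(1) obtain s6 t6 t7 where s6: "exec W ?pre (R4, snd s') t6 s6"
      "exec W (WhileLess temp (temp + 1) (Seq (cst c) ?pre)) s6 t7 (R5, snd s'')" "t5 = t6 + t7"
    unfolding cst.simps by (rule SeqE)
  have "exec W (WhileLess temp (temp + 1) (Seq (cst c) ?pre)) (R3, M) ((t4 + t6) + t7 + 1)
      (R5, snd s'')"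
    by (rule exec.WhileTrue[OF _ exec.Seq[OF c(1) s6(1)] s6(2)]) (use a b run_WhT in auto)
  from exec.Seq[OF exec.Seq[OF a(1) b(1)] this]
  have "exec W (cst ?c) (R1, M) (cex_time a + cex_time b + (t4 + t6 + t7 + 1)) (R5, snd s'')"
    by simp
  moreover have "cex_time a + cex_time b + (t4 + t6 + t7 + 1) \<le> cst_time ?c * (t1 + t2 + 1)"
    using c(2) w(2) s6(3) by (simp add: algebra_simps)
  ultimately show ?case using w by (simp only: snd_conv) blast
next
  case (run_WhF a R M b c)
  let ?c = "Wh a b c"
  have le: "G ^ leaves a \<le> W" "G ^ leaves b \<le> W"
    using run_WhF.prems(2) by (auto intro!: power_le_mono_exp[OF run_WhF.prems(4)])
  obtain R2 where a: "exec W (cex a temp) (R1, M) (cex_time a) (R2, M)"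
      "R2 temp = ev a R M" "\<forall>r<temp. R2 r = R1 r"
    using cex_correct[of a temp G W R M R1] run_WhF le by auto
  obtain R3 where b: "exec W (cex b (temp + 1)) (R2, M) (cex_time b) (R3, M)"
      "R3 (temp + 1) = ev b R M" "\<forall>r<temp+1. R3 r = R2 r"
    using cex_correct[of b "temp + 1" G W R M R2] run_WhF le a by auto
  let ?pre = "Seq (cex a temp) (cex b (temp + 1))"
  have "exec W (WhileLess temp (temp + 1) (Seq (cst c) ?pre)) (R3, M) 1 (R3, M)"
    by (rule exec.WhileFalse) (use a b run_WhF in auto)
  from exec.Seq[OF exec.Seq[OF a(1) b(1)] this] show ?case using a b run_WhF
    by (auto intro!: exI)
qed

section \<open>The discrete Fourier transform in bit-reversed order\<close>

text \<open>The base-2 van der Corput sequence: the binary digits of \<open>n\<close> reflected at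
  the radix point. Unlike bit reversal of fixed width it does not depend on the transform length, so
  one table of twiddle factors serves every level.\<close>

fun bitrev :: "nat \<Rightarrow> real" where
  "bitrev n = (if n = 0 then 0 else (bitrev (n div 2) + real (n mod 2)) / 2)"

declare bitrev.simps [simp del]

definition twiddle :: "nat \<Rightarrow> complex" where
  "twiddle n = cis (2 * pi * bitrev n)"

lemma bitrev_0 [simp]: "bitrev 0 = 0"
  by (simp add: bitrev.simps)

lemma bitrev_rec: "2 * bitrev n = bitrev (n div 2) + real (n mod 2)"
  by (cases "n = 0") (auto simp: bitrev.simps[of n])

lemma twiddle_0 [simp]: "twiddle 0 = 1"
  by (simp add: twiddle_def)

lemma norm_twiddle [simp]: "norm (twiddle n) = 1"
  by (simp add: twiddle_def)

lemma twiddle_mult_cnj [simp]: "twiddle n * cnj (twiddle n) = 1"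
  by (simp add: twiddle_def cis_cnj cis_mult)

text \<open>Doubling the angle moves the last binary digit of \<open>n\<close> in front of the radix
  point, where it contributes whole turns only.\<close>

lemma twiddle_square: "twiddle n ^ 2 = twiddle (n div 2)"
proof -
  have "twiddle n ^ 2 = cis (2 * pi * (2 * bitrev n))"
    by (simp add: twiddle_def power2_eq_square cis_mult mult_ac)
  also have "\<dots> = cis (2 * pi * bitrev (n div 2) + 2 * pi * real (n mod 2))"
    by (simp only: bitrev_rec distrib_left)
  also have "\<dots> = cis (2 * pi * bitrev (n div 2)) * cis (2 * pi * real (n mod 2))"
    by (simp only: cis_mult)
  also have "cis (2 * pi * real (n mod 2)) = 1"
    by (cases "even n") (auto simp: odd_iff_mod_2_eq_one even_iff_mod_2_eq_zero)
  finally show ?thesis by (simp add: twiddle_def)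
qed

lemma twiddle_odd: "twiddle (2 * t + 1) = - twiddle (2 * t)"
proof -
  have "bitrev (2 * t + 1) = bitrev (2 * t) + 1 / 2"
    using bitrev_rec[of "2 * t + 1"] bitrev_rec[of "2 * t"] by simp
  then have "twiddle (2 * t + 1) = cis (2 * pi * bitrev (2 * t) + pi)"
    by (simp add: twiddle_def algebra_simps)
  also have "\<dots> = twiddle (2 * t) * cis pi" by (simp only: cis_mult twiddle_def)
  finally show ?thesis by simp
qed

text \<open>The top digit of \<open>2 ^ j + t\<close> becomes the lowest one after reflection. Hence
  the first \<open>2 ^ j\<close> table entries extend to twice as many by a single common
  rotation.\<close>

lemma bitrev_add_power2: "t < 2 ^ j \<Longrightarrow> bitrev (2 ^ j + t) = bitrev t + 1 / 2 ^ (j + 1)"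
proof (induction j arbitrary: t)
  case 0
  then show ?case by (simp add: bitrev.simps[of "Suc 0"])
next
  case (Suc j)
  have "(2 ^ Suc j + t) div 2 = 2 ^ j + t div 2" "(2 ^ Suc j + t) mod 2 = t mod 2"
    by auto
  moreover have "t div 2 < 2 ^ j" using Suc.prems by auto
  ultimately have "2 * bitrev (2 ^ Suc j + t) = bitrev (t div 2) + 1 / 2 ^ (j + 1) + real (t mod 2)"
    using bitrev_rec[of "2 ^ Suc j + t"] Suc.IH[of "t div 2"] by simp
  also have "\<dots> = 2 * bitrev t + 1 / 2 ^ (j + 1)" by (simp add: bitrev_rec)
  finally show ?case by (simp add: field_simps)
qed

lemma twiddle_add_power2: "t < 2 ^ j \<Longrightarrow> twiddle (2 ^ j + t) = twiddle t * cis (pi / 2 ^ j)"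
proof -
  assume "t < 2 ^ j"
  then have "2 * pi * bitrev (2 ^ j + t) = 2 * pi * bitrev t + pi / 2 ^ j"
    unfolding bitrev_add_power2[OF \<open>t < 2 ^ j\<close>] by (simp add: field_simps)
  then show ?thesis by (simp only: twiddle_def cis_mult)
qed

text \<open>When all residues modulo \<open>x\<^sup>m - twiddle t\<close> of a polynomial with \<open>m * D\<close> coefficients \<open>a\<close>
  are taken, \<open>residue a m D t i\<close> is the \<open>i\<close>-th coefficient of the \<open>t\<close>-th one.\<close>

definition residue :: "(nat \<Rightarrow> complex) \<Rightarrow> nat \<Rightarrow> nat \<Rightarrow> nat \<Rightarrow> nat \<Rightarrow> complex" where
  "residue a m D t i = (\<Sum>l<D. a (i + l * m) * twiddle t ^ l)"

lemma sum_lessThan_double: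
  fixes f :: "nat \<Rightarrow> 'a::comm_monoid_add"
  shows "(\<Sum>l<2 * D. f l) = (\<Sum>l<D. f (2 * l)) + (\<Sum>l<D. f (2 * l + 1))"
  by (induction D) (auto simp: add_ac)

text \<open>The factorization of \<open>x ^ (2 * m) - w\<^sup>2\<close> into
  \<open>x ^ m - w\<close> and \<open>x ^ m + w\<close> with \<open>w = twiddle t\<close>: one
  residue of length \<open>2 * m\<close> yields two of length \<open>m\<close>. This is the forward
  butterfly.\<close>

lemma residue_split:
  "residue a m (2 * D) t i =
    residue a (2 * m) D (t div 2) i + twiddle t * residue a (2 * m) D (t div 2) (i + m)"
proof -
  have "twiddle t ^ (2 * l) = twiddle (t div 2) ^ l" for l
    by (simp add: power_mult twiddle_square)
  then show ?thesis
    unfolding residue_def sum_lessThan_double sum_distrib_left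
    by (auto intro!: arg_cong2[where f = "(+)"] sum.cong simp: algebra_simps)
qed

text \<open>The inverse butterfly, together with \<open>residue_diff\<close>. The factor 2 is not
  divided out; over all levels it accumulates to the transform length.\<close>

lemma residue_add:
  "residue a m (2 * D) (2 * t) i + residue a m (2 * D) (2 * t + 1) i = 2 * residue a (2 * m) D t i"
  using twiddle_odd[of t] by (simp add: residue_split)

lemma residue_diff:
  "(residue a m (2 * D) (2 * t) i - residue a m (2 * D) (2 * t + 1) i) * cnj (twiddle (2 * t))
    = 2 * residue a (2 * m) D t (i + m)"
proof -
  have "residue a m (2 * D) (2 * t) i - residue a m (2 * D) (2 * t + 1) i
      = 2 * residue a (2 * m) D t (i + m) * twiddle (2 * t)"
    using twiddle_odd[of t] by (simp add: residue_split)
  then show ?thesis by (simp add: mult.assoc)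
qed

lemma norm_residue_le:
  assumes "\<And>i. norm (a i) \<le> c"
  shows "norm (residue a m D t i) \<le> real D * c"
proof -
  have "norm (residue a m D t i) \<le> (\<Sum>l<D. norm (a (i + l * m) * twiddle t ^ l))"
    unfolding residue_def by (rule norm_sum)
  also have "\<dots> \<le> (\<Sum>l<D. c)"
    by (rule sum_mono) (simp add: norm_mult norm_power assms)
  finally show ?thesis by simp
qed

section \<open>Transforms of indicator vectors and the convolution theorem\<close>

definition indic :: "nat set \<Rightarrow> nat \<Rightarrow> complex" where
  "indic X l = of_bool (l \<in> X)"

definition reps :: "nat set \<Rightarrow> nat set \<Rightarrow> nat \<Rightarrow> nat" where
  "reps X Y l = card {(x, y). x \<in> X \<and> y \<in> Y \<and> x + y = l}"

lemma residue_indic: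
  assumes "X \<subseteq> {..<N}"
  shows "residue (indic X) 1 N t 0 = (\<Sum>x\<in>X. twiddle t ^ x)"
proof -
  have "residue (indic X) 1 N t 0 = (\<Sum>l<N. if l \<in> X then twiddle t ^ l else 0)"
    unfolding residue_def indic_def by (rule sum.cong) auto
  also have "\<dots> = (\<Sum>x\<in>{..<N} \<inter> X. twiddle t ^ x)"
    by (simp add: sum.inter_restrict)
  finally show ?thesis using assms by (simp add: Int_absorb1)
qed

text \<open>With \<open>m = 1\<close> a residue is the value of the polynomial at
  \<open>twiddle t\<close>, and values multiply. As all sums stay below \<open>N\<close>, the
  product polynomial still fits into \<open>N\<close> coefficients and nothing wraps around.\<close>

lemma residue_product:
  assumes "X \<subseteq> {..<N}" "Y \<subseteq> {..<N}" and le: "\<And>x y. x \<in> X \<Longrightarrow> y \<in> Y \<Longrightarrow> x + y < N"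
  shows "residue (indic X) 1 N t 0 * residue (indic Y) 1 N t 0
    = residue (\<lambda>l. of_nat (reps X Y l)) 1 N t 0"
proof -
  let ?w = "twiddle t"
  have fin: "finite X" "finite Y" using assms finite_subset by blast+
  have "residue (indic X) 1 N t 0 * residue (indic Y) 1 N t 0
      = (\<Sum>(x, y)\<in>X \<times> Y. ?w ^ (x + y))"
    unfolding residue_indic[OF assms(1)] residue_indic[OF assms(2)]
    by (simp add: sum_product sum.cartesian_product power_add)
  also have "\<dots> = (\<Sum>l<N. \<Sum>(x, y)\<in>{z \<in> X \<times> Y. fst z + snd z = l}. ?w ^ (x + y))"
    by (rule sum.group[symmetric, of _ _ "\<lambda>z. fst z + snd z"]) (use fin le in auto)
  also have "\<dots> = (\<Sum>l<N. of_nat (reps X Y l) * ?w ^ l)"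
  proof (rule sum.cong[OF refl])
    fix l
    have "{z \<in> X \<times> Y. fst z + snd z = l} = {(x, y). x \<in> X \<and> y \<in> Y \<and> x + y = l}" by auto
    moreover have "(\<Sum>(x, y)\<in>{z \<in> X \<times> Y. fst z + snd z = l}. ?w ^ (x + y))
        = (\<Sum>z\<in>{z \<in> X \<times> Y. fst z + snd z = l}. ?w ^ l)"
      by (rule sum.cong) auto
    ultimately show "(\<Sum>(x, y)\<in>{z \<in> X \<times> Y. fst z + snd z = l}. ?w ^ (x + y))
        = of_nat (reps X Y l) * ?w ^ l"
      by (simp add: reps_def)
  qed
  finally show ?thesis by (simp add: residue_def)
qed

lemma reps_pos_iff:
  assumes "finite X" "finite Y"
  shows "reps X Y l > 0 \<longleftrightarrow> (\<exists>x\<in>X. \<exists>y\<in>Y. x + y = l)"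
proof -
  have "finite {(x, y). x \<in> X \<and> y \<in> Y \<and> x + y = l}"
    by (rule finite_subset[of _ "X \<times> Y"]) (use assms in auto)
  then show ?thesis by (auto simp: reps_def card_gt_0_iff)
qed

lemma reps_le:
  assumes "X \<subseteq> {..<N}"
  shows "reps X Y l \<le> N"
proof -
  have "card {(x, y). x \<in> X \<and> y \<in> Y \<and> x + y = l} \<le> card {..<N}"
    by (rule card_inj_on_le[where f = fst]) (use assms in \<open>auto simp: inj_on_def\<close>)
  then show ?thesis by (simp add: reps_def)
qed

section \<open>Fixed-point complex arithmetic\<close>

text \<open>The pair \<open>X, Y\<close> of naturals stands for the complex number with real part \<open>(X - B) / S\<close> and
  imaginary part \<open>(Y - B) / S\<close>; the offset \<open>B\<close> makes negative values available.\<close>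

locale fixpoint =
  fixes G S B Q Nb :: nat and e0 :: real
  assumes S_pos: "0 < S" and e0: "2 / real S \<le> e0" and e0_small: "64 * real Nb ^ 8 * e0 \<le> 1"
    and B_large: "16 * Nb ^ 4 * S \<le> B" and B_G: "4 * B < G" and Nb: "2 \<le> Nb"
    and Nb_Q: "Nb \<le> Q" and Q_G: "40 * Q < G"
begin

definition cv :: "nat \<Rightarrow> nat \<Rightarrow> complex" where
  "cv X Y = Complex ((real X - real B) / real S) ((real Y - real B) / real S)"

text \<open>The expanded real part of a product of offset numbers. Positive terms are collected
  before the subtraction, so that for operands in range nothing is truncated; \<open>B * S\<close>
  restores the offset and the division by \<open>S\<close> the scale. Here the squares of
  \<open>B\<close> cancel, whereas in \<open>mul_im\<close> two of them remain.\<close>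

definition mul_re :: "nat \<Rightarrow> nat \<Rightarrow> nat \<Rightarrow> nat \<Rightarrow> nat" where
  "mul_re a b c d = (a * c + B * (b + d) + B * S - (b * d + B * (a + c))) div S"

definition mul_im :: "nat \<Rightarrow> nat \<Rightarrow> nat \<Rightarrow> nat \<Rightarrow> nat" where
  "mul_im a b c d = (a * d + b * c + B * B + B * B + B * S - B * (a + b + c + d)) div S"

lemma e0_pos: "0 < e0"
  using e0 S_pos by (meson divide_pos_pos less_le_trans of_nat_0_less_iff zero_less_numeral)

text \<open>\<open>P\<close> is the exact product at scale \<open>S\<^sup>2\<close>. Its size bound
  keeps the natural subtraction from truncating, and the flooring division then loses at most one
  unit at scale \<open>S\<close>.\<close>

lemma fixed_floor:
  fixes P :: real and m n :: nat
  assumes "real m - real n = P + real B * real S" and P: "\<bar>P / (real S)\<^sup>2\<bar> * real S \<le> real B"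
  shows "(m - n) div S < G" "\<bar>(real ((m - n) div S) - real B) / real S - P / (real S)\<^sup>2\<bar> \<le> 1 / real S"
proof -
  have S: "real S > 0" using S_pos by simp
  have "\<bar>P\<bar> = \<bar>P / (real S)\<^sup>2\<bar> * real S * real S"
    using S by (simp add: power2_eq_square abs_mult)
  also have "\<dots> \<le> real B * real S" using mult_right_mono[OF P, of "real S"] by simp
  finally have Pb: "\<bar>P\<bar> \<le> real B * real S" .
  then have "n \<le> m" using assms(1) by linarith
  then have d: "real (m - n) = P + real B * real S" using assms(1) by (simp add: of_nat_diff)
  let ?z = "(m - n) div S"
  have "real ?z * real S \<le> real (m - n)" "real (m - n) < (real ?z + 1) * real S"
  proof -
    have "?z * S \<le> m - n" by simp
    then show "real ?z * real S \<le> real (m - n)" by (metis of_nat_le_iff of_nat_mult)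
    have "m - n < (?z + 1) * S"
      using dividend_less_div_times[OF S_pos, of "m - n"] by simp
    then have "real (m - n) < real ((?z + 1) * S)" by (simp only: of_nat_less_iff)
    then show "real (m - n) < (real ?z + 1) * real S" by (simp add: algebra_simps)
  qed
  with d have z: "(real ?z - real B) * real S \<le> P" "P < (real ?z - real B + 1) * real S"
    by (auto simp: algebra_simps)
  have "(real ?z - real B) * real S \<le> real B * real S" using z(1) Pb by linarith
  then have "real ?z \<le> 2 * real B" using S by simp
  then show "?z < G" using B_G by linarith
  have "(real ?z - real B) / real S \<le> P / (real S)\<^sup>2"
    using z(1) S by (simp add: power2_eq_square divide_simps mult_ac)
  moreover have "P / (real S)\<^sup>2 \<le> (real ?z - real B) / real S + 1 / real S"
    using z(2) S by (simp add: power2_eq_square divide_simps mult_ac)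
  ultimately show "\<bar>(real ?z - real B) / real S - P / (real S)\<^sup>2\<bar> \<le> 1 / real S" by linarith
qed

lemma mul_approx:
  assumes "norm (cv a b * cv c d) * real S \<le> real B"
  shows "mul_re a b c d < G" "mul_im a b c d < G"
    and "norm (cv (mul_re a b c d) (mul_im a b c d) - cv a b * cv c d) \<le> e0"
proof -
  have S: "real S > 0" using S_pos by simp
  let ?z = "cv a b * cv c d"
  define x y v w where "x = real a - B" "y = real b - B" "v = real c - B" "w = real d - B"
  note xy = this
  have cvx: "cv a b = Complex (x / S) (y / S)" "cv c d = Complex (v / S) (w / S)"
    by (simp_all add: cv_def xy)
  have re: "Re ?z = (x * v - y * w) / (real S)\<^sup>2" and im: "Im ?z = (x * w + y * v) / (real S)\<^sup>2"
    by (simp_all add: cvx power2_eq_square diff_divide_distrib add_divide_distrib)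
  have "\<bar>Re ?z\<bar> * S \<le> B" "\<bar>Im ?z\<bar> * S \<le> B"
    using mult_right_mono[OF abs_Re_le_cmod, of S ?z] mult_right_mono[OF abs_Im_le_cmod, of S ?z]
      assms by auto
  note bd = this[unfolded re im]
  note 1 = fixed_floor[OF _ bd(1), of "a * c + B * (b + d) + B * S" "b * d + B * (a + c)",
      folded mul_re_def]
  note 2 = fixed_floor[OF _ bd(2), of "a * d + b * c + B * B + B * B + B * S" "B * (a + b + c + d)",
      folded mul_im_def]
  have 3: "real (a * c + B * (b + d) + B * S) - real (b * d + B * (a + c)) = x * v - y * w + real B * S"
    "real (a * d + b * c + B * B + B * B + B * S) - real (B * (a + b + c + d)) = x * w + y * v + real B * S"
    by (simp_all add: xy algebra_simps)
  show "mul_re a b c d < G" "mul_im a b c d < G" using 1(1)[OF 3(1)] 2(1)[OF 3(2)] .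
  have "norm (cv (mul_re a b c d) (mul_im a b c d) - ?z)
      \<le> \<bar>Re (cv (mul_re a b c d) (mul_im a b c d) - ?z)\<bar>
        + \<bar>Im (cv (mul_re a b c d) (mul_im a b c d) - ?z)\<bar>"
    by (rule cmod_le)
  also have "\<dots> \<le> 1 / real S + 1 / real S"
    using 1(2)[OF 3(1)] 2(2)[OF 3(2)]
    by (intro add_mono) (simp_all only: minus_complex.sel re im, simp_all add: cv_def)
  also have "\<dots> = 2 / real S" by simp
  also have "\<dots> \<le> e0" by (rule e0)
  finally show "norm (cv (mul_re a b c d) (mul_im a b c d) - ?z) \<le> e0" .
qed

text \<open>The offset dominates \<open>16 * Nb ^ 4 * S\<close>, the largest scaled magnitude that
  the transform steps allow, so coordinates of that size lie between 0 and
  \<open>2 * B\<close>.\<close>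

lemma cv_bound:
  assumes "norm (cv a b) \<le> h" "h \<le> 16 * real Nb ^ 4"
  shows "a \<le> 2 * B" "b \<le> 2 * B" and "\<bar>real a - real B\<bar> \<le> h * S" "\<bar>real b - real B\<bar> \<le> h * S"
proof -
  have S: "real S > 0" using S_pos by simp
  have "\<bar>Re (cv a b)\<bar> \<le> h" "\<bar>Im (cv a b)\<bar> \<le> h"
    using assms(1) abs_Re_le_cmod[of "cv a b"] abs_Im_le_cmod[of "cv a b"] by linarith+
  then show *: "\<bar>real a - real B\<bar> \<le> h * S" "\<bar>real b - real B\<bar> \<le> h * S"
    using S by (simp_all add: cv_def divide_simps)
  have "h * S \<le> 16 * real Nb ^ 4 * S" using assms(2) S by (simp add: mult_right_mono)
  also have "\<dots> = real (16 * Nb ^ 4 * S)" by simp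
  also have "\<dots> \<le> real B" using B_large by (simp only: of_nat_le_iff)
  finally show "a \<le> 2 * B" "b \<le> 2 * B" using * by linarith+
qed

lemma cv_add: "B \<le> a + c \<Longrightarrow> B \<le> b + d \<Longrightarrow> cv (a + c - B) (b + d - B) = cv a b + cv c d"
  using S_pos by (simp add: cv_def complex_eq_iff of_nat_diff field_simps)

lemma cv_diff: "c \<le> a + B \<Longrightarrow> d \<le> b + B \<Longrightarrow> cv (a + B - c) (b + B - d) = cv a b - cv c d"
  using S_pos by (simp add: cv_def complex_eq_iff of_nat_diff field_simps)

lemma cv_cnj: "b \<le> 2 * B \<Longrightarrow> cv a (B + B - b) = cnj (cv a b)"
  using S_pos by (simp add: cv_def complex_eq_iff of_nat_diff field_simps)

lemma cv_const: "cv B B = 0" "cv (B + S) B = 1"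
  using S_pos by (simp_all add: cv_def complex_eq_iff)

end

section \<open>The transform as a program\<close>

text \<open>Registers 10, 11, 12 hold \<open>S\<close>, \<open>B\<close>, \<open>Q\<close>.  Memory is divided into areas of size \<open>Q\<close>:
  real and imaginary parts of the roots \<open>cis (pi / 2 ^ j)\<close> (areas 1, 2), of the twiddle factors
  (3, 4), of the two operands (5 to 8) and of a scratch array (9, 10).  Register 60 holds the
  transform length and register 68 the address of the array to be transformed.\<close>

abbreviation area :: "nat \<Rightarrow> ex" where
  "area k \<equiv> Nm k [*] Rg 12"

abbreviation seq (infixr ";;" 60) where "a ;; b \<equiv> Sq a b"

definition CMUL :: st where
  "CMUL =
    Asg 104 ((Rg 100 [*] Rg 102 [+] Rg 11 [*] (Rg 101 [+] Rg 103) [+] Rg 11 [*] Rg 10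
      [-] (Rg 101 [*] Rg 103 [+] Rg 11 [*] (Rg 100 [+] Rg 102))) [div] Rg 10) ;;
    Asg 105 ((Rg 100 [*] Rg 103 [+] Rg 101 [*] Rg 102 [+] Rg 11 [*] Rg 11 [+] Rg 11 [*] Rg 11
      [+] Rg 11 [*] Rg 10 [-] Rg 11 [*] (Rg 100 [+] Rg 101 [+] Rg 102 [+] Rg 103)) [div] Rg 10)"

definition TWIDDLE_STEP :: st where
  "TWIDDLE_STEP =
    For 84 (Rg 80) (
      Asg 100 (Ld (area 3 [+] Rg 84)) ;; Asg 101 (Ld (area 4 [+] Rg 84)) ;; CMUL ;;
      Sto (area 3 [+] Rg 80 [+] Rg 84) (Rg 104) ;;
      Sto (area 4 [+] Rg 80 [+] Rg 84) (Rg 105))"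

definition TWIDDLES :: st where
  "TWIDDLES =
    Sto (area 3) (Rg 11 [+] Rg 10) ;; Sto (area 4) (Rg 11) ;; Asg 80 (Nm 1) ;; Asg 81 (Nm 0) ;;
    Wh (Rg 80) (Rg 60) (
      Asg 102 (Ld (area 1 [+] Rg 81)) ;; Asg 103 (Ld (area 2 [+] Rg 81)) ;; TWIDDLE_STEP ;;
      Asg 80 (Rg 80 [+] Rg 80) ;; Asg 81 (Rg 81 [+] Nm 1))"

text \<open>Register 82 is the number of the residue being produced and register 84 the position of
  its first source coefficient. Remainders are formed as a difference from a rounded-down multiple,
  because the instruction set has no \<open>mod\<close>.\<close>

definition FORWARD_STEP :: st where
  "FORWARD_STEP =
    For 81 (Rg 60) (
      Asg 82 (Rg 81 [div] Rg 80) ;;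
      Asg 84 (Rg 82 [div] Nm 2 [*] (Nm 2 [*] Rg 80) [+] (Rg 81 [-] Rg 82 [*] Rg 80)) ;;
      Asg 100 (Ld (Rg 68 [+] (Rg 84 [+] Rg 80))) ;;
      Asg 101 (Ld (Rg 68 [+] Rg 12 [+] (Rg 84 [+] Rg 80))) ;;
      Asg 102 (Ld (area 3 [+] Rg 82)) ;; Asg 103 (Ld (area 4 [+] Rg 82)) ;; CMUL ;;
      Sto (area 9 [+] Rg 81) (Ld (Rg 68 [+] Rg 84) [+] Rg 104 [-] Rg 11) ;;
      Sto (area 10 [+] Rg 81) (Ld (Rg 68 [+] Rg 12 [+] Rg 84) [+] Rg 105 [-] Rg 11))"

definition COPY_BACK :: st where
  "COPY_BACK =
    For 81 (Rg 60) (
      Sto (Rg 68 [+] Rg 81) (Ld (area 9 [+] Rg 81)) ;;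
      Sto (Rg 68 [+] Rg 12 [+] Rg 81) (Ld (area 10 [+] Rg 81)))"

definition FORWARD :: st where
  "FORWARD =
    Asg 80 (Rg 60) ;;
    Wh (Nm 1) (Rg 80) (Asg 80 (Rg 80 [div] Nm 2) ;; FORWARD_STEP ;; COPY_BACK)"

definition POINTWISE :: st where
  "POINTWISE =
    For 81 (Rg 60) (
      Asg 100 (Ld (area 5 [+] Rg 81)) ;; Asg 101 (Ld (area 6 [+] Rg 81)) ;;
      Asg 102 (Ld (area 7 [+] Rg 81)) ;; Asg 103 (Ld (area 8 [+] Rg 81)) ;; CMUL ;;
      Sto (area 9 [+] Rg 81) (Rg 104) ;; Sto (area 10 [+] Rg 81) (Rg 105))"

definition BACKWARD_STEP :: st where
  "BACKWARD_STEP =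
    For 81 (Rg 60) (
      Asg 82 (Rg 81 [div] (Nm 2 [*] Rg 80)) ;;
      Asg 83 (Rg 81 [-] Rg 82 [*] (Nm 2 [*] Rg 80)) ;;
      Cond (Rg 83) (Rg 80) (
        Asg 84 (Rg 82 [*] (Nm 2 [*] Rg 80) [+] Rg 83) ;;
        Sto (area 9 [+] Rg 81)
          (Ld (Rg 68 [+] Rg 84) [+] Ld (Rg 68 [+] (Rg 84 [+] Rg 80)) [-] Rg 11) ;;
        Sto (area 10 [+] Rg 81)
          (Ld (Rg 68 [+] Rg 12 [+] Rg 84) [+] Ld (Rg 68 [+] Rg 12 [+] (Rg 84 [+] Rg 80)) [-] Rg 11))
      (
        Asg 84 (Rg 82 [*] (Nm 2 [*] Rg 80) [+] (Rg 83 [-] Rg 80)) ;;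
        Asg 100 (Ld (Rg 68 [+] Rg 84) [+] Rg 11 [-] Ld (Rg 68 [+] (Rg 84 [+] Rg 80))) ;;
        Asg 101 (Ld (Rg 68 [+] Rg 12 [+] Rg 84) [+] Rg 11
          [-] Ld (Rg 68 [+] Rg 12 [+] (Rg 84 [+] Rg 80))) ;;
        Asg 102 (Ld (area 3 [+] Nm 2 [*] Rg 82)) ;;
        Asg 103 (Rg 11 [+] Rg 11 [-] Ld (area 4 [+] Nm 2 [*] Rg 82)) ;; CMUL ;;
        Sto (area 9 [+] Rg 81) (Rg 104) ;; Sto (area 10 [+] Rg 81) (Rg 105)))"

definition BACKWARD :: st where
  "BACKWARD =
    Asg 80 (Nm 1) ;;
    Wh (Rg 80) (Rg 60) (BACKWARD_STEP ;; COPY_BACK ;; Asg 80 (Rg 80 [+] Rg 80))"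

section \<open>Frame conditions and propagation of rounding errors\<close>

definition same :: "nat set \<Rightarrow> (nat \<Rightarrow> nat) \<Rightarrow> (nat \<Rightarrow> nat) \<Rightarrow> bool" where
  "same X f g \<longleftrightarrow> (\<forall>x. x \<notin> X \<longrightarrow> f x = g x)"

lemma same_refl [simp]: "same X f f"
  by (simp add: same_def)

lemma same_trans:
  assumes "same X f g" "same Y g h" "X \<subseteq> Z" "Y \<subseteq> Z"
  shows "same Z f h"
  unfolding same_def
proof (intro allI impI)
  fix x assume "x \<notin> Z"
  then have "x \<notin> X" "x \<notin> Y" using assms(3,4) by auto
  then show "f x = h x" using assms(1,2) by (simp add: same_def)
qed

lemma same_mono: "same X f g \<Longrightarrow> X \<subseteq> Z \<Longrightarrow> same Z f g"
  unfolding same_def by blast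

lemma same_upd: "same X f g \<Longrightarrow> x \<in> X \<Longrightarrow> same X (f(x := y)) g"
  unfolding same_def by auto

lemma same_eq: "same X f g \<Longrightarrow> x \<notin> X \<Longrightarrow> f x = g x"
  by (simp add: same_def)

text \<open>In the applications \<open>w\<close> is a root of unity. The perturbed \<open>w'\<close>
  then has norm at most 2, which is the coefficient of the incoming error \<open>e\<close>.\<close>

lemma approx_mult:
  fixes x y x' w :: "'a::real_normed_field"
  assumes "norm (x' - x) \<le> e" "norm (w' - w) \<le> d" "norm x \<le> h" "norm w \<le> 1" "d \<le> 1"
  shows "norm (x' * w' - x * w) \<le> 2 * e + h * d"
proof -
  have "norm w' \<le> 2" using assms(2,4,5) norm_triangle_sub[of w' w] by linarith
  have "x' * w' - x * w = (x' - x) * w' + x * (w' - w)" by (simp add: algebra_simps)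
  then have "norm (x' * w' - x * w) \<le> norm (x' - x) * norm w' + norm x * norm (w' - w)"
    by (simp only: norm_mult[symmetric] norm_triangle_ineq)
  also have "\<dots> \<le> e * 2 + h * d"
    using assms \<open>norm w' \<le> 2\<close> order_trans[OF norm_ge_zero assms(1)] order_trans[OF norm_ge_zero assms(3)]
    by (intro add_mono mult_mono) auto
  finally show ?thesis by simp
qed

lemma norm_mult_le:
  fixes x y :: "'a::real_normed_field"
  assumes "norm x \<le> a" "norm y \<le> b"
  shows "norm (x * y) \<le> a * b"
  unfolding norm_mult using assms order_trans[OF norm_ge_zero assms(1)] by (intro mult_mono) auto

lemma norm_close_le:
  fixes x y :: "'a::real_normed_vector"
  assumes "norm (x' - x) \<le> e" "norm x \<le> h"
  shows "norm x' \<le> h + e"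
  using assms norm_triangle_sub[of x' x] by linarith

context fixpoint
begin

definition consts_ok :: "(nat \<Rightarrow> nat) \<Rightarrow> bool" where
  "consts_ok R \<longleftrightarrow> R 10 = S \<and> R 11 = B \<and> R 12 = Q"

text \<open>An array at \<open>b\<close> has its real parts there and its imaginary parts one area,
  that is \<open>Q\<close> cells, further on.\<close>

definition approx :: "(nat \<Rightarrow> nat) \<Rightarrow> nat \<Rightarrow> nat \<Rightarrow> (nat \<Rightarrow> complex) \<Rightarrow> real \<Rightarrow> bool" where
  "approx M b n f e \<longleftrightarrow> (\<forall>p<n. norm (cv (M (b + p)) (M (b + Q + p)) - f p) \<le> e)"

lemma G_pos: "0 < G" using B_G by simp

lemma approx_store:
  assumes "approx M b n f e" "norm (cv x y - f n) \<le> e" "n < Q" "a = b + n" "a' = b + Q + n"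
  shows "approx (M(a := x, a' := y)) b (Suc n) f e"
  unfolding approx_def
proof (intro allI impI)
  fix p assume "p < Suc n"
  then show "norm (cv ((M(a := x, a' := y)) (b + p)) ((M(a := x, a' := y)) (b + Q + p)) - f p) \<le> e"
    using assms by (cases "p = n") (auto simp: approx_def)
qed

lemma approx_same:
  assumes "approx M b n f e" "same {lo..<hi} M' M" "b + Q + n \<le> lo \<or> hi \<le> b" "n \<le> Q"
  shows "approx M' b n f e"
  using assms by (auto simp: approx_def same_eq[OF assms(2)])

lemma approx_mono: "approx M b n f e \<Longrightarrow> e \<le> e' \<Longrightarrow> approx M b n f e'"
  unfolding approx_def by (meson order_trans)

lemma approxD: "approx M b n f e \<Longrightarrow> p < n \<Longrightarrow> norm (cv (M (b + p)) (M (b + Q + p)) - f p) \<le> e"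
  by (simp add: approx_def)

lemma e0_le_1: "e0 \<le> 1"
proof -
  have "1 * e0 \<le> 64 * real Nb ^ 8 * e0"
    using Nb e0_pos by (intro mult_right_mono) (auto intro: order_trans[of _ "64 * 1"])
  then show ?thesis using e0_small by linarith
qed

text \<open>The common shape of the butterfly and pointwise loops. Results go to areas 9 and 10
  only, so every iteration finds its operands in their original state \<open>M\<close> and the body
  can be verified for one position in isolation.\<close>

lemma wp_map:
  assumes N: "R 60 = N" "N \<le> Q" "60 \<notin> X" "81 \<in> X"
    and body: "\<And>j R1 M1 t1. j < N \<Longrightarrow> same X R1 R \<Longrightarrow> R1 81 = j \<Longrightarrow> same {9 * Q..<11 * Q} M1 M \<Longrightarrow>
      wp G c (\<lambda>R2 M2 t2. \<exists>x y. M2 = M1(9 * Q + j := x, 10 * Q + j := y) \<and> norm (cv x y - f j) \<le> e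
        \<and> same X R2 R \<and> R2 81 = j \<and> t2 \<le> t1 + k) R1 M1 t1"
  shows "wp G (For 81 (Rg 60) c) (\<lambda>R' M' t'. approx M' (9 * Q) N f e \<and> same X R' R
    \<and> same {9 * Q..<11 * Q} M' M \<and> t' \<le> t + 2 + (k + 2) * N) R M t"
proof (rule wp_For[where n = N and I = "\<lambda>j R' M' t'. R' 81 = j \<and> same X R' R \<and>
    same {9 * Q..<11 * Q} M' M \<and> approx M' (9 * Q) j f e \<and> t' \<le> t + 1 + (k + 2) * j"])
  fix j R' M' t'
  assume I: "R' 81 = j \<and> same X R' R \<and> same {9 * Q..<11 * Q} M' M \<and> approx M' (9 * Q) j f e
      \<and> t' \<le> t + 1 + (k + 2) * j" and j: "j < N"
  show "wp G c (\<lambda>R' M' t'. R' 81 = j \<and> (R'(81 := Suc j)) 81 = Suc j \<and> same X (R'(81 := Suc j)) R \<and>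
      same {9 * Q..<11 * Q} M' M \<and> approx M' (9 * Q) (Suc j) f e \<and>
      t' + 1 \<le> t + 1 + (k + 2) * Suc j) R' M' (t' + 1)"
  proof (rule wp_mono[OF body[of j R' M' "t' + 1"]])
    fix R2 M2 t2
    assume "\<exists>x y. M2 = M'(9 * Q + j := x, 10 * Q + j := y) \<and> norm (cv x y - f j) \<le> e
        \<and> same X R2 R \<and> R2 81 = j \<and> t2 \<le> t' + 1 + k"
    then obtain x y where *: "M2 = M'(9 * Q + j := x, 10 * Q + j := y)" "norm (cv x y - f j) \<le> e"
      "same X R2 R" "R2 81 = j" "t2 \<le> t' + 1 + k" by blast
    have "approx M2 (9 * Q) (Suc j) f e"
      unfolding *(1) by (rule approx_store) (use I * j N in auto)
    moreover have "same {9 * Q..<11 * Q} M2 M"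
      unfolding *(1) using I j N by (intro same_upd) auto
    ultimately show "R2 81 = j \<and> (R2(81 := Suc j)) 81 = Suc j \<and> same X (R2(81 := Suc j)) R \<and>
      same {9 * Q..<11 * Q} M2 M \<and> approx M2 (9 * Q) (Suc j) f e \<and>
      t2 + 1 \<le> t + 1 + (k + 2) * Suc j"
      using I * N same_upd[of X R2 R 81 "Suc j"] by (auto simp: algebra_simps)
  qed (use I j in auto)
next
  show "N < G" using N Q_G by linarith
  show "0 < G" by (rule G_pos)
  show "(R(81 := 0)) 81 = 0 \<and> same X (R(81 := 0)) R \<and> same {9 * Q..<11 * Q} M M \<and>
      approx M (9 * Q) 0 f e \<and> t + 1 \<le> t + 1 + (k + 2) * 0"
    using same_upd[OF same_refl N(4)] by (simp add: approx_def)
next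
  fix j R' M' t'
  assume "R' 81 = j \<and> same X R' R \<and> same {9 * Q..<11 * Q} M' M \<and> approx M' (9 * Q) j f e \<and>
    t' \<le> t + 1 + (k + 2) * j"
  then show "R' 81 = j \<and> ev (Rg 60) R' M' = N" using N same_eq[of X R' R 60] by simp
qed simp

lemma S_le_B: "S \<le> B"
proof -
  have "1 * S \<le> 16 * Nb ^ 4 * S" using Nb by (intro mult_right_mono) auto
  then show ?thesis using B_large by linarith
qed

lemma scaled_le:
  assumes "h \<le> 16 * real Nb ^ 4"
  shows "h * real S \<le> real B"
proof -
  have "h * S \<le> 16 * real Nb ^ 4 * S" using assms by (simp add: mult_right_mono)
  also have "\<dots> = real (16 * Nb ^ 4 * S)" by simp
  also have "\<dots> \<le> real B" using B_large by (simp only: of_nat_le_iff)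
  finally show ?thesis .
qed

lemma power_Nb_le:
  assumes "N \<le> Nb" "i \<le> j"
  shows "real N ^ i \<le> real Nb ^ j"
proof -
  have "real N ^ i \<le> real Nb ^ i" using assms by (intro power_mono) auto
  also have "\<dots> \<le> real Nb ^ j" using assms Nb by (intro power_increasing) auto
  finally show ?thesis .
qed

text \<open>Hides the computed digits: a caller learns only that some pair within \<open>e0\<close>
  of the product is produced.\<close>

lemma wp_CMUL:
  assumes "consts_ok R" "norm (cv (R 100) (R 101) * cv (R 102) (R 103)) \<le> h" "h \<le> 16 * real Nb ^ 4"
    and "\<And>x y. x < G \<Longrightarrow> y < G \<Longrightarrow>
      norm (cv x y - cv (R 100) (R 101) * cv (R 102) (R 103)) \<le> e0 \<Longrightarrow>
      P (R(104 := x, 105 := y)) M (t + 2)"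
  shows "wp G CMUL P R M t"
proof -
  have "norm (cv (R 100) (R 101) * cv (R 102) (R 103)) * S \<le> real B"
    by (rule order_trans[OF mult_right_mono[OF assms(2) of_nat_0_le_iff] scaled_le[OF assms(3)]])
  from mul_approx[OF this] assms(4)
  have "P (R(104 := mul_re (R 100) (R 101) (R 102) (R 103),
      105 := mul_im (R 100) (R 101) (R 102) (R 103))) M (t + 2)" by blast
  moreover note mul_approx(1,2)[OF \<open>norm (cv (R 100) (R 101) * cv (R 102) (R 103)) * S \<le> real B\<close>]
  ultimately show ?thesis
    using assms(1) unfolding CMUL_def wp_simps consts_ok_def
    by (simp add: mul_re_def mul_im_def numeral_2_eq_2)
qed

text \<open>By \<open>twiddle_add_power2\<close> the upper half of the table is the lower half
  rotated by one stored root. One \<open>e0\<close> in the new error stems from that root, the other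
  from rounding the product.\<close>

lemma TWIDDLE_STEP_spec:
  assumes "consts_ok R" "R 80 = 2 ^ j" "2 * 2 ^ j \<le> Nb"
    and z: "norm (cv (R 102) (R 103) - cis (pi / 2 ^ j)) \<le> e0"
    and a: "approx M (3 * Q) (2 ^ j) twiddle e" "e \<le> 1"
  shows "wp G TWIDDLE_STEP (\<lambda>R' M' t'. same {84, 100, 101, 104, 105} R' R \<and>
    approx M' (3 * Q) (2 * 2 ^ j) twiddle (2 * e + 2 * e0) \<and> same {3 * Q..<5 * Q} M' M \<and>
    t' = t + 2 + 8 * 2 ^ j) R M t"
proof -
  let ?w = "2 ^ j :: nat"
  define I where "I = (\<lambda>i R' M' t'. same {84, 100, 101, 104, 105} R' R \<and> R' 84 = i \<and>
    (\<forall>p<?w. M' (3 * Q + p) = M (3 * Q + p) \<and> M' (4 * Q + p) = M (4 * Q + p)) \<and>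
    approx M' (3 * Q) (?w + i) twiddle (2 * e + 2 * e0) \<and> same {3 * Q..<5 * Q} M' M \<and>
    t' = t + 1 + 8 * i)"
  have QG: "?w \<le> Q" "?w + ?w \<le> Q" "5 * Q < G" using assms(3) Nb_Q Q_G by auto
  have e_nonneg: "0 \<le> e"
  proof -
    have "norm (cv (M (3 * Q + 0)) (M (3 * Q + Q + 0)) - twiddle 0) \<le> e"
      using a(1)[unfolded approx_def, rule_format, of 0] by simp
    then show ?thesis by (rule order_trans[OF norm_ge_zero])
  qed
  note e01 = e0_le_1
  show ?thesis
    unfolding TWIDDLE_STEP_def
  proof (rule wp_For[where n = ?w and I = I])
    show "0 < G" "?w < G" using QG by auto
    show "I 0 (R(84 := 0)) M (t + 1)"
      using a e_nonneg e0_pos unfolding I_def approx_def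
      by (auto simp: same_def intro: order_trans)
  next
    fix i R' M' t'
    assume "I i R' M' t'"
    then show "R' 84 = i \<and> ev (Rg 80) R' M' = ?w" using assms(2) by (simp add: I_def same_def)
  next
    fix R' M' t'
    assume "I ?w R' M' t'"
    then show "same {84, 100, 101, 104, 105} R' R \<and>
        approx M' (3 * Q) (2 * ?w) twiddle (2 * e + 2 * e0) \<and> same {3 * Q..<5 * Q} M' M \<and>
        t' + 1 = t + 2 + 8 * ?w" by (simp add: I_def mult_2[symmetric])
  next
    fix i R' M' t'
    assume I: "I i R' M' t'" and i: "i < ?w" "R' 84 = i"
    from I have s: "same {84, 100, 101, 104, 105} R' R" by (simp add: I_def)
    have regs: "R' 10 = S" "R' 11 = B" "R' 12 = Q" "R' 80 = ?w" "R' 102 = R 102" "R' 103 = R 103"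
      using assms(1,2) by (simp_all add: same_eq[OF s] consts_ok_def)
    have ok: "consts_ok (R'(100 := x, 101 := y))" for x y using regs by (simp add: consts_ok_def)
    let ?x = "cv (M' (3 * Q + i)) (M' (4 * Q + i))" and ?z = "cv (R 102) (R 103)"
    have x: "norm (?x - twiddle i) \<le> e"
      using a(1) i I unfolding approx_def I_def by (auto simp: algebra_simps)
    have "norm (?x * ?z - twiddle i * cis (pi / 2 ^ j)) \<le> 2 * e + 1 * e0"
      by (rule approx_mult[OF x z]) (use e01 in auto)
    then have xz: "norm (?x * ?z - twiddle (?w + i)) \<le> 2 * e + e0"
      using i by (simp add: twiddle_add_power2)
    then have "norm (?x * ?z) \<le> 1 + (2 * e + e0)" by (rule norm_close_le) simp
    then have le: "norm (?x * ?z) \<le> 16" using a(2) e01 by linarith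
    have "(1::real) \<le> real Nb ^ 4" using Nb by (intro one_le_power) auto
    then have 16: "16 \<le> 16 * real Nb ^ 4" by simp
    have lt: "M' (3 * Q + i) < G" "M' (4 * Q + i) < G"
      using cv_bound(1,2)[of "M' (3 * Q + i)" "M' (4 * Q + i)" 2] norm_close_le[OF x, of 1] a(2) B_G 16
      by auto
    show "wp G (Asg 100 (Ld (area 3 [+] Rg 84)) ;; Asg 101 (Ld (area 4 [+] Rg 84)) ;; CMUL ;;
        Sto (area 3 [+] Rg 80 [+] Rg 84) (Rg 104) ;; Sto (area 4 [+] Rg 80 [+] Rg 84) (Rg 105))
      (\<lambda>R' M' t'. R' 84 = i \<and> I (Suc i) (R'(84 := Suc i)) M' (t' + 1)) R' M' (t' + 1)"
      apply (simp add: wp_simps regs i lt)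
      apply (rule wp_CMUL[where h = 16])
         apply (rule ok)
        apply (use le regs in simp)
       apply (rule 16)
      subgoal for x y
        using I i QG xz assms(3)
        apply (simp add: wp_simps regs I_def)
        apply (intro conjI)
          apply (simp add: same_def)
         apply (rule approx_store)
             apply simp
        using norm_triangle_ineq[of "cv x y - ?x * ?z" "?x * ?z - twiddle (?w + i)"]
            apply (simp add: algebra_simps)
           apply simp_all
        apply (intro same_upd)
          apply simp_all
        done
      done
  qed
qed

lemma COPY_BACK_spec:
  assumes "consts_ok R" "R 60 = N" "N \<le> Nb" "R 68 = b" "5 * Q \<le> b" "b + 2 * Q \<le> 9 * Q"
    and a: "approx M (9 * Q) N f e" "e \<le> 1" "\<And>p. p < N \<Longrightarrow> norm (f p) \<le> 8 * real Nb ^ 4"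
  shows "wp G COPY_BACK (\<lambda>R' M' t'. approx M' b N f e \<and> same {81} R' R
    \<and> same {b..<b + 2 * Q} M' M \<and> t' \<le> t + 2 + 4 * N) R M t"
proof -
  have NQ: "N \<le> Q" "20 * Q < G" using assms(3) Nb_Q Q_G by auto
  define I where "I = (\<lambda>j R' M' t'. R' 81 = j \<and> same {81} R' R \<and>
    same {b..<b + 2 * Q} M' M \<and> approx M' b j f e \<and> t' \<le> t + 1 + 4 * j)"
  show ?thesis
    unfolding COPY_BACK_def
  proof (rule wp_For[where n = N and I = I])
    show "N < G" using NQ by linarith
    show "I 0 (R(81 := 0)) M (t + 1)" by (simp add: I_def approx_def same_upd)
  next
    fix j R' M' t'
    assume I: "I j R' M' t'" and j: "j < N" "R' 81 = j"
    then have s: "same {81} R' R" and sm: "same {b..<b + 2 * Q} M' M" by (auto simp: I_def)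
    have regs: "R' 10 = S" "R' 11 = B" "R' 12 = Q" "R' 60 = N" "R' 68 = b"
      using assms by (simp_all add: same_eq[OF s] consts_ok_def)
    have m: "M' (9 * Q + j) = M (9 * Q + j)" "M' (10 * Q + j) = M (10 * Q + j)"
      using assms j by (auto simp: same_eq[OF sm])
    have c: "norm (cv (M (9 * Q + j)) (M (10 * Q + j)) - f j) \<le> e"
      using approxD[OF a(1) j(1)] by (simp add: algebra_simps)
    have "norm (cv (M (9 * Q + j)) (M (10 * Q + j))) \<le> 8 * real Nb ^ 4 + e"
      by (rule norm_close_le[OF c a(3)[OF j(1)]])
    moreover have "(1::real) \<le> real Nb ^ 4" using Nb by (intro one_le_power) auto
    ultimately have "norm (cv (M (9 * Q + j)) (M (10 * Q + j))) \<le> 16 * real Nb ^ 4"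
      using a(2) by linarith
    from cv_bound(1,2)[OF this] have lt: "M (9 * Q + j) < G" "M (10 * Q + j) < G"
      using B_G by auto
    show "wp G (Sto (Rg 68 [+] Rg 81) (Ld (area 9 [+] Rg 81)) ;;
        Sto (Rg 68 [+] Rg 12 [+] Rg 81) (Ld (area 10 [+] Rg 81)))
      (\<lambda>R' M' t'. R' 81 = j \<and> I (Suc j) (R'(81 := Suc j)) M' (t' + 1)) R' M' (t' + 1)"
      using I NQ j assms(5,6) c
      apply (simp add: wp_simps regs lt m I_def)
      apply (intro conjI same_upd approx_store)
      apply (simp_all add: m)
      done
  next
    fix j R' M' t'
    assume "I j R' M' t'"
    then show "R' 81 = j \<and> ev (Rg 60) R' M' = N"
      using same_eq[of "{81}" R' R 60] assms(2) by (simp add: I_def)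
  qed (simp_all add: I_def G_pos)
qed

text \<open>The recursion from \<open>e\<close> to \<open>2 * e + 2 * e0\<close> is dominated by
  \<open>2 * 4 ^ j * e0\<close>, that is, by \<open>e0\<close> times twice the square of the table
  length.\<close>

lemma TWIDDLES_spec:
  assumes "consts_ok R" "R 60 = 2 ^ L" "2 ^ L \<le> Nb" "L \<le> J" "J \<le> Q"
    and z: "approx M Q J (\<lambda>j. cis (pi / 2 ^ j)) e0"
  shows "wp G TWIDDLES (\<lambda>R' M' t'. approx M' (3 * Q) (2 ^ L) twiddle (2 * 4 ^ L * e0)
    \<and> same {80..<120} R' R \<and> same {3 * Q..<5 * Q} M' M \<and> t' \<le> t + 5 + 20 * 2 ^ L) R M t"
proof -
  define I where "I = (\<lambda>R' M' t'. \<exists>j\<le>L. R' 80 = 2 ^ j \<and> R' 81 = j \<and>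
    approx M' (3 * Q) (2 ^ j) twiddle (2 * 4 ^ j * e0) \<and> same {80..<120} R' R \<and>
    same {3 * Q..<5 * Q} M' M \<and> t' \<le> t + 4 + 20 * 2 ^ j)"
  have regs: "R 10 = S" "R 11 = B" "R 12 = Q" using assms(1) by (auto simp: consts_ok_def)
  have QG: "2 ^ L \<le> Q" "40 * Q < G" "1 \<le> Q" using assms(3) Nb Nb_Q Q_G by auto
  have BS: "B + S < G" using S_le_B B_G by linarith
  have wh: "wp G (Wh (Rg 80) (Rg 60) (
      Asg 102 (Ld (area 1 [+] Rg 81)) ;; Asg 103 (Ld (area 2 [+] Rg 81)) ;; TWIDDLE_STEP ;;
      Asg 80 (Rg 80 [+] Rg 80) ;; Asg 81 (Rg 81 [+] Nm 1)))
    (\<lambda>R' M' t'. approx M' (3 * Q) (2 ^ L) twiddle (2 * 4 ^ L * e0)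
    \<and> same {80..<120} R' R \<and> same {3 * Q..<5 * Q} M' M \<and> t' \<le> t + 5 + 20 * 2 ^ L)
    R1 M1 t1" if "I R1 M1 t1" for R1 M1 t1
  proof (rule wp_Wh[where I = I and f = "\<lambda>R M. 2 ^ L - R 80"])
    fix R' M' t'
    assume "I R' M' t'" and lt: "ev (Rg 80) R' M' < ev (Rg 60) R' M'"
    then obtain j where j: "R' 80 = 2 ^ j" "R' 81 = j" "approx M' (3 * Q) (2 ^ j) twiddle (2 * 4 ^ j * e0)"
      and s: "same {80..<120} R' R" and sm: "same {3 * Q..<5 * Q} M' M" and t: "t' \<le> t + 4 + 20 * 2 ^ j"
      unfolding I_def by blast
    have regs': "R' 10 = S" "R' 11 = B" "R' 12 = Q" "R' 60 = 2 ^ L"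
      using regs assms(2) by (auto simp: same_eq[OF s])
    have "(2::nat) ^ j < 2 ^ L" using lt j regs' by simp
    then have jL: "j < L" by simp
    then have "(2::nat) ^ Suc j \<le> 2 ^ L" by (intro power_increasing) auto
    then have le: "2 * 2 ^ j \<le> (2::nat) ^ L" by simp
    have m: "M' (Q + j) = M (Q + j)" "M' (2 * Q + j) = M (2 * Q + j)"
      using jL assms(4,5) by (auto simp: same_eq[OF sm])
    have zj: "norm (cv (M (Q + j)) (M (2 * Q + j)) - cis (pi / 2 ^ j)) \<le> e0"
      using approxD[OF z, of j] jL assms(4) by (simp add: mult_2)
    have "norm (cv (M (Q + j)) (M (2 * Q + j))) \<le> 1 + e0"
      by (rule norm_close_le[OF zj]) simp
    moreover have "(1::real) \<le> real Nb ^ 4" using Nb by (intro one_le_power) auto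
    ultimately have "norm (cv (M (Q + j)) (M (2 * Q + j))) \<le> 16 * real Nb ^ 4"
      using e0_le_1 by linarith
    from cv_bound(1,2)[OF this] have lt: "M (Q + j) < G" "M (2 * Q + j) < G" using B_G by auto
    have e1: "2 * 4 ^ j * e0 \<le> 1"
    proof -
      have "(4::real) ^ j = (2 ^ j)\<^sup>2" by (simp add: power2_eq_square power_mult_distrib[symmetric])
      also have "\<dots> = real (2 ^ j) ^ 2" by simp
      also have "\<dots> \<le> real Nb ^ 8" by (rule power_Nb_le) (use le assms(3) in auto)
      finally have "2 * 4 ^ j \<le> 64 * real Nb ^ 8" using zero_le_power[of "real Nb" 8] by linarith
      then have "2 * 4 ^ j * e0 \<le> 64 * real Nb ^ 8 * e0"
        using e0_pos by (intro mult_right_mono) auto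
      then show ?thesis using e0_small by linarith
    qed
    have c: "consts_ok (R'(102 := x, 103 := y))" for x y using regs' by (simp add: consts_ok_def)
    have "2 * (2 * 4 ^ j * e0) + 2 * e0 \<le> 2 * 4 ^ Suc j * e0"
    proof -
      have "(1::real) \<le> 4 ^ j" by simp
      then have "(1::real) \<le> 2 * 4 ^ j" by linarith
      then have "2 * e0 * 1 \<le> 2 * e0 * (2 * 4 ^ j)" using e0_pos by (intro mult_left_mono) auto
      then show ?thesis by (simp add: algebra_simps)
    qed
    note e2 = this
    show "wp G (Asg 102 (Ld (area 1 [+] Rg 81)) ;; Asg 103 (Ld (area 2 [+] Rg 81)) ;; TWIDDLE_STEP ;;
        Asg 80 (Rg 80 [+] Rg 80) ;; Asg 81 (Rg 81 [+] Nm 1))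
      (\<lambda>R2 M2 t2. I R2 M2 t2 \<and> 2 ^ L - R2 80 < 2 ^ L - R' 80) R' M' (t' + 1)"
      apply (simp add: wp_simps regs' j m lt)
      apply (rule wp_mono[OF TWIDDLE_STEP_spec[where j = j and e = "2 * 4 ^ j * e0"]])
            apply (rule c)
           apply (simp add: j)
      using le assms(3) apply simp
         apply (simp add: zj)
        apply (rule j(3))
       apply (rule e1)
      subgoal premises p for R2 M2 t2
      proof -
        from p have A: "same {84, 100, 101, 104, 105} R2 (R'(102 := M (Q + j), 103 := M (2 * Q + j))) \<and>
          approx M2 (3 * Q) (2 * 2 ^ j) twiddle (2 * (2 * 4 ^ j * e0) + 2 * e0) \<and>
          same {3 * Q..<5 * Q} M2 M' \<and> t2 = Suc (Suc (Suc t')) + 2 + 8 * 2 ^ j"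
          by simp
        then have s2: "same {84, 100, 101, 104, 105} R2 (R'(102 := M (Q + j), 103 := M (2 * Q + j)))"
          by blast
        have R2: "R2 80 = 2 ^ j" "R2 81 = j" using j by (simp_all add: same_eq[OF s2])
        have "same {80..<120} R2 R"
          by (rule same_trans[OF same_mono[OF s2, of "{80..<120}"] same_upd[OF same_upd[OF s]]]) auto
        moreover have "same {3 * Q..<5 * Q} M2 M" using A sm by (blast intro: same_trans)
        moreover have "approx M2 (3 * Q) (2 ^ Suc j) twiddle (2 * 4 ^ Suc j * e0)"
          using A approx_mono[OF _ e2] by simp
        moreover have "j < G" "2 ^ j + 2 ^ j < G" "Suc j < G"
          using jL assms(4,5) le QG by auto
        moreover have "(1::nat) \<le> 2 ^ j" by simp
        then have "t2 + 2 \<le> t + 4 + 20 * 2 ^ Suc j" "(2::nat) ^ L - (2 ^ j + 2 ^ j) < 2 ^ L - 2 ^ j"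
          using A t le by (simp_all only: power_Suc)
        ultimately show ?thesis
          using R2 jL unfolding I_def
          by (simp add: wp_simps) (intro conjI exI[of _ "Suc j"] same_upd; simp)
      qed
      done
  next
    fix R' M' t'
    assume "I R' M' t'" and lt: "\<not> ev (Rg 80) R' M' < ev (Rg 60) R' M'"
    then obtain j where j: "j \<le> L" "R' 80 = 2 ^ j" "approx M' (3 * Q) (2 ^ j) twiddle (2 * 4 ^ j * e0)"
      and s: "same {80..<120} R' R" and sm: "same {3 * Q..<5 * Q} M' M" and t: "t' \<le> t + 4 + 20 * 2 ^ j"
      unfolding I_def by blast
    have "R' 60 = 2 ^ L" using assms(2) by (simp add: same_eq[OF s])
    then have "\<not> (2::nat) ^ j < 2 ^ L" using lt j by simp
    then have "j = L" using j(1) power_strict_increasing[of j L "2::nat"] by (cases "j < L") auto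
    then show "approx M' (3 * Q) (2 ^ L) twiddle (2 * 4 ^ L * e0) \<and> same {80..<120} R' R \<and>
        same {3 * Q..<5 * Q} M' M \<and> t' + 1 \<le> t + 5 + 20 * 2 ^ L"
      using j s sm t by simp
  qed (rule that)
  show ?thesis
    unfolding TWIDDLES_def
    apply (simp add: wp_simps regs)
    apply (intro conjI)
    using QG BS B_G apply simp_all
    apply (rule wh[unfolded One_nat_def])
    unfolding I_def
    apply (rule exI[of _ 0])
    apply (intro conjI same_upd)
    using QG e0_pos
            apply (simp_all add: approx_def cv_const mult_2[symmetric])
    done
qed

end

declare One_nat_def [simp del]

context fixpoint
begin

text \<open>Half of the admissible magnitude keeps both coordinates within \<open>B / 2\<close> of
  the offset. Sums and differences of two such numbers can then be formed on naturals without
  truncation or overflow.\<close>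

lemma cv_half:
  assumes "norm (cv a b) \<le> h" "h \<le> 8 * real Nb ^ 4"
  shows "B \<le> 2 * a" "2 * a \<le> 3 * B" "B \<le> 2 * b" "2 * b \<le> 3 * B"
proof -
  have h: "h \<le> 16 * real Nb ^ 4" "2 * h \<le> 16 * real Nb ^ 4"
    using assms(2) zero_le_power[of "real Nb" 4] by linarith+
  have "2 * (h * S) \<le> real B" using scaled_le[OF h(2)] by (simp add: mult_ac)
  then show "B \<le> 2 * a" "2 * a \<le> 3 * B" "B \<le> 2 * b" "2 * b \<le> 3 * B"
    using cv_bound(3,4)[OF assms(1) h(1)] by linarith+
qed

lemma cv_add_ok:
  assumes "norm (cv a b) \<le> h" "norm (cv c d) \<le> h" "h \<le> 8 * real Nb ^ 4"
  shows "cv (a + c - B) (b + d - B) = cv a b + cv c d" "a + c - B < G" "b + d - B < G"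
  using cv_half[OF assms(1,3)] cv_half[OF assms(2,3)] B_G
  by (auto intro!: cv_add)

lemma cv_diff_ok:
  assumes "norm (cv a b) \<le> h" "norm (cv c d) \<le> h" "h \<le> 8 * real Nb ^ 4"
  shows "cv (a + B - c) (b + B - d) = cv a b - cv c d" "a + B - c < G" "b + B - d < G"
  using cv_half[OF assms(1,3)] cv_half[OF assms(2,3)] B_G
  by (auto intro!: cv_diff)

lemma real_Nb_ge: "(1::real) \<le> real Nb ^ 4"
  using Nb by (intro one_le_power) auto

text \<open>Position \<open>p\<close> holds coefficient \<open>p mod m\<close> of residue number
  \<open>p div m\<close>. The error consists of \<open>e\<close> from the unmultiplied operand,
  \<open>2 * e + D * \<epsilon>\<close> from the product with an approximate twiddle factor, and
  \<open>e0\<close> from rounding.\<close>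

lemma FORWARD_STEP_spec:
  assumes "consts_ok R" "R 60 = N" "R 80 = m" "N = 2 * m * D" "N \<le> Nb" "0 < N"
    and b: "R 68 = b" "5 * Q \<le> b" "b + 2 * Q \<le> 9 * Q"
    and tab: "approx M (3 * Q) N twiddle \<epsilon>" "\<epsilon> \<le> 1"
    and src: "approx M b N (\<lambda>p. residue a (2 * m) D (p div (2 * m)) (p mod (2 * m))) e"
      "0 \<le> e" "e \<le> 1"
    and a: "\<And>i. norm (a i) \<le> 1"
  shows "wp G FORWARD_STEP (\<lambda>R' M' t'.
    approx M' (9 * Q) N (\<lambda>p. residue a m (2 * D) (p div m) (p mod m)) (3 * e + D * \<epsilon> + e0)
    \<and> same {81..<120} R' R \<and> same {9 * Q..<11 * Q} M' M \<and> t' \<le> t + 2 + (10 + 2) * N) R M t"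
  unfolding FORWARD_STEP_def
proof (rule wp_map)
  show "R 60 = N" "N \<le> Q" using assms Nb_Q by auto
  fix j R1 M1 t1
  assume j: "j < N" and s: "same {81..<120} R1 R" and R1: "R1 81 = j"
    and sm: "same {9 * Q..<11 * Q} M1 M"
  have m: "0 < m" "0 < D" using assms(4,6) by auto
  have QG: "N \<le> Q" "40 * Q < G" using assms(5) Nb_Q Q_G by auto
  have regs: "R1 10 = S" "R1 11 = B" "R1 12 = Q" "R1 60 = N" "R1 68 = b" "R1 80 = m"
    using assms by (auto simp: same_eq[OF s] consts_ok_def)
  define u i where "u = j div m" "i = j mod m"
  \<comment> \<open>\<open>A\<close> and \<open>A + m\<close> are the positions of the two
    coefficients of the parent residue \<open>u div 2\<close> that feed position
    \<open>j\<close>.\<close>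
  define A where "A = u div 2 * (2 * m) + i"
  have im: "i < m" using m by (simp add: u_i_def)
  have "u < 2 * D" using j m by (simp add: u_i_def less_mult_imp_div_less assms(4) mult_ac)
  then have "u div 2 < D" by auto
  then have "u div 2 * (2 * m) + 2 * m \<le> D * (2 * m)"
    by (metis Suc_leI add.commute mult_Suc mult_le_mono1)
  then have A: "A + m < N" using im assms(4) unfolding A_def by (simp add: mult_ac)
  have dm: "A div (2 * m) = u div 2" "A mod (2 * m) = i"
      "(A + m) div (2 * m) = u div 2" "(A + m) mod (2 * m) = i + m"
    using im m unfolding A_def by (simp_all add: add.assoc)
  have uN: "u < N" using j le_less_trans[of u j N] by (simp add: u_i_def)
  have ji: "j - u * m = i" by (simp add: u_i_def minus_div_mult_eq_mod)
  let ?x = "cv (M (b + A)) (M (b + Q + A))"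
  let ?y = "cv (M (b + (A + m))) (M (b + Q + (A + m)))"
  let ?w = "cv (M (3 * Q + u)) (M (4 * Q + u))"
  let ?X = "residue a (2 * m) D (u div 2) i" and ?Y = "residue a (2 * m) D (u div 2) (i + m)"
  have x: "norm (?x - ?X) \<le> e" and y: "norm (?y - ?Y) \<le> e"
    using approxD[OF src(1), of A] approxD[OF src(1) A] A by (simp_all add: dm)
  have "3 * Q + Q + u = 4 * Q + u" by simp
  then have w: "norm (?w - twiddle u) \<le> \<epsilon>" using approxD[OF tab(1) uN] by metis
  have nX: "norm ?X \<le> real D" "norm ?Y \<le> real D"
    using norm_residue_le[of a 1 "2 * m" D] a by auto
  have yw: "norm (?y * ?w - ?Y * twiddle u) \<le> 2 * e + D * \<epsilon>"
    by (rule approx_mult[OF y w nX(2)]) (use tab in auto)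
  have DN: "real D \<le> real Nb ^ 4"
  proof -
    have "1 * D \<le> 2 * m * D" using m by (intro mult_right_mono) auto
    then have "D \<le> Nb" using assms(4,5) by linarith
    then show ?thesis using power_Nb_le[of D 1 4] m by simp
  qed
  have hx: "norm ?x \<le> 2 * real Nb ^ 4"
    using norm_close_le[OF x nX(1)] src(3) DN real_Nb_ge by linarith
  have hyw: "norm (?y * ?w) \<le> 4 * real Nb ^ 4"
  proof -
    have "norm ?y \<le> 2 * real Nb ^ 4"
      using norm_close_le[OF y nX(2)] src(3) DN real_Nb_ge by linarith
    moreover have "norm ?w \<le> 2" using norm_close_le[OF w, of 1] tab(2) by simp
    ultimately have "norm (?y * ?w) \<le> (2 * real Nb ^ 4) * 2" by (rule norm_mult_le)
    then show ?thesis by simp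
  qed
  have hy: "norm ?y \<le> 2 * real Nb ^ 4" "norm ?w \<le> 2 * real Nb ^ 4"
    using norm_close_le[OF y nX(2)] src(3) DN real_Nb_ge norm_close_le[OF w, of 1] tab(2)
    by (linarith, simp)
  have ge0: "0 \<le> real Nb ^ 4" by simp
  note lt = cv_half[OF hy(1)] cv_half[OF hy(2)]
  have lt: "M (b + (A + m)) < G" "M (b + Q + (A + m)) < G" "M (3 * Q + u) < G" "M (4 * Q + u) < G"
    using lt ge0 B_G by auto
  have mem: "M1 (b + (A + m)) = M (b + (A + m))" "M1 (b + Q + (A + m)) = M (b + Q + (A + m))"
      "M1 (3 * Q + u) = M (3 * Q + u)" "M1 (4 * Q + u) = M (4 * Q + u)"
      "M1 (b + A) = M (b + A)" "M1 (b + Q + A) = M (b + Q + A)"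
    using A uN QG b by (auto simp: same_eq[OF sm])
  have ok: "consts_ok (R1(82 := q1, 84 := q2, 100 := q3, 101 := q4, 102 := q5, 103 := q6))"
    for q1 q2 q3 q4 q5 q6 using regs by (simp add: consts_ok_def)
  have AG: "A < G" "u < G" using A uN QG by auto
  show "wp G
        (Asg 82 (Rg 81 [div] Rg 80) ;;
         Asg 84 (Rg 82 [div] Nm 2 [*] (Nm 2 [*] Rg 80) [+] (Rg 81 [-] Rg 82 [*] Rg 80)) ;;
         Asg 100 (Ld (Rg 68 [+] (Rg 84 [+] Rg 80))) ;;
         Asg 101 (Ld (Rg 68 [+] Rg 12 [+] (Rg 84 [+] Rg 80))) ;;
         Asg 102 (Ld (area 3 [+] Rg 82)) ;; Asg 103 (Ld (area 4 [+] Rg 82)) ;; CMUL ;;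
         Sto (area 9 [+] Rg 81) (Ld (Rg 68 [+] Rg 84) [+] Rg 104 [-] Rg 11) ;;
         Sto (area 10 [+] Rg 81) (Ld (Rg 68 [+] Rg 12 [+] Rg 84) [+] Rg 105 [-] Rg 11))
        (\<lambda>R2 M2 t2. \<exists>x y. M2 = M1(9 * Q + j := x, 10 * Q + j := y) \<and>
          norm (cv x y - residue a m (2 * D) (j div m) (j mod m)) \<le> 3 * e + real D * \<epsilon> + e0 \<and>
          same {81..<120} R2 R \<and> R2 81 = j \<and> t2 \<le> t1 + 10) R1 M1 t1"
    apply (simp add: wp_simps regs R1 u_i_def(1)[symmetric] ji A_def[symmetric] mem lt AG)
    apply (rule wp_CMUL[where h = "4 * real Nb ^ 4"])
       apply (rule ok)
      apply (simp add: hyw)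
     apply simp
    subgoal premises p for zr zi
    proof -
      have z: "norm (cv zr zi - ?y * ?w) \<le> e0" using p(3) by simp
      have "norm (cv zr zi) \<le> 4 * real Nb ^ 4 + e0" by (rule norm_close_le[OF z hyw])
      then have hz: "norm (cv zr zi) \<le> 8 * real Nb ^ 4" using e0_le_1 real_Nb_ge by linarith
      have hx': "norm ?x \<le> 8 * real Nb ^ 4" using hx ge0 by linarith
      note add = cv_add_ok[OF hx' hz order_refl]
      have eq: "residue a m (2 * D) u i = ?X + twiddle u * ?Y" by (rule residue_split)
      have "norm (cv (M (b + A) + zr - B) (M (b + Q + A) + zi - B) - residue a m (2 * D) u i)
          = norm ((?x - ?X) + (cv zr zi - ?y * ?w) + (?y * ?w - ?Y * twiddle u))"
        unfolding add(1) eq by (simp add: algebra_simps)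
      also have "\<dots> \<le> e + e0 + (2 * e + D * \<epsilon>)"
        by (intro norm_triangle_le add_mono x z yw)
      finally have fin: "norm (cv (M (b + A) + zr - B) (M (b + Q + A) + zi - B)
          - residue a m (2 * D) u i) \<le> 3 * e + D * \<epsilon> + e0" by simp
      have ad: "b + Q + A \<noteq> 9 * Q + j" using A QG b by linarith
      have "same {81..<120} (R1(82 := u, 84 := A, 100 := M (b + (A + m)),
          101 := M (b + Q + (A + m)), 102 := M (3 * Q + u), 103 := M (4 * Q + u), 104 := zr, 105 := zi)) R"
        using s by (intro same_upd) auto
      then show ?thesis
        using add fin QG j R1 ad
        by (simp add: wp_simps regs mem u_i_def(2)[symmetric])
          (intro exI conjI, rule refl, simp_all)
    qed
    done
qed auto

text \<open>Initially there is a single residue, the polynomial itself; after \<open>L\<close>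
  halvings there are \<open>2 ^ L\<close> constants. With \<open>d\<close> residues the error is at
  most \<open>2 * d\<^sup>2 * \<epsilon>\<close>, since tripling it and adding the lower-order terms
  stays within a factor 4.\<close>

lemma FORWARD_spec:
  assumes "consts_ok R" "R 60 = 2 ^ L" "2 ^ L \<le> Nb"
    and b: "R 68 = b" "5 * Q \<le> b" "b + 2 * Q \<le> 9 * Q"
    and tab: "approx M (3 * Q) (2 ^ L) twiddle \<epsilon>" "e0 \<le> \<epsilon>" "2 * real (2 ^ L) ^ 2 * \<epsilon> \<le> 1"
    and src: "approx M b (2 ^ L) a 0" and a: "\<And>i. norm (a i) \<le> 1"
  shows "wp G FORWARD (\<lambda>R' M' t'.
    approx M' b (2 ^ L) (\<lambda>p. residue a 1 (2 ^ L) p 0) (2 * real (2 ^ L) ^ 2 * \<epsilon>)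
    \<and> same {80..<120} R' R \<and> same ({b..<b + 2 * Q} \<union> {9 * Q..<11 * Q}) M' M
    \<and> t' \<le> t + 2 + L * (8 + 16 * 2 ^ L)) R M t"
proof -
  let ?N = "2 ^ L :: nat"
  define I where "I = (\<lambda>R' M' t'. \<exists>j\<le>L. R' 80 = 2 ^ (L - j) \<and>
    approx M' b ?N (\<lambda>p. residue a (2 ^ (L - j)) (2 ^ j) (p div 2 ^ (L - j)) (p mod 2 ^ (L - j)))
      (2 * real (2 ^ j) ^ 2 * \<epsilon>)
    \<and> same {80..<120} R' R \<and> same ({b..<b + 2 * Q} \<union> {9 * Q..<11 * Q}) M' M
    \<and> t' \<le> t + 1 + j * (8 + 16 * ?N))"
  have QG: "?N \<le> Q" "40 * Q < G" using assms(3) Nb_Q Q_G by auto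
  have eps: "0 < \<epsilon>" using e0_pos tab(2) by linarith
  have eps1: "\<epsilon> \<le> 1"
  proof -
    have "(1::real) * 1 \<le> 2 * real ?N ^ 2" by (intro mult_mono one_le_power) auto
    then have "1 * \<epsilon> \<le> 2 * real ?N ^ 2 * \<epsilon>" using eps by (intro mult_right_mono) auto
    then show ?thesis using tab(3) by linarith
  qed
  show ?thesis
    unfolding FORWARD_def wp_Sq wp_Asg
    apply (rule conjI)
    subgoal using QG assms(2) by simp
  proof (rule wp_Wh[where I = I and f = "\<lambda>R M. R 80"])
    have "approx M b ?N (\<lambda>p. residue a ?N 1 (p div ?N) (p mod ?N)) (2 * \<epsilon>)"
      using src eps unfolding approx_def by (force simp: residue_def)
    then show "I (R(80 := ev (Rg 60) R M)) M (t + 1)"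
      unfolding I_def using assms(2) by (intro exI[of _ 0]) (auto simp: same_def)
  next
    fix R' M' t'
    assume "I R' M' t'" and "ev (Nm 1) R' M' < ev (Rg 80) R' M'"
    then obtain j where j: "j \<le> L" "R' 80 = 2 ^ (L - j)"
      "approx M' b ?N (\<lambda>p. residue a (2 ^ (L - j)) (2 ^ j) (p div 2 ^ (L - j)) (p mod 2 ^ (L - j)))
        (2 * real (2 ^ j) ^ 2 * \<epsilon>)"
      and s: "same {80..<120} R' R" and sm: "same ({b..<b + 2 * Q} \<union> {9 * Q..<11 * Q}) M' M"
      and t: "t' \<le> t + 1 + j * (8 + 16 * ?N)" and gt: "1 < (2::nat) ^ (L - j)"
      unfolding I_def by auto
    have jL: "j < L" using gt j(1) by (metis diff_is_0_eq less_irrefl linorder_not_less power_0)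
    define m where "m = (2::nat) ^ (L - Suc j)"
    have m2: "2 ^ (L - j) = 2 * m" using jL by (simp add: m_def Suc_diff_Suc flip: power_Suc)
    have mN: "?N = 2 * m * 2 ^ j"
      using j(1) by (simp add: m2[symmetric] flip: power_add)
    have regs: "R' 10 = S" "R' 11 = B" "R' 12 = Q" "R' 60 = ?N" "R' 68 = b"
      using assms(1,2) b by (auto simp: same_eq[OF s] consts_ok_def)
    define e where "e = 2 * real (2 ^ j) ^ 2 * \<epsilon>"
    have jN: "(2::nat) ^ j \<le> ?N" "(2::nat) ^ Suc j \<le> ?N" using jL by (auto intro!: power_increasing simp del: power_Suc)
    have e: "0 \<le> e" "e \<le> 1"
    proof -
      have "real (2 ^ j) ^ 2 \<le> real ?N ^ 2" using jN by (intro power_mono) auto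
      then have "e \<le> 2 * real ?N ^ 2 * \<epsilon>" unfolding e_def using eps by (intro mult_right_mono) auto
      then show "e \<le> 1" using tab(3) by linarith
    qed (use eps in \<open>simp add: e_def\<close>)
    have e': "3 * e + real (2 ^ j) * \<epsilon> + e0 \<le> 2 * real (2 ^ Suc j) ^ 2 * \<epsilon>"
    proof -
      define d where "d = real (2 ^ j)"
      have "1 \<le> d" by (simp add: d_def)
      then have "d * 1 \<le> d * d" "1 * 1 \<le> d * d" by (intro mult_mono; simp)+
      then have "d * \<epsilon> \<le> d * d * \<epsilon>" "1 * \<epsilon> \<le> d * d * \<epsilon>" using eps by (intro mult_right_mono; simp)+
      moreover have "2 * real (2 ^ Suc j) ^ 2 * \<epsilon> = 8 * (d * d * \<epsilon>)" "e = 2 * (d * d * \<epsilon>)"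
        by (simp_all add: d_def e_def power2_eq_square)
      ultimately show ?thesis using tab(2) unfolding d_def[symmetric] by linarith
    qed
    have e'1: "2 * real (2 ^ Suc j) ^ 2 * \<epsilon> \<le> 1"
    proof -
      have "real (2 ^ Suc j) ^ 2 \<le> real ?N ^ 2"
        using jN(2) by (intro power_mono) (simp_all only: of_nat_le_iff of_nat_0_le_iff)
      then have "2 * real (2 ^ Suc j) ^ 2 * \<epsilon> \<le> 2 * real ?N ^ 2 * \<epsilon>"
        using eps by (intro mult_right_mono) auto
      then show ?thesis using tab(3) by linarith
    qed
    have tab': "approx M' (3 * Q) ?N twiddle \<epsilon>"
      using tab(1) QG b unfolding approx_def by (auto simp: same_eq[OF sm])
    have "m * 1 \<le> m * (2 * 2 ^ j)" by (intro mult_le_mono2) (simp add: Suc_leI One_nat_def)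
    also have "m * (2 * 2 ^ j) = ?N" using mN by (simp add: mult_ac)
    finally have mG: "m < G" using QG by linarith
    show "wp G (Asg 80 (Rg 80 [div] Nm 2) ;; FORWARD_STEP ;; COPY_BACK)
        (\<lambda>R2 M2 t2. I R2 M2 t2 \<and> R2 80 < R' 80) R' M' (t' + 1)"
      unfolding wp_Sq wp_Asg
      apply (rule conjI)
      subgoal using mG by (simp add: j(2) m2)
      apply (simp add: j(2) m2)
      apply (rule wp_mono[OF FORWARD_STEP_spec[where N = ?N and m = m and D = "2 ^ j" and b = b
          and \<epsilon> = \<epsilon> and e = e and a = a]])
      subgoal using regs by (simp add: consts_ok_def)
      subgoal using regs by simp
      subgoal by simp
      subgoal by (rule mN)
      subgoal by (rule assms(3))
      subgoal by simp
      subgoal using regs by simp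
      subgoal by (rule b(2))
      subgoal by (rule b(3))
      subgoal by (rule tab')
      subgoal by (rule eps1)
      subgoal using j(3) by (simp add: m2 e_def)
      subgoal by (rule e(1))
      subgoal by (rule e(2))
      subgoal by (rule a)
      subgoal premises p for R2 M2 t2
      proof -
        from p have s2: "same {81..<120} R2 (R'(80 := m))" and sm2: "same {9 * Q..<11 * Q} M2 M'"
          and t2: "t2 \<le> Suc (Suc t') + 2 + 12 * ?N"
          and ap: "approx M2 (9 * Q) ?N (\<lambda>p. residue a m (2 * 2 ^ j) (p div m) (p mod m))
            (3 * e + real (2 ^ j) * \<epsilon> + e0)" by auto
        have ap': "approx M2 (9 * Q) ?N (\<lambda>p. residue a m (2 ^ Suc j) (p div m) (p mod m))
            (2 * real (2 ^ Suc j) ^ 2 * \<epsilon>)"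
          using approx_mono[OF ap e'] by simp
        have r: "R2 10 = S" "R2 11 = B" "R2 12 = Q" "R2 60 = ?N" "R2 68 = b" "R2 80 = m"
          using regs by (simp_all add: same_eq[OF s2])
        show ?thesis
        proof (rule wp_mono[OF COPY_BACK_spec[OF _ r(4) assms(3) r(5) b(2,3) ap' e'1]])
          show "consts_ok R2" using r by (simp add: consts_ok_def)
          fix p
          have "norm (residue a m (2 ^ Suc j) (p div m) (p mod m)) \<le> real (2 ^ Suc j) * 1"
            by (rule norm_residue_le) (rule a)
          also have "\<dots> \<le> real Nb ^ 4"
            using power_Nb_le[of "2 ^ Suc j" 1 4] jN(2) assms(3) by simp
          finally show "norm (residue a m (2 ^ Suc j) (p div m) (p mod m)) \<le> 8 * real Nb ^ 4"
            using real_Nb_ge by linarith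
        next
          fix R3 M3 t3
          assume A: "approx M3 b ?N (\<lambda>p. residue a m (2 ^ Suc j) (p div m) (p mod m))
              (2 * real (2 ^ Suc j) ^ 2 * \<epsilon>) \<and> same {81} R3 R2 \<and> same {b..<b + 2 * Q} M3 M2 \<and>
              t3 \<le> t2 + 2 + 4 * ?N"
          have "same {80..<120} R3 (R'(80 := m))"
            by (rule same_trans[of "{81}" _ R2 "{81..<120}"]) (use A s2 in auto)
          then have s3: "same {80..<120} R3 R"
            by (rule same_trans[OF _ same_upd[OF s]]) auto
          have "same ({b..<b + 2 * Q} \<union> {9 * Q..<11 * Q}) M3 M'"
            by (rule same_trans[of "{b..<b + 2 * Q}" _ M2 "{9 * Q..<11 * Q}"]) (use A sm2 in auto)
          then have sm3: "same ({b..<b + 2 * Q} \<union> {9 * Q..<11 * Q}) M3 M"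
            by (rule same_trans[OF _ sm]) auto
          have r3: "R3 80 = m" using A r by (simp add: same_def)
          have m0: "0 < m" by (simp add: m_def)
          have "t3 \<le> t + 1 + Suc j * (8 + 16 * ?N)" using A t2 t by simp
          then show "I R3 M3 t3 \<and> R3 80 < 2 * m"
            using A s3 sm3 r3 jL mN m0 unfolding I_def
            by (auto intro!: exI[of _ "Suc j"] simp: m_def[symmetric] simp del: power_Suc)
        qed
      qed
      done
  next
    fix R' M' t'
    assume "I R' M' t'" and "\<not> ev (Nm 1) R' M' < ev (Rg 80) R' M'"
    then obtain j where j: "j \<le> L" "R' 80 = 2 ^ (L - j)"
      "approx M' b ?N (\<lambda>p. residue a (2 ^ (L - j)) (2 ^ j) (p div 2 ^ (L - j)) (p mod 2 ^ (L - j)))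
        (2 * real (2 ^ j) ^ 2 * \<epsilon>)"
      and s: "same {80..<120} R' R" and sm: "same ({b..<b + 2 * Q} \<union> {9 * Q..<11 * Q}) M' M"
      and t: "t' \<le> t + 1 + j * (8 + 16 * ?N)" and gt: "\<not> 1 < (2::nat) ^ (L - j)"
      unfolding I_def by auto
    have "j = L"
    proof (rule ccontr)
      assume "j \<noteq> L"
      then have "0 < L - j" using j(1) by simp
      then have "1 < (2::nat) ^ (L - j)" by (rule one_less_power[rotated]) simp
      then show False using gt by simp
    qed
    then show "approx M' b ?N (\<lambda>p. residue a 1 ?N p 0) (2 * real ?N ^ 2 * \<epsilon>)
        \<and> same {80..<120} R' R \<and> same ({b..<b + 2 * Q} \<union> {9 * Q..<11 * Q}) M' M
        \<and> t' + 1 \<le> t + 2 + L * (8 + 16 * ?N)"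
      using j s sm t by simp
  qed
qed

text \<open>Two factors of size at most \<open>N\<close>, each wrong by at most \<open>E\<close>,
  give a product error of \<open>2 * N * E + E\<close> before rounding; the rest of
  \<open>4 * N * E\<close> covers \<open>e0\<close>.\<close>

lemma POINTWISE_spec:
  assumes "consts_ok R" "R 60 = N" "N \<le> Nb" "0 < N"
    and f: "approx M (5 * Q) N f E" "\<And>p. p < N \<Longrightarrow> norm (f p) \<le> real N"
    and g: "approx M (7 * Q) N g E" "\<And>p. p < N \<Longrightarrow> norm (g p) \<le> real N"
    and E: "E \<le> 1" "e0 \<le> E"
  shows "wp G POINTWISE (\<lambda>R' M' t'. approx M' (9 * Q) N (\<lambda>p. f p * g p) (4 * real N * E)
    \<and> same {81..<120} R' R \<and> same {9 * Q..<11 * Q} M' M \<and> t' \<le> t + 2 + (8 + 2) * N) R M t"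
  unfolding POINTWISE_def
proof (rule wp_map)
  show "R 60 = N" "N \<le> Q" using assms Nb_Q by auto
  fix j R1 M1 t1
  assume j: "j < N" and s: "same {81..<120} R1 R" and R1: "R1 81 = j"
    and sm: "same {9 * Q..<11 * Q} M1 M"
  have QG: "N \<le> Q" "40 * Q < G" using assms(3) Nb_Q Q_G by auto
  have regs: "R1 10 = S" "R1 11 = B" "R1 12 = Q" "R1 60 = N"
    using assms by (auto simp: same_eq[OF s] consts_ok_def)
  let ?x = "cv (M (5 * Q + j)) (M (6 * Q + j))" and ?y = "cv (M (7 * Q + j)) (M (8 * Q + j))"
  have x: "norm (?x - f j) \<le> E"
    using approxD[OF f(1) j] by (simp add: algebra_simps)
  have y: "norm (?y - g j) \<le> E"
    using approxD[OF g(1) j] by (simp add: algebra_simps)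
  have N1: "1 \<le> real N" using assms(4) by simp
  have nx: "norm ?x \<le> real N + E" "norm ?y \<le> real N + E"
    using norm_close_le[OF x f(2)[OF j]] norm_close_le[OF y g(2)[OF j]] .
  have E0: "0 \<le> E" using E e0_pos by linarith
  have xy: "norm (?x * ?y - f j * g j) \<le> 2 * real N * E + E"
  proof -
    have "norm (?x * ?y - f j * g j) = norm ((?x - f j) * ?y + f j * (?y - g j))"
      by (simp add: algebra_simps)
    also have "\<dots> \<le> E * (N + E) + N * E"
      by (intro norm_triangle_le add_mono norm_mult_le x y nx f(2) j)
    also have "\<dots> \<le> 2 * real N * E + E" using mult_right_mono[OF E(1) E0] by (simp add: algebra_simps)
    finally show ?thesis .
  qed
  have N2: "real N ^ 2 \<le> real Nb ^ 4" "real N \<le> real Nb ^ 4"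
    using power_Nb_le[OF assms(3), of 2 4] power_Nb_le[OF assms(3), of 1 4] by simp_all
  have "norm (?x * ?y) \<le> (2 * real N) * (2 * real N)"
    by (rule norm_mult_le) (use nx E N1 in linarith)+
  also have "\<dots> = 4 * real N ^ 2" by (simp add: power2_eq_square)
  finally have hxy: "norm (?x * ?y) \<le> 4 * real Nb ^ 4" using N2 by linarith
  have h: "norm ?x \<le> 2 * real Nb ^ 4" "norm ?y \<le> 2 * real Nb ^ 4"
    using nx E N1 N2 real_Nb_ge by linarith+
  have ge0: "0 \<le> real Nb ^ 4" by simp
  have lt: "M (5 * Q + j) < G" "M (6 * Q + j) < G" "M (7 * Q + j) < G" "M (8 * Q + j) < G"
    using cv_half[OF h(1)] cv_half[OF h(2)] ge0 B_G by auto
  have mem: "M1 (5 * Q + j) = M (5 * Q + j)" "M1 (6 * Q + j) = M (6 * Q + j)"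
    "M1 (7 * Q + j) = M (7 * Q + j)" "M1 (8 * Q + j) = M (8 * Q + j)"
    using j QG by (auto simp: same_eq[OF sm])
  have ok: "consts_ok (R1(100 := q3, 101 := q4, 102 := q5, 103 := q6))"
    for q3 q4 q5 q6 using regs by (simp add: consts_ok_def)
  show "wp G
        (Asg 100 (Ld (area 5 [+] Rg 81)) ;; Asg 101 (Ld (area 6 [+] Rg 81)) ;;
         Asg 102 (Ld (area 7 [+] Rg 81)) ;; Asg 103 (Ld (area 8 [+] Rg 81)) ;; CMUL ;;
         Sto (area 9 [+] Rg 81) (Rg 104) ;; Sto (area 10 [+] Rg 81) (Rg 105))
        (\<lambda>R2 M2 t2. \<exists>x y. M2 = M1(9 * Q + j := x, 10 * Q + j := y) \<and>
          norm (cv x y - f j * g j) \<le> 4 * real N * E \<and>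
          same {81..<120} R2 R \<and> R2 81 = j \<and> t2 \<le> t1 + 8) R1 M1 t1"
    apply (simp add: wp_simps regs R1 mem lt)
    apply (rule wp_CMUL[where h = "4 * real Nb ^ 4"])
       apply (rule ok)
      apply (simp add: hxy)
     apply simp
    subgoal premises p for zr zi
    proof -
      have z: "norm (cv zr zi - ?x * ?y) \<le> e0" using p(3) by simp
      have "norm (cv zr zi - f j * g j) = norm ((cv zr zi - ?x * ?y) + (?x * ?y - f j * g j))"
        by simp
      also have "\<dots> \<le> e0 + (2 * real N * E + E)" by (intro norm_triangle_le add_mono z xy)
      also have "\<dots> \<le> 4 * real N * E"
        using mult_right_mono[OF N1 E0] E by linarith
      finally have fin: "norm (cv zr zi - f j * g j) \<le> 4 * real N * E" .
      have "same {81..<120} (R1(100 := M (5 * Q + j), 101 := M (6 * Q + j),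
          102 := M (7 * Q + j), 103 := M (8 * Q + j), 104 := zr, 105 := zi)) R"
        using s by (intro same_upd) auto
      then show ?thesis
        using fin QG j R1 p(1,2)
        by (simp add: wp_simps regs) (intro exI conjI, rule refl, simp_all)
    qed
    done
qed auto

text \<open>In the application \<open>c\<close> is the power of two collected so far by not halving.
  Positions in the first half of a block receive sums; those in the second half receive differences
  rotated back by the conjugate twiddle factor, and these determine the error.\<close>

lemma BACKWARD_STEP_spec:
  assumes "consts_ok R" "R 60 = N" "R 80 = m" "N = 2 * m * D" "N \<le> Nb" "0 < N"
    and b: "R 68 = b" "5 * Q \<le> b" "b + 2 * Q \<le> 9 * Q"
    and tab: "approx M (3 * Q) N twiddle \<epsilon>" "\<epsilon> \<le> 1"
    and src: "approx M b N (\<lambda>p. c * residue a m (2 * D) (p div m) (p mod m)) e" "0 \<le> e" "e \<le> 1"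
    and h: "\<And>t i. norm (c * residue a m (2 * D) t i) \<le> h" "h \<le> real Nb ^ 4"
  shows "wp G BACKWARD_STEP (\<lambda>R' M' t'.
    approx M' (9 * Q) N (\<lambda>p. 2 * c * residue a (2 * m) D (p div (2 * m)) (p mod (2 * m)))
      (4 * e + 2 * h * \<epsilon> + e0)
    \<and> same {81..<120} R' R \<and> same {9 * Q..<11 * Q} M' M \<and> t' \<le> t + 2 + (12 + 2) * N) R M t"
  unfolding BACKWARD_STEP_def
proof (rule wp_map)
  show "R 60 = N" "N \<le> Q" using assms Nb_Q by auto
  fix j R1 M1 t1
  assume j: "j < N" and s: "same {81..<120} R1 R" and R1: "R1 81 = j"
    and sm: "same {9 * Q..<11 * Q} M1 M"
  have m: "0 < m" "0 < D" using assms(4,6) by auto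
  have QG: "N \<le> Q" "40 * Q < G" using assms(5) Nb_Q Q_G by auto
  have regs: "R1 10 = S" "R1 11 = B" "R1 12 = Q" "R1 60 = N" "R1 68 = b" "R1 80 = m"
    using assms by (auto simp: same_eq[OF s] consts_ok_def)
  define t i where "t = j div (2 * m)" "i = j mod (2 * m)"
  note ti = this
  have i2m: "i < 2 * m" using m by (simp add: ti)
  have ji: "j = t * (2 * m) + i" unfolding ti by (rule div_mult_mod_eq[symmetric])
  then have jt: "j - t * (2 * m) = i" by simp
  have "t < D" using j m by (simp add: ti less_mult_imp_div_less assms(4) mult_ac)
  then have "Suc t * (2 * m) \<le> D * (2 * m)" by (intro mult_le_mono1) simp
  then have tN: "t * (2 * m) + 2 * m \<le> N" using assms(4) by (simp add: mult_ac)
  have "2 * t \<le> t * (2 * m)" using m by (cases m) auto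
  then have tw: "2 * t < N" using tN m by linarith
  \<comment> \<open>The offset inside a half block. With it \<open>A\<close> and
    \<open>A + m\<close> address the same coefficient in the two children \<open>2 * t\<close> and
    \<open>2 * t + 1\<close>.\<close>
  define r where "r = (if i < m then i else i - m)"
  have r: "r < m" using i2m by (auto simp: r_def)
  define A where "A = t * (2 * m) + r"
  have A: "A + m < N" "A < N" using tN r by (simp_all add: A_def)
  have "A = r + 2 * t * m" "A + m = r + (2 * t + 1) * m" by (simp_all add: A_def algebra_simps)
  then have dm: "A div m = 2 * t" "A mod m = r" "(A + m) div m = 2 * t + 1" "(A + m) mod m = r"
    using r m by (simp_all only: div_mult_self1 mod_mult_self1 div_less mod_less add_0)
  let ?x = "cv (M (b + A)) (M (b + Q + A))"
  let ?y = "cv (M (b + (A + m))) (M (b + Q + (A + m)))"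
  let ?w = "cv (M (3 * Q + 2 * t)) (M (4 * Q + 2 * t))"
  let ?X = "c * residue a m (2 * D) (2 * t) r" and ?Y = "c * residue a m (2 * D) (2 * t + 1) r"
  have x: "norm (?x - ?X) \<le> e" and y: "norm (?y - ?Y) \<le> e"
    using approxD[OF src(1) A(2)] approxD[OF src(1) A(1)] by (simp_all only: dm)
  have "3 * Q + Q + 2 * t = 4 * Q + 2 * t" by simp
  then have w: "norm (?w - twiddle (2 * t)) \<le> \<epsilon>" using approxD[OF tab(1) tw] by metis
  have ge0: "0 \<le> real Nb ^ 4" by simp
  have hx: "norm ?x \<le> 2 * real Nb ^ 4" "norm ?y \<le> 2 * real Nb ^ 4"
    using norm_close_le[OF x h(1)] norm_close_le[OF y h(1)] src(3) h(2) real_Nb_ge by linarith+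
  have hw: "norm ?w \<le> 2" "norm ?w \<le> 2 * real Nb ^ 4"
    using norm_close_le[OF w, of 1] tab(2) real_Nb_ge by (simp, simp)
  have le8: "2 * real Nb ^ 4 \<le> 8 * real Nb ^ 4" by simp
  have mem: "M1 (b + (A + m)) = M (b + (A + m))" "M1 (b + Q + (A + m)) = M (b + Q + (A + m))"
      "M1 (3 * Q + 2 * t) = M (3 * Q + 2 * t)" "M1 (4 * Q + 2 * t) = M (4 * Q + 2 * t)"
      "M1 (b + A) = M (b + A)" "M1 (b + Q + A) = M (b + Q + A)"
    using A tw QG b by (auto simp: same_eq[OF sm])
  have ok: "consts_ok (R1(82 := q1, 83 := q2, 84 := q7, 100 := q3, 101 := q4, 102 := q5, 103 := q6))"
    for q1 q2 q3 q4 q5 q6 q7 using regs by (simp add: consts_ok_def)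
  have lt: "A < G" "t < G" "i < G" using A tw QG i2m tN by auto
  show "wp G
     (Asg 82 (Rg 81 [div] (Nm 2 [*] Rg 80)) ;;
      Asg 83 (Rg 81 [-] Rg 82 [*] (Nm 2 [*] Rg 80)) ;;
      Cond (Rg 83) (Rg 80) (
        Asg 84 (Rg 82 [*] (Nm 2 [*] Rg 80) [+] Rg 83) ;;
        Sto (area 9 [+] Rg 81)
          (Ld (Rg 68 [+] Rg 84) [+] Ld (Rg 68 [+] (Rg 84 [+] Rg 80)) [-] Rg 11) ;;
        Sto (area 10 [+] Rg 81)
          (Ld (Rg 68 [+] Rg 12 [+] Rg 84) [+] Ld (Rg 68 [+] Rg 12 [+] (Rg 84 [+] Rg 80)) [-] Rg 11))
      (
        Asg 84 (Rg 82 [*] (Nm 2 [*] Rg 80) [+] (Rg 83 [-] Rg 80)) ;;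
        Asg 100 (Ld (Rg 68 [+] Rg 84) [+] Rg 11 [-] Ld (Rg 68 [+] (Rg 84 [+] Rg 80))) ;;
        Asg 101 (Ld (Rg 68 [+] Rg 12 [+] Rg 84) [+] Rg 11
          [-] Ld (Rg 68 [+] Rg 12 [+] (Rg 84 [+] Rg 80))) ;;
        Asg 102 (Ld (area 3 [+] Nm 2 [*] Rg 82)) ;;
        Asg 103 (Rg 11 [+] Rg 11 [-] Ld (area 4 [+] Nm 2 [*] Rg 82)) ;; CMUL ;;
        Sto (area 9 [+] Rg 81) (Rg 104) ;; Sto (area 10 [+] Rg 81) (Rg 105)))
     (\<lambda>R2 M2 t2. \<exists>x y. M2 = M1(9 * Q + j := x, 10 * Q + j := y) \<and>
       norm (cv x y - 2 * c * residue a (2 * m) D (j div (2 * m)) (j mod (2 * m)))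
         \<le> 4 * e + 2 * h * \<epsilon> + e0 \<and>
       same {81..<120} R2 R \<and> R2 81 = j \<and> t2 \<le> t1 + 12) R1 M1 t1"
  proof (cases "i < m")
    case True
    then have "r = i" by (simp add: r_def)
    note A' = A_def[unfolded this, symmetric]
    note add = cv_add_ok[OF hx le8]
    have eq: "2 * c * residue a (2 * m) D t i = ?X + ?Y"
      unfolding \<open>r = i\<close> distrib_left[symmetric] residue_add by simp
    have h0: "0 \<le> h" using h(1) norm_ge_zero order_trans by blast
    have eps0: "0 \<le> \<epsilon>" using w norm_ge_zero order_trans by blast
    have "norm (?x + ?y - 2 * c * residue a (2 * m) D t i) = norm ((?x - ?X) + (?y - ?Y))"
      unfolding eq by (simp add: algebra_simps)
    also have "\<dots> \<le> e + e" by (intro norm_triangle_le add_mono x y)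
    also have "\<dots> \<le> 4 * e + 2 * h * \<epsilon> + e0"
      using src(2) e0_pos mult_nonneg_nonneg[OF h0 eps0] by linarith
    finally have fin: "norm (?x + ?y - 2 * c * residue a (2 * m) D t i) \<le> 4 * e + 2 * h * \<epsilon> + e0" .
    have ad: "b + Q + A \<noteq> 9 * Q + j" "b + Q + (A + m) \<noteq> 9 * Q + j" using A QG b by linarith+
    have "same {81..<120} (R1(82 := t, 83 := i, 84 := A)) R"
      using s by (intro same_upd) auto
    then show ?thesis
      using True add fin QG j R1 ad lt
      by (simp add: wp_simps regs mem ti[symmetric] jt A')
        (intro exI conjI, rule refl, simp_all)
  next
    case False
    then have ri: "r = i - m" "i = r + m" by (auto simp: r_def)
    note A' = A_def[unfolded ri(1), symmetric]
    note diff = cv_diff_ok[OF hx le8]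
    have wB: "M (4 * Q + 2 * t) \<le> 2 * B" using cv_half(4)[OF hw(2) le8] by linarith
    let ?d = "?x - ?y" and ?v = "cnj ?w"
    have v: "norm (?v - cnj (twiddle (2 * t))) \<le> \<epsilon>"
      using w by (metis complex_cnj_diff complex_mod_cnj)
    have d: "norm (?d - (?X - ?Y)) \<le> 2 * e"
    proof -
      have "?d - (?X - ?Y) = (?x - ?X) - (?y - ?Y)" by simp
      then have "norm (?d - (?X - ?Y)) \<le> norm (?x - ?X) + norm (?y - ?Y)"
        by (metis norm_triangle_ineq4)
      then show ?thesis using x y by linarith
    qed
    have hd: "norm (?X - ?Y) \<le> 2 * h"
      using norm_triangle_ineq4[of ?X ?Y] h(1)[of "2 * t" r] h(1)[of "2 * t + 1" r] by linarith
    have "norm (?d * ?v - (?X - ?Y) * cnj (twiddle (2 * t))) \<le> 2 * (2 * e) + 2 * h * \<epsilon>"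
      by (rule approx_mult[OF d v hd]) (use tab in auto)
    moreover have "(?X - ?Y) * cnj (twiddle (2 * t)) = 2 * c * residue a (2 * m) D t i"
      unfolding right_diff_distrib[symmetric] mult.assoc residue_diff ri(2) by simp
    ultimately have dv: "norm (?d * ?v - 2 * c * residue a (2 * m) D t i) \<le> 4 * e + 2 * h * \<epsilon>"
      by simp
    have "norm ?d \<le> 4 * real Nb ^ 4" using norm_triangle_ineq4[of ?x ?y] hx by linarith
    then have "norm (?d * ?v) \<le> (4 * real Nb ^ 4) * 2"
      by (rule norm_mult_le) (use hw in simp)
    then have hdv: "norm (?d * ?v) \<le> 16 * real Nb ^ 4" using ge0 by linarith
    note cvs = diff(1) cv_cnj[OF wB, of "M (3 * Q + 2 * t)"]
    have ltw: "M (3 * Q + 2 * t) < G" "B + B - M (4 * Q + 2 * t) < G"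
      using cv_half[OF hw(2) le8] B_G by auto
    show ?thesis
      using False
      apply (simp add: wp_simps regs R1 mem ti[symmetric] jt A' lt diff(2,3) ltw)
      apply (rule wp_CMUL[where h = "16 * real Nb ^ 4"])
         apply (rule ok)
        apply (simp add: cvs hdv)
       apply simp
      subgoal premises p for zr zi
      proof -
        have z: "norm (cv zr zi - ?d * ?v) \<le> e0" using p(4) by (simp add: cvs)
        have "norm (cv zr zi - 2 * c * residue a (2 * m) D t i)
            = norm ((cv zr zi - ?d * ?v) + (?d * ?v - 2 * c * residue a (2 * m) D t i))"
          by simp
        also have "\<dots> \<le> e0 + (4 * e + 2 * h * \<epsilon>)" by (intro norm_triangle_le add_mono z dv)
        finally have fin: "norm (cv zr zi - 2 * c * residue a (2 * m) D t i)
            \<le> 4 * e + 2 * h * \<epsilon> + e0" by simp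
        have "same {81..<120} (R1(82 := t, 83 := i, 84 := A,
            100 := M (b + A) + B - M (b + (A + m)), 101 := M (b + Q + A) + B - M (b + Q + (A + m)),
            102 := M (3 * Q + 2 * t), 103 := B + B - M (4 * Q + 2 * t), 104 := zr, 105 := zi)) R"
          using s by (intro same_upd) auto
        then show ?thesis
          using fin QG j R1 p
          by (simp add: wp_simps regs) (intro exI conjI, rule refl, simp_all)
      qed
      done
  qed
qed auto

text \<open>If the additive part of the error recursion is at most \<open>4 * e\<close>, a level
  multiplies the error by at most 8, which gives the cube of the length in the end. The scaled
  residues never exceed \<open>(2 ^ L)\<^sup>2\<close>, because the gained factor
  \<open>2 ^ j\<close> compensates the smaller number \<open>2 ^ (L - j)\<close> of
  summands.\<close>

lemma BACKWARD_spec: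
  assumes "consts_ok R" "R 60 = 2 ^ L" "2 ^ L \<le> Nb"
    and b: "R 68 = b" "5 * Q \<le> b" "b + 2 * Q \<le> 9 * Q"
    and tab: "approx M (3 * Q) (2 ^ L) twiddle \<epsilon>" "\<epsilon> \<le> 1"
    and src: "approx M b (2 ^ L) (\<lambda>p. residue a 1 (2 ^ L) p 0) e" "e * 8 ^ L \<le> 1"
    and e: "2 * real (2 ^ L) ^ 2 * \<epsilon> + e0 \<le> 4 * e"
    and a: "\<And>i. norm (a i) \<le> real (2 ^ L)"
  shows "wp G BACKWARD (\<lambda>R' M' t'.
    approx M' b (2 ^ L) (\<lambda>p. 2 ^ L * a p) (e * 8 ^ L)
    \<and> same {80..<120} R' R \<and> same ({b..<b + 2 * Q} \<union> {9 * Q..<11 * Q}) M' M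
    \<and> t' \<le> t + 2 + L * (8 + 18 * 2 ^ L)) R M t"
proof -
  let ?N = "2 ^ L :: nat"
  define st where "st = (\<lambda>j p. 2 ^ j * residue a (2 ^ j) (2 ^ (L - j)) (p div 2 ^ j) (p mod 2 ^ j))"
  define I where "I = (\<lambda>R' M' t'. \<exists>j\<le>L. R' 80 = 2 ^ j \<and> approx M' b ?N (st j) (e * 8 ^ j)
    \<and> same {80..<120} R' R \<and> same ({b..<b + 2 * Q} \<union> {9 * Q..<11 * Q}) M' M
    \<and> t' \<le> t + 1 + j * (8 + 18 * ?N))"
  have QG: "?N \<le> Q" "40 * Q < G" using assms(3) Nb_Q Q_G by auto
  have eps0: "0 \<le> \<epsilon>"
  proof -
    have "norm (cv (M (3 * Q + 0)) (M (3 * Q + Q + 0)) - twiddle 0) \<le> \<epsilon>"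
      by (rule approxD[OF tab(1)]) simp
    then show ?thesis by (rule order_trans[OF norm_ge_zero])
  qed
  have "0 \<le> real ?N ^ 2 * \<epsilon>" using eps0 by (intro mult_nonneg_nonneg zero_le_power) simp_all
  then have e_pos: "0 < e" using e e0_pos by linarith
  have h: "norm (2 ^ j * residue a (2 ^ j) (2 ^ (L - j)) t i) \<le> real ?N ^ 2" if "j \<le> L" for j t i
  proof -
    have "norm (residue a (2 ^ j) (2 ^ (L - j)) t i) \<le> real (2 ^ (L - j)) * real ?N"
      by (rule norm_residue_le) (rule a)
    then have "norm (2 ^ j * residue a (2 ^ j) (2 ^ (L - j)) t i)
        \<le> 2 ^ j * (real (2 ^ (L - j)) * real ?N)"
      by (intro norm_mult_le) (simp_all add: norm_power)
    also have "\<dots> = real ?N ^ 2"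
      using that by (simp add: power2_eq_square flip: power_add)
    finally show ?thesis .
  qed
  have h4: "real ?N ^ 2 \<le> real Nb ^ 4" by (rule power_Nb_le) (use assms(3) in auto)
  have e8: "e * 8 ^ j \<le> 1" if "j \<le> L" for j
  proof -
    have "e * 8 ^ j \<le> e * 8 ^ L"
      using that e_pos by (intro mult_left_mono power_increasing) auto
    then show ?thesis using src(2) by linarith
  qed
  show ?thesis
    unfolding BACKWARD_def wp_Sq[of G "Asg 80 (Nm 1)"] wp_Asg
    apply (rule conjI)
    subgoal using Nb Nb_Q Q_G by simp
  proof (rule wp_Wh[where I = I and f = "\<lambda>R M. ?N - R 80"])
    have "approx M b ?N (st 0) e"
      using src(1) by (simp add: st_def)
    then show "I (R(80 := ev (Nm 1) R M)) M (t + 1)"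
      unfolding I_def by (intro exI[of _ 0]) (simp add: same_def)
  next
    fix R' M' t'
    assume "I R' M' t'" and lt: "ev (Rg 80) R' M' < ev (Rg 60) R' M'"
    then obtain j where j: "j \<le> L" "R' 80 = 2 ^ j" "approx M' b ?N (st j) (e * 8 ^ j)"
      and s: "same {80..<120} R' R" and sm: "same ({b..<b + 2 * Q} \<union> {9 * Q..<11 * Q}) M' M"
      and t: "t' \<le> t + 1 + j * (8 + 18 * ?N)"
      unfolding I_def by auto
    have regs: "R' 10 = S" "R' 11 = B" "R' 12 = Q" "R' 60 = ?N" "R' 68 = b"
      using assms(1,2) b by (auto simp: same_eq[OF s] consts_ok_def)
    have "(2::nat) ^ j < 2 ^ L" using lt j(2) regs by simp
    then have jL: "j < L" by simp
    have m2: "2 ^ (L - j) = 2 * (2::nat) ^ (L - Suc j)" using jL by (simp add: Suc_diff_Suc flip: power_Suc)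
    have mN: "?N = 2 * 2 ^ j * 2 ^ (L - Suc j)"
      using jL by (simp flip: power_add power_Suc)
    have tab': "approx M' (3 * Q) ?N twiddle \<epsilon>"
      using tab(1) QG b unfolding approx_def by (auto simp: same_eq[OF sm])
    have e1: "1 * e \<le> 8 ^ j * e" using e_pos by (intro mult_right_mono) auto
    have "4 * (e * 8 ^ j) + 2 * real ?N ^ 2 * \<epsilon> + e0 \<le> e * 8 ^ Suc j"
      using e e1 by (simp add: mult_ac)
    note e' = this
    show "wp G (BACKWARD_STEP ;; COPY_BACK ;; Asg 80 (Rg 80 [+] Rg 80))
        (\<lambda>R2 M2 t2. I R2 M2 t2 \<and> ?N - R2 80 < ?N - R' 80) R' M' (t' + 1)"
      unfolding wp_Sq
    proof (rule wp_mono[OF BACKWARD_STEP_spec[where N = ?N and m = "2 ^ j" and D = "2 ^ (L - Suc j)" and b = b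
          and \<epsilon> = \<epsilon> and e = "e * 8 ^ j" and a = a and c = "2 ^ j" and h = "real ?N ^ 2"]])
      show "consts_ok R'" using regs by (simp add: consts_ok_def)
      show "approx M' b ?N (\<lambda>p. 2 ^ j * residue a (2 ^ j) (2 * 2 ^ (L - Suc j)) (p div 2 ^ j) (p mod 2 ^ j))
          (e * 8 ^ j)"
        using j(3) by (simp add: st_def m2)
      show "norm (2 ^ j * residue a (2 ^ j) (2 * 2 ^ (L - Suc j)) t i) \<le> real ?N ^ 2" for t i
        using h[OF j(1), of t i] by (simp add: m2)
      show "e * 8 ^ j \<le> 1" by (rule e8[OF j(1)])
    next
      fix R2 M2 t2
      assume "approx M2 (9 * Q) ?N (\<lambda>p. 2 * 2 ^ j * residue a (2 * 2 ^ j) (2 ^ (L - Suc j))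
            (p div (2 * 2 ^ j)) (p mod (2 * 2 ^ j))) (4 * (e * 8 ^ j) + 2 * real ?N ^ 2 * \<epsilon> + e0)
          \<and> same {81..<120} R2 R' \<and> same {9 * Q..<11 * Q} M2 M'
          \<and> t2 \<le> t' + 1 + 2 + (12 + 2) * ?N"
      then have s2: "same {81..<120} R2 R'" and sm2: "same {9 * Q..<11 * Q} M2 M'"
          and t2: "t2 \<le> t' + 1 + 2 + (12 + 2) * ?N"
          and ap: "approx M2 (9 * Q) ?N (st (Suc j)) (4 * (e * 8 ^ j) + 2 * real ?N ^ 2 * \<epsilon> + e0)"
        by (auto simp: st_def)
      note ap' = approx_mono[OF ap e']
      have r: "R2 10 = S" "R2 11 = B" "R2 12 = Q" "R2 60 = ?N" "R2 68 = b" "R2 80 = 2 ^ j"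
        using regs j(2) by (simp_all add: same_eq[OF s2])
      show "wp G COPY_BACK (wp G (Asg 80 (Rg 80 [+] Rg 80))
          (\<lambda>R2 M2 t2. I R2 M2 t2 \<and> ?N - R2 80 < ?N - R' 80)) R2 M2 t2"
      proof (rule wp_mono[OF COPY_BACK_spec[OF _ r(4) assms(3) r(5) b(2,3) ap']])
        show "consts_ok R2" using r by (simp add: consts_ok_def)
        show "e * 8 ^ Suc j \<le> 1" using e8[of "Suc j"] jL by simp
        show "norm (st (Suc j) p) \<le> 8 * real Nb ^ 4" for p
        proof -
          have "norm (st (Suc j) p) \<le> real ?N ^ 2" unfolding st_def by (rule h) (use jL in simp)
          then show ?thesis using h4 real_Nb_ge by linarith
        qed
      next
        fix R3 M3 t3
        assume A: "approx M3 b ?N (st (Suc j)) (e * 8 ^ Suc j) \<and> same {81} R3 R2 \<and>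
            same {b..<b + 2 * Q} M3 M2 \<and> t3 \<le> t2 + 2 + 4 * ?N"
        have "same {80..<120} R3 R'"
          by (rule same_trans[of "{81}" _ R2 "{81..<120}"]) (use A s2 in auto)
        then have s3: "same {80..<120} R3 R"
          by (rule same_trans[OF _ s]) auto
        have "same ({b..<b + 2 * Q} \<union> {9 * Q..<11 * Q}) M3 M'"
          by (rule same_trans[of "{b..<b + 2 * Q}" _ M2 "{9 * Q..<11 * Q}"]) (use A sm2 in auto)
        then have sm3: "same ({b..<b + 2 * Q} \<union> {9 * Q..<11 * Q}) M3 M"
          by (rule same_trans[OF _ sm]) auto
        have r3: "R3 80 = 2 ^ j" using A r by (simp add: same_def)
        have t3: "t3 + 1 \<le> t + 1 + Suc j * (8 + 18 * ?N)" using A t2 t by simp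
        have le: "2 ^ j + 2 ^ j \<le> ?N"
          using power_increasing[of "Suc j" L "2::nat"] jL by simp
        have "(0::nat) < 2 ^ j" by simp
        then have d: "?N - (2 ^ j + 2 ^ j) < ?N - 2 ^ j" using le by linarith
        have "I (R3(80 := 2 ^ j + 2 ^ j)) M3 (t3 + 1)"
          unfolding I_def using A s3 sm3 t3 jL
          by (intro exI[of _ "Suc j"] conjI same_upd) simp_all
        then show "wp G (Asg 80 (Rg 80 [+] Rg 80))
          (\<lambda>R2 M2 t2. I R2 M2 t2 \<and> ?N - R2 80 < ?N - R' 80) R3 M3 t3"
          using r3 le QG d j(2) by (simp add: wp_simps)
      qed
    qed (use regs j(2) mN assms(3) b tab' tab(2) e_pos h4 in simp_all)
  next
    fix R' M' t'
    assume "I R' M' t'" and lt: "\<not> ev (Rg 80) R' M' < ev (Rg 60) R' M'"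
    then obtain j where j: "j \<le> L" "R' 80 = 2 ^ j" "approx M' b ?N (st j) (e * 8 ^ j)"
      and s: "same {80..<120} R' R" and sm: "same ({b..<b + 2 * Q} \<union> {9 * Q..<11 * Q}) M' M"
      and t: "t' \<le> t + 1 + j * (8 + 18 * ?N)"
      unfolding I_def by auto
    have "R' 60 = ?N" using assms(2) by (simp add: same_eq[OF s])
    then have "\<not> (2::nat) ^ j < 2 ^ L" using lt j by simp
    then have jL: "j = L" using j(1) power_strict_increasing[of j L "2::nat"] by (cases "j < L") auto
    have "approx M' b ?N (\<lambda>p. 2 ^ L * a p) (e * 8 ^ L)"
      using j(3) unfolding jL approx_def st_def by (simp add: residue_def)
    then show "approx M' b ?N (\<lambda>p. 2 ^ L * a p) (e * 8 ^ L)
        \<and> same {80..<120} R' R \<and> same ({b..<b + 2 * Q} \<union> {9 * Q..<11 * Q}) M' M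
        \<and> t' + 1 \<le> t + 2 + L * (8 + 18 * ?N)"
      using jL s sm t by simp
  qed
qed

end

definition CONVOLVE :: st where
  "CONVOLVE = TWIDDLES ;; Asg 68 (area 5) ;; FORWARD ;; Asg 68 (area 7) ;; FORWARD ;;
    POINTWISE ;; Asg 68 (area 5) ;; COPY_BACK ;; BACKWARD"

lemma wp_SqI:
  assumes "wp G c1 P R M t" "\<And>R' M' t'. P R' M' t' \<Longrightarrow> wp G c2 Q R' M' t'"
  shows "wp G (Sq c1 c2) Q R M t"
  unfolding wp_Sq by (rule wp_mono[OF assms])

lemma wp_Asg_SqI:
  assumes "ev e R M < G" "wp G c Q (R(d := ev e R M)) M (t + 1)"
  shows "wp G (Sq (Asg d e) c) Q R M t"
  using assms by (simp add: wp_simps)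

text \<open>\<open>J\<close> is the number of precomputed roots \<open>cis (pi / 2 ^ j)\<close>,
  enough for every transform length up to \<open>Nb\<close>.\<close>

locale fixpoint_table = fixpoint +
  fixes J :: nat
  assumes J: "\<And>L. 2 ^ L \<le> Nb \<Longrightarrow> L \<le> J" and J_Q: "J \<le> Q"
begin

definition table_ok :: "(nat \<Rightarrow> nat) \<Rightarrow> bool" where
  "table_ok M \<longleftrightarrow> approx M Q J (\<lambda>j. cis (pi / 2 ^ j)) e0"

lemma table_ok_same: "table_ok M \<Longrightarrow> same X M' M \<Longrightarrow> X \<inter> {Q..<3 * Q} = {} \<Longrightarrow> table_ok M'"
  unfolding table_ok_def approx_def
proof (intro allI impI)
  fix p
  assume *: "\<forall>p<J. cmod (cv (M (Q + p)) (M (Q + Q + p)) - cis (pi / 2 ^ p)) \<le> e0"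
    "same X M' M" "X \<inter> {Q..<3 * Q} = {}" "p < J"
  then have "Q + p \<in> {Q..<3 * Q}" "Q + Q + p \<in> {Q..<3 * Q}" using J_Q by auto
  then have "Q + p \<notin> X" "Q + Q + p \<notin> X" using *(3) by blast+
  then show "cmod (cv (M' (Q + p)) (M' (Q + Q + p)) - cis (pi / 2 ^ p)) \<le> e0"
    using * by (simp add: same_eq[OF *(2)])
qed

text \<open>Errors for \<open>n = 2 ^ L\<close>: \<open>2 * n\<^sup>2 * e0\<close> in the twiddle
  table, \<open>4 * n ^ 4 * e0\<close> after the forward transforms, \<open>16 * n ^ 5 * e0\<close>
  after the product and \<open>16 * n ^ 8 * e0\<close> at the end. This is the origin of the
  condition \<open>64 * real Nb ^ 8 * e0 \<le> 1\<close>: the final error is at most 1/4, small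
  enough to tell 0 from \<open>2 ^ L\<close>.\<close>

lemma CONVOLVE_spec:
  assumes c: "consts_ok R" and N: "R 60 = 2 ^ L" "2 ^ L \<le> Nb" and tab: "table_ok M"
    and X: "approx M (5 * Q) (2 ^ L) (indic X) 0" "X \<subseteq> {..<2 ^ L}"
    and Y: "approx M (7 * Q) (2 ^ L) (indic Y) 0" "Y \<subseteq> {..<2 ^ L}"
    and XY: "\<And>x y. x \<in> X \<Longrightarrow> y \<in> Y \<Longrightarrow> x + y < 2 ^ L"
  shows "wp G CONVOLVE (\<lambda>R' M' t'.
    approx M' (5 * Q) (2 ^ L) (\<lambda>p. of_nat (2 ^ L * reps X Y p)) (1 / 4)
    \<and> same ({68} \<union> {80..<120}) R' R \<and> same {3 * Q..<11 * Q} M' M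
    \<and> t' \<le> t + 30 + 40 * 2 ^ L + L * (30 + 60 * 2 ^ L)) R M t"
proof -
  let ?N = "2 ^ L :: nat"
  define n where "n = real ?N"
  have n1: "1 \<le> n" by (simp add: n_def)
  have nN: "n ^ i \<le> real Nb ^ 8" "n ^ i \<le> n ^ 8" if "i \<le> 8" for i
    using power_Nb_le[OF N(2) that] power_increasing[OF that n1] by (simp_all add: n_def)
  have small: "64 * (n ^ i * e0) \<le> 1" if "i \<le> 8" for i
  proof -
    have "64 * n ^ i * e0 \<le> 64 * real Nb ^ 8 * e0"
      using nN[OF that] e0_pos by (intro mult_right_mono) auto
    then show ?thesis using e0_small by (simp add: mult_ac)
  qed
  have mono: "n ^ i * e0 \<le> n ^ j * e0" if "i \<le> j" for i j
    using power_increasing[OF that n1] e0_pos by (intro mult_right_mono) auto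
  define \<epsilon> where "\<epsilon> = 2 * n ^ 2 * e0"
  have eps: "2 * 4 ^ L * e0 = \<epsilon>"
    by (simp add: \<epsilon>_def n_def power_mult[symmetric] mult.commute[of L] flip: power_mult_distrib)
      (simp add: power_mult)
  have e0eps: "e0 \<le> \<epsilon>" using mono[of 0 2] e0_pos by (simp add: \<epsilon>_def)
  define E where "E = 4 * n ^ 4 * e0"
  have Eeps: "2 * real ?N ^ 2 * \<epsilon> = E"
  proof -
    have "n ^ 4 = n ^ 2 * n ^ 2" by (simp flip: power_add)
    then show ?thesis unfolding E_def \<epsilon>_def n_def[symmetric] by simp
  qed
  have E1: "E \<le> 1" "e0 \<le> E" "\<epsilon> \<le> 1"
    using small[of 4] small[of 2] mono[of 0 4] e0_pos by (simp_all add: E_def \<epsilon>_def)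
  have QG: "?N \<le> Q" "40 * Q < G" "0 < Q" "?N > 0" using N Nb_Q Q_G Nb by auto
  have regs: "R 10 = S" "R 11 = B" "R 12 = Q" using c by (auto simp: consts_ok_def)
  have LJ: "L \<le> J" using J N(2) .
  have indic_le: "norm (indic Z i) \<le> 1" for Z i by (simp add: indic_def)
  define F where "F = (\<lambda>Z p. residue (indic Z) 1 ?N p 0)"
  have F: "norm (F Z p) \<le> real ?N" for Z p
    using norm_residue_le[of "indic Z" 1 1 ?N p 0] indic_le by (simp add: F_def)
  define C where "C = (\<lambda>l. of_nat (reps X Y l) :: complex)"
  have FF: "F X p * F Y p = residue C 1 ?N p 0" for p
    unfolding F_def C_def by (rule residue_product[OF X(2) Y(2) XY])
  have Cle: "norm (C l) \<le> real ?N" for l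
    using reps_le[OF X(2), of Y l] unfolding C_def norm_of_nat by (simp only: of_nat_le_iff)
  show ?thesis
    unfolding CONVOLVE_def
  proof (rule wp_SqI[OF TWIDDLES_spec[OF c N LJ J_Q tab[unfolded table_ok_def]]], elim conjE,
      unfold eps, goal_cases)
    case T: (1 R1 M1 t1)
    have r1: "R1 10 = S" "R1 11 = B" "R1 12 = Q" "R1 60 = ?N"
      using regs N by (simp_all add: same_eq[OF T(2)])
    have X1: "approx M1 (5 * Q) ?N (indic X) 0" "approx M1 (7 * Q) ?N (indic Y) 0"
      using approx_same[OF X(1) T(3)] approx_same[OF Y(1) T(3)] QG by simp_all
    let ?R1 = "R1(68 := 5 * Q)"
    have f1: "wp G FORWARD (\<lambda>R' M' t'. approx M' (5 * Q) ?N (F X) E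
        \<and> same {80..<120} R' ?R1 \<and> same ({5 * Q..<5 * Q + 2 * Q} \<union> {9 * Q..<11 * Q}) M' M1
        \<and> t' \<le> t1 + 1 + 2 + L * (8 + 16 * ?N)) ?R1 M1 (t1 + 1)"
      using FORWARD_spec[of ?R1 L "5 * Q" M1 \<epsilon> "indic X" "t1 + 1"] r1 N T(1) X1 e0eps E1 indic_le
      unfolding Eeps F_def by (simp add: consts_ok_def)
    show ?case
    proof (rule wp_Asg_SqI, goal_cases)
      case 1 show ?case using r1 QG by simp
    next
      case 2
      show ?case
      proof (simp only: ev.simps arith_op.simps r1, rule wp_SqI[OF f1], elim conjE, goal_cases)
        case A: (1 R2 M2 t2)
        have r2: "R2 10 = S" "R2 11 = B" "R2 12 = Q" "R2 60 = ?N"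
          using r1 by (simp_all add: same_eq[OF A(2)])
        have tab2: "approx M2 (3 * Q) ?N twiddle \<epsilon>" "approx M2 (7 * Q) ?N (indic Y) 0"
          using T(1) X1(2) QG unfolding approx_def by (auto simp: same_eq[OF A(3)])
        let ?R2 = "R2(68 := 7 * Q)"
        have f2: "wp G FORWARD (\<lambda>R' M' t'. approx M' (7 * Q) ?N (F Y) E
            \<and> same {80..<120} R' ?R2 \<and> same ({7 * Q..<7 * Q + 2 * Q} \<union> {9 * Q..<11 * Q}) M' M2
            \<and> t' \<le> t2 + 1 + 2 + L * (8 + 16 * ?N)) ?R2 M2 (t2 + 1)"
          using FORWARD_spec[of ?R2 L "7 * Q" M2 \<epsilon> "indic Y" "t2 + 1"] r2 N tab2 e0eps E1 indic_le
          unfolding Eeps F_def by (simp add: consts_ok_def)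
        show ?case
        proof (rule wp_Asg_SqI, goal_cases)
          case 1 show ?case using r2 QG by simp
        next
          case 2
          show ?case
          proof (simp only: ev.simps arith_op.simps r2, rule wp_SqI[OF f2], elim conjE, goal_cases)
            case D: (1 R3 M3 t3)
            have r3: "R3 10 = S" "R3 11 = B" "R3 12 = Q" "R3 60 = ?N"
              using r2 by (simp_all add: same_eq[OF D(2)])
            have tab3: "approx M3 (3 * Q) ?N twiddle \<epsilon>" "approx M3 (5 * Q) ?N (F X) E"
              using tab2(1) A(1) QG unfolding approx_def by (auto simp: same_eq[OF D(3)])
            have p3: "wp G POINTWISE (\<lambda>R' M' t'. approx M' (9 * Q) ?N (\<lambda>p. residue C 1 ?N p 0)
                (4 * n * E) \<and> same {81..<120} R' R3 \<and> same {9 * Q..<11 * Q} M' M3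
                \<and> t' \<le> t3 + 2 + (8 + 2) * ?N) R3 M3 t3"
              using POINTWISE_spec[of R3 ?N M3 "F X" E "F Y" t3] r3 N tab3(2) D(1) E1 QG F
              unfolding FF n_def by (simp add: consts_ok_def)
            show ?case
            proof (rule wp_SqI[OF p3], elim conjE, goal_cases)
              case P: (1 R4 M4 t4)
              have r4: "R4 10 = S" "R4 11 = B" "R4 12 = Q" "R4 60 = ?N"
                using r3 by (simp_all add: same_eq[OF P(2)])
              have tab4: "approx M4 (3 * Q) ?N twiddle \<epsilon>"
                using tab3(1) QG unfolding approx_def by (auto simp: same_eq[OF P(3)])
              define e where "e = 4 * n * E"
              have "e = 16 * (n ^ 5 * e0)" "E = 4 * (n ^ 4 * e0)"
                by (simp_all add: e_def E_def power_numeral_reduce)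
              then have e: "e = 16 * (n ^ 5 * e0)" "e \<le> 1" "e0 \<le> e" "E \<le> e"
                using small[of 5] mono[of 0 5] mono[of 4 5] e0_pos by simp_all
              have nC: "norm (residue C 1 ?N p 0) \<le> 8 * real Nb ^ 4" for p
              proof -
                have "norm (residue C 1 ?N p 0) \<le> real ?N * real ?N"
                  unfolding FF[symmetric] by (intro norm_mult_le F)
                also have "\<dots> \<le> real Nb ^ 4"
                  using power_Nb_le[OF N(2), of 2 4] by (simp add: power2_eq_square)
                finally show ?thesis using real_Nb_ge by linarith
              qed
              let ?R4 = "R4(68 := 5 * Q)"
              have c4: "wp G COPY_BACK (\<lambda>R' M' t'. approx M' (5 * Q) ?N (\<lambda>p. residue C 1 ?N p 0) e
                  \<and> same {81} R' ?R4 \<and> same {5 * Q..<5 * Q + 2 * Q} M' M4 \<and> t' \<le> t4 + 1 + 2 + 4 * ?N)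
                  ?R4 M4 (t4 + 1)"
                by (rule COPY_BACK_spec) (use r4 N P(1) e nC QG in \<open>simp_all add: consts_ok_def e_def\<close>)
              show ?case
              proof (rule wp_Asg_SqI, goal_cases)
                case 1 show ?case using r4 QG by simp
              next
                case 2
                show ?case
                proof (simp only: ev.simps arith_op.simps r4, rule wp_SqI[OF c4], elim conjE, goal_cases)
                  case K: (1 R5 M5 t5)
                  have r5: "R5 10 = S" "R5 11 = B" "R5 12 = Q" "R5 60 = ?N" "R5 68 = 5 * Q"
                    using r4 by (simp_all add: same_eq[OF K(2)])
                  have tab5: "approx M5 (3 * Q) ?N twiddle \<epsilon>"
                    using tab4 QG unfolding approx_def by (auto simp: same_eq[OF K(3)])
                  have "e * 8 ^ L = 16 * (n ^ 8 * e0)"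
                  proof -
                    have "(8::real) ^ L = (2 ^ 3) ^ L" by simp
                    also have "\<dots> = (2 ^ L) ^ 3" by (simp only: power_mult[symmetric] mult.commute)
                    finally have "(8::real) ^ L = n ^ 3" by (simp add: n_def)
                    moreover have "n ^ 8 = n ^ 5 * n ^ 3" by (simp flip: power_add)
                    ultimately show ?thesis unfolding e(1) by simp
                  qed
                  then have e8: "e * 8 ^ L \<le> 1 / 4" using small[of 8] by simp
                  have e4: "2 * real ?N ^ 2 * \<epsilon> + e0 \<le> 4 * e"
                    unfolding Eeps using e(3,4) e0_pos by linarith
                  have e81: "e * 8 ^ L \<le> 1" using e8 by simp
                  have b5: "wp G BACKWARD (\<lambda>R' M' t'. approx M' (5 * Q) ?N (\<lambda>p. 2 ^ L * C p) (e * 8 ^ L)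
                      \<and> same {80..<120} R' R5 \<and> same ({5 * Q..<5 * Q + 2 * Q} \<union> {9 * Q..<11 * Q}) M' M5
                      \<and> t' \<le> t5 + 2 + L * (8 + 18 * ?N)) R5 M5 t5"
                    by (rule BACKWARD_spec[OF _ r5(4) N(2) r5(5) _ _ tab5 E1(3) K(1) e81 e4 Cle])
                      (use r5 in \<open>simp_all add: consts_ok_def\<close>)
                  show ?case
                  proof (rule wp_mono[OF b5], elim conjE, goal_cases)
                    case Z: (1 R6 M6 t6)
                    have "approx M6 (5 * Q) ?N (\<lambda>p. of_nat (2 ^ L * reps X Y p)) (1 / 4)"
                      using approx_mono[OF Z(1) e8] by (simp add: C_def)
                    moreover have "same ({68} \<union> {80..<120}) R6 R"
                      unfolding same_def
                      by (auto simp: same_eq[OF Z(2)] same_eq[OF K(2)] same_eq[OF P(2)] same_eq[OF D(2)]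
                          same_eq[OF A(2)] same_eq[OF T(2)])
                    moreover have "same {3 * Q..<11 * Q} M6 M"
                      unfolding same_def
                      by (auto simp: same_eq[OF Z(3)] same_eq[OF K(3)] same_eq[OF P(3)] same_eq[OF D(3)]
                          same_eq[OF A(3)] same_eq[OF T(3)])
                    moreover have "t6 \<le> t + 30 + 40 * ?N + L * (30 + 60 * ?N)"
                      using Z(4) K(4) P(4) D(4) A(4) T(4) by (simp add: algebra_simps)
                    ultimately show ?case by blast
                  qed
                qed
              qed
            qed
          qed
        qed
      qed
    qed
  qed
qed

end

section \<open>Sumsets of bit vectors\<close>

text \<open>An index \<open>s * K + c\<close> with \<open>c < K\<close> stands for a sum of \<open>c\<close> elements.  Registers 13, 14, 15
  hold \<open>K\<close>, the bound \<open>k\<close> on the number of elements, and the amount \<open>h\<close> by which each element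
  of the second operand is increased; register 16 holds the slack \<open>e\<close> in the length of the
  result.\<close>

definition SIZE :: st where
  "SIZE = Asg 60 (Nm 1) ;;
    Asg 67 (Rg 62 [+] Rg 64 [+] Rg 14 [*] (Rg 15 [*] Rg 13) [+] Rg 16) ;;
    Wh (Rg 60) (Rg 67) (Asg 60 (Rg 60 [+] Rg 60))"

definition CLEAR :: st where
  "CLEAR = For 69 (Rg 60) (
    Sto (area 5 [+] Rg 69) (Rg 11) ;; Sto (area 6 [+] Rg 69) (Rg 11) ;;
    Sto (area 7 [+] Rg 69) (Rg 11) ;; Sto (area 8 [+] Rg 69) (Rg 11))"

definition LOAD_FIRST :: st where
  "LOAD_FIRST = For 69 (Rg 62) (Sto (area 5 [+] Rg 69) (Rg 11 [+] Ld (Rg 61 [+] Rg 69) [*] Rg 10))"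

definition LOAD_SECOND :: st where
  "LOAD_SECOND = For 69 (Rg 64) (
    Cond (Nm 0) (Ld (Rg 63 [+] Rg 69))
      (Sto (area 7 [+] (Rg 69 [+] (Rg 69 [-] Rg 69 [div] Rg 13 [*] Rg 13) [*] (Rg 15 [*] Rg 13)))
        (Rg 11 [+] Rg 10))
      (Asg 70 (Nm 0)))"

definition EMIT :: st where
  "EMIT = Asg 66 (Rg 62 [+] Rg 64 [+] Rg 16) ;; For 69 (Rg 66) (
    Cond (Nm 2 [*] Rg 11 [+] Rg 10 [*] Rg 60) (Nm 2 [*] Ld (area 5 [+] Rg 69))
      (Cond (Rg 14) (Rg 69 [-] Rg 69 [div] Rg 13 [*] Rg 13)
        (Sto (Rg 65 [+] Rg 69) (Nm 0)) (Sto (Rg 65 [+] Rg 69) (Nm 1)))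
      (Sto (Rg 65 [+] Rg 69) (Nm 0)))"

definition COMBINE :: st where
  "COMBINE = SIZE ;; CLEAR ;; LOAD_FIRST ;; LOAD_SECOND ;; CONVOLVE ;; EMIT"

definition bits :: "(nat \<Rightarrow> nat) \<Rightarrow> nat \<Rightarrow> nat \<Rightarrow> nat set \<Rightarrow> bool" where
  "bits M p l X \<longleftrightarrow> (\<forall>i<l. M (p + i) = of_bool (i \<in> X))"

lemma bits_same: "bits M p l X \<Longrightarrow> same Z M' M \<Longrightarrow> Z \<inter> {p..<p + l} = {} \<Longrightarrow> bits M' p l X"
  unfolding bits_def
proof (intro allI impI)
  fix i assume *: "\<forall>i<l. M (p + i) = of_bool (i \<in> X)" "same Z M' M" "Z \<inter> {p..<p + l} = {}" "i < l"
  then have "p + i \<in> {p..<p + l}" by auto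
  then have "p + i \<notin> Z" using *(3) by blast
  then show "M' (p + i) = of_bool (i \<in> X)" using * by (simp add: same_eq[OF *(2)])
qed

text \<open>\<open>y mod K\<close> is the number of summands recorded in \<open>y\<close>, and each
  of them adds \<open>h\<close> to the part above the counter. This turns an excess over multiples
  of \<open>a + h\<close> into an excess over multiples of \<open>a\<close>.\<close>

definition lift :: "nat \<Rightarrow> nat \<Rightarrow> nat \<Rightarrow> nat" where
  "lift K h y = y + y mod K * (h * K)"

definition sumset :: "nat \<Rightarrow> nat \<Rightarrow> nat \<Rightarrow> nat set \<Rightarrow> nat set \<Rightarrow> nat set" where
  "sumset K k h X Y = {i. (\<exists>x\<in>X. \<exists>y\<in>Y. x + lift K h y = i) \<and> i mod K \<le> k}"

context fixpoint_table
begin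

text \<open>Zeros and ones have exact representations, so a convolution starts from error 0.\<close>

definition arr :: "(nat \<Rightarrow> nat) \<Rightarrow> nat \<Rightarrow> nat \<Rightarrow> nat set \<Rightarrow> bool" where
  "arr M b n X \<longleftrightarrow> (\<forall>p<n. M (b + p) = B + of_bool (p \<in> X) * S \<and> M (b + Q + p) = B)"

lemma arr_approx: "arr M b n X \<Longrightarrow> approx M b n (indic X) 0"
  unfolding arr_def approx_def indic_def by (auto simp: cv_const)

text \<open>The length includes \<open>k * (h * K)\<close>, the farthest that lifting can move an
  element, so that the convolution with the lifted operand cannot wrap around.\<close>

lemma SIZE_spec:
  assumes n: "R 62 + R 64 + R 14 * (R 15 * R 13) + R 16 = n" "1 \<le> n" "2 * n \<le> Nb"
  shows "wp G SIZE (\<lambda>R' M' t'. (\<exists>L. R' 60 = 2 ^ L \<and> n \<le> 2 ^ L \<and> 2 ^ L \<le> 2 * n \<and> L \<le> J \<and>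
    t' \<le> t + 3 + 2 * L) \<and> M' = M \<and> same {60, 67} R' R) R M t"
proof -
  have nG: "n < G" "2 * n < G" using n Nb_Q Q_G by linarith+
  define I where "I = (\<lambda>R' M' t'. \<exists>L. R' 60 = 2 ^ L \<and> (2::nat) ^ L \<le> 2 * n \<and>
    t' \<le> t + 2 + 2 * L \<and> M' = M \<and> R' 67 = n \<and> same {60, 67} R' R)"
  have wh: "wp G (Wh (Rg 60) (Rg 67) (Asg 60 (Rg 60 [+] Rg 60)))
     (\<lambda>R' M' t'. (\<exists>L. R' 60 = 2 ^ L \<and> n \<le> 2 ^ L \<and> 2 ^ L \<le> 2 * n \<and> L \<le> J \<and>
       t' \<le> t + 3 + 2 * L) \<and> M' = M \<and> same {60, 67} R' R) (R(60 := 1, 67 := n)) M (t + 1 + 1)"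
  proof (rule wp_Wh[where I = I and f = "\<lambda>R M. n - R 60"])
    show "I (R(60 := 1, 67 := n)) M (t + 1 + 1)"
      unfolding I_def using n by (intro exI[of _ 0]) (auto intro!: same_upd)
  next
    fix R' M' t'
    assume "I R' M' t'" "ev (Rg 60) R' M' < ev (Rg 67) R' M'"
    then obtain L where L: "R' 60 = 2 ^ L" "t' \<le> t + 2 + 2 * L" "M' = M" "R' 67 = n"
      "same {60, 67} R' R" and lt: "2 ^ L < n" unfolding I_def by auto
    have "I (R'(60 := 2 ^ L + 2 ^ L)) M' (t' + 1 + 1)"
      unfolding I_def using L lt by (intro exI[of _ "Suc L"]) (auto intro!: same_upd)
    moreover have "n - (2 ^ L + 2 ^ L) < n - 2 ^ L"
    proof -
      have "0 < (2::nat) ^ L" by simp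
      then show ?thesis using lt by linarith
    qed
    ultimately show "wp G (Asg 60 (Rg 60 [+] Rg 60))
        (\<lambda>R2 M2 t2. I R2 M2 t2 \<and> n - R2 60 < n - R' 60) R' M' (t' + 1)"
      using L lt nG by (simp add: wp_simps)
  next
    fix R' M' t'
    assume "I R' M' t'" "\<not> ev (Rg 60) R' M' < ev (Rg 67) R' M'"
    then obtain L where L: "R' 60 = 2 ^ L" "t' \<le> t + 2 + 2 * L" "M' = M" "R' 67 = n"
      "same {60, 67} R' R" "2 ^ L \<le> 2 * n" and lt: "n \<le> 2 ^ L" unfolding I_def by auto
    moreover have "L \<le> J" by (rule J) (use L n in linarith)
    ultimately show "(\<exists>L. R' 60 = 2 ^ L \<and> n \<le> 2 ^ L \<and> 2 ^ L \<le> 2 * n \<and> L \<le> J \<and>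
       t' + 1 \<le> t + 3 + 2 * L) \<and> M' = M \<and> same {60, 67} R' R" by auto
  qed
  show ?thesis
    unfolding SIZE_def using wh nG n by (simp add: wp_Asg wp_Sq)
qed

lemma CLEAR_spec:
  assumes "consts_ok R" "R 60 = N" "N \<le> Nb"
  shows "wp G CLEAR (\<lambda>R' M' t'. arr M' (5 * Q) N {} \<and> arr M' (7 * Q) N {} \<and> same {69} R' R \<and>
    same {5 * Q..<9 * Q} M' M \<and> t' \<le> t + 2 + 6 * N) R M t"
  unfolding CLEAR_def
proof (rule wp_For[where n = N and I = "\<lambda>j R' M' t'. R' 69 = j \<and> same {69} R' R \<and>
    same {5 * Q..<9 * Q} M' M \<and> arr M' (5 * Q) j {} \<and> arr M' (7 * Q) j {} \<and> t' \<le> t + 1 + 6 * j"])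
  have NQ: "N \<le> Q" "40 * Q < G" "B < G" using assms(3) Nb_Q Q_G B_G by auto
  show "N < G" "0 < G" using NQ by auto
  show "(R(69 := 0)) 69 = 0 \<and> same {69} (R(69 := 0)) R \<and> same {5 * Q..<9 * Q} M M \<and>
    arr M (5 * Q) 0 {} \<and> arr M (7 * Q) 0 {} \<and> t + 1 \<le> t + 1 + 6 * 0"
    by (simp add: arr_def same_upd)
  fix j R' M' t'
  assume I: "R' 69 = j \<and> same {69} R' R \<and>
    same {5 * Q..<9 * Q} M' M \<and> arr M' (5 * Q) j {} \<and> arr M' (7 * Q) j {} \<and> t' \<le> t + 1 + 6 * j"
  then have s: "same {69} R' R" by blast
  have regs: "R' 10 = S" "R' 11 = B" "R' 12 = Q" "R' 60 = N"
    using assms by (simp_all add: same_eq[OF s] consts_ok_def)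
  show "R' 69 = j \<and> ev (Rg 60) R' M' = N" using I regs by simp
  assume j: "j < N"
  show "wp G (Sto (area 5 [+] Rg 69) (Rg 11) ;; Sto (area 6 [+] Rg 69) (Rg 11) ;;
      Sto (area 7 [+] Rg 69) (Rg 11) ;; Sto (area 8 [+] Rg 69) (Rg 11))
    (\<lambda>R' M' t'. R' 69 = j \<and> (R'(69 := Suc j)) 69 = Suc j \<and> same {69} (R'(69 := Suc j)) R \<and>
      same {5 * Q..<9 * Q} M' M \<and> arr M' (5 * Q) (Suc j) {} \<and> arr M' (7 * Q) (Suc j) {} \<and>
      t' + 1 \<le> t + 1 + 6 * Suc j) R' M' (t' + 1)"
    using I j NQ
    apply (simp add: wp_simps regs)
    apply (intro conjI same_upd)
    apply (simp_all add: arr_def less_Suc_eq)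
    done
qed simp

lemma LOAD_FIRST_spec:
  assumes "consts_ok R" "R 60 = N" "N \<le> Nb" "R 61 = p" "R 62 = l" "l \<le> N"
    and X: "bits M p l X" "X \<subseteq> {..<l}" "11 * Q \<le> p" and a: "arr M (5 * Q) N {}"
  shows "wp G LOAD_FIRST (\<lambda>R' M' t'. arr M' (5 * Q) N X \<and> same {69} R' R \<and>
    same {5 * Q..<6 * Q} M' M \<and> t' \<le> t + 2 + 3 * l) R M t"
  unfolding LOAD_FIRST_def
proof (rule wp_For[where n = l and I = "\<lambda>j R' M' t'. R' 69 = j \<and> same {69} R' R \<and>
    same {5 * Q..<6 * Q} M' M \<and> arr M' (5 * Q) N (X \<inter> {..<j}) \<and> t' \<le> t + 1 + 3 * j"])
  have NQ: "N \<le> Q" "40 * Q < G" "B < G" "B + S < G" using assms(3) Nb_Q Q_G B_G S_le_B by auto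
  show "l < G" "0 < G" using NQ assms by auto
  show "(R(69 := 0)) 69 = 0 \<and> same {69} (R(69 := 0)) R \<and> same {5 * Q..<6 * Q} M M \<and>
    arr M (5 * Q) N (X \<inter> {..<0}) \<and> t + 1 \<le> t + 1 + 3 * 0"
    using a by (simp add: same_upd)
  fix R' M' t'
  show "arr M' (5 * Q) N X \<and> same {69} R' R \<and> same {5 * Q..<6 * Q} M' M \<and> t' + 1 \<le> t + 2 + 3 * l"
    if "R' 69 = l \<and> same {69} R' R \<and> same {5 * Q..<6 * Q} M' M \<and>
      arr M' (5 * Q) N (X \<inter> {..<l}) \<and> t' \<le> t + 1 + 3 * l"
    using that X(2) by (simp add: Int_absorb2)
  fix j
  assume I: "R' 69 = j \<and> same {69} R' R \<and> same {5 * Q..<6 * Q} M' M \<and>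
      arr M' (5 * Q) N (X \<inter> {..<j}) \<and> t' \<le> t + 1 + 3 * j"
  then have s: "same {69} R' R" and sm: "same {5 * Q..<6 * Q} M' M" by blast+
  have regs: "R' 10 = S" "R' 11 = B" "R' 12 = Q" "R' 60 = N" "R' 61 = p" "R' 62 = l"
    using assms by (simp_all add: same_eq[OF s] consts_ok_def)
  show "R' 69 = j \<and> ev (Rg 62) R' M' = l" using I regs by simp
  assume j: "j < l"
  have m: "M' (p + j) = of_bool (j \<in> X)"
    using X(1,3) j by (auto simp: same_eq[OF sm] bits_def)
  have vG: "B + of_bool (j \<in> X) * S < G" using NQ by simp
  have "arr (M'(5 * Q + j := B + of_bool (j \<in> X) * S)) (5 * Q) N (X \<inter> {..<Suc j})"
    unfolding arr_def
  proof (intro allI impI)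
    fix q assume "q < N"
    then show "(M'(5 * Q + j := B + of_bool (j \<in> X) * S)) (5 * Q + q)
        = B + of_bool (q \<in> X \<inter> {..<Suc j}) * S \<and>
        (M'(5 * Q + j := B + of_bool (j \<in> X) * S)) (5 * Q + Q + q) = B"
      using I j assms(6) NQ by (cases "q = j") (auto simp: arr_def less_Suc_eq)
  qed
  then show "wp G (Sto (area 5 [+] Rg 69) (Rg 11 [+] Ld (Rg 61 [+] Rg 69) [*] Rg 10))
    (\<lambda>R' M' t'. R' 69 = j \<and> (R'(69 := Suc j)) 69 = Suc j \<and> same {69} (R'(69 := Suc j)) R \<and>
      same {5 * Q..<6 * Q} M' M \<and> arr M' (5 * Q) N (X \<inter> {..<Suc j}) \<and>
      t' + 1 \<le> t + 1 + 3 * Suc j) R' M' (t' + 1)"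
    using I j NQ vG assms(6)
    by (simp add: wp_simps regs m same_upd)
qed

text \<open>Only ones are written, each at its lifted position; the positions in between rely on the
  array having been cleared in full length.\<close>

lemma LOAD_SECOND_spec:
  assumes "consts_ok R" "R 60 = N" "N \<le> Nb" "R 63 = p" "R 64 = l" "l \<le> N"
    and K: "R 13 = K" "R 15 = h" "0 < K"
    and Y: "bits M p l Y" "Y \<subseteq> {..<l}" "11 * Q \<le> p" "\<And>y. y \<in> Y \<Longrightarrow> lift K h y < N"
    and a: "arr M (7 * Q) N {}"
  shows "wp G LOAD_SECOND (\<lambda>R' M' t'. arr M' (7 * Q) N (lift K h ` Y) \<and> same {69, 70} R' R \<and>
    same {7 * Q..<8 * Q} M' M \<and> t' \<le> t + 2 + 4 * l) R M t"
  unfolding LOAD_SECOND_def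
proof (rule wp_For[where n = l and I = "\<lambda>j R' M' t'. R' 69 = j \<and> same {69, 70} R' R \<and>
    same {7 * Q..<8 * Q} M' M \<and> arr M' (7 * Q) N (lift K h ` (Y \<inter> {..<j})) \<and> t' \<le> t + 1 + 4 * j"])
  have NQ: "N \<le> Q" "40 * Q < G" "B < G" "B + S < G" using assms(3) Nb_Q Q_G B_G S_le_B by auto
  show "l < G" "0 < G" using NQ assms by auto
  show "(R(69 := 0)) 69 = 0 \<and> same {69, 70} (R(69 := 0)) R \<and> same {7 * Q..<8 * Q} M M \<and>
    arr M (7 * Q) N (lift K h ` (Y \<inter> {..<0})) \<and> t + 1 \<le> t + 1 + 4 * 0"
    using a by (simp add: same_upd)
  fix R' M' t'
  show "arr M' (7 * Q) N (lift K h ` Y) \<and> same {69, 70} R' R \<and> same {7 * Q..<8 * Q} M' M \<and>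
      t' + 1 \<le> t + 2 + 4 * l"
    if "R' 69 = l \<and> same {69, 70} R' R \<and> same {7 * Q..<8 * Q} M' M \<and>
      arr M' (7 * Q) N (lift K h ` (Y \<inter> {..<l})) \<and> t' \<le> t + 1 + 4 * l"
    using that Y(2) by (simp add: Int_absorb2)
  fix j
  assume I: "R' 69 = j \<and> same {69, 70} R' R \<and> same {7 * Q..<8 * Q} M' M \<and>
      arr M' (7 * Q) N (lift K h ` (Y \<inter> {..<j})) \<and> t' \<le> t + 1 + 4 * j"
  then have s: "same {69, 70} R' R" and sm: "same {7 * Q..<8 * Q} M' M" by blast+
  have regs: "R' 10 = S" "R' 11 = B" "R' 12 = Q" "R' 60 = N" "R' 63 = p" "R' 64 = l"
      "R' 13 = K" "R' 15 = h"
    using assms by (simp_all add: same_eq[OF s] consts_ok_def)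
  show "R' 69 = j \<and> ev (Rg 64) R' M' = l" using I regs by simp
  assume j: "j < l"
  have m: "M' (p + j) = of_bool (j \<in> Y)"
    using Y(1,3) j by (auto simp: same_eq[OF sm] bits_def)
  have md: "j - j div K * K = j mod K" by (simp add: minus_div_mult_eq_mod)
  show "wp G (Cond (Nm 0) (Ld (Rg 63 [+] Rg 69))
      (Sto (area 7 [+] (Rg 69 [+] (Rg 69 [-] Rg 69 [div] Rg 13 [*] Rg 13) [*] (Rg 15 [*] Rg 13)))
        (Rg 11 [+] Rg 10))
      (Asg 70 (Nm 0)))
    (\<lambda>R' M' t'. R' 69 = j \<and> (R'(69 := Suc j)) 69 = Suc j \<and> same {69, 70} (R'(69 := Suc j)) R \<and>
      same {7 * Q..<8 * Q} M' M \<and> arr M' (7 * Q) N (lift K h ` (Y \<inter> {..<Suc j})) \<and>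
      t' + 1 \<le> t + 1 + 4 * Suc j) R' M' (t' + 1)"
  proof (cases "j \<in> Y")
    case True
    have lN: "lift K h j < N" by (rule Y(4)[OF True])
    have im: "lift K h ` (Y \<inter> {..<Suc j}) = insert (lift K h j) (lift K h ` (Y \<inter> {..<j}))"
      using True by (auto simp: less_Suc_eq)
    have "arr (M'(7 * Q + lift K h j := B + S)) (7 * Q) N (lift K h ` (Y \<inter> {..<Suc j}))"
      unfolding arr_def im
    proof (intro allI impI)
      fix q assume "q < N"
      then show "(M'(7 * Q + lift K h j := B + S)) (7 * Q + q)
          = B + of_bool (q \<in> insert (lift K h j) (lift K h ` (Y \<inter> {..<j}))) * S \<and>
          (M'(7 * Q + lift K h j := B + S)) (7 * Q + Q + q) = B"
        using I lN NQ by (cases "q = lift K h j") (auto simp: arr_def)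
    qed
    then show ?thesis
      using I j NQ True lN
      apply (simp add: wp_simps regs m md lift_def[symmetric])
      apply (intro conjI same_upd)
      apply simp_all
      done
  next
    case False
    then have "Y \<inter> {..<Suc j} = Y \<inter> {..<j}" by (auto simp: less_Suc_eq)
    then show ?thesis
      using I j NQ False by (simp add: wp_simps regs m same_upd)
  qed
qed

lemma EMIT_spec:
  assumes "consts_ok R" "R 60 = N" "0 < N" "N \<le> Nb" "R 13 = K" "R 14 = k" "0 < K" "R 65 = p"
    and l: "R 62 + R 64 + R 16 = l" "l \<le> N" "11 * Q \<le> p" "p + l < G"
    and a: "approx M (5 * Q) N (\<lambda>i. of_nat (N * f i)) (1 / 4)"
  shows "wp G EMIT (\<lambda>R' M' t'. bits M' p l {i. 0 < f i \<and> i mod K \<le> k} \<and> R' 66 = l \<and>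
    same {66, 69} R' R \<and> same {p..<p + l} M' M \<and> t' \<le> t + 3 + 5 * l) R M t"
  unfolding EMIT_def
proof (rule wp_Asg_SqI, goal_cases)
  case 1 show ?case using l by simp
next
  case 2
  let ?R = "R(66 := l)"
  let ?Z = "{i. 0 < f i \<and> i mod K \<le> k}"
  have NQ: "N \<le> Q" "40 * Q < G" using assms(4) Nb_Q Q_G by auto
  have G1: "1 < G" using Nb Nb_Q Q_G by linarith
  have "wp G (For 69 (Rg 66) (
    Cond (Nm 2 [*] Rg 11 [+] Rg 10 [*] Rg 60) (Nm 2 [*] Ld (area 5 [+] Rg 69))
      (Cond (Rg 14) (Rg 69 [-] Rg 69 [div] Rg 13 [*] Rg 13)
        (Sto (Rg 65 [+] Rg 69) (Nm 0)) (Sto (Rg 65 [+] Rg 69) (Nm 1)))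
      (Sto (Rg 65 [+] Rg 69) (Nm 0))))
    (\<lambda>R' M' t'. bits M' p l ?Z \<and> R' 66 = l \<and>
      same {66, 69} R' R \<and> same {p..<p + l} M' M \<and> t' \<le> t + 3 + 5 * l) ?R M (t + 1)"
  proof (rule wp_For[where n = l and I = "\<lambda>j R' M' t'. R' 69 = j \<and> same {69} R' ?R \<and>
      same {p..<p + l} M' M \<and> bits M' p j ?Z \<and> t' \<le> t + 2 + 5 * j"])
    show "l < G" "0 < G" using NQ l by auto
    show "(?R(69 := 0)) 69 = 0 \<and> same {69} (?R(69 := 0)) ?R \<and> same {p..<p + l} M M \<and>
      bits M p 0 ?Z \<and> t + 1 + 1 \<le> t + 2 + 5 * 0"
      by (simp add: same_upd bits_def)
    fix R' M' t'
    show "bits M' p l ?Z \<and> R' 66 = l \<and>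
      same {66, 69} R' R \<and> same {p..<p + l} M' M \<and> t' + 1 \<le> t + 3 + 5 * l"
      if *: "R' 69 = l \<and> same {69} R' ?R \<and> same {p..<p + l} M' M \<and> bits M' p l ?Z \<and> t' \<le> t + 2 + 5 * l"
    proof -
      have "same {66, 69} R' R"
        by (rule same_trans[of "{69}" _ ?R "{66}"]) (use * in \<open>auto intro: same_upd\<close>)
      moreover have "R' 66 = l" using * by (simp add: same_def)
      ultimately show ?thesis using * by simp
    qed
    fix j
    assume I: "R' 69 = j \<and> same {69} R' ?R \<and> same {p..<p + l} M' M \<and> bits M' p j ?Z \<and> t' \<le> t + 2 + 5 * j"
    then have s: "same {69} R' ?R" and sm: "same {p..<p + l} M' M" by blast+
    have regs: "R' 10 = S" "R' 11 = B" "R' 12 = Q" "R' 60 = N" "R' 66 = l" "R' 65 = p" "R' 13 = K" "R' 14 = k"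
      using assms by (simp_all add: same_eq[OF s] consts_ok_def)
    show "R' 69 = j \<and> ev (Rg 66) R' M' = l" using I regs by simp
    assume j: "j < l"
    have md: "j - j div K * K = j mod K" by (simp add: minus_div_mult_eq_mod)
    have m: "M' (5 * Q + j) = M (5 * Q + j)"
      using j l NQ by (auto simp: same_eq[OF sm])
    have "j < N" using j l by simp
    from approxD[OF a this]
    have "\<bar>Re (cv (M (5 * Q + j)) (M (5 * Q + Q + j)) - of_nat (N * f j))\<bar> \<le> 1 / 4"
      using abs_Re_le_cmod order_trans by blast
    then have "\<bar>(real (M (5 * Q + j)) - real B) / real S - real (N * f j)\<bar> \<le> 1 / 4"
      by (simp add: cv_def)
    then have d: "(real (M (5 * Q + j)) - real B) / real S \<le> real (N * f j) + 1 / 4"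
      "real (N * f j) - 1 / 4 \<le> (real (M (5 * Q + j)) - real B) / real S" by linarith+
    have S: "0 < real S" using S_pos by simp
    \<comment> \<open>The stored value is \<open>N * f j\<close> up to 1/4, scaled by
      \<open>S\<close> and shifted by \<open>B\<close>, so comparison with \<open>N / 2\<close>
      decides whether \<open>f j\<close> vanishes. Both sides are doubled to avoid the
      fraction.\<close>
    have test: "2 * B + S * N < 2 * M (5 * Q + j) \<longleftrightarrow> 0 < f j"
    proof
      assume f: "0 < f j"
      have "N * 1 \<le> N * f j" using f by (intro mult_le_mono2) simp
      then have "real N \<le> real (N * f j)" by (simp only: of_nat_le_iff mult_1_right)
      moreover have "1 \<le> real N" using assms(3) by simp
      ultimately have "real N / 2 < (real (M (5 * Q + j)) - real B) / real S" using d(2) by linarith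
      then have "real N * S < 2 * (real (M (5 * Q + j)) - real B)"
        using S by (simp add: field_simps)
      then have "real (2 * B + S * N) < real (2 * M (5 * Q + j))" by (simp add: algebra_simps)
      then show "2 * B + S * N < 2 * M (5 * Q + j)" by (simp only: of_nat_less_iff)
    next
      assume *: "2 * B + S * N < 2 * M (5 * Q + j)"
      show "0 < f j"
      proof (rule ccontr)
        assume "\<not> 0 < f j"
        then have "(real (M (5 * Q + j)) - real B) / real S \<le> 1 / 4" using d(1) by simp
        moreover have "1 \<le> real N" using assms(3) by simp
        ultimately have "(real (M (5 * Q + j)) - real B) / real S \<le> real N / 2" by linarith
        then have "2 * (real (M (5 * Q + j)) - real B) \<le> real N * S" using S by (simp add: field_simps)
        then have "real (2 * M (5 * Q + j)) \<le> real (2 * B + S * N)" by (simp add: algebra_simps)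
        then have "2 * M (5 * Q + j) \<le> 2 * B + S * N" by (simp only: of_nat_le_iff)
        then show False using * by simp
      qed
    qed
    have upd: "bits (M'(p + j := of_bool (j \<in> ?Z))) p (Suc j) ?Z"
      using I by (auto simp: bits_def less_Suc_eq)
    show "wp G (
      Cond (Nm 2 [*] Rg 11 [+] Rg 10 [*] Rg 60) (Nm 2 [*] Ld (area 5 [+] Rg 69))
        (Cond (Rg 14) (Rg 69 [-] Rg 69 [div] Rg 13 [*] Rg 13)
          (Sto (Rg 65 [+] Rg 69) (Nm 0)) (Sto (Rg 65 [+] Rg 69) (Nm 1)))
        (Sto (Rg 65 [+] Rg 69) (Nm 0)))
      (\<lambda>R' M' t'. R' 69 = j \<and> (R'(69 := Suc j)) 69 = Suc j \<and> same {69} (R'(69 := Suc j)) ?R \<and>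
        same {p..<p + l} M' M \<and> bits M' p (Suc j) ?Z \<and> t' + 1 \<le> t + 2 + 5 * Suc j) R' M' (t' + 1)"
      using I j l(4) G1 upd
      by (cases "0 < f j"; cases "j mod K \<le> k") (simp_all add: wp_simps regs m md test same_upd)
  qed
  then show ?case using l(1) by simp
qed

text \<open>\<open>n\<close> is the length before rounding up to a power of two, which at most
  doubles it; \<open>J + 1\<close> bounds the number of transform levels.\<close>

lemma COMBINE_spec:
  assumes c: "consts_ok R" and tab: "table_ok M"
    and regs: "R 13 = K" "R 14 = k" "R 15 = h" "R 16 = e" "R 61 = p" "R 62 = l" "R 63 = p'" "R 64 = l'" "R 65 = q"
    and K: "0 < K"
    and X: "bits M p l X" "X \<subseteq> {..<l}" "11 * Q \<le> p"
    and Y: "bits M p' l' Y" "Y \<subseteq> {..<l'}" "11 * Q \<le> p'" "\<And>y. y \<in> Y \<Longrightarrow> y mod K \<le> k"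
    and n: "l + l' + k * (h * K) + e = n" "1 \<le> n" "2 * n \<le> Nb" "11 * Q \<le> q" "q + (l + l' + e) < G"
  shows "wp G COMBINE (\<lambda>R' M' t'. bits M' q (l + l' + e) (sumset K k h X Y) \<and> R' 66 = l + l' + e \<and>
    same ({60} \<union> {66..<120}) R' R \<and> same ({3 * Q..<11 * Q} \<union> {q..<q + (l + l' + e)}) M' M \<and>
    t' \<le> t + 200 * n * (J + 1)) R M t"
proof -
  have n': "R 62 + R 64 + R 14 * (R 15 * R 13) + R 16 = n" using regs n by simp
  have c': "R 10 = S" "R 11 = B" "R 12 = Q" using c by (auto simp: consts_ok_def)
  show ?thesis
    unfolding COMBINE_def
  proof (rule wp_SqI[OF SIZE_spec[OF n' n(2,3)]], elim conjE exE, goal_cases)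
    case A: (1 R1 M1 t1 L)
    let ?N = "2 ^ L :: nat"
    have N: "?N \<le> Nb" "n \<le> ?N" "?N \<le> 2 * n" using A n by auto
    have NQ: "?N \<le> Q" "40 * Q < G" using N Nb_Q Q_G by auto
    have r1: "consts_ok R1" "R1 60 = ?N" "R1 13 = K" "R1 14 = k" "R1 15 = h" "R1 16 = e" "R1 61 = p"
      "R1 62 = l" "R1 63 = p'" "R1 64 = l'" "R1 65 = q"
      using A regs c' by (simp_all add: same_eq[OF A(2)] consts_ok_def)
    show ?case
    proof (rule wp_SqI[OF CLEAR_spec[OF r1(1,2) N(1)]], elim conjE, goal_cases)
      case C: (1 R2 M2 t2)
      have r2: "consts_ok R2" "R2 60 = ?N" "R2 13 = K" "R2 14 = k" "R2 15 = h" "R2 16 = e" "R2 61 = p"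
        "R2 62 = l" "R2 63 = p'" "R2 64 = l'" "R2 65 = q"
        using r1 by (simp_all add: same_eq[OF C(3)] consts_ok_def)
      have b2: "bits M2 p l X" "bits M2 p' l' Y"
        using bits_same[OF X(1)] bits_same[OF Y(1)] C(4) X(3) Y(3) A(1) by auto
      have lN: "l \<le> ?N" "l' \<le> ?N" using n(1) N(2) by linarith+
      show ?case
      proof (rule wp_SqI[OF LOAD_FIRST_spec[OF r2(1,2) N(1) r2(7,8) lN(1) b2(1) X(2,3) C(1)]],
          elim conjE, goal_cases)
        case D: (1 R3 M3 t3)
        have r3: "consts_ok R3" "R3 60 = ?N" "R3 13 = K" "R3 14 = k" "R3 15 = h" "R3 16 = e" "R3 61 = p"
          "R3 62 = l" "R3 63 = p'" "R3 64 = l'" "R3 65 = q"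
          using r2 by (simp_all add: same_eq[OF D(2)] consts_ok_def)
        have b3: "bits M3 p' l' Y"
          using bits_same[OF b2(2) D(3)] Y(3) by auto
        have a3: "arr M3 (7 * Q) ?N {}"
          using C(2) NQ by (auto simp: arr_def same_eq[OF D(3)])
        have lift_le: "lift K h y < l' + k * (h * K)" if "y \<in> Y" for y
        proof -
          have "y mod K * (h * K) \<le> k * (h * K)" using Y(4)[OF that] by (rule mult_le_mono1)
          moreover have "y < l'" using that Y(2) by auto
          ultimately show ?thesis unfolding lift_def by linarith
        qed
        then have Yl: "y \<in> Y \<Longrightarrow> lift K h y < ?N" for y using n(1) N(2) by fastforce
        show ?case
        proof (rule wp_SqI[OF LOAD_SECOND_spec[OF r3(1,2) N(1) r3(9,10) lN(2) r3(3,5) K b3 Y(2,3) Yl a3]],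
            simp, elim conjE, goal_cases)
          case E: (1 R4 M4 t4)
          have r4: "consts_ok R4" "R4 60 = ?N" "R4 13 = K" "R4 14 = k" "R4 15 = h" "R4 16 = e" "R4 61 = p"
            "R4 62 = l" "R4 63 = p'" "R4 64 = l'" "R4 65 = q"
            using r3 by (simp_all add: same_eq[OF E(2)] consts_ok_def)
          have a4: "arr M4 (5 * Q) ?N X"
            using D(1) NQ by (auto simp: arr_def same_eq[OF E(3)])
          have tab4: "table_ok M4"
          proof -
            have "table_ok M2" by (rule table_ok_same[OF tab]) (use C(4) A(1) in auto)
            then have "table_ok M3" by (rule table_ok_same[OF _ D(3)]) auto
            then show ?thesis by (rule table_ok_same[OF _ E(3)]) auto
          qed
          let ?Y = "lift K h ` Y"
          have sub: "X \<subseteq> {..<?N}" "?Y \<subseteq> {..<?N}" using X(2) lN(1) Yl by auto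
          have XY: "x + y < ?N" if "x \<in> X" "y \<in> ?Y" for x y
          proof -
            from that(2) obtain y' where y: "y' \<in> Y" "y = lift K h y'" by blast
            have "x < l" using that(1) X(2) by auto
            then show ?thesis using lift_le[OF y(1)] y(2) n(1) N(2) by linarith
          qed
          have fin: "finite X" "finite ?Y" using sub finite_subset by blast+
          show ?case
          proof (rule wp_SqI[OF CONVOLVE_spec[OF r4(1,2) N(1) tab4 arr_approx[OF a4] sub(1)
                arr_approx[OF E(1)] sub(2) XY]], assumption, assumption, elim conjE, goal_cases)
            case F: (1 R5 M5 t5)
            have r5: "consts_ok R5" "R5 60 = ?N" "R5 13 = K" "R5 14 = k" "R5 65 = q" "R5 62 + R5 64 + R5 16 = l + l' + e"
              using r4 by (simp_all add: same_eq[OF F(2)] consts_ok_def)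
            have le: "l + l' + e \<le> ?N" using n(1) N(2) by linarith
            have N0: "0 < ?N" by simp
            have Z: "{i. 0 < reps X ?Y i \<and> i mod K \<le> k} = sumset K k h X Y"
              unfolding sumset_def reps_pos_iff[OF fin] by blast
            show ?case
            proof (rule wp_mono[OF EMIT_spec[OF r5(1,2) N0 N(1) r5(3,4) K r5(5,6) le n(4,5) F(1)]],
                elim conjE, unfold Z, goal_cases)
              case H: (1 R6 M6 t6)
              have "same ({60} \<union> {66..<120}) R6 R"
                unfolding same_def
                by (auto simp: same_eq[OF H(3)] same_eq[OF F(2)] same_eq[OF E(2)] same_eq[OF D(2)]
                    same_eq[OF C(3)] same_eq[OF A(2)])
              moreover have "same ({3 * Q..<11 * Q} \<union> {q..<q + (l + l' + e)}) M6 M"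
                unfolding same_def
                by (auto simp: same_eq[OF H(4)] same_eq[OF F(3)] same_eq[OF E(3)] same_eq[OF D(3)]
                    same_eq[OF C(4)] A(1))
              moreover have "t6 \<le> t + 200 * n * (J + 1)"
              proof -
                have LJ: "L \<le> J" by fact
                have "L * (30 + 60 * ?N) \<le> J * (30 + 60 * (2 * n))"
                  using LJ N(3) by (intro mult_le_mono) auto
                also have "\<dots> = 30 * J + 120 * (J * n)" by (simp add: algebra_simps)
                also have "J \<le> J * n" using n(2) by (cases n) (auto simp: One_nat_def)
                then have "30 * J + 120 * (J * n) \<le> 150 * (J * n)" by simp
                finally have 1: "L * (30 + 60 * ?N) \<le> 150 * (J * n)" .
                define W V m where "W = L * (30 + 60 * ?N)" "V = J * n" "m = ?N"
                note WV = this
                have t1: "t1 \<le> t + 3 + 2 * L" by fact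
                have L: "L \<le> V" using LJ \<open>J \<le> J * n\<close> unfolding WV by linarith
                have ln: "l \<le> n" "l' \<le> n" "l + l' + e \<le> n" using n(1) by linarith+
                have "t6 \<le> t + 42 + 46 * m + 3 * l + 4 * l' + 5 * (l + l' + e) + W + 2 * L"
                  using H(5) F(4)[folded WV] E(4) D(4) C(5)[folded WV(3)] t1 by linarith
                also have "\<dots> \<le> t + 42 * n + 46 * (2 * n) + 3 * n + 4 * n + 5 * n + 150 * V + 2 * V"
                  using ln L 1[folded WV] N(3)[folded WV(3)] n(2) by (intro add_mono mult_le_mono) simp_all
                finally have "t6 \<le> t + 42 * n + 92 * n + 12 * n + 152 * V" by simp
                then show ?thesis by (simp add: WV(2) algebra_simps)
              qed
              ultimately show ?case using H(1,2) by blast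
            qed
          qed
        qed
      qed
    qed
  qed
qed

end

section \<open>Pairwise merging of lists of bit vectors\<close>

type_synonym block = "nat \<times> nat set"

text \<open>\<open>Suc\<close> accounts for the length word stored in front of each block.\<close>

definition total :: "block list \<Rightarrow> nat" where
  "total bs = (\<Sum>b\<leftarrow>bs. Suc (fst b))"

lemma total_simps [simp]:
  "total [] = 0" "total (b # bs) = Suc (fst b) + total bs" "total (bs @ cs) = total bs + total cs"
  by (simp_all add: total_def)

lemma length_le_total: "length bs \<le> total bs"
  by (induction bs) auto

fun blks :: "(nat \<Rightarrow> nat) \<Rightarrow> nat \<Rightarrow> block list \<Rightarrow> bool" where
  "blks M p [] \<longleftrightarrow> True"
| "blks M p (b # bs) \<longleftrightarrow> M p = fst b \<and> bits M (p + 1) (fst b) (snd b) \<and> blks M (p + Suc (fst b)) bs"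

lemma blks_append: "blks M p (as @ bs) \<longleftrightarrow> blks M p as \<and> blks M (p + total as) bs"
  by (induction as arbitrary: p) (auto simp: add_ac)

lemma blks_cong:
  "blks M p bs \<Longrightarrow> (\<And>i. i < total bs \<Longrightarrow> M' (p' + i) = M (p + i)) \<Longrightarrow> blks M' p' bs"
proof (induction bs arbitrary: p p')
  case (Cons b bs)
  have "blks M' (p' + Suc (fst b)) bs"
  proof (rule Cons.IH)
    show "blks M (p + Suc (fst b)) bs" using Cons.prems by simp
    fix i assume "i < total bs"
    then show "M' (p' + Suc (fst b) + i) = M (p + Suc (fst b) + i)"
      using Cons.prems(2)[of "Suc (fst b) + i"] by (simp add: add_ac)
  qed
  moreover have "M' p' = M p" using Cons.prems(2)[of 0] by simp
  moreover have "bits M' (p' + 1) (fst b) (snd b)"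
    unfolding bits_def
  proof (intro allI impI)
    fix i assume i: "i < fst b"
    then have "M' (p' + (1 + i)) = M (p + (1 + i))" using Cons.prems(2)[of "1 + i"] by simp
    then show "M' (p' + 1 + i) = of_bool (i \<in> snd b)"
      using Cons.prems(1) i by (simp add: bits_def add.assoc)
  qed
  ultimately show ?case using Cons.prems(1) by simp
qed simp

lemma blks_same:
  assumes "blks M p bs" "same Z M' M" "Z \<inter> {p..<p + total bs} = {}"
  shows "blks M' p bs"
proof (rule blks_cong[OF assms(1)])
  fix i assume "i < total bs"
  then have "p + i \<in> {p..<p + total bs}" by simp
  then have "p + i \<notin> Z" using assms(3) by blast
  then show "M' (p + i) = M (p + i)" by (rule same_eq[OF assms(2)])
qed

text \<open>Cells are bits or lengths. This supplies the word-size bound needed whenever blocks are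
  copied.\<close>

lemma blks_le_total: "blks M p bs \<Longrightarrow> i < total bs \<Longrightarrow> M (p + i) \<le> total bs"
proof (induction bs arbitrary: p i)
  case (Cons b bs)
  consider "i = 0" | "0 < i" "i \<le> fst b" | "Suc (fst b) \<le> i" by linarith
  then show ?case
  proof cases
    case 1
    then show ?thesis using Cons.prems by simp
  next
    case 2
    then obtain j where j: "i = Suc j" "j < fst b" by (cases i) auto
    then have "M (p + 1 + j) = of_bool (j \<in> snd b)"
      using Cons.prems(1) by (simp add: bits_def)
    moreover have "p + i = p + 1 + j" using j by simp
    ultimately have "M (p + i) = of_bool (j \<in> snd b)" by (simp only:)
    then show ?thesis by simp
  next
    case 3
    then have "M (p + Suc (fst b) + (i - Suc (fst b))) \<le> total bs"
      using Cons.prems by (intro Cons.IH) auto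
    then show ?thesis using 3 by simp
  qed
qed simp

fun merge :: "('a \<Rightarrow> 'a \<Rightarrow> 'a) \<Rightarrow> 'a list \<Rightarrow> 'a list" where
  "merge f (x # y # zs) = f x y # merge f zs"
| "merge f xs = xs"

lemma length_merge: "length (merge f bs) = (length bs + 1) div 2"
  by (induction f bs rule: merge.induct) (auto simp: One_nat_def)

text \<open>The slack \<open>e\<close> is there because rebasing the second operand can push sums
  beyond the two lengths together. The intersection reflects that nothing past the stored length is
  represented.\<close>

definition join :: "nat \<Rightarrow> nat \<Rightarrow> nat \<Rightarrow> nat \<Rightarrow> block \<Rightarrow> block \<Rightarrow> block" where
  "join K k e h a b = (fst a + fst b + e,
    sumset K k h (snd a) (snd b) \<inter> {..<fst a + fst b + e})"

definition wf_block :: "nat \<Rightarrow> nat \<Rightarrow> block \<Rightarrow> bool" where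
  "wf_block K k b \<longleftrightarrow> 1 \<le> fst b \<and> snd b \<subseteq> {..<fst b} \<and> (\<forall>y\<in>snd b. y mod K \<le> k)"

lemma total_merge_le: "total (merge (join K k e h) bs) \<le> total bs + length bs * e"
  by (induction "join K k e h" bs rule: merge.induct) (auto simp: join_def)

definition PASS_LOOP :: st where
  "PASS_LOOP = Wh (Nm 1) (Rg 43) (
    Asg 62 (Ld (Rg 41)) ;; Asg 61 (Rg 41 [+] Nm 1) ;; Asg 63 (Rg 61 [+] Rg 62 [+] Nm 1) ;;
    Asg 64 (Ld (Rg 61 [+] Rg 62)) ;; Asg 65 (Rg 42 [+] Nm 1) ;; COMBINE ;;
    Sto (Rg 42) (Rg 66) ;; Asg 41 (Rg 63 [+] Rg 64) ;; Asg 42 (Rg 65 [+] Rg 66) ;;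
    Asg 43 (Rg 43 [-] Nm 2) ;; Asg 44 (Rg 44 [+] Nm 1))"

definition LEFTOVER :: st where
  "LEFTOVER = Cond (Nm 0) (Rg 43) (
      Asg 62 (Ld (Rg 41)) ;;
      For 45 (Rg 62 [+] Nm 1) (Sto (Rg 42 [+] Rg 45) (Ld (Rg 41 [+] Rg 45))) ;;
      Asg 42 (Rg 42 [+] Rg 62 [+] Nm 1) ;; Asg 44 (Rg 44 [+] Nm 1))
    (Asg 45 (Nm 0))"

definition PASS :: st where
  "PASS = Asg 41 (area 11) ;; Asg 42 (area 12) ;; Asg 43 (Rg 40) ;; Asg 44 (Nm 0) ;;
    PASS_LOOP ;; LEFTOVER ;; Asg 46 (Rg 42 [-] area 12) ;;
    For 45 (Rg 46) (Sto (area 11 [+] Rg 45) (Ld (area 12 [+] Rg 45))) ;; Asg 40 (Rg 44)"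

definition TREE :: st where
  "TREE = Wh (Nm 1) (Rg 40) (PASS ;; Asg 15 (Rg 15 [+] Rg 15))"

lemma wp_copy:
  assumes "0 < G" "n < G" "a + n \<le> G" "{a..<a + n} \<inter> {b..<b + n} = {}" "\<And>j. j < n \<Longrightarrow> M (b + j) < G"
    and e: "\<And>R' M'. same {i} R' R \<Longrightarrow> ev ea R' M' = a \<and> ev eb R' M' = b \<and> ev en R' M' = n"
  shows "wp G (For i en (Sto (ea [+] Rg i) (Ld (eb [+] Rg i)))) (\<lambda>R' M' t'.
    (\<forall>j<n. M' (a + j) = M (b + j)) \<and> same {a..<a + n} M' M \<and> same {i} R' R \<and> t' \<le> t + 2 + 3 * n) R M t"
proof (rule wp_For[where n = n and I = "\<lambda>j R' M' t'. R' i = j \<and> same {i} R' R \<and>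
    (\<forall>q<j. M' (a + q) = M (b + q)) \<and> same {a..<a + n} M' M \<and> t' \<le> t + 1 + 3 * j"])
  fix j R' M' t'
  assume I: "R' i = j \<and> same {i} R' R \<and>
    (\<forall>q<j. M' (a + q) = M (b + q)) \<and> same {a..<a + n} M' M \<and> t' \<le> t + 1 + 3 * j"
  then have e': "ev ea R' M' = a" "ev eb R' M' = b" "ev en R' M' = n" using e by auto
  show "R' i = j \<and> ev en R' M' = n" using I e' by simp
  assume j: "j < n"
  then have "b + j \<in> {b..<b + n}" by simp
  then have "b + j \<notin> {a..<a + n}" using assms(4) by blast
  then have "M' (b + j) = M (b + j)" using I same_eq[of "{a..<a + n}" M' M] by blast
  then show "wp G (Sto (ea [+] Rg i) (Ld (eb [+] Rg i)))
    (\<lambda>R' M' t'. R' i = j \<and> (R'(i := Suc j)) i = Suc j \<and> same {i} (R'(i := Suc j)) R \<and>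
      (\<forall>q<Suc j. M' (a + q) = M (b + q)) \<and> same {a..<a + n} M' M \<and> t' + 1 \<le> t + 1 + 3 * Suc j)
    R' M' (t' + 1)"
    using I j e' assms(3,5) by (simp add: wp_simps same_upd less_Suc_eq)
qed (use assms in \<open>auto simp: same_upd\<close>)

context fixpoint_table
begin

text \<open>\<open>w\<close> is the convolution length that each merge needs beyond the lengths of
  its operands, caused by lifting and slack.\<close>

definition cost :: "nat \<Rightarrow> block list \<Rightarrow> nat" where
  "cost w bs = total bs + length bs * w"

text \<open>Amortized analysis: \<open>300 * (J + 1) * cost w rest\<close> is the time still
  reserved for the blocks not yet read. Source and target are the separate areas 11 and 12, so
  results never overwrite unread input. An odd last block remains in \<open>rest\<close>.\<close>

lemma PASS_LOOP_spec:
  assumes c: "consts_ok R" "R 13 = K" "R 14 = k" "R 15 = h" "R 16 = e" "0 < K" and tab: "table_ok M"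
    and R: "R 41 = 11 * Q" "R 42 = 12 * Q" "R 43 = length bs" "R 44 = 0"
    and bs: "blks M (11 * Q) bs" "\<And>b. b \<in> set bs \<Longrightarrow> wf_block K k b"
    and T: "total bs \<le> T" "k * (h * K) + e = w" "w \<le> T" "4 * T \<le> Nb"
      "total (merge (join K k e h) bs) \<le> Q"
  shows "wp G PASS_LOOP (\<lambda>R' M' t'. \<exists>ds rest. merge (join K k e h) bs = ds @ rest \<and> length rest \<le> 1 \<and>
      total rest \<le> total bs \<and> R' 41 + total rest = 11 * Q + total bs \<and> R' 42 = 12 * Q + total ds \<and>
      R' 43 = length rest \<and> R' 44 = length ds \<and> blks M' (R' 41) rest \<and> blks M' (12 * Q) ds \<and>
      same ({41..<120}) R' R \<and> same ({3 * Q..<11 * Q} \<union> {12 * Q..<13 * Q}) M' M \<and>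
      t' \<le> t + 1 + 300 * (J + 1) * cost w bs) R M t"
proof -
  let ?f = "join K k e h" and ?c = "300 * (J + 1)"
  define I where "I = (\<lambda>R' M' t'. \<exists>ds rest. merge ?f bs = ds @ merge ?f rest \<and>
    set rest \<subseteq> set bs \<and> total rest \<le> total bs \<and>
    R' 41 + total rest = 11 * Q + total bs \<and> R' 42 = 12 * Q + total ds \<and>
    R' 43 = length rest \<and> R' 44 = length ds \<and> blks M' (R' 41) rest \<and> blks M' (12 * Q) ds \<and>
    same {41..<120} R' R \<and> same ({3 * Q..<11 * Q} \<union> {12 * Q..<13 * Q}) M' M \<and>
    t' + ?c * cost w rest \<le> t + ?c * cost w bs)"
  have QG: "40 * Q < G" "T \<le> Q" "total bs \<le> Q" "1 \<le> Q" using T Nb Nb_Q Q_G by linarith+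
  show ?thesis
    unfolding PASS_LOOP_def
  proof (rule wp_Wh[where I = I and f = "\<lambda>R M. R 43"])
    show "I R M t" unfolding I_def using R bs by (intro exI[of _ "[]"] exI[of _ bs]) auto
  next
    fix R' M' t'
    assume "I R' M' t'" and lt: "ev (Nm 1) R' M' < ev (Rg 43) R' M'"
    then obtain ds rest where I: "merge ?f bs = ds @ merge ?f rest"
      "set rest \<subseteq> set bs" "total rest \<le> total bs"
      "R' 41 + total rest = 11 * Q + total bs" "R' 42 = 12 * Q + total ds"
      "R' 43 = length rest" "R' 44 = length ds" "blks M' (R' 41) rest" "blks M' (12 * Q) ds"
      and s: "same {41..<120} R' R" and sm: "same ({3 * Q..<11 * Q} \<union> {12 * Q..<13 * Q}) M' M"
      and t: "t' + ?c * cost w rest \<le> t + ?c * cost w bs" unfolding I_def by blast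
    have "1 < length rest" using lt I by simp
    then obtain a b zs where rest: "rest = a # b # zs"
      by (cases rest; cases "tl rest") auto
    obtain l X l' Y where ab: "a = (l, X)" "b = (l', Y)" by (cases a, cases b)
    let ?n = "l + l' + k * (h * K) + e"
    have wf: "1 \<le> l" "X \<subseteq> {..<l}" "Y \<subseteq> {..<l'}" "\<And>y. y \<in> Y \<Longrightarrow> y mod K \<le> k"
      using bs(2)[of a] bs(2)[of b] I(2) rest ab by (auto simp: wf_block_def)
    define p where "p = R' 41"
    have p: "11 * Q \<le> p" "p + Suc l + Suc l' + total zs = 11 * Q + total bs"
      using I(3,4) rest ab by (simp_all add: p_def)
    define q where "q = R' 42"
    have tq: "total ds + Suc (l + l' + e) \<le> Q"
      using T(5) unfolding I(1) rest ab by (simp add: join_def)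
    then have q: "q = 12 * Q + total ds" "q + Suc (l + l' + e) \<le> 13 * Q" using I(5) by (simp_all add: q_def)
    have M': "M' p = l" "bits M' (p + 1) l X" "M' (p + 1 + l) = l'" "bits M' (p + 1 + l + 1) l' Y"
      "blks M' (p + Suc l + Suc l') zs"
      using I(8) unfolding rest ab p_def by (simp_all add: add_ac One_nat_def)
    have r: "R' 10 = S" "R' 11 = B" "R' 12 = Q" "R' 13 = K" "R' 14 = k" "R' 15 = h" "R' 16 = e"
      using c by (simp_all add: same_eq[OF s] consts_ok_def)
    have n: "?n = ?n" "1 \<le> ?n" "2 * ?n \<le> Nb" using wf T p by auto
    have tab': "table_ok M'" by (rule table_ok_same[OF tab sm]) auto
    have ls: "p + 1 + l + 1 + l' < G" "p + 1 < G" "p + 1 + l + 1 < G" "l < G" "l' < G" "q + 1 + (l + l' + e) < G" "length rest < G" "q + 1 < G"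
      using p q QG I(3) length_le_total[of rest] by linarith+
    let ?R = "R'(62 := l, 61 := p + 1, 63 := p + 1 + l + 1, 64 := l', 65 := q + 1)"
    have ok: "consts_ok ?R" using r by (simp add: consts_ok_def)
    have comb: "wp G COMBINE (\<lambda>R2 M2 t2. bits M2 (q + 1) (l + l' + e) (sumset K k h X Y) \<and>
        R2 66 = l + l' + e \<and> same ({60} \<union> {66..<120}) R2 ?R \<and>
        same ({3 * Q..<11 * Q} \<union> {q + 1..<q + 1 + (l + l' + e)}) M2 M' \<and>
        t2 \<le> t' + 1 + 1 + 1 + 1 + 1 + 1 + 200 * ?n * (J + 1)) ?R M' (t' + 1 + 1 + 1 + 1 + 1 + 1)"
      by (rule COMBINE_spec[OF ok tab' _ _ _ _ _ _ _ _ _ c(6) M'(2) wf(2) _ M'(4) wf(3) _ wf(4) n])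
        (use r p q ls QG in auto)
    show "wp G (Asg 62 (Ld (Rg 41)) ;; Asg 61 (Rg 41 [+] Nm 1) ;; Asg 63 (Rg 61 [+] Rg 62 [+] Nm 1) ;;
        Asg 64 (Ld (Rg 61 [+] Rg 62)) ;; Asg 65 (Rg 42 [+] Nm 1) ;; COMBINE ;;
        Sto (Rg 42) (Rg 66) ;; Asg 41 (Rg 63 [+] Rg 64) ;; Asg 42 (Rg 65 [+] Rg 66) ;;
        Asg 43 (Rg 43 [-] Nm 2) ;; Asg 44 (Rg 44 [+] Nm 1))
      (\<lambda>R2 M2 t2. I R2 M2 t2 \<and> R2 43 < R' 43) R' M' (t' + 1)"
    proof (simp add: wp_Sq wp_Asg M'(1,3) p_def[symmetric] q_def[symmetric] ls, intro wp_mono[OF comb],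
        elim conjE, goal_cases)
      case C: (1 R2 M2 t2)
      have r2: "R2 42 = q" "R2 66 = l + l' + e" "R2 63 = p + 1 + l + 1" "R2 64 = l'" "R2 65 = q + 1"
        "R2 43 = length rest" "R2 44 = length ds"
        using C(2) I q_def by (simp_all add: same_eq[OF C(3)])
      let ?d = "join K k e h a b"
      let ?M = "M2(q := l + l' + e)"
      let ?R2 = "R2(41 := p + 1 + l + 1 + l', 42 := q + 1 + (l + l' + e), 43 := length rest - 2,
        44 := length ds + 1)"
      have sM: "same ({3 * Q..<11 * Q} \<union> {q..<q + Suc (l + l' + e)}) ?M M'"
        by (rule same_upd[OF same_mono[OF C(4)]]) auto
      have "same ({3 * Q..<11 * Q} \<union> {12 * Q..<13 * Q}) ?M M"
        by (rule same_trans[OF sM sm]) (use q in auto)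
      moreover have "blks ?M (p + 1 + l + 1 + l') zs"
        by (rule blks_same[OF _ sM]) (use M'(5) p q QG in \<open>auto simp: add_ac One_nat_def\<close>)
      moreover have "blks ?M (12 * Q) (ds @ [?d])"
      proof -
        have "blks ?M (12 * Q) ds" by (rule blks_same[OF I(9) sM]) (use q in auto)
        moreover have "bits ?M (q + 1) (l + l' + e) (sumset K k h X Y \<inter> {..<l + l' + e})"
          using C(1) by (simp add: bits_def)
        ultimately show ?thesis using q(1) by (simp add: blks_append join_def ab)
      qed
      moreover have "same {41..<120} ?R2 R"
      proof -
        have "same {41..<120} R2 R"
          by (rule same_trans[OF C(3) same_upd[OF same_upd[OF same_upd[OF same_upd[OF same_upd[OF s]]]]]]) auto
        then show ?thesis by (intro same_upd) auto
      qed
      moreover have "t2 + 5 + ?c * cost w zs \<le> t + ?c * cost w bs"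
      proof -
        have "cost w rest = cost w zs + (?n + (2 + w))"
          using T(2) by (simp add: cost_def rest ab)
        then have "t' + (?c * cost w zs + ?c * (?n + (2 + w))) \<le> t + ?c * cost w bs"
          using t by (simp only: distrib_left)
        moreover have "11 + 200 * m * (J + 1) \<le> ?c * (m + (2 + w))" for m
          by (simp add: algebra_simps)
        from this[of ?n] have "11 + 200 * ?n * (J + 1) \<le> ?c * (?n + (2 + w))" .
        ultimately show ?thesis using C(5) by linarith
      qed
      moreover have "merge ?f bs = (ds @ [?d]) @ merge ?f zs" using I(1) rest by simp
      ultimately have "I ?R2 ?M (t2 + 5)"
        unfolding I_def using I(2,3) rest p q(1)
        by (intro exI[of _ "ds @ [?d]"] exI[of _ zs] conjI; simp add: join_def ab)
      moreover have "p + 1 + l + 1 + l' < G" "q + 1 + (l + l' + e) < G" "length rest - 2 < G" "length ds + 1 < G"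
          "q < G" "l + l' + e < G"
        using ls q QG tq length_le_total[of ds] by linarith+
      moreover have t5: "t2 + 1 + 1 + 1 + 1 + 1 = t2 + 5" by simp
      ultimately show ?case
        using r2 rest by (simp add: wp_simps t5 I(6))
    qed
  next
    fix R' M' t'
    assume "I R' M' t'" and lt: "\<not> ev (Nm 1) R' M' < ev (Rg 43) R' M'"
    then obtain ds rest where I: "merge ?f bs = ds @ merge ?f rest"
      "set rest \<subseteq> set bs" "total rest \<le> total bs"
      "R' 41 + total rest = 11 * Q + total bs" "R' 42 = 12 * Q + total ds"
      "R' 43 = length rest" "R' 44 = length ds" "blks M' (R' 41) rest" "blks M' (12 * Q) ds"
      and s: "same {41..<120} R' R" and sm: "same ({3 * Q..<11 * Q} \<union> {12 * Q..<13 * Q}) M' M"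
      and t: "t' + ?c * cost w rest \<le> t + ?c * cost w bs" unfolding I_def by blast
    have len: "length rest \<le> 1" using lt I by simp
    then have "merge ?f rest = rest" by (cases rest; cases "tl rest") auto
    then have m: "merge ?f bs = ds @ rest" using I(1) by simp
    have t1: "t' + 1 \<le> t + 1 + 300 * (J + 1) * cost w bs" using t by linarith
    show "\<exists>ds rest. merge ?f bs = ds @ rest \<and> length rest \<le> 1 \<and>
      total rest \<le> total bs \<and> R' 41 + total rest = 11 * Q + total bs \<and> R' 42 = 12 * Q + total ds \<and>
      R' 43 = length rest \<and> R' 44 = length ds \<and> blks M' (R' 41) rest \<and> blks M' (12 * Q) ds \<and>
      same ({41..<120}) R' R \<and> same ({3 * Q..<11 * Q} \<union> {12 * Q..<13 * Q}) M' M \<and>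
      t' + 1 \<le> t + 1 + 300 * (J + 1) * cost w bs"
      by (intro exI[of _ ds] exI[of _ rest] conjI m len I(3-9) s sm t1)
  qed
qed

lemma PASS_spec:
  assumes c: "consts_ok R" "R 13 = K" "R 14 = k" "R 15 = h" "R 16 = e" "0 < K" and tab: "table_ok M"
    and R: "R 40 = length bs"
    and bs: "blks M (11 * Q) bs" "\<And>b. b \<in> set bs \<Longrightarrow> wf_block K k b" "bs \<noteq> []"
    and T: "total bs \<le> T" "k * (h * K) + e = w" "w \<le> T" "4 * T \<le> Nb"
      "total (merge (join K k e h) bs) \<le> Q"
  shows "wp G PASS (\<lambda>R' M' t'. blks M' (11 * Q) (merge (join K k e h) bs) \<and>
      R' 40 = length (merge (join K k e h) bs) \<and>
      same {40..<120} R' R \<and> same {3 * Q..<13 * Q} M' M \<and>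
      t' \<le> t + 400 * (J + 1) * cost w bs) R M t"
proof -
  let ?m = "merge (join K k e h) bs"
  have QG: "40 * Q < G" "T \<le> Q" "total bs \<le> Q" "1 \<le> Q" using T Nb Nb_Q Q_G by linarith+
  have c': "R 10 = S" "R 11 = B" "R 12 = Q" using c by (auto simp: consts_ok_def)
  have lG: "length bs < G" using length_le_total[of bs] QG by linarith
  let ?R = "R(41 := 11 * Q, 42 := 12 * Q, 43 := length bs, 44 := 0)"
  have r: "consts_ok ?R" "?R 13 = K" "?R 14 = k" "?R 15 = h" "?R 16 = e" "?R 41 = 11 * Q"
    "?R 42 = 12 * Q" "?R 43 = length bs" "?R 44 = 0"
    using c c' by (simp_all add: consts_ok_def)
  note loop = PASS_LOOP_spec[OF r(1-5) c(6) tab r(6-9) bs(1,2) T, of "t + 1 + 1 + 1 + 1"]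
  have "wp G (PASS_LOOP ;; LEFTOVER ;; Asg 46 (Rg 42 [-] area 12) ;;
    For 45 (Rg 46) (Sto (area 11 [+] Rg 45) (Ld (area 12 [+] Rg 45))) ;; Asg 40 (Rg 44))
    (\<lambda>R' M' t'. blks M' (11 * Q) ?m \<and> R' 40 = length ?m \<and>
      same {40..<120} R' R \<and> same {3 * Q..<13 * Q} M' M \<and>
      t' \<le> t + 400 * (J + 1) * cost w bs) ?R M (t + 1 + 1 + 1 + 1)"
  proof (rule wp_SqI[OF loop], assumption, elim exE conjE, goal_cases)
    case A: (1 R1 M1 t1 ds rest)
    note m = A(1)
    have tot: "total ds + total rest \<le> Q" using T(5) unfolding m by simp
    have r1: "R1 10 = S" "R1 11 = B" "R1 12 = Q" using c' by (simp_all add: same_eq[OF A(10)])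
    have left: "wp G LEFTOVER (\<lambda>R' M' t'. blks M' (12 * Q) ?m \<and> R' 42 = 12 * Q + total ?m \<and>
        R' 44 = length ?m \<and> same {41..<120} R' R1 \<and> same {12 * Q..<13 * Q} M' M1 \<and>
        t' \<le> t1 + 6 + 3 * total bs) R1 M1 t1"
    proof (cases rest)
      case Nil
      then show ?thesis unfolding LEFTOVER_def using A G_pos m by (simp add: wp_simps same_upd)
    next
      case (Cons b zs)
      then have rest: "rest = [b]" using A(2) by (cases zs) auto
      define l where "l = fst b"
      define p where "p = R1 41"
      define q where "q = R1 42"
      have p: "p + Suc l = 11 * Q + total bs" "Suc l \<le> total bs"
        using A(3,4) rest by (simp_all add: p_def l_def)
      have q: "q = 12 * Q + total ds" "total ds + Suc l \<le> Q" "R1 44 = length ds" "R1 43 = 1"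
        using A(5,6,7) tot rest by (simp_all add: q_def l_def One_nat_def)
      have M1: "M1 p = l" "blks M1 p [b]" using A(8) rest by (simp_all add: p_def l_def)
      have vG: "M1 (p + j) < G" if "j < l + 1" for j
        using blks_le_total[OF M1(2), of j] that QG p by (simp add: l_def[symmetric])
      let ?R1 = "R1(62 := l)"
      have cp: "wp G (For 45 (Rg 62 [+] Nm 1) (Sto (Rg 42 [+] Rg 45) (Ld (Rg 41 [+] Rg 45))))
        (\<lambda>R' M' t'. (\<forall>j<l + 1. M' (q + j) = M1 (p + j)) \<and> same {q..<q + (l + 1)} M' M1 \<and>
          same {45} R' ?R1 \<and> t' \<le> t1 + 1 + 1 + 2 + 3 * (l + 1)) ?R1 M1 (t1 + 1 + 1)"
      proof (rule wp_copy)
        show "ev (Rg 42) R' M' = q \<and> ev (Rg 41) R' M' = p \<and> ev (Rg 62 [+] Nm 1) R' M' = l + 1"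
          if "same {45} R' ?R1" for R' M'
          by (simp add: same_eq[OF that] p_def q_def)
      qed (use p q QG vG G_pos in auto)
      show ?thesis
        unfolding LEFTOVER_def
      proof (simp add: wp_Cond wp_Sq wp_Asg q(4) p_def[symmetric] M1(1), intro conjI, goal_cases)
        case 1
        show ?case using p QG by linarith
      next
        case 2
        show ?case
        proof (rule wp_mono[OF cp], elim conjE, goal_cases)
          case D: (1 R2 M2 t2)
          have r2: "R2 42 = q" "R2 62 = l" "R2 44 = length ds"
            using q by (simp_all add: same_eq[OF D(3)] q_def)
          have "blks M2 q [b]" by (rule blks_cong[OF M1(2)]) (use D(1) in \<open>simp add: l_def\<close>)
          moreover have "blks M2 (12 * Q) ds" by (rule blks_same[OF A(9) D(2)]) (use q in auto)
          ultimately have "blks M2 (12 * Q) ?m" using q by (simp add: m rest blks_append)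
          moreover have "same {41..<120} R2 R1"
            by (rule same_trans[OF D(3) same_upd[OF same_refl, of 62 "{62}"]]) auto
          moreover have "same {12 * Q..<13 * Q} M2 M1" by (rule same_mono[OF D(2)]) (use q in auto)
          moreover have "length ds + 1 < G" "q + l + 1 < G"
            using q QG length_le_total[of ds] by linarith+
          ultimately show ?case
            using r2 q D(4) p m rest QG
            by (simp add: wp_simps same_upd l_def[symmetric] length_le_total)
        qed
      qed
    qed
    show ?case
    proof (rule wp_SqI[OF left], elim conjE, goal_cases)
      case L: (1 R2 M2 t2)
      have r2: "R2 10 = S" "R2 11 = B" "R2 12 = Q" using r1 by (simp_all add: same_eq[OF L(4)])
      let ?n = "total ?m"
      have nQ: "?n \<le> Q" "length ?m < G" using T(5) length_le_total[of ?m] QG by linarith+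
      let ?R2 = "R2(46 := ?n)"
      have cp: "wp G (For 45 (Rg 46) (Sto (area 11 [+] Rg 45) (Ld (area 12 [+] Rg 45))))
        (\<lambda>R' M' t'. (\<forall>j<?n. M' (11 * Q + j) = M2 (12 * Q + j)) \<and> same {11 * Q..<11 * Q + ?n} M' M2 \<and>
          same {45} R' ?R2 \<and> t' \<le> t2 + 1 + 2 + 3 * ?n) ?R2 M2 (t2 + 1)"
      proof (rule wp_copy)
        show "M2 (12 * Q + j) < G" if "j < ?n" for j
          using blks_le_total[OF L(1) that] nQ QG by linarith
        show "ev (area 11) R' M' = 11 * Q \<and> ev (area 12) R' M' = 12 * Q \<and> ev (Rg 46) R' M' = ?n"
          if "same {45} R' ?R2" for R' M'
          using r2 by (simp add: same_eq[OF that])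
      qed (use nQ QG G_pos in auto)
      show ?case
      proof (rule wp_Asg_SqI, goal_cases)
        case 1 show ?case using L(2) r2 nQ QG by simp
      next
        case 2
        have ev46: "ev (Rg 42 [-] area 12) R2 M2 = ?n" using L(2) r2 by simp
        show ?case
          unfolding ev46
        proof (rule wp_SqI[OF cp], elim conjE, goal_cases)
          case D: (1 R3 M3 t3)
          have r3: "R3 44 = length ?m" using L(3) by (simp add: same_eq[OF D(3)])
          have b: "blks M3 (11 * Q) ?m" by (rule blks_cong[OF L(1)]) (use D(1) in simp)
          have s: "same {40..<120} (R3(40 := length ?m)) R"
            unfolding same_def
            by (auto simp: same_eq[OF D(3)] same_eq[OF L(4)] same_eq[OF A(10)])
          have sm: "same {3 * Q..<13 * Q} M3 M"
            unfolding same_def using nQ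
            by (auto simp: same_eq[OF D(2)] same_eq[OF L(5)] same_eq[OF A(11)])
          have le: "total bs \<le> cost w bs" "?n \<le> cost w bs" "1 \<le> cost w bs"
          proof -
            show "total bs \<le> cost w bs" by (simp add: cost_def)
            have "length bs * e \<le> length bs * w" using T(2) by (intro mult_le_mono2) linarith
            then show "?n \<le> cost w bs" using total_merge_le[of K k e h bs] unfolding cost_def by linarith
            show "1 \<le> cost w bs" using bs(3) by (cases bs) (auto simp: cost_def)
          qed
          have "t3 + 1 \<le> t + 18 + 3 * total bs + 3 * ?n + 300 * (J + 1) * cost w bs"
            using D(4) L(6) A(12) by simp
          also have "\<dots> \<le> t + 18 * cost w bs + 3 * cost w bs + 3 * cost w bs + 300 * (J + 1) * cost w bs"
            using le by (intro add_mono mult_le_mono) simp_all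
          also have "\<dots> \<le> t + 400 * (J + 1) * cost w bs" by (simp add: algebra_simps)
          finally have t3: "t3 + 1 \<le> t + 400 * (J + 1) * cost w bs" .
          show ?case
            using r3 b s sm t3 nQ by (simp add: wp_Asg)
        qed
      qed
    qed
  qed
  then show ?thesis
    unfolding PASS_def using c' QG lG R G_pos by (simp add: wp_Asg wp_Sq)
qed

text \<open>\<open>inv\<close> abstracts from the meaning of the blocks, so that the same proof
  serves plain sums, where \<open>h\<close> stays 0, and counted sums, where the width
  \<open>h\<close> of a block doubles with every pass. A list of at most \<open>2 ^ p\<close> blocks
  needs at most \<open>p\<close> passes, and \<open>C\<close> bounds \<open>cost\<close> uniformly
  over them.\<close>

lemma TREE_spec:
  fixes inv :: "nat \<Rightarrow> block list \<Rightarrow> bool"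
  assumes c: "consts_ok R" "R 13 = K" "R 14 = k" "R 15 = h0" "R 16 = e" "0 < K" "0 < k"
    and tab: "table_ok M" and R: "R 40 = length bs0"
    and bs: "blks M (11 * Q) bs0" "bs0 \<noteq> []" "length bs0 \<le> 2 ^ p"
    and inv: "inv h0 bs0"
    and step: "\<And>h bs. inv h bs \<Longrightarrow> 1 < length bs \<Longrightarrow> inv (2 * h) (merge (join K k e h) bs)"
    and ok: "\<And>h bs. inv h bs \<Longrightarrow> total bs \<le> T \<and> k * (h * K) + e \<le> T \<and>
      (\<forall>b\<in>set bs. wf_block K k b) \<and> cost (k * (h * K) + e) bs \<le> C"
    and T: "4 * T \<le> Nb"
  shows "wp G TREE (\<lambda>R' M' t'. \<exists>h b. inv h [b] \<and> blks M' (11 * Q) [b] \<and>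
      same ({15} \<union> {40..<120}) R' R \<and> same {3 * Q..<13 * Q} M' M \<and>
      t' \<le> t + 1 + p * (2 + 400 * (J + 1) * C)) R M t"
proof -
  define I where "I = (\<lambda>R' M' t'. \<exists>h bs p'. inv h bs \<and> blks M' (11 * Q) bs \<and> bs \<noteq> [] \<and>
    R' 15 = h \<and> R' 40 = length bs \<and> length bs \<le> 2 ^ p' \<and>
    same ({15} \<union> {40..<120}) R' R \<and> same {3 * Q..<13 * Q} M' M \<and>
    t' + p' * (2 + 400 * (J + 1) * C) \<le> t + p * (2 + 400 * (J + 1) * C))"
  have c': "R 10 = S" "R 11 = B" "R 12 = Q" using c by (auto simp: consts_ok_def)
  show ?thesis
    unfolding TREE_def
  proof (rule wp_Wh[where I = I and f = "\<lambda>R M. R 40"])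
    show "I R M t" unfolding I_def using assms by (intro exI[of _ h0] exI[of _ bs0] exI[of _ p]) auto
  next
    fix R' M' t'
    assume "I R' M' t'" and lt: "ev (Nm 1) R' M' < ev (Rg 40) R' M'"
    then obtain h bs p' where I: "inv h bs" "blks M' (11 * Q) bs" "bs \<noteq> []"
      "R' 15 = h" "R' 40 = length bs" "length bs \<le> 2 ^ p'"
      and s: "same ({15} \<union> {40..<120}) R' R" and sm: "same {3 * Q..<13 * Q} M' M"
      and t: "t' + p' * (2 + 400 * (J + 1) * C) \<le> t + p * (2 + 400 * (J + 1) * C)"
      unfolding I_def by blast
    have len: "1 < length bs" using lt I by simp
    have "p' \<noteq> 0" using len I(6) by (intro notI) simp
    then obtain p1 where p1: "p' = Suc p1" by (cases p') auto
    have r: "R' 10 = S" "R' 11 = B" "R' 12 = Q" "R' 13 = K" "R' 14 = k" "R' 16 = e"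
      using c c' by (simp_all add: same_eq[OF s])
    have cr: "consts_ok R'" using r by (simp add: consts_ok_def)
    let ?m = "merge (join K k e h) bs" and ?w = "k * (h * K) + e"
    note ok' = ok[OF I(1)] and ok2 = ok[OF step[OF I(1) len]]
    have tab': "table_ok M'" by (rule table_ok_same[OF tab sm]) auto
    have TQ: "T \<le> Q" "40 * Q < G" using T Nb_Q Q_G by linarith+
    have m: "total ?m \<le> Q" using ok2 TQ by linarith
    have mlen: "length ?m < length bs" "length ?m \<le> 2 ^ p1" "?m \<noteq> []"
      using len I(6) length_merge[of "join K k e h" bs] p1 by auto
    have "h * 1 \<le> k * (h * K)"
    proof -
      have "h * 1 \<le> h * K" using c(6) by (intro mult_le_mono2) simp
      also have "\<dots> \<le> k * (h * K)" using c(7) by simp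
      finally show ?thesis .
    qed
    then have hG: "h + h < G" using ok' TQ by linarith
    have wfb: "\<And>b. b \<in> set bs \<Longrightarrow> wf_block K k b" using ok' by blast
    have pass: "wp G PASS (\<lambda>R2 M2 t2. blks M2 (11 * Q) ?m \<and> R2 40 = length ?m \<and>
      same {40..<120} R2 R' \<and> same {3 * Q..<13 * Q} M2 M' \<and>
      t2 \<le> t' + 1 + 400 * (J + 1) * cost ?w bs) R' M' (t' + 1)"
      by (rule PASS_spec[OF cr r(4,5) I(4) r(6) c(6) tab' I(5,2) wfb I(3) _ refl _ T m])
        (use ok' in auto)
    show "wp G (PASS ;; Asg 15 (Rg 15 [+] Rg 15))
      (\<lambda>R2 M2 t2. I R2 M2 t2 \<and> R2 40 < R' 40) R' M' (t' + 1)"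
    proof (rule wp_SqI[OF pass], elim conjE, goal_cases)
      case A: (1 R2 M2 t2)
      have r2: "R2 15 = h" using I(4) by (simp add: same_eq[OF A(3)])
      have "same ({15} \<union> {40..<120}) (R2(15 := h + h)) R"
        by (intro same_upd same_trans[OF A(3) s]) auto
      moreover have "same {3 * Q..<13 * Q} M2 M" by (rule same_trans[OF A(4) sm]) auto
      moreover have "t2 + 1 + p1 * (2 + 400 * (J + 1) * C) \<le> t + p * (2 + 400 * (J + 1) * C)"
      proof -
        define Z where "Z = 400 * (J + 1) * C"
        have "400 * (J + 1) * cost ?w bs \<le> Z"
          unfolding Z_def using ok' by (intro mult_le_mono2) blast
        moreover have "p' * (2 + Z) = 2 + Z + p1 * (2 + Z)" by (simp add: p1)
        ultimately show ?thesis using A(5) t unfolding Z_def[symmetric] by linarith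
      qed
      ultimately have "I (R2(15 := h + h)) M2 (t2 + 1)"
        unfolding I_def using A(1,2) step[OF I(1) len] mlen
        by (intro exI[of _ "2 * h"] exI[of _ ?m] exI[of _ p1]) auto
      then show ?case using r2 hG A(2) mlen(1) I(5) by (simp add: wp_Asg)
    qed
  next
    fix R' M' t'
    assume "I R' M' t'" and lt: "\<not> ev (Nm 1) R' M' < ev (Rg 40) R' M'"
    then obtain h bs p' where I: "inv h bs" "blks M' (11 * Q) bs" "bs \<noteq> []"
      "R' 15 = h" "R' 40 = length bs" "length bs \<le> 2 ^ p'"
      and s: "same ({15} \<union> {40..<120}) R' R" and sm: "same {3 * Q..<13 * Q} M' M"
      and t: "t' + p' * (2 + 400 * (J + 1) * C) \<le> t + p * (2 + 400 * (J + 1) * C)"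
      unfolding I_def by blast
    obtain b where "bs = [b]" using I(3,5) lt by (cases bs; cases "tl bs") auto
    then show "\<exists>h b. inv h [b] \<and> blks M' (11 * Q) [b] \<and>
      same ({15} \<union> {40..<120}) R' R \<and> same {3 * Q..<13 * Q} M' M \<and>
      t' + 1 \<le> t + 1 + p * (2 + 400 * (J + 1) * C)"
      using I s sm t by (intro exI[of _ h] exI[of _ b]) auto
  qed
qed

end

section \<open>Subset sums of multiplicity functions\<close>

definition ssum :: "(nat \<Rightarrow> nat) \<Rightarrow> nat set \<Rightarrow> nat set" where
  "ssum f A = {(\<Sum>v\<in>A. j v * v) | j. \<forall>v\<in>A. j v \<le> f v}"

lemma ssum_empty [simp]: "ssum f {} = {0}"
  by (auto simp: ssum_def)

lemma ssum_Un:
  assumes "finite A" "finite B" "A \<inter> B = {}"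
  shows "ssum f (A \<union> B) = {a + b | a b. a \<in> ssum f A \<and> b \<in> ssum f B}"
proof (intro equalityI subsetI)
  fix s assume "s \<in> ssum f (A \<union> B)"
  then obtain j where j: "s = (\<Sum>v\<in>A \<union> B. j v * v)" "\<forall>v\<in>A \<union> B. j v \<le> f v"
    unfolding ssum_def by blast
  then have "s = (\<Sum>v\<in>A. j v * v) + (\<Sum>v\<in>B. j v * v)" using assms by (simp add: sum.union_disjoint)
  then show "s \<in> {a + b | a b. a \<in> ssum f A \<and> b \<in> ssum f B}"
    using j(2) unfolding ssum_def by blast
next
  fix s assume "s \<in> {a + b | a b. a \<in> ssum f A \<and> b \<in> ssum f B}"
  then obtain j j' where j: "s = (\<Sum>v\<in>A. j v * v) + (\<Sum>v\<in>B. j' v * v)"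
    "\<forall>v\<in>A. j v \<le> f v" "\<forall>v\<in>B. j' v \<le> f v" unfolding ssum_def by blast
  let ?j = "\<lambda>v. if v \<in> A then j v else j' v"
  have "(\<Sum>v\<in>A \<union> B. ?j v * v) = (\<Sum>v\<in>A. ?j v * v) + (\<Sum>v\<in>B. ?j v * v)"
    using assms by (simp add: sum.union_disjoint)
  also have "(\<Sum>v\<in>A. ?j v * v) = (\<Sum>v\<in>A. j v * v)" by (rule sum.cong) auto
  also have "(\<Sum>v\<in>B. ?j v * v) = (\<Sum>v\<in>B. j' v * v)" by (rule sum.cong) (use assms in auto)
  finally have "s = (\<Sum>v\<in>A \<union> B. ?j v * v)" using j by simp
  then show "s \<in> ssum f (A \<union> B)" using j(2,3) unfolding ssum_def
    by (intro CollectI exI[of _ ?j] conjI) auto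
qed

lemma ssum_single: "ssum f {v} = {a * v | a. a \<le> f v}"
proof (intro equalityI subsetI)
  fix s assume "s \<in> {a * v | a. a \<le> f v}"
  then obtain a where "s = a * v" "a \<le> f v" by blast
  then show "s \<in> ssum f {v}" unfolding ssum_def by (intro CollectI exI[of _ "\<lambda>_. a"]) simp
qed (auto simp: ssum_def)

lemma ssum_insert:
  assumes "finite A" "v \<notin> A"
  shows "ssum f (insert v A) = {a * v + s | a s. a \<le> f v \<and> s \<in> ssum f A}"
  using ssum_Un[of "{v}" A f] assms by (auto simp: ssum_single)

lemma ssum_cong: "(\<And>v. v \<in> A \<Longrightarrow> f v = g v) \<Longrightarrow> ssum f A = ssum g A"
  unfolding ssum_def by (metis (no_types, lifting))

lemma ssum_zero: "f v = 0 \<Longrightarrow> finite A \<Longrightarrow> v \<notin> A \<Longrightarrow> ssum f (insert v A) = ssum f A"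
  by (auto simp: ssum_insert)

subsection \<open>Reducing multiplicities to at most two\<close>

text \<open>For nonzero \<open>f v\<close> the remainder \<open>f v - 2 * q\<close> is 1 or 2; for
  \<open>f v = 0\<close> truncated subtraction gives \<open>q = 0\<close>. If \<open>2 * v\<close>
  exceeds \<open>u\<close> the pairs are dropped, as no sum up to \<open>u\<close> contains
  \<open>v\<close> twice.\<close>

definition carry :: "nat \<Rightarrow> nat \<Rightarrow> (nat \<Rightarrow> nat) \<Rightarrow> (nat \<Rightarrow> nat)" where
  "carry u v f = (let q = (f v - 1) div 2; g = f(v := f v - 2 * q)
    in if 2 * v \<le> u then g(2 * v := f (2 * v) + q) else g)"

text \<open>A single unit coin already fills the gaps between multiples of 2, so the set depends
  only on the total \<open>m + 2 * n\<close>. This is why carrying leaves at least one copy of a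
  value behind.\<close>

lemma interval_coins:
  assumes "1 \<le> (m::nat)"
  shows "{a + 2 * b | a b. a \<le> m \<and> b \<le> n} = {..m + 2 * n}"
proof (intro equalityI subsetI)
  fix s assume s: "s \<in> {..m + 2 * n}"
  show "s \<in> {a + 2 * b | a b. a \<le> m \<and> b \<le> n}"
  proof (cases "s \<le> 2 * n")
    case True
    then have "s = s mod 2 + 2 * (s div 2)" "s mod 2 \<le> m" "s div 2 \<le> n" using assms by auto
    then show ?thesis by blast
  next
    case False
    then have "s = (s - 2 * n) + 2 * n" "s - 2 * n \<le> m" using s by auto
    then show ?thesis by blast
  qed
qed auto

text \<open>For \<open>2 * v \<le> u\<close> only the multiplicities of \<open>v\<close> and
  \<open>2 * v\<close> change, and by \<open>interval_coins\<close> they matter only through a total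
  that carrying preserves. Otherwise at most one copy of \<open>v\<close> fits below
  \<open>u\<close>, before and after.\<close>

lemma carry_ssum:
  assumes v: "1 \<le> v" "v \<le> u"
  shows "ssum (carry u v f) {1..u} \<inter> {..u} = ssum f {1..u} \<inter> {..u}"
proof (cases "f v \<le> 2")
  case True
  then have "(f v - 1) div 2 = 0" by auto
  then have "carry u v f = f" by (auto simp: carry_def)
  then show ?thesis by simp
next
  case False
  define q where "q = (f v - 1) div 2"
  have q: "2 * q < f v" using False by (auto simp: q_def)
  show ?thesis
  proof (cases "2 * v \<le> u")
    case True
    define A where "A = {1..u} - {v, 2 * v}"
    have A: "{1..u} = insert v (insert (2 * v) A)" "finite A" "v \<notin> insert (2 * v) A" "2 * v \<notin> A"
      using v True by (auto simp: A_def)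
    have g: "carry u v f v = f v - 2 * q" "carry u v f (2 * v) = f (2 * v) + q"
      using True v by (auto simp: carry_def q_def Let_def)
    have gA: "ssum (carry u v f) A = ssum f A"
      by (rule ssum_cong) (use True in \<open>auto simp: carry_def A_def Let_def\<close>)
    have eq: "ssum h {1..u} = {t * v + s | t s. t \<in> {a + 2 * b | a b. a \<le> h v \<and> b \<le> h (2 * v)} \<and> s \<in> ssum h A}" for h
    proof -
      have "ssum h {1..u} = {a * v + (b * (2 * v) + s) | a b s. a \<le> h v \<and> b \<le> h (2 * v) \<and> s \<in> ssum h A}"
        unfolding A(1) using A(2-4) by (auto simp: ssum_insert)
      also have "\<dots> = {(a + 2 * b) * v + s | a b s. a \<le> h v \<and> b \<le> h (2 * v) \<and> s \<in> ssum h A}"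
        by (simp add: algebra_simps)
      finally show ?thesis by blast
    qed
    have "{a + 2 * b | a b. a \<le> carry u v f v \<and> b \<le> carry u v f (2 * v)}
        = {a + 2 * b | a b. a \<le> f v \<and> b \<le> f (2 * v)}"
      using q False unfolding g by (subst (1 2) interval_coins) auto
    then show ?thesis unfolding eq gA by simp
  next
    case F2: False
    define A where "A = {1..u} - {v}"
    have A: "{1..u} = insert v A" "finite A" "v \<notin> A" using v by (auto simp: A_def)
    have g: "carry u v f v = f v - 2 * q" using F2 v by (auto simp: carry_def q_def Let_def)
    have gA: "ssum (carry u v f) A = ssum f A"
      by (rule ssum_cong) (use F2 in \<open>auto simp: carry_def A_def Let_def\<close>)
    have le: "a \<le> 1" if "a * v + s \<le> u" for a s
    proof (rule ccontr)
      assume "\<not> a \<le> 1"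
      then have "2 * v \<le> a * v" by (intro mult_le_mono1) simp
      then show False using that F2 by linarith
    qed
    have "ssum h {1..u} \<inter> {..u} = {a * v + s | a s. a \<le> 1 \<and> s \<in> ssum h A} \<inter> {..u}" if "1 \<le> h v" for h
    proof -
      have "a \<le> h v \<longleftrightarrow> a \<le> 1" if "a * v + s \<le> u" for a s
        using le[OF that] \<open>1 \<le> h v\<close> by linarith
      then show ?thesis unfolding A(1) ssum_insert[OF A(2,3)] by blast
    qed
    then show ?thesis using g q False gA by simp
  qed
qed

text \<open>The increasing order matters: whatever is carried into \<open>2 * v\<close> is treated
  when \<open>2 * v\<close> is reached, and the multiplicity of \<open>v\<close> is never changed
  again.\<close>

definition carried :: "nat \<Rightarrow> nat \<Rightarrow> (nat \<Rightarrow> nat) \<Rightarrow> (nat \<Rightarrow> nat)" where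
  "carried u n f = fold (carry u) [1..<n] f"

lemma carried_Suc: "1 \<le> n \<Longrightarrow> carried u (Suc n) f = carry u n (carried u n f)"
  by (simp add: carried_def)

lemma carried_1: "carried u 1 f = f"
  by (simp add: carried_def)

lemma carried_ssum:
  assumes "1 \<le> n" "n \<le> Suc u"
  shows "ssum (carried u n f) {1..u} \<inter> {..u} = ssum f {1..u} \<inter> {..u}"
  using assms
proof (induction n rule: nat_induct_at_least)
  case base
  then show ?case by (simp only: carried_1)
next
  case (Suc n)
  then show ?case by (simp add: carried_Suc carry_ssum)
qed

lemma carry_le2: "carry u v f v \<le> 2" if "1 \<le> v"
  using that by (auto simp: carry_def Let_def)

lemma carried_le2:
  assumes "1 \<le> n"
  shows "\<forall>v. 1 \<le> v \<and> v < n \<longrightarrow> carried u n f v \<le> 2"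
  using assms
proof (induction n rule: nat_induct_at_least)
  case base
  then show ?case by simp
next
  case (Suc n)
  show ?case
  proof (intro allI impI)
    fix v assume v: "1 \<le> v \<and> v < Suc n"
    show "carried u (Suc n) f v \<le> 2"
    proof (cases "v = n")
      case True
      then show ?thesis using carry_le2[of n u "carried u n f"] Suc.hyps by (simp add: carried_Suc)
    next
      case False
      then have "carry u n (carried u n f) v = carried u n f v"
        using v by (auto simp: carry_def Let_def)
      then show ?thesis using Suc v False by (simp add: carried_Suc)
    qed
  qed
qed

lemma carry_sum_le:
  assumes "1 \<le> v" "v \<le> u"
  shows "(\<Sum>x\<in>{1..u}. carry u v f x * x) \<le> (\<Sum>x\<in>{1..u}. f x * x)"
proof -
  define q where "q = (f v - 1) div 2"
  have q: "2 * q \<le> f v" by (auto simp: q_def)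
  show ?thesis
  proof (cases "2 * v \<le> u")
    case True
    define A where "A = {1..u} - {v, 2 * v}"
    have A: "{1..u} = insert v (insert (2 * v) A)" "finite A" "v \<notin> insert (2 * v) A" "2 * v \<notin> A"
      using assms True by (auto simp: A_def)
    have g: "carry u v f v = f v - 2 * q" "carry u v f (2 * v) = f (2 * v) + q"
      using True assms by (auto simp: carry_def q_def Let_def)
    have gA: "(\<Sum>x\<in>A. carry u v f x * x) = (\<Sum>x\<in>A. f x * x)"
      by (rule sum.cong) (use True in \<open>auto simp: carry_def A_def Let_def\<close>)
    have "(f v - 2 * q) * v + (f (2 * v) + q) * (2 * v) = f v * v + f (2 * v) * (2 * v)"
    proof -
      have "(f v - 2 * q) * v + 2 * q * v = f v * v" using q by (simp flip: distrib_right)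
      then show ?thesis by (simp add: algebra_simps)
    qed
    then show ?thesis unfolding A(1) using A(2-4) g gA by simp
  next
    case False
    show ?thesis
      by (rule sum_mono) (use False in \<open>auto simp: carry_def Let_def\<close>)
  qed
qed

lemma carried_sum_le:
  assumes "1 \<le> n" "n \<le> Suc u"
  shows "(\<Sum>x\<in>{1..u}. carried u n f x * x) \<le> (\<Sum>x\<in>{1..u}. f x * x)"
  using assms
proof (induction n rule: nat_induct_at_least)
  case base
  then show ?case by (simp only: carried_1)
next
  case (Suc n)
  then have "(\<Sum>x\<in>{1..u}. carry u n (carried u n f) x * x) \<le> (\<Sum>x\<in>{1..u}. carried u n f x * x)"
    by (intro carry_sum_le) auto
  then show ?case using Suc by (simp add: carried_Suc)
qed

text \<open>Carrying only doubles values, so each new value is an original one times a power of two.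
  For values below \<open>2 ^ L\<close> this leaves at most \<open>L\<close> candidates per original
  value, which \<open>carried_card\<close> counts.\<close>

lemma carried_support:
  assumes "1 \<le> n"
  shows "\<forall>v. 0 < carried u n f v \<longrightarrow> (\<exists>x i. 0 < f x \<and> v = x * 2 ^ i)"
  using assms
proof (induction n rule: nat_induct_at_least)
  case base
  show ?case unfolding carried_1 by (metis mult.right_neutral power_0)
next
  case (Suc n)
  show ?case
  proof (intro allI impI)
    fix v assume "0 < carried u (Suc n) f v"
    then have v: "0 < carry u n (carried u n f) v" using Suc by (simp add: carried_Suc)
    show "\<exists>x i. 0 < f x \<and> v = x * 2 ^ i"
    proof (cases "0 < carried u n f v")
      case True
      then show ?thesis using Suc.IH by blast
    next
      case False
      then have "v = 2 * n" "0 < carried u n f n"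
        using v by (auto simp: carry_def Let_def split: if_splits)
      then obtain x i where "0 < f x" "n = x * 2 ^ i" using Suc.IH by blast
      then have "0 < f x \<and> v = x * 2 ^ Suc i" using \<open>v = 2 * n\<close> by simp
      then show ?thesis by blast
    qed
  qed
qed

lemma carried_outside: "1 \<le> n \<Longrightarrow> n \<le> Suc u \<Longrightarrow> u < v \<Longrightarrow> carried u n f v = f v"
proof (induction n rule: nat_induct_at_least)
  case base
  then show ?case by (simp only: carried_1)
next
  case (Suc n)
  then show ?case by (auto simp: carried_Suc carry_def Let_def)
qed

lemma carried_card:
  assumes "u < 2 ^ L" "finite {x. 0 < f x}" "f 0 = 0"
  shows "card {v \<in> {1..u}. 0 < carried u (Suc u) f v} \<le> card {x. 0 < f x} * L"
proof -
  have "{v \<in> {1..u}. 0 < carried u (Suc u) f v} \<subseteq> (\<lambda>(x, i). x * 2 ^ i) ` ({x. 0 < f x} \<times> {..<L})"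
  proof
    fix v assume v: "v \<in> {v \<in> {1..u}. 0 < carried u (Suc u) f v}"
    have "1 \<le> Suc u" by simp
    from carried_support[OF this, of u f] v
    obtain x i where x: "0 < f x" "v = x * 2 ^ i" by blast
    have "1 \<le> x" using x assms(3) by (cases x) auto
    then have "1 * 2 ^ i \<le> v" unfolding x(2) by (rule mult_le_mono1)
    moreover have "v \<le> u" using v by simp
    ultimately have "(2::nat) ^ i < 2 ^ L" using assms(1) by linarith
    then have "i < L" by simp
    then show "v \<in> (\<lambda>(x, i). x * 2 ^ i) ` ({x. 0 < f x} \<times> {..<L})" using x by force
  qed
  then have "card {v \<in> {1..u}. 0 < carried u (Suc u) f v} \<le> card ({x. 0 < f x} \<times> {..<L})"
    by (rule surj_card_le[rotated]) (use assms(2) in simp)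
  then show ?thesis by (simp add: card_cartesian_product)
qed

subsection \<open>Multisets\<close>

lemma sum_mset_eq_sum_count:
  fixes T :: "nat multiset"
  assumes "finite A" "set_mset T \<subseteq> A"
  shows "sum_mset T = (\<Sum>v\<in>A. count T v * v)"
  using assms(2)
proof (induction T)
  case (add x T)
  have "(\<Sum>v\<in>A. count (add_mset x T) v * v) = (\<Sum>v\<in>A. (if v = x then v else 0) + count T v * v)"
    by (rule sum.cong) auto
  also have "\<dots> = x + (\<Sum>v\<in>A. count T v * v)"
    using add.prems assms(1) by (simp add: sum.distrib)
  finally show ?case using add by simp
qed simp

lemma subset_sums_eq_ssum:
  assumes "set_mset S \<subseteq> {1..m}"
  shows "{sum_mset T | T. T \<subseteq># S} = ssum (count S) {1..m}"
proof (intro equalityI subsetI)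
  fix s assume "s \<in> {sum_mset T | T. T \<subseteq># S}"
  then obtain T where T: "s = sum_mset T" "T \<subseteq># S" by blast
  then have "set_mset T \<subseteq> {1..m}" using assms set_mset_mono by blast
  then have "s = (\<Sum>v\<in>{1..m}. count T v * v)" using T by (simp add: sum_mset_eq_sum_count)
  moreover have "\<forall>v\<in>{1..m}. count T v \<le> count S v" using T(2) by (simp add: mset_subset_eq_count)
  ultimately show "s \<in> ssum (count S) {1..m}" unfolding ssum_def by blast
next
  fix s assume "s \<in> ssum (count S) {1..m}"
  then obtain j where j: "s = (\<Sum>v\<in>{1..m}. j v * v)" "\<forall>v\<in>{1..m}. j v \<le> count S v"
    unfolding ssum_def by blast
  define T where "T = (\<Sum>v\<in>{1..m}. replicate_mset (j v) v)"
  have cnt: "count T x = (if x \<in> {1..m} then j x else 0)" for x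
  proof -
    have "count T x = (\<Sum>v\<in>{1..m}. if v = x then j v else 0)"
      unfolding T_def count_sum by (rule sum.cong) (auto)
    then show ?thesis by simp
  qed
  have "set_mset T \<subseteq> {1..m}"
  proof
    fix x assume "x \<in># T"
    then have "count T x \<noteq> 0" by (simp only: count_eq_zero_iff not_not)
    then show "x \<in> {1..m}" unfolding cnt by presburger
  qed
  then have sumT: "sum_mset T = (\<Sum>v\<in>{1..m}. count T v * v)"
    by (intro sum_mset_eq_sum_count finite_atLeastAtMost)
  have "T \<subseteq># S" unfolding subseteq_mset_def using j(2) cnt by auto
  moreover have "s = sum_mset T" unfolding sumT j(1) by (rule sum.cong) (simp_all add: cnt)
  ultimately show "s \<in> {sum_mset T | T. T \<subseteq># S}" by (intro CollectI exI[of _ T] conjI)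
qed

text \<open>Neither an element nor a subset sum exceeds \<open>sum_mset S\<close>, so
  \<open>u\<close> may be lowered to it. The maximum with 1 keeps the new bound positive for the
  empty multiset.\<close>

lemma subset_sums_upto_eq:
  assumes "set_mset S \<subseteq> {1..u}" "0 < u"
  defines "m \<equiv> max 1 (min u (sum_mset S))"
  shows "subset_sums_upto u S = ssum (count S) {1..m} \<inter> {..m}" "set_mset S \<subseteq> {1..m}"
proof -
  have "x \<le> sum_mset S" if x: "x \<in># S" for x
  proof -
    obtain S' where "S = add_mset x S'" using multi_member_split[OF x] by blast
    then show ?thesis by simp
  qed
  then show sub: "set_mset S \<subseteq> {1..m}" using assms(1) unfolding m_def by fastforce
  have "sum_mset T \<le> sum_mset S" if T: "T \<subseteq># S" for T
  proof -
    obtain U where "S = T + U" using T by (auto simp: mset_subset_eq_exists_conv)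
    then show ?thesis by simp
  qed
  then have eq: "s \<le> m \<longleftrightarrow> s \<le> u" if "s \<in> {sum_mset T | T. T \<subseteq># S}" for s
  proof -
    have "s \<le> sum_mset S" using that \<open>\<And>T. T \<subseteq># S \<Longrightarrow> sum_mset T \<le> sum_mset S\<close> by blast
    then show ?thesis using assms(2) unfolding m_def by linarith
  qed
  show "subset_sums_upto u S = ssum (count S) {1..m} \<inter> {..m}"
    unfolding subset_sums_upto_def subset_sums_eq_ssum[OF sub, symmetric]
  proof (rule set_eqI)
    fix s
    show "s \<in> {sum_mset T | T. T \<subseteq># S} \<inter> {0..u} \<longleftrightarrow> s \<in> {sum_mset T | T. T \<subseteq># S} \<inter> {..m}"
      using eq[of s] by (cases "s \<in> {sum_mset T | T. T \<subseteq># S}")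
        (simp_all only: Int_iff atLeastAtMost_iff atMost_iff le0 simp_thms)
  qed
qed

subsection \<open>Small values\<close>

definition leaf :: "(nat \<Rightarrow> nat) \<Rightarrow> nat \<Rightarrow> block" where
  "leaf f v = (f v * v + 1, {a * v | a. a \<le> f v})"

definition block_sums :: "block list \<Rightarrow> nat set" where
  "block_sums bs = foldr (\<lambda>b Z. {x + y | x y. x \<in> snd b \<and> y \<in> Z}) bs {0}"

lemma block_sums_simps [simp]:
  "block_sums [] = {0}"
  "block_sums (b # bs) = {x + y | x y. x \<in> snd b \<and> y \<in> block_sums bs}"
  by (simp_all add: block_sums_def)

lemma block_sums_leaves:
  "distinct vs \<Longrightarrow> block_sums (map (leaf f) vs) = ssum f (set vs)"
  by (induction vs) (auto simp: ssum_insert leaf_def; blast)+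

text \<open>With \<open>K = 1\<close> every index is 0 modulo \<open>K\<close>: nothing is lifted,
  every sum passes the filter, and the sumset is the ordinary one.\<close>

lemma join_plain:
  assumes "snd a \<subseteq> {..<fst a}" "snd b \<subseteq> {..<fst b}"
  shows "join 1 1 0 0 a b = (fst a + fst b, {x + y | x y. x \<in> snd a \<and> y \<in> snd b})"
proof -
  have "x + y < fst a + fst b" if "x \<in> snd a" "y \<in> snd b" for x y
    using that assms by (intro add_strict_mono) auto
  then show ?thesis by (auto simp: join_def sumset_def lift_def)
qed

text \<open>Associativity of the sumset: a pass only changes the grouping.\<close>

lemma block_sums_merge:
  assumes "\<And>b. b \<in> set bs \<Longrightarrow> wf_block 1 1 b"
  shows "block_sums (merge (join 1 1 0 0) bs) = block_sums bs \<and>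
    (\<forall>b\<in>set (merge (join 1 1 0 0) bs). wf_block 1 1 b)"
  using assms
proof (induction "join 1 1 0 0" bs rule: merge.induct)
  case (1 x y zs)
  have xy: "1 \<le> fst x" "snd x \<subseteq> {..<fst x}" "snd y \<subseteq> {..<fst y}"
    using "1.prems"[of x] "1.prems"[of y] by (auto simp: wf_block_def)
  have j: "join 1 1 0 0 x y = (fst x + fst y, {a + b | a b. a \<in> snd x \<and> b \<in> snd y})"
    by (rule join_plain) (use xy in auto)
  have IH: "block_sums (merge (join 1 1 0 0) zs) = block_sums zs \<and>
      (\<forall>b\<in>set (merge (join 1 1 0 0) zs). wf_block 1 1 b)"
    by (rule "1.hyps") (use "1.prems" in auto)
  have "{a + b | a b. a \<in> {a + b | a b. a \<in> snd x \<and> b \<in> snd y} \<and> b \<in> block_sums zs}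
      = {a + c | a c. a \<in> snd x \<and> c \<in> {a + b | a b. a \<in> snd y \<and> b \<in> block_sums zs}}"
    by (auto simp: add.assoc) (metis add.assoc)+
  moreover have "wf_block 1 1 (join 1 1 0 0 x y)"
    unfolding j wf_block_def using xy by (auto intro!: add_strict_mono)
  ultimately show ?case using IH by (simp add: j)
qed auto

subsection \<open>Large values\<close>

text \<open>Index \<open>s * K + c\<close> represents a selection of \<open>c \<le> k\<close> elements from \<open>{a..<a + h}\<close> whose sum
  is \<open>c * a + s\<close>.\<close>

definition offsets :: "(nat \<Rightarrow> nat) \<Rightarrow> nat \<Rightarrow> nat \<Rightarrow> nat \<Rightarrow> nat \<Rightarrow> nat set" where
  "offsets f K k a h = {(\<Sum>v\<in>{a..<a + h}. j v * ((v - a) * K + 1)) | j.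
    (\<forall>v\<in>{a..<a + h}. j v \<le> f v) \<and> sum j {a..<a + h} \<le> k}"

text \<open>Mixed radix: the excess over the base is the upper digit and the number of summands the
  lower one, as long as the latter stays below \<open>K\<close>.\<close>

lemma offset_eq:
  "(\<Sum>v\<in>I. j v * ((v - a) * K + 1)) = (\<Sum>v\<in>I. j v * (v - a)) * K + sum j (I :: nat set)"
proof -
  have "(\<Sum>v\<in>I. j v * ((v - a) * K + 1)) = (\<Sum>v\<in>I. j v * (v - a) * K + j v)"
    by (rule sum.cong) (simp_all add: distrib_left mult.assoc)
  then show ?thesis by (simp add: sum.distrib sum_distrib_right)
qed

text \<open>At most \<open>k\<close> elements contribute an excess of at most \<open>h - 1\<close>
  each; the \<open>+ 1\<close> makes room for the counter digit.\<close>

lemma offset_less: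
  fixes a h :: nat
  assumes "sum j {a..<a + h} \<le> k" "k < K" "1 \<le> h"
  shows "(\<Sum>v\<in>{a..<a + h}. j v * ((v - a) * K + 1)) < (k * (h - 1) + 1) * K"
proof -
  have "(\<Sum>v\<in>{a..<a + h}. j v * (v - a)) \<le> (\<Sum>v\<in>{a..<a + h}. j v * (h - 1))"
    by (rule sum_mono) (auto intro!: mult_le_mono2)
  also have "\<dots> \<le> k * (h - 1)" using assms(1) by (simp flip: sum_distrib_right)
  finally have "(\<Sum>v\<in>{a..<a + h}. j v * (v - a)) * K \<le> k * (h - 1) * K" by (rule mult_le_mono1)
  moreover have "(k * (h - 1) + 1) * K = k * (h - 1) * K + K" by (simp add: distrib_right)
  ultimately show ?thesis unfolding offset_eq using assms by linarith
qed

lemma offsets_subset: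
  assumes "k < K" "1 \<le> h"
  shows "offsets f K k a h \<subseteq> {..<(k * (h - 1) + 1) * K}"
proof
  fix i assume "i \<in> offsets f K k a h"
  then obtain j where j: "i = (\<Sum>v\<in>{a..<a + h}. j v * ((v - a) * K + 1))" "sum j {a..<a + h} \<le> k"
    unfolding offsets_def by blast
  show "i \<in> {..<(k * (h - 1) + 1) * K}"
    unfolding j(1) lessThan_iff by (rule offset_less[OF j(2) assms])
qed

lemma offsets_mod: "i \<in> offsets f K k a h \<Longrightarrow> k < K \<Longrightarrow> i mod K \<le> k"
  unfolding offsets_def offset_eq by auto

text \<open>Two counters up to \<open>k\<close> add up to at most \<open>2 * k < K\<close>. Hence
  they never spill into the excess, \<open>i mod K\<close> is the true number of summands, and the
  filter removes exactly the selections of more than \<open>k\<close> elements. Lifting changes the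
  base of the upper half from \<open>a + h\<close> to \<open>a\<close>.\<close>

lemma sumset_offsets:
  assumes "2 * k < K" "0 < h"
  shows "sumset K k h (offsets f K k a h) (offsets f K k (a + h) h) = offsets f K k a (2 * h)"
proof -
  let ?I = "{a..<a + h}" and ?J = "{a + h..<a + h + h}" and ?IJ = "{a..<a + 2 * h}"
  have IJ: "?IJ = ?I \<union> ?J" "?I \<inter> ?J = {}" by auto
  have split: "(\<Sum>v\<in>?IJ. g v) = (\<Sum>v\<in>?I. g v) + (\<Sum>v\<in>?J. g v)" for g :: "nat \<Rightarrow> nat"
    unfolding IJ(1) by (rule sum.union_disjoint) auto
  have lift: "lift K h (\<Sum>v\<in>?J. j v * ((v - (a + h)) * K + 1)) = (\<Sum>v\<in>?J. j v * ((v - a) * K + 1))"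
    if "sum j ?J \<le> k" for j
  proof -
    let ?y = "\<Sum>v\<in>?J. j v * ((v - (a + h)) * K + 1)"
    have "?y mod K = sum j ?J" unfolding offset_eq using that assms by simp
    then have "lift K h ?y = ?y + (\<Sum>v\<in>?J. j v * (h * K))"
      by (simp add: lift_def sum_distrib_right)
    also have "\<dots> = (\<Sum>v\<in>?J. j v * ((v - (a + h)) * K + 1) + j v * (h * K))"
      by (simp only: sum.distrib)
    also have "\<dots> = (\<Sum>v\<in>?J. j v * ((v - a) * K + 1))"
    proof (rule sum.cong[OF refl])
      fix v assume "v \<in> ?J"
      then have "v - a = (v - (a + h)) + h" by auto
      then show "j v * ((v - (a + h)) * K + 1) + j v * (h * K) = j v * ((v - a) * K + 1)"
        by (simp add: algebra_simps)
    qed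
    finally show ?thesis .
  qed
  show ?thesis
  proof (intro equalityI subsetI)
    fix i assume "i \<in> sumset K k h (offsets f K k a h) (offsets f K k (a + h) h)"
    then obtain x y where xy: "x \<in> offsets f K k a h" "y \<in> offsets f K k (a + h) h"
      "i = x + lift K h y" "i mod K \<le> k" unfolding sumset_def by blast
    obtain j where j: "x = (\<Sum>v\<in>?I. j v * ((v - a) * K + 1))" "\<forall>v\<in>?I. j v \<le> f v" "sum j ?I \<le> k"
      using xy(1) unfolding offsets_def by blast
    obtain j' where j': "y = (\<Sum>v\<in>?J. j' v * ((v - (a + h)) * K + 1))" "\<forall>v\<in>?J. j' v \<le> f v"
      "sum j' ?J \<le> k"
      using xy(2) unfolding offsets_def by blast
    let ?j = "\<lambda>v. if v < a + h then j v else j' v"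
    have e: "(\<Sum>v\<in>?I. ?j v * g v) = (\<Sum>v\<in>?I. j v * g v)" "(\<Sum>v\<in>?J. ?j v * g v) = (\<Sum>v\<in>?J. j' v * g v)"
      "sum ?j ?I = sum j ?I" "sum ?j ?J = sum j' ?J" for g
      by (auto intro!: sum.cong)
    have i: "i = (\<Sum>v\<in>?IJ. ?j v * ((v - a) * K + 1))"
      unfolding split e using xy(3) lift[OF j'(3)] j(1) j'(1) by simp
    have c: "sum ?j ?IJ = sum j ?I + sum j' ?J" unfolding split e ..
    then have "sum ?j ?IJ < K" using j(3) j'(3) assms by linarith
    then have "i mod K = sum ?j ?IJ" unfolding i offset_eq by simp
    then have "sum ?j ?IJ \<le> k" using xy(4) by simp
    then show "i \<in> offsets f K k a (2 * h)"
      unfolding offsets_def i using j(2) j'(2) by (intro CollectI exI[of _ ?j] conjI refl) auto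
  next
    fix i assume "i \<in> offsets f K k a (2 * h)"
    then obtain j where j: "i = (\<Sum>v\<in>?IJ. j v * ((v - a) * K + 1))" "\<forall>v\<in>?IJ. j v \<le> f v" "sum j ?IJ \<le> k"
      unfolding offsets_def by blast
    have c: "sum j ?I \<le> k" "sum j ?J \<le> k" using j(3) unfolding split by auto
    let ?x = "\<Sum>v\<in>?I. j v * ((v - a) * K + 1)" and ?y = "\<Sum>v\<in>?J. j v * ((v - (a + h)) * K + 1)"
    have "?x \<in> offsets f K k a h" "?y \<in> offsets f K k (a + h) h"
      unfolding offsets_def using j(2) c IJ(1) by blast+
    moreover have "?x + lift K h ?y = i" unfolding lift[OF c(2)] j(1) split ..
    moreover have "i mod K \<le> k" unfolding j(1) offset_eq using j(3) assms by simp
    ultimately show "i \<in> sumset K k h (offsets f K k a h) (offsets f K k (a + h) h)"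
      unfolding sumset_def by blast
  qed
qed

definition level :: "(nat \<Rightarrow> nat) \<Rightarrow> nat \<Rightarrow> nat \<Rightarrow> nat \<Rightarrow> nat \<Rightarrow> nat \<Rightarrow> block list" where
  "level f K k x h n = map (\<lambda>i. ((k * (h - 1) + 1) * K, offsets f K k (x + i * h) h)) [0..<n]"

lemma merge_map_upt:
  "merge g (map f [0..<2 * n]) = map (\<lambda>i. g (f (2 * i)) (f (2 * i + 1))) [0..<n]"
proof (induction n arbitrary: f)
  case (Suc n)
  have "[0..<2 * Suc n] = 0 # 1 # map (\<lambda>i. i + 2) [0..<2 * n]"
  proof -
    have *: "[0..<Suc m] = 0 # map Suc [0..<m]" for m
      by (simp add: upt_conv_Cons map_Suc_upt del: upt_Suc)
    have "2 * Suc n = Suc (Suc (2 * n))" by simp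
    then show ?thesis by (simp only: * list.map map_map o_def) (simp add: One_nat_def)
  qed
  moreover have "[0..<Suc n] = 0 # map Suc [0..<n]"
    by (simp add: upt_conv_Cons map_Suc_upt del: upt_Suc)
  ultimately show ?case using Suc[of "\<lambda>i. f (i + 2)"] by (simp add: o_def One_nat_def)
qed simp

text \<open>Origin of the slack: in units of \<open>K\<close>, two blocks have length
  \<open>2 * (k * (h - 1) + 1)\<close>, whereas a block of width \<open>2 * h\<close> needs
  \<open>k * (2 * h - 1) + 1\<close>. The difference is \<open>k - 1\<close>.\<close>

lemma merge_level:
  assumes "0 < k" "K = 2 * k + 2" "0 < h"
  shows "merge (join K k ((k - 1) * K) h) (level f K k x h (2 * n)) = level f K k x (2 * h) n"
proof -
  have len: "(k * (h - 1) + 1) * K + (k * (h - 1) + 1) * K + (k - 1) * K = (k * (2 * h - 1) + 1) * K"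
  proof -
    obtain k' h' where "k = Suc k'" "h = Suc h'" using assms(1,3) by (metis gr0_implies_Suc)
    then show ?thesis by (simp add: algebra_simps)
  qed
  have "join K k ((k - 1) * K) h ((k * (h - 1) + 1) * K, offsets f K k (x + 2 * i * h) h)
      ((k * (h - 1) + 1) * K, offsets f K k (x + (2 * i + 1) * h) h)
    = ((k * (2 * h - 1) + 1) * K, offsets f K k (x + i * (2 * h)) (2 * h))" for i
  proof -
    have "x + (2 * i + 1) * h = x + 2 * i * h + h" by (simp add: algebra_simps)
    then have "sumset K k h (offsets f K k (x + 2 * i * h) h) (offsets f K k (x + (2 * i + 1) * h) h)
        = offsets f K k (x + i * (2 * h)) (2 * h)"
    proof -
      have e: "x + i * (2 * h) = x + 2 * i * h" by simp
      show ?thesis unfolding \<open>x + (2 * i + 1) * h = x + 2 * i * h + h\<close> e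
        by (rule sumset_offsets) (use assms in auto)
    qed
    moreover have "offsets f K k (x + i * (2 * h)) (2 * h) \<subseteq> {..<(k * (2 * h - 1) + 1) * K}"
      by (rule offsets_subset) (use assms in \<open>auto simp: One_nat_def\<close>)
    ultimately show ?thesis unfolding join_def fst_conv snd_conv len by (simp add: Int_absorb2)
  qed
  then show ?thesis unfolding level_def merge_map_upt by simp
qed

lemma wf_level: "b \<in> set (level f K k x h n) \<Longrightarrow> k < K \<Longrightarrow> 0 < h \<Longrightarrow> wf_block K k b"
proof -
  assume *: "b \<in> set (level f K k x h n)" "k < K" "0 < h"
  then obtain a where b: "b = ((k * (h - 1) + 1) * K, offsets f K k a h)" unfolding level_def by auto
  have "offsets f K k a h \<subseteq> {..<(k * (h - 1) + 1) * K}"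
    by (rule offsets_subset) (use * in \<open>auto simp: One_nat_def\<close>)
  moreover have "1 \<le> (k * (h - 1) + 1) * K" using * by (simp add: One_nat_def Suc_le_eq)
  ultimately show ?thesis unfolding b wf_block_def using offsets_mod * by auto
qed

lemma total_level: "total (level f K k x h n) = n * Suc ((k * (h - 1) + 1) * K)"
  by (simp add: level_def total_def o_def sum_list_triv)

text \<open>In a block of width 1 the excess is 0 and an index is just a number of copies, so a leaf
  is an initial run of ones.\<close>

lemma level_leaf: "level f K k x 1 n = map (\<lambda>i. (K, {j. j \<le> min (f (x + i)) k})) [0..<n]"
proof -
  have sing: "{a..<a + 1} = {a}" for a :: nat by (auto simp: One_nat_def)
  have "offsets f K k a 1 = {j. j \<le> min (f a) k}" for a
  proof (intro equalityI subsetI)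
    fix j assume "j \<in> {j. j \<le> min (f a) k}"
    then show "j \<in> offsets f K k a 1"
      unfolding offsets_def sing by (intro CollectI exI[of _ "\<lambda>_. j"]) auto
  qed (auto simp: offsets_def sing)
  then show ?thesis by (simp add: level_def)
qed

text \<open>All values are at least \<open>x\<close>, so a sum up to \<open>u\<close> has at most
  \<open>u div x\<close> summands. The sum is recovered as the counter times \<open>x\<close> plus
  the excess.\<close>

lemma offsets_ssum:
  assumes "0 < x" "u div x < K"
  shows "{i mod K * x + i div K | i. i \<in> offsets f K (u div x) x x} \<inter> {..u} = ssum f {x..<2 * x} \<inter> {..u}"
proof -
  let ?I = "{x..<2 * x}"
  have I: "{x..<x + x} = ?I" by auto
  have val: "i mod K * x + i div K = (\<Sum>v\<in>?I. j v * v)"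
    if "sum j ?I < K" "i = (\<Sum>v\<in>?I. j v * ((v - x) * K + 1))" for i j
  proof -
    have "i = (\<Sum>v\<in>?I. j v * (v - x)) * K + sum j ?I" unfolding that(2) by (rule offset_eq)
    then have "i mod K = sum j ?I" "i div K = (\<Sum>v\<in>?I. j v * (v - x))" using that(1) by auto
    then have "i mod K * x + i div K = (\<Sum>v\<in>?I. j v * x + j v * (v - x))"
      by (simp add: sum_distrib_right sum.distrib)
    also have "\<dots> = (\<Sum>v\<in>?I. j v * v)" by (rule sum.cong) (auto simp flip: distrib_left)
    finally show ?thesis .
  qed
  show ?thesis
  proof (intro equalityI subsetI)
    fix s assume s: "s \<in> {i mod K * x + i div K | i. i \<in> offsets f K (u div x) x x} \<inter> {..u}"
    then obtain j where j: "s = (\<Sum>v\<in>?I. j v * ((v - x) * K + 1)) mod K * x + (\<Sum>v\<in>?I. j v * ((v - x) * K + 1)) div K"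
      "\<forall>v\<in>?I. j v \<le> f v" "sum j ?I \<le> u div x" unfolding offsets_def I by blast
    then have "s = (\<Sum>v\<in>?I. j v * v)" using val[of j] assms by simp
    then show "s \<in> ssum f ?I \<inter> {..u}" using j(2) s unfolding ssum_def by blast
  next
    fix s assume "s \<in> ssum f ?I \<inter> {..u}"
    then obtain j where j: "s = (\<Sum>v\<in>?I. j v * v)" "\<forall>v\<in>?I. j v \<le> f v" "s \<le> u"
      unfolding ssum_def by blast
    have "sum j ?I * x \<le> s" unfolding j(1) sum_distrib_right by (rule sum_mono) simp
    then have c: "sum j ?I \<le> u div x" using j(3) assms(1) by (simp add: less_eq_div_iff_mult_less_eq)
    then have "sum j ?I < K" using assms by simp
    from val[OF this refl] have "s = (\<Sum>v\<in>?I. j v * ((v - x) * K + 1)) mod K * x + (\<Sum>v\<in>?I. j v * ((v - x) * K + 1)) div K"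
      using j(1) by simp
    moreover have "(\<Sum>v\<in>?I. j v * ((v - x) * K + 1)) \<in> offsets f K (u div x) x x"
      unfolding offsets_def I using j(2) c by blast
    ultimately show "s \<in> {i mod K * x + i div K | i. i \<in> offsets f K (u div x) x x} \<inter> {..u}"
      using j(3) by blast
  qed
qed

section \<open>Small and large values as programs\<close>

text \<open>Register 2 holds \<open>u\<close>, register 5 the threshold \<open>r\<close>, register 6 the lower end \<open>x\<close> of the
  current interval \<open>{x..<2 * x}\<close> of large values.  Area 13 contains the multiplicities, area 14 the
  sums found so far.\<close>

definition LEAF :: st where
  "LEAF = For 25 (Rg 24) (Sto (Rg 21 [+] Rg 25) (Nm 0)) ;;
    For 25 (Rg 23 [+] Nm 1) (Sto (Rg 21 [+] Rg 25 [*] Rg 26) (Nm 1))"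

definition SMALL_LEAVES :: st where
  "SMALL_LEAVES = Sto (area 11) (Nm 1) ;; Sto (area 11 [+] Nm 1) (Nm 1) ;;
    Asg 21 (area 11 [+] Nm 2) ;; Asg 40 (Nm 1) ;;
    For 22 (Rg 5) (
      Asg 23 (Ld (area 13 [+] Rg 22)) ;;
      Cond (Nm 0) (Rg 23) (
        Asg 26 (Rg 22) ;; Asg 24 (Rg 23 [*] Rg 22 [+] Nm 1) ;; Sto (Rg 21) (Rg 24) ;;
        Asg 21 (Rg 21 [+] Nm 1) ;; LEAF ;; Asg 21 (Rg 21 [+] Rg 24) ;; Asg 40 (Rg 40 [+] Nm 1))
      (Asg 24 (Nm 0)))"

definition LARGE_LEAVES :: st where
  "LARGE_LEAVES = Asg 24 (Rg 13) ;; Asg 26 (Nm 1) ;; Asg 21 (area 11) ;;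
    For 22 (Rg 6) (
      Sto (Rg 21) (Rg 24) ;; Asg 21 (Rg 21 [+] Nm 1) ;; Asg 23 (Ld (area 13 [+] (Rg 6 [+] Rg 22))) ;;
      Cond (Rg 14) (Rg 23) (Asg 23 (Rg 14)) (Asg 23 (Rg 23)) ;; LEAF ;; Asg 21 (Rg 21 [+] Rg 24)) ;;
    Asg 40 (Rg 6)"

definition SMALL_SUMS :: st where
  "SMALL_SUMS = SMALL_LEAVES ;;
    Asg 13 (Nm 1) ;; Asg 14 (Nm 1) ;; Asg 15 (Nm 0) ;; Asg 16 (Nm 0) ;; TREE ;;
    For 22 (Rg 2 [+] Nm 1) (
      Cond (Rg 22) (Ld (area 11)) (Sto (area 14 [+] Rg 22) (Ld (area 11 [+] Nm 1 [+] Rg 22)))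
        (Sto (area 14 [+] Rg 22) (Nm 0)))"

definition EXTRACT :: st where
  "EXTRACT = For 22 (Rg 2 [+] Nm 1) (Sto (area 15 [+] Rg 22) (Nm 0)) ;;
    For 22 (Ld (area 11)) (
      Cond (Nm 0) (Ld (area 11 [+] Nm 1 [+] Rg 22)) (
        Asg 23 ((Rg 22 [-] Rg 22 [div] Rg 13 [*] Rg 13) [*] Rg 6 [+] Rg 22 [div] Rg 13) ;;
        Cond (Rg 23) (Rg 2 [+] Nm 1) (Sto (area 15 [+] Rg 23) (Nm 1)) (Asg 24 (Nm 0)))
      (Asg 24 (Nm 0)))"

text \<open>After the extraction the parameters are reset to \<open>K = 1\<close> and
  \<open>h = 0\<close>, so that the same \<open>COMBINE\<close> performs an ordinary sumset with the
  sums found so far.\<close>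

definition LARGE_STEP :: st where
  "LARGE_STEP = Asg 14 (Rg 2 [div] Rg 6) ;; Asg 13 (Nm 2 [*] Rg 14 [+] Nm 2) ;; Asg 15 (Nm 1) ;;
    Asg 16 ((Rg 14 [-] Nm 1) [*] Rg 13) ;; LARGE_LEAVES ;; TREE ;; EXTRACT ;;
    Asg 13 (Nm 1) ;; Asg 14 (Nm 1) ;; Asg 15 (Nm 0) ;; Asg 16 (Nm 0) ;;
    Asg 61 (area 14) ;; Asg 62 (Rg 2 [+] Nm 1) ;; Asg 63 (area 15) ;; Asg 64 (Rg 2 [+] Nm 1) ;;
    Asg 65 (area 16) ;; COMBINE ;;
    For 22 (Rg 2 [+] Nm 1) (Sto (area 14 [+] Rg 22) (Ld (area 16 [+] Rg 22))) ;;
    Asg 6 (Rg 6 [+] Rg 6)"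

definition OUTPUT :: st where
  "OUTPUT = Asg 0 (Nm 0) ;; Asg 1 (area 17) ;;
    For 22 (Rg 2 [+] Nm 1) (
      Cond (Nm 0) (Ld (area 14 [+] Rg 22)) (Sto (Rg 1 [+] Rg 0) (Rg 22) ;; Asg 0 (Rg 0 [+] Nm 1))
        (Asg 24 (Nm 0)))"

lemma bits_Int: "bits M p l (X \<inter> {..<l}) \<longleftrightarrow> bits M p l X"
  by (auto simp: bits_def)

lemma wp_fill_zero:
  assumes "0 < G" "n < G" "a + n \<le> G"
    and e: "\<And>R' M'. same {i} R' R \<Longrightarrow> ev ea R' M' = a \<and> ev en R' M' = n"
  shows "wp G (For i en (Sto (ea [+] Rg i) (Nm 0))) (\<lambda>R' M' t'.
    bits M' a n {} \<and> same {a..<a + n} M' M \<and> same {i} R' R \<and> t' \<le> t + 2 + 3 * n) R M t"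
proof (rule wp_For[where n = n and I = "\<lambda>j R' M' t'. R' i = j \<and> same {i} R' R \<and>
    bits M' a j {} \<and> same {a..<a + n} M' M \<and> t' \<le> t + 1 + 3 * j"])
  fix j R' M' t'
  assume I: "R' i = j \<and> same {i} R' R \<and> bits M' a j {} \<and> same {a..<a + n} M' M \<and> t' \<le> t + 1 + 3 * j"
  then have e': "ev ea R' M' = a" "ev en R' M' = n" using e by auto
  show "R' i = j \<and> ev en R' M' = n" using I e' by simp
  assume j: "j < n"
  show "wp G (Sto (ea [+] Rg i) (Nm 0))
    (\<lambda>R' M' t'. R' i = j \<and> (R'(i := Suc j)) i = Suc j \<and> same {i} (R'(i := Suc j)) R \<and>
      bits M' a (Suc j) {} \<and> same {a..<a + n} M' M \<and> t' + 1 \<le> t + 1 + 3 * Suc j)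
    R' M' (t' + 1)"
    using I j e' assms(1-3) by (simp add: wp_simps same_upd bits_def less_Suc_eq)
qed (use assms in \<open>auto simp: same_upd bits_def\<close>)

text \<open>Serves both kinds of leaves: stride \<open>q = v\<close> for the multiples of a small
  value \<open>v\<close>, stride 1 for the copy counts of a large one.\<close>

lemma LEAF_spec:
  assumes G: "1 < G" "p + l < G" and R: "R 21 = p" "R 24 = l" "R 23 = m" "R 26 = q"
    and m: "m * q < l" "1 \<le> q"
  shows "wp G LEAF (\<lambda>R' M' t'. bits M' p l {a * q | a. a \<le> m} \<and> same {25} R' R \<and>
    same {p..<p + l} M' M \<and> t' \<le> t + 4 + 6 * l) R M t"
proof -
  have ml: "m + 1 \<le> l"
  proof -
    have "m * 1 \<le> m * q" using m(2) by (rule mult_le_mono2)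
    then show ?thesis using m(1) by linarith
  qed
  have fill: "wp G (For 25 (Rg 24) (Sto (Rg 21 [+] Rg 25) (Nm 0))) (\<lambda>R' M' t'.
    bits M' p l {} \<and> same {p..<p + l} M' M \<and> same {25} R' R \<and> t' \<le> t + 2 + 3 * l) R M t"
    by (rule wp_fill_zero) (use G R in \<open>auto simp: same_def\<close>)
  show ?thesis
    unfolding LEAF_def
  proof (rule wp_SqI[OF fill], elim conjE, goal_cases)
    case A: (1 R1 M1 t1)
    show ?case
    proof (rule wp_For[where n = "m + 1" and I = "\<lambda>j R' M' t'. R' 25 = j \<and> same {25} R' R \<and>
        bits M' p l {a * q | a. a < j} \<and> same {p..<p + l} M' M \<and> t' \<le> t + 3 + 3 * l + 3 * j"])
      show "0 < G" "m + 1 < G" using G ml by auto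
      show "(R1(25 := 0)) 25 = 0 \<and> same {25} (R1(25 := 0)) R \<and>
        bits M1 p l {a * q | a. a < 0} \<and> same {p..<p + l} M1 M \<and> t1 + 1 \<le> t + 3 + 3 * l + 3 * 0"
        using A by (simp add: same_upd)
    next
      fix R' M' t'
      assume *: "R' 25 = m + 1 \<and> same {25} R' R \<and> bits M' p l {a * q | a. a < m + 1} \<and>
        same {p..<p + l} M' M \<and> t' \<le> t + 3 + 3 * l + 3 * (m + 1)"
      have "{a * q | a. a < m + 1} = {a * q | a. a \<le> m}" by (simp add: less_Suc_eq_le One_nat_def)
      then show "bits M' p l {a * q | a. a \<le> m} \<and> same {25} R' R \<and> same {p..<p + l} M' M \<and>
          t' + 1 \<le> t + 4 + 6 * l" using * ml by simp
    next
      fix j R' M' t'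
      assume I: "R' 25 = j \<and> same {25} R' R \<and> bits M' p l {a * q | a. a < j} \<and>
        same {p..<p + l} M' M \<and> t' \<le> t + 3 + 3 * l + 3 * j"
      then have s: "same {25} R' R" by blast
      have r: "R' 21 = p" "R' 23 = m" "R' 26 = q" using R by (simp_all add: same_eq[OF s])
      show "R' 25 = j \<and> ev (Rg 23 [+] Nm 1) R' M' = m + 1" using I r by simp
      assume j: "j < m + 1"
      have "j * q \<le> m * q" using j by (intro mult_le_mono1) simp
      then have jl: "j * q < l" using m(1) by (rule le_less_trans)
      have "{a * q | a. a < Suc j} = insert (j * q) {a * q | a. a < j}" by (auto simp: less_Suc_eq)
      then have "bits (M'(p + j * q := 1)) p l {a * q | a. a < Suc j}"
        using I by (simp add: bits_def)
      then show "wp G (Sto (Rg 21 [+] Rg 25 [*] Rg 26) (Nm 1))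
        (\<lambda>R' M' t'. R' 25 = j \<and> (R'(25 := Suc j)) 25 = Suc j \<and> same {25} (R'(25 := Suc j)) R \<and>
          bits M' p l {a * q | a. a < Suc j} \<and> same {p..<p + l} M' M \<and>
          t' + 1 \<le> t + 3 + 3 * l + 3 * Suc j) R' M' (t' + 1)"
        using I j G jl by (simp add: wp_simps r same_upd)
    qed
  qed
qed

text \<open>The block \<open>(1, {0})\<close> is neutral for sums and keeps the list nonempty, so
  that the tree always ends with exactly one block.\<close>

definition small_blocks :: "(nat \<Rightarrow> nat) \<Rightarrow> nat \<Rightarrow> block list" where
  "small_blocks f r = (1, {0}) # map (leaf f) (filter (\<lambda>v. 0 < f v) [0..<r])"

lemma small_blocks_0: "small_blocks f 0 = [(1, {0})]"
  by (simp add: small_blocks_def)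

lemma small_blocks_Suc:
  "small_blocks f (Suc r) = small_blocks f r @ (if 0 < f r then [leaf f r] else [])"
  by (simp add: small_blocks_def)

lemma total_small_blocks_mono: "i \<le> j \<Longrightarrow> total (small_blocks f i) \<le> total (small_blocks f j)"
proof (induction rule: dec_induct)
  case (step n)
  then show ?case by (simp add: small_blocks_Suc)
qed simp

context fixpoint_table
begin

lemma G1: "1 < G" using Nb Nb_Q Q_G by linarith

lemma SMALL_LEAVES_spec:
  assumes c: "consts_ok R" "R 5 = r" and f: "\<And>i. i < r \<Longrightarrow> M (13 * Q + i) = f i" "f 0 = 0"
    and T: "total (small_blocks f r) \<le> Q" "r \<le> Q"
  shows "wp G SMALL_LEAVES (\<lambda>R' M' t'. blks M' (11 * Q) (small_blocks f r) \<and>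
    R' 40 = length (small_blocks f r) \<and> same ({21..<30} \<union> {40}) R' R \<and> same {11 * Q..<12 * Q} M' M \<and>
    t' \<le> t + 10 + 8 * r + 20 * total (small_blocks f r)) R M t"
proof -
  have r: "R 10 = S" "R 11 = B" "R 12 = Q" using c by (auto simp: consts_ok_def)
  let ?b = "small_blocks f"
  have QG: "40 * Q < G" "1 < G" using Q_G G1 by auto
  have T2: "2 \<le> total (?b r)" by (simp add: small_blocks_def)
  have Q2: "2 \<le> Q" using T2 T(1) by linarith
  let ?R = "R(21 := 11 * Q + 2, 40 := 1)" and ?M = "M(11 * Q := 1, 11 * Q + 1 := 1)"
  let ?body = "Asg 23 (Ld (area 13 [+] Rg 22)) ;;
      Cond (Nm 0) (Rg 23) (
        Asg 26 (Rg 22) ;; Asg 24 (Rg 23 [*] Rg 22 [+] Nm 1) ;; Sto (Rg 21) (Rg 24) ;;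
        Asg 21 (Rg 21 [+] Nm 1) ;; LEAF ;; Asg 21 (Rg 21 [+] Rg 24) ;; Asg 40 (Rg 40 [+] Nm 1))
      (Asg 24 (Nm 0))"
  define I where "I = (\<lambda>j R' M' t'. R' 22 = j \<and> blks M' (11 * Q) (?b j) \<and>
      R' 21 = 11 * Q + total (?b j) \<and> R' 40 = length (?b j) \<and> same ({21..<30} \<union> {40}) R' R \<and>
      same {11 * Q..<12 * Q} M' M \<and> t' \<le> t + 5 + 8 * j + 20 * total (?b j))"
  have "wp G (For 22 (Rg 5) ?body) (\<lambda>R' M' t'. blks M' (11 * Q) (?b r) \<and>
    R' 40 = length (?b r) \<and> same ({21..<30} \<union> {40}) R' R \<and> same {11 * Q..<12 * Q} M' M \<and>
    t' \<le> t + 10 + 8 * r + 20 * total (?b r)) ?R ?M (t + 1 + 1 + 1 + 1)"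
  proof (rule wp_For[where n = r and I = I])
    show "0 < G" "r < G" using QG T(2) by auto
    have "same {11 * Q..<12 * Q} ?M M" using Q2 by (intro same_upd) auto
    moreover have "same ({21..<30} \<union> {40}) (?R(22 := 0)) R" by (intro same_upd) auto
    ultimately show "I 0 (?R(22 := 0)) ?M (t + 1 + 1 + 1 + 1 + 1)"
      by (simp add: I_def small_blocks_0 bits_def One_nat_def)
  next
    fix R' M' t' assume "I r R' M' t'"
    then show "blks M' (11 * Q) (?b r) \<and> R' 40 = length (?b r) \<and> same ({21..<30} \<union> {40}) R' R \<and>
      same {11 * Q..<12 * Q} M' M \<and> t' + 1 \<le> t + 10 + 8 * r + 20 * total (?b r)"
      unfolding I_def by auto
  next
    fix j R' M' t'
    assume I: "I j R' M' t'"
    then have s: "same ({21..<30} \<union> {40}) R' R" and sm: "same {11 * Q..<12 * Q} M' M"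
      and bl: "blks M' (11 * Q) (?b j)" and r22: "R' 22 = j" "R' 21 = 11 * Q + total (?b j)"
        "R' 40 = length (?b j)" and t: "t' \<le> t + 5 + 8 * j + 20 * total (?b j)" by (auto simp: I_def)
    have r': "R' 12 = Q" "R' 5 = r" using r c by (simp_all add: same_eq[OF s])
    show "R' 22 = j \<and> ev (Rg 5) R' M' = r" using r22 r' by simp
    assume j: "j < r"
    have m: "M' (13 * Q + j) = f j" using f(1)[OF j] by (simp add: same_eq[OF sm])
    show "wp G ?body (\<lambda>R' M' t'. R' 22 = j \<and> I (Suc j) (R'(22 := Suc j)) M' (t' + 1)) R' M' (t' + 1)"
    proof (cases "0 < f j")
      case False
      then have "?b (Suc j) = ?b j" by (simp add: small_blocks_Suc)
      moreover have "same ({21..<30} \<union> {40}) (R'(23 := 0, 24 := 0, 22 := Suc j)) R"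
        using s by (intro same_upd) auto
      ultimately show ?thesis using False I QG
        by (simp add: wp_simps r' r22 m I_def)
    next
      case True
      define l where "l = f j * j + 1"
      define p where "p = 11 * Q + total (?b j)"
      have bs: "?b (Suc j) = ?b j @ [leaf f j]" using True by (simp add: small_blocks_Suc)
      have "total (?b (Suc j)) \<le> total (?b r)" using j by (intro total_small_blocks_mono) simp
      then have tot: "total (?b j) + Suc l \<le> Q" using T(1) by (simp add: bs leaf_def l_def)
      have j1: "1 \<le> j" using True f(2) by (cases j) auto
      have fl: "f j < l"
      proof -
        have "f j * 1 \<le> f j * j" using j1 by (rule mult_le_mono2)
        then show ?thesis unfolding l_def by linarith
      qed
      let ?R1 = "R'(23 := f j, 26 := j, 24 := l, 21 := p + 1)" and ?M1 = "M'(p := l)"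
      have leaf: "wp G LEAF (\<lambda>R2 M2 t2. bits M2 (p + 1) l {a * j | a. a \<le> f j} \<and> same {25} R2 ?R1 \<and>
          same {p + 1..<p + 1 + l} M2 ?M1 \<and> t2 \<le> t' + 7 + 4 + 6 * l) ?R1 ?M1 (t' + 7)"
        by (rule LEAF_spec) (use QG tot j1 in \<open>auto simp: p_def l_def\<close>)
      have t7: "t' + 1 + 1 + 1 + 1 + 1 + 1 + 1 = t' + 7" by simp
      have lt: "l < G" "p + 1 < G" "p < G" "f j < G" "j < G" "p + 1 + l < G" "length (?b j) + 1 < G"
        using tot QG fl j T(2) length_le_total[of "?b j"] unfolding p_def by linarith+
      have "wp G (LEAF ;; Asg 21 (Rg 21 [+] Rg 24) ;; Asg 40 (Rg 40 [+] Nm 1))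
        (\<lambda>R' M' t'. R' 22 = j \<and> I (Suc j) (R'(22 := Suc j)) M' (t' + 1)) ?R1 ?M1 (t' + 7)"
      proof (rule wp_SqI[OF leaf], elim conjE, goal_cases)
        case A: (1 R2 M2 t2)
        have r2: "R2 21 = p + 1" "R2 24 = l" "R2 40 = length (?b j)" "R2 22 = j"
          using r22 by (simp_all add: same_eq[OF A(2)])
        have sM: "same {p..<p + Suc l} M2 M'"
          by (rule same_trans[OF A(3) same_upd[OF same_refl, of p "{p}"]]) auto
        have "blks M2 (11 * Q) (?b j)" by (rule blks_same[OF bl sM]) (auto simp: p_def)
        moreover have "M2 p = l" by (simp add: same_eq[OF A(3)])
        ultimately have b: "blks M2 (11 * Q) (?b (Suc j))"
          using A(1) by (simp add: bs blks_append p_def[symmetric] leaf_def l_def)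
        have "same ({21..<30} \<union> {40}) R2 R"
          by (rule same_trans[OF A(2) same_upd[OF same_upd[OF same_upd[OF same_upd[OF s]]]]]) auto
        then have s2: "same ({21..<30} \<union> {40}) (R2(21 := p + 1 + l, 40 := length (?b j) + 1, 22 := Suc j)) R"
          by (intro same_upd) auto
        have sm2: "same {11 * Q..<12 * Q} M2 M"
          by (rule same_trans[OF sM sm]) (use tot in \<open>auto simp: p_def\<close>)
        have tt: "total (?b (Suc j)) = total (?b j) + Suc l" by (simp add: bs leaf_def l_def)
        have "I (Suc j) (R2(21 := p + 1 + l, 40 := length (?b j) + 1, 22 := Suc j)) M2 (t2 + 1 + 1 + 1)"
          unfolding I_def using b s2 sm2 A(4) t unfolding tt
          by (simp add: bs p_def)
        then show ?case using r2 lt by (simp add: wp_simps)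
      qed
      then show ?thesis
        using True lt by (simp add: wp_Sq wp_Asg wp_Cond wp_Sto r' r22 m p_def[symmetric] l_def[symmetric] t7)
    qed
  qed
  then show ?thesis
    unfolding SMALL_LEAVES_def using QG Q2 by (simp add: wp_simps r)
qed

lemma LARGE_LEAVES_spec:
  assumes c: "consts_ok R" "R 6 = x" "R 13 = K" "R 14 = k" "k < K" and x: "0 < x"
    and f: "\<And>i. i < 2 * x \<Longrightarrow> M (13 * Q + i) = f i"
    and T: "x * Suc K \<le> Q" "2 * x \<le> Q" "k < G" "\<And>i. i < 2 * x \<Longrightarrow> f i < G"
  shows "wp G LARGE_LEAVES (\<lambda>R' M' t'. blks M' (11 * Q) (level f K k x 1 x) \<and>
    R' 40 = x \<and> same ({21..<30} \<union> {40}) R' R \<and> same {11 * Q..<12 * Q} M' M \<and>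
    t' \<le> t + 10 + x * (20 + 6 * K)) R M t"
proof -
  have r: "R 10 = S" "R 11 = B" "R 12 = Q" using c by (auto simp: consts_ok_def)
  let ?b = "level f K k x 1"
  have b: "?b (Suc j) = ?b j @ [(K, {a * 1 | a. a \<le> min (f (x + j)) k})]" "?b 0 = []"
    "total (?b j) = j * Suc K" "length (?b j) = j" for j
    by (simp add: level_leaf, simp add: level_def, simp add: total_level, simp add: level_def)
  have QG: "40 * Q < G" "1 < G" using Q_G G1 by auto
  have KG: "x = 0 \<or> K \<le> Q" using T(1) by (cases x) auto
  let ?R = "R(24 := K, 26 := 1, 21 := 11 * Q)"
  let ?body = "Sto (Rg 21) (Rg 24) ;; Asg 21 (Rg 21 [+] Nm 1) ;; Asg 23 (Ld (area 13 [+] (Rg 6 [+] Rg 22))) ;;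
      Cond (Rg 14) (Rg 23) (Asg 23 (Rg 14)) (Asg 23 (Rg 23)) ;; LEAF ;; Asg 21 (Rg 21 [+] Rg 24)"
  define I where "I = (\<lambda>j R' M' t'. R' 22 = j \<and> blks M' (11 * Q) (?b j) \<and>
      R' 21 = 11 * Q + j * Suc K \<and> R' 24 = K \<and> R' 26 = 1 \<and> same {21..<30} R' R \<and>
      same {11 * Q..<12 * Q} M' M \<and> t' \<le> t + 4 + j * (20 + 6 * K))"
  have lp: "wp G (For 22 (Rg 6) ?body) (\<lambda>R' M' t'. blks M' (11 * Q) (?b x) \<and>
    same {21..<30} R' R \<and> same {11 * Q..<12 * Q} M' M \<and>
    t' \<le> t + 5 + x * (20 + 6 * K)) ?R M (t + 1 + 1 + 1)"
  proof (rule wp_For[where n = x and I = I])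
    show "0 < G" "x < G" using QG T(2) by auto
    have "same {21..<30} (?R(22 := 0)) R" by (intro same_upd) auto
    then show "I 0 (?R(22 := 0)) M (t + 1 + 1 + 1 + 1)" by (simp add: I_def b(2))
  next
    fix R' M' t' assume "I x R' M' t'"
    then show "blks M' (11 * Q) (?b x) \<and> same {21..<30} R' R \<and>
      same {11 * Q..<12 * Q} M' M \<and> t' + 1 \<le> t + 5 + x * (20 + 6 * K)"
      unfolding I_def by auto
  next
    fix j R' M' t'
    assume I: "I j R' M' t'"
    then have s: "same {21..<30} R' R" and sm: "same {11 * Q..<12 * Q} M' M"
      and bl: "blks M' (11 * Q) (?b j)" and r22: "R' 22 = j" "R' 21 = 11 * Q + j * Suc K" "R' 24 = K" "R' 26 = 1"
      and t: "t' \<le> t + 4 + j * (20 + 6 * K)" by (auto simp: I_def)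
    have r': "R' 12 = Q" "R' 6 = x" "R' 14 = k" using r c by (simp_all add: same_eq[OF s])
    show "R' 22 = j \<and> ev (Rg 6) R' M' = x" using r22 r' by simp
    assume j: "j < x"
    have m: "M' (13 * Q + (x + j)) = f (x + j)" using f[of "x + j"] j by (simp add: same_eq[OF sm])
    define p where "p = 11 * Q + j * Suc K"
    define mm where "mm = min (f (x + j)) k"
    have "Suc j * Suc K \<le> x * Suc K" using j by (intro mult_le_mono1) simp
    then have tot: "j * Suc K + Suc K \<le> Q" using T(1) by simp
    let ?R1 = "R'(21 := p + 1, 23 := mm)" and ?M1 = "M'(p := K)"
    have leaf: "wp G LEAF (\<lambda>R2 M2 t2. bits M2 (p + 1) K {a * 1 | a. a \<le> mm} \<and> same {25} R2 ?R1 \<and>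
        same {p + 1..<p + 1 + K} M2 ?M1 \<and> t2 \<le> t' + 6 + 4 + 6 * K) ?R1 ?M1 (t' + 6)"
    proof (rule LEAF_spec)
      show "p + 1 + K < G" using tot QG by (simp add: p_def)
    qed (use QG c r22 in \<open>auto simp: mm_def\<close>)
    have t6: "t' + 1 + 1 + 1 + 1 + 1 + 1 = t' + 6" by simp
    have lt: "K < G" "p + 1 < G" "p < G" "f (x + j) < G" "p + 1 + K < G"
      using tot QG T(4)[of "x + j"] j unfolding p_def by simp_all
    have ne: "13 * Q + (x + j) \<noteq> p" using tot QG by (simp add: p_def)
    have body: "wp G (LEAF ;; Asg 21 (Rg 21 [+] Rg 24))
      (\<lambda>R' M' t'. R' 22 = j \<and> I (Suc j) (R'(22 := Suc j)) M' (t' + 1)) ?R1 ?M1 (t' + 6)"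
    proof (rule wp_SqI[OF leaf], elim conjE, goal_cases)
      case A: (1 R2 M2 t2)
      have r2: "R2 21 = p + 1" "R2 24 = K" "R2 22 = j" "R2 26 = 1"
        using r22 by (simp_all add: same_eq[OF A(2)])
      have sM: "same {p..<p + Suc K} M2 M'"
        by (rule same_trans[OF A(3) same_upd[OF same_refl, of p "{p}"]]) auto
      have "blks M2 (11 * Q) (?b j)" by (rule blks_same[OF bl sM]) (auto simp: p_def b(3))
      moreover have "M2 p = K" by (simp add: same_eq[OF A(3)])
      ultimately have bb: "blks M2 (11 * Q) (?b (Suc j))"
        using A(1) unfolding b(1) blks_append b(3) p_def[symmetric] mm_def by simp
      have "same {21..<30} R2 R"
        by (rule same_trans[OF A(2) same_upd[OF same_upd[OF s]]]) auto
      then have s2: "same {21..<30} (R2(21 := p + 1 + K, 22 := Suc j)) R"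
        by (intro same_upd) auto
      have sm2: "same {11 * Q..<12 * Q} M2 M"
        by (rule same_trans[OF sM sm]) (use tot in \<open>auto simp: p_def\<close>)
      have "I (Suc j) (R2(21 := p + 1 + K, 22 := Suc j)) M2 (t2 + 1 + 1)"
        unfolding I_def using bb s2 sm2 A(4) t r2
        by (simp add: p_def)
      then show ?case using r2 lt by (simp add: wp_simps)
    qed
    show "wp G ?body (\<lambda>R' M' t'. R' 22 = j \<and> I (Suc j) (R'(22 := Suc j)) M' (t' + 1)) R' M' (t' + 1)"
    proof (cases "k < f (x + j)")
      case True
      then have "mm = k" by (simp add: mm_def)
      then show ?thesis using True body lt T(3)
        by (simp add: wp_Sq wp_Asg wp_Cond wp_Sto r' r22 m ne p_def[symmetric] t6 del: mult_Suc_right)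
    next
      case False
      then have "mm = f (x + j)" by (simp add: mm_def)
      then show ?thesis using False body lt T(3)
        by (simp add: wp_Sq wp_Asg wp_Cond wp_Sto r' r22 m ne p_def[symmetric] t6 del: mult_Suc_right)
    qed
  qed
  have rest: "wp G (For 22 (Rg 6) ?body ;; Asg 40 (Rg 6)) (\<lambda>R' M' t'. blks M' (11 * Q) (?b x) \<and>
    R' 40 = x \<and> same ({21..<30} \<union> {40}) R' R \<and> same {11 * Q..<12 * Q} M' M \<and>
    t' \<le> t + 10 + x * (20 + 6 * K)) ?R M (t + 1 + 1 + 1)"
  proof (rule wp_SqI[OF lp], elim conjE, goal_cases)
    case A: (1 R2 M2 t2)
    have "R2 6 = x" using c by (simp add: same_eq[OF A(2)])
    moreover have "same ({21..<30} \<union> {40}) (R2(40 := x)) R"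
      by (rule same_upd[OF same_mono[OF A(2)]]) auto
    ultimately show ?case using A QG T(2) by (simp add: wp_Asg)
  qed
  have "K < G" using KG QG x by auto
  then show ?thesis
    unfolding LARGE_LEAVES_def using rest QG by (simp add: wp_Sq wp_Asg r c)
qed

end

lemma ssum_support: "finite A \<Longrightarrow> ssum f {v \<in> A. 0 < f v} = ssum f A"
proof (induction A rule: finite_induct)
  case (insert x A)
  show ?case
  proof (cases "f x = 0")
    case True
    then have "{v \<in> insert x A. 0 < f v} = {v \<in> A. 0 < f v}" by auto
    then show ?thesis using insert True by (simp add: ssum_zero)
  next
    case False
    then have "{v \<in> insert x A. 0 < f v} = insert x {v \<in> A. 0 < f v}" by auto
    then show ?thesis using insert by (simp add: ssum_insert)
  qed
qed simp

lemma block_sums_small_blocks: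
  assumes "f 0 = 0"
  shows "block_sums (small_blocks f r) = ssum f {1..<r}"
proof -
  have "block_sums (small_blocks f r) = ssum f (set (filter (\<lambda>v. 0 < f v) [0..<r]))"
    by (simp add: small_blocks_def block_sums_leaves)
  also have "set (filter (\<lambda>v. 0 < f v) [0..<r]) = {v \<in> {1..<r}. 0 < f v}"
    using assms by (auto simp: One_nat_def Suc_le_eq intro: gr0I)
  finally show ?thesis by (simp only: ssum_support finite_atLeastLessThan)
qed

lemma wf_small_blocks:
  assumes "b \<in> set (small_blocks f r)"
  shows "wf_block 1 1 b"
proof -
  have "a * v < f v * v + 1" if "a \<le> f v" for a v
    using mult_le_mono1[OF that, of v] by linarith
  then show ?thesis using assms by (auto simp: small_blocks_def wf_block_def leaf_def One_nat_def)
qed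

context fixpoint_table
begin

lemma SMALL_SUMS_spec:
  assumes c: "consts_ok R" "R 5 = r" "R 2 = u" and tab: "table_ok M"
    and f: "\<And>i. i < r \<Longrightarrow> M (13 * Q + i) = f i" "f 0 = 0"
    and A: "total (small_blocks f r) = A" "4 * A \<le> Nb" "r \<le> Q" "u + 1 \<le> Q"
    and p: "length (small_blocks f r) \<le> 2 ^ p"
  shows "wp G SMALL_SUMS (\<lambda>R' M' t'. bits M' (14 * Q) (u + 1) (ssum f {1..<r}) \<and>
    same ({13..<17} \<union> {21..<120}) R' R \<and> same ({3 * Q..<13 * Q} \<union> {14 * Q..<15 * Q}) M' M \<and>
    t' \<le> t + 30 + 8 * r + 4 * u + 20 * A + p * (2 + 400 * (J + 1) * A)) R M t"
proof -
  have QG: "40 * Q < G" "1 < G" using Q_G G1 by auto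
  have AQ: "A \<le> Q" using A(2) Nb_Q by linarith
  let ?b = "small_blocks f r" and ?X = "ssum f {1..<r}"
  have tot: "total ?b \<le> Q" using A AQ by simp
  \<comment> \<open>\<open>h = 0\<close> is preserved by doubling, and without slack the total never
    grows, so \<open>A\<close> bounds every level of the tree.\<close>
  define inv where "inv = (\<lambda>h bs. h = (0::nat) \<and> block_sums bs = ?X \<and> total bs \<le> A \<and>
    (\<forall>b\<in>set bs. wf_block 1 1 b))"
  show ?thesis
    unfolding SMALL_SUMS_def
  proof (rule wp_SqI[OF SMALL_LEAVES_spec[OF c(1,2) f tot A(3)]], assumption, elim conjE, goal_cases)
    case L: (1 R1 M1 t1)
    let ?R1 = "R1(13 := 1, 14 := 1, 15 := 0, 16 := 0)"
    have r1: "R1 10 = S" "R1 11 = B" "R1 12 = Q" "R1 2 = u"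
      using c by (simp_all add: same_eq[OF L(3)] consts_ok_def)
    have tab1: "table_ok M1" by (rule table_ok_same[OF tab L(4)]) auto
    have tree: "wp G TREE (\<lambda>R' M' t'. \<exists>h b. inv h [b] \<and> blks M' (11 * Q) [b] \<and>
      same ({15} \<union> {40..<120}) R' ?R1 \<and> same {3 * Q..<13 * Q} M' M1 \<and>
      t' \<le> t1 + 4 + 1 + p * (2 + 400 * (J + 1) * A)) ?R1 M1 (t1 + 4)"
    proof (rule TREE_spec[where K = 1 and k = 1 and ?h0.0 = 0 and e = 0 and T = A and ?bs0.0 = ?b])
      show "consts_ok ?R1" using r1 by (simp add: consts_ok_def)
      show "inv 0 ?b"
        unfolding inv_def using block_sums_small_blocks[of f r] f(2) A(1) wf_small_blocks by auto
      show "inv (2 * h) (merge (join 1 1 0 h) bs)" if "inv h bs" "1 < length bs" for h bs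
        using that block_sums_merge[of bs] total_merge_le[of 1 1 0 0 bs] unfolding inv_def by auto
      show "total bs \<le> A \<and> 1 * (h * 1) + 0 \<le> A \<and> (\<forall>b\<in>set bs. wf_block 1 1 b) \<and>
          cost (1 * (h * 1) + 0) bs \<le> A" if "inv h bs" for h bs
        using that unfolding inv_def by (simp add: cost_def)
      show "?b \<noteq> []" by (simp add: small_blocks_def)
    qed (use L p A tab1 in simp_all)
    have t4: "t1 + 1 + 1 + 1 + 1 = t1 + 4" by simp
    have "wp G (TREE ;;
        For 22 (Rg 2 [+] Nm 1) (
          Cond (Rg 22) (Ld (area 11)) (Sto (area 14 [+] Rg 22) (Ld (area 11 [+] Nm 1 [+] Rg 22)))
            (Sto (area 14 [+] Rg 22) (Nm 0))))
      (\<lambda>R' M' t'. bits M' (14 * Q) (u + 1) ?X \<and>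
        same ({13..<17} \<union> {21..<120}) R' R \<and> same ({3 * Q..<13 * Q} \<union> {14 * Q..<15 * Q}) M' M \<and>
        t' \<le> t + 30 + 8 * r + 4 * u + 20 * A + p * (2 + 400 * (J + 1) * A)) ?R1 M1 (t1 + 4)"
    proof (rule wp_SqI[OF tree], elim exE conjE, goal_cases)
      case B: (1 R2 M2 t2 h b)
      define l where "l = fst b"
      have b: "snd b = ?X" "snd b \<subseteq> {..<l}" using B(1) unfolding inv_def l_def by (auto simp: wf_block_def)
      have M2: "M2 (11 * Q) = l" "bits M2 (11 * Q + 1) l ?X" using B(2) b by (simp_all add: l_def)
      have r2: "R2 12 = Q" "R2 2 = u" using r1 by (simp_all add: same_eq[OF B(3)])
      have l: "l < Q" using B(1) AQ by (simp add: inv_def l_def)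
      have sR: "same ({13..<17} \<union> {21..<120}) R2 R"
        unfolding same_def by (auto simp: same_eq[OF B(3)] same_eq[OF L(3)])
      have sM: "same ({3 * Q..<13 * Q} \<union> {14 * Q..<15 * Q}) M2 M"
        unfolding same_def by (auto simp: same_eq[OF B(4)] same_eq[OF L(4)])
      show ?case
      proof (rule wp_For[where n = "u + 1" and I = "\<lambda>j R' M' t'. R' 22 = j \<and> same {22} R' R2 \<and>
          bits M' (14 * Q) j ?X \<and> same {14 * Q..<15 * Q} M' M2 \<and> t' \<le> t2 + 1 + 4 * j"])
        show "0 < G" "u + 1 < G" using QG A by auto
        show "(R2(22 := 0)) 22 = 0 \<and> same {22} (R2(22 := 0)) R2 \<and>
          bits M2 (14 * Q) 0 ?X \<and> same {14 * Q..<15 * Q} M2 M2 \<and> t2 + 1 \<le> t2 + 1 + 4 * 0"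
          by (simp add: same_upd bits_def)
      next
        fix R' M' t'
        assume *: "R' 22 = u + 1 \<and> same {22} R' R2 \<and> bits M' (14 * Q) (u + 1) ?X \<and>
          same {14 * Q..<15 * Q} M' M2 \<and> t' \<le> t2 + 1 + 4 * (u + 1)"
        have "same ({13..<17} \<union> {21..<120}) R' R" by (rule same_trans[OF _ sR, of "{22}"]) (use * in auto)
        moreover have "same ({3 * Q..<13 * Q} \<union> {14 * Q..<15 * Q}) M' M"
          by (rule same_trans[OF _ sM, of "{14 * Q..<15 * Q}"]) (use * in auto)
        moreover have "t' + 1 \<le> t + 30 + 8 * r + 4 * u + 20 * A + p * (2 + 400 * (J + 1) * A)"
        proof -
          have "t' \<le> t2 + 1 + 4 * (u + 1)" using * by blast
          moreover define Z where "Z = p * (2 + 400 * (J + 1) * A)"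
          ultimately show ?thesis using B(5) L(5) unfolding A(1) Z_def[symmetric] by presburger
        qed
        ultimately show "bits M' (14 * Q) (u + 1) ?X \<and>
          same ({13..<17} \<union> {21..<120}) R' R \<and> same ({3 * Q..<13 * Q} \<union> {14 * Q..<15 * Q}) M' M \<and>
          t' + 1 \<le> t + 30 + 8 * r + 4 * u + 20 * A + p * (2 + 400 * (J + 1) * A)" using * by blast
      next
        fix j R' M' t'
        assume I: "R' 22 = j \<and> same {22} R' R2 \<and> bits M' (14 * Q) j ?X \<and>
          same {14 * Q..<15 * Q} M' M2 \<and> t' \<le> t2 + 1 + 4 * j"
        then have s: "same {22} R' R2" and sm: "same {14 * Q..<15 * Q} M' M2" by blast+
        have r': "R' 12 = Q" "R' 2 = u" using r2 by (simp_all add: same_eq[OF s])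
        show "R' 22 = j \<and> ev (Rg 2 [+] Nm 1) R' M' = u + 1" using I r' by simp
        assume j: "j < u + 1"
        have m: "M' (11 * Q) = l" using M2(1) l by (simp add: same_eq[OF sm])
        have upd: "bits (M'(14 * Q + j := of_bool (j \<in> ?X))) (14 * Q) (Suc j) ?X"
          using I by (auto simp: bits_def less_Suc_eq)
        show "wp G (Cond (Rg 22) (Ld (area 11)) (Sto (area 14 [+] Rg 22) (Ld (area 11 [+] Nm 1 [+] Rg 22)))
            (Sto (area 14 [+] Rg 22) (Nm 0)))
          (\<lambda>R' M' t'. R' 22 = j \<and> (R'(22 := Suc j)) 22 = Suc j \<and> same {22} (R'(22 := Suc j)) R2 \<and>
            bits M' (14 * Q) (Suc j) ?X \<and> same {14 * Q..<15 * Q} M' M2 \<and> t' + 1 \<le> t2 + 1 + 4 * Suc j)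
          R' M' (t' + 1)"
        proof (cases "j < l")
          case True
          have "M' (11 * Q + 1 + j) = of_bool (j \<in> ?X)"
            using M2(2) True l A(4) by (simp add: same_eq[OF sm] bits_def)
          then show ?thesis using I j True upd QG A(4) m r' by (simp add: wp_simps same_upd)
        next
          case False
          then have "j \<notin> ?X" using b by auto
          then show ?thesis using I j False upd QG A(4) m r' by (simp add: wp_simps same_upd)
        qed
      qed
    qed
    then show ?case using QG G1 by (simp add: wp_Sq wp_Asg t4)
  qed
qed

text \<open>A decoded value may exceed \<open>u\<close> before it is discarded;
  \<open>l * x + l < G\<close> ensures that it still fits into a word.\<close>

lemma EXTRACT_spec:
  assumes c: "consts_ok R" "R 2 = u" "R 6 = x" "R 13 = K"
    and M: "M (11 * Q) = l" "bits M (11 * Q + 1) l X" "X \<subseteq> {..<l}"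
    and u: "u + 1 \<le> Q" "l < Q" "l * x + l < G"
  shows "wp G EXTRACT (\<lambda>R' M' t'. bits M' (15 * Q) (u + 1) {i mod K * x + i div K | i. i \<in> X} \<and>
    same {22..<25} R' R \<and> same {15 * Q..<16 * Q} M' M \<and> t' \<le> t + 10 + 3 * u + 8 * l) R M t"
proof -
  have QG: "40 * Q < G" "1 < G" using Q_G G1 by auto
  have r: "R 10 = S" "R 11 = B" "R 12 = Q" using c by (auto simp: consts_ok_def)
  define g where "g = (\<lambda>i. i mod K * x + i div K)"
  have im: "{i mod K * x + i div K | i. i \<in> X} = g ` X" by (auto simp: g_def)
  have fill: "wp G (For 22 (Rg 2 [+] Nm 1) (Sto (area 15 [+] Rg 22) (Nm 0))) (\<lambda>R' M' t'.
    bits M' (15 * Q) (u + 1) {} \<and> same {15 * Q..<15 * Q + (u + 1)} M' M \<and> same {22} R' R \<and>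
    t' \<le> t + 2 + 3 * (u + 1)) R M t"
    by (rule wp_fill_zero) (use QG u r c in \<open>auto simp: same_def\<close>)
  show ?thesis
    unfolding EXTRACT_def im
  proof (rule wp_SqI[OF fill], elim conjE, goal_cases)
    case A: (1 R1 M1 t1)
    have sm1: "same {15 * Q..<16 * Q} M1 M" by (rule same_mono[OF A(2)]) (use u in auto)
    show ?case
    proof (rule wp_For[where n = l and I = "\<lambda>j R' M' t'. R' 22 = j \<and> same {22..<25} R' R \<and>
        bits M' (15 * Q) (u + 1) (g ` (X \<inter> {..<j})) \<and> same {15 * Q..<16 * Q} M' M \<and>
        t' \<le> t + 8 + 3 * u + 6 * j"])
      show "0 < G" "l < G" using QG u by auto
      have "same {22..<25} (R1(22 := 0)) R" by (intro same_upd same_mono[OF A(3)]) auto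
      then show "(R1(22 := 0)) 22 = 0 \<and> same {22..<25} (R1(22 := 0)) R \<and>
        bits M1 (15 * Q) (u + 1) (g ` (X \<inter> {..<0})) \<and> same {15 * Q..<16 * Q} M1 M \<and>
        t1 + 1 \<le> t + 8 + 3 * u + 6 * 0"
        using A sm1 by simp
    next
      fix R' M' t'
      assume "R' 22 = l \<and> same {22..<25} R' R \<and> bits M' (15 * Q) (u + 1) (g ` (X \<inter> {..<l})) \<and>
        same {15 * Q..<16 * Q} M' M \<and> t' \<le> t + 8 + 3 * u + 6 * l"
      then show "bits M' (15 * Q) (u + 1) (g ` X) \<and> same {22..<25} R' R \<and> same {15 * Q..<16 * Q} M' M \<and>
          t' + 1 \<le> t + 10 + 3 * u + 8 * l" using M(3) by (simp add: Int_absorb2)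
    next
      fix j R' M' t'
      assume I: "R' 22 = j \<and> same {22..<25} R' R \<and> bits M' (15 * Q) (u + 1) (g ` (X \<inter> {..<j})) \<and>
        same {15 * Q..<16 * Q} M' M \<and> t' \<le> t + 8 + 3 * u + 6 * j"
      then have s: "same {22..<25} R' R" and sm: "same {15 * Q..<16 * Q} M' M" by blast+
      have r': "R' 12 = Q" "R' 2 = u" "R' 6 = x" "R' 13 = K" using r c by (simp_all add: same_eq[OF s])
      have m: "M' (11 * Q) = l" using M(1) u by (simp add: same_eq[OF sm])
      show "R' 22 = j \<and> ev (Ld (area 11)) R' M' = l" using I r' m by simp
      assume j: "j < l"
      have mj: "M' (11 * Q + 1 + j) = of_bool (j \<in> X)"
        using M(2) j u by (simp add: same_eq[OF sm] bits_def)
      have md: "j - j div K * K = j mod K" by (simp add: minus_div_mult_eq_mod)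
      have gj: "j mod K * x + j div K = g j" by (simp add: g_def)
      have "j mod K * x \<le> l * x" using j by (intro mult_le_mono1) (meson le_trans less_imp_le mod_less_eq_dividend)
      moreover have "j div K \<le> l" using j by (meson le_trans less_imp_le div_le_dividend)
      ultimately have gG: "g j < G" using u(3) unfolding g_def by linarith
      have sR: "same {22..<25} (R'(23 := a, 24 := b, 22 := Suc j)) R" "same {22..<25} (R'(23 := a, 22 := Suc j)) R"
        "same {22..<25} (R'(24 := b, 22 := Suc j)) R" for a b
        using s by (auto intro!: same_upd)
      show "wp G (Cond (Nm 0) (Ld (area 11 [+] Nm 1 [+] Rg 22)) (
          Asg 23 ((Rg 22 [-] Rg 22 [div] Rg 13 [*] Rg 13) [*] Rg 6 [+] Rg 22 [div] Rg 13) ;;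
          Cond (Rg 23) (Rg 2 [+] Nm 1) (Sto (area 15 [+] Rg 23) (Nm 1)) (Asg 24 (Nm 0)))
        (Asg 24 (Nm 0)))
        (\<lambda>R' M' t'. R' 22 = j \<and> (R'(22 := Suc j)) 22 = Suc j \<and> same {22..<25} (R'(22 := Suc j)) R \<and>
          bits M' (15 * Q) (u + 1) (g ` (X \<inter> {..<Suc j})) \<and> same {15 * Q..<16 * Q} M' M \<and>
          t' + 1 \<le> t + 8 + 3 * u + 6 * Suc j) R' M' (t' + 1)"
      proof (cases "j \<in> X")
        case False
        then have "X \<inter> {..<Suc j} = X \<inter> {..<j}" by (auto simp: less_Suc_eq)
        then show ?thesis using False I QG by (simp add: wp_simps r' mj sR)
      next
        case True
        then have ins: "g ` (X \<inter> {..<Suc j}) = insert (g j) (g ` (X \<inter> {..<j}))" by (auto simp: less_Suc_eq)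
        show ?thesis
        proof (cases "g j < u + 1")
          case T2: True
          have "bits (M'(15 * Q + g j := 1)) (15 * Q) (u + 1) (g ` (X \<inter> {..<Suc j}))"
            unfolding ins using I by (simp add: bits_def)
          then show ?thesis using True T2 I QG u gG
            by (simp add: wp_simps r' mj md gj sR same_upd)
        next
          case F2: False
          have "bits M' (15 * Q) (u + 1) (g ` (X \<inter> {..<Suc j}))"
            unfolding ins using I F2 by (auto simp: bits_def)
          then show ?thesis using True F2 I QG u gG
            by (simp add: wp_simps r' mj md gj sR)
        qed
      qed
    qed
  qed
qed

lemma OUTPUT_spec:
  assumes c: "consts_ok R" "R 2 = u" and M: "bits M (14 * Q) (u + 1) X" "X \<subseteq> {..u}"
    and u: "u + 1 \<le> Q"
  shows "wp G OUTPUT (\<lambda>R' M' t'. outputs_set (R', M') X \<and> t' \<le> t + 5 + 6 * (u + 1)) R M t"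
proof -
  have QG: "40 * Q < G" "1 < G" using Q_G G1 by auto
  have r: "R 10 = S" "R 11 = B" "R 12 = Q" using c by (auto simp: consts_ok_def)
  let ?R = "R(0 := 0, 1 := 17 * Q)"
  define xs where "xs = (\<lambda>j. filter (\<lambda>i. i \<in> X) [0..<j])"
  have xs: "xs (Suc j) = xs j @ (if j \<in> X then [j] else [])" "length (xs j) \<le> j" for j
    using length_filter_le[of "\<lambda>i. i \<in> X" "[0..<j]"] by (auto simp: xs_def)
  have "wp G (For 22 (Rg 2 [+] Nm 1) (
      Cond (Nm 0) (Ld (area 14 [+] Rg 22)) (Sto (Rg 1 [+] Rg 0) (Rg 22) ;; Asg 0 (Rg 0 [+] Nm 1))
        (Asg 24 (Nm 0))))
    (\<lambda>R' M' t'. outputs_set (R', M') X \<and> t' \<le> t + 5 + 6 * (u + 1)) ?R M (t + 1 + 1)"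
  proof (rule wp_For[where n = "u + 1" and I = "\<lambda>j R' M' t'. R' 22 = j \<and> same {0, 22, 24} R' ?R \<and>
      R' 0 = length (xs j) \<and> (\<forall>i<length (xs j). M' (17 * Q + i) = xs j ! i) \<and>
      same {17 * Q..<18 * Q} M' M \<and> t' \<le> t + 3 + 5 * j"])
    show "0 < G" "u + 1 < G" using QG u by auto
    show "(?R(22 := 0)) 22 = 0 \<and> same {0, 22, 24} (?R(22 := 0)) ?R \<and> (?R(22 := 0)) 0 = length (xs 0) \<and>
      (\<forall>i<length (xs 0). M (17 * Q + i) = xs 0 ! i) \<and> same {17 * Q..<18 * Q} M M \<and> t + 1 + 1 + 1 \<le> t + 3 + 5 * 0"
      by (simp add: xs_def same_upd)
  next
    fix R' M' t'
    assume *: "R' 22 = u + 1 \<and> same {0, 22, 24} R' ?R \<and>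
      R' 0 = length (xs (u + 1)) \<and> (\<forall>i<length (xs (u + 1)). M' (17 * Q + i) = xs (u + 1) ! i) \<and>
      same {17 * Q..<18 * Q} M' M \<and> t' \<le> t + 3 + 5 * (u + 1)"
    then have "R' 1 = 17 * Q" by (simp add: same_def)
    moreover have "map M' [17 * Q..<17 * Q + length (xs (u + 1))] = xs (u + 1)"
      using * by (intro nth_equalityI) auto
    moreover have "set (xs (u + 1)) = X" "distinct (xs (u + 1))" using M(2) by (auto simp: xs_def)
    moreover have "R' 0 = length (xs (u + 1))" using * by blast
    ultimately have "outputs_set (R', M') X"
      unfolding outputs_set_def Let_def prod.case by (simp only: simp_thms)
    then show "outputs_set (R', M') X \<and> t' + 1 \<le> t + 5 + 6 * (u + 1)"
      using * by simp
  next
    fix j R' M' t'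
    assume I: "R' 22 = j \<and> same {0, 22, 24} R' ?R \<and>
      R' 0 = length (xs j) \<and> (\<forall>i<length (xs j). M' (17 * Q + i) = xs j ! i) \<and>
      same {17 * Q..<18 * Q} M' M \<and> t' \<le> t + 3 + 5 * j"
    then have s: "same {0, 22, 24} R' ?R" and sm: "same {17 * Q..<18 * Q} M' M" by blast+
    have r': "R' 12 = Q" "R' 2 = u" "R' 1 = 17 * Q" using r c by (simp_all add: same_eq[OF s])
    show "R' 22 = j \<and> ev (Rg 2 [+] Nm 1) R' M' = u + 1" using I r' by simp
    assume j: "j < u + 1"
    have mj: "M' (14 * Q + j) = of_bool (j \<in> X)"
      using M(1) j u by (simp add: same_eq[OF sm] bits_def)
    have len: "length (xs j) < Q" using xs(2)[of j] j u by linarith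
    show "wp G (Cond (Nm 0) (Ld (area 14 [+] Rg 22)) (Sto (Rg 1 [+] Rg 0) (Rg 22) ;; Asg 0 (Rg 0 [+] Nm 1))
        (Asg 24 (Nm 0)))
      (\<lambda>R' M' t'. R' 22 = j \<and> ((R'(22 := Suc j)) 22 = Suc j \<and> same {0, 22, 24} (R'(22 := Suc j)) ?R \<and>
        (R'(22 := Suc j)) 0 = length (xs (Suc j)) \<and> (\<forall>i<length (xs (Suc j)). M' (17 * Q + i) = xs (Suc j) ! i) \<and>
        same {17 * Q..<18 * Q} M' M \<and> t' + 1 \<le> t + 3 + 5 * Suc j)) R' M' (t' + 1)"
    proof (cases "j \<in> X")
      case True
      then show ?thesis
        using I QG j u len by (simp add: wp_simps r' mj xs(1) same_upd nth_append less_Suc_eq)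
    next
      case False
      then show ?thesis using I QG by (simp add: wp_simps r' mj xs(1) same_upd)
    qed
  qed
  then show ?thesis unfolding OUTPUT_def using QG by (simp add: wp_Sq wp_Asg r)
qed

end

definition LARGE_LOOP :: st where
  "LARGE_LOOP = Asg 6 (Rg 5) ;; Wh (Rg 6) (Rg 2 [+] Nm 1) LARGE_STEP"

context fixpoint_table
begin

text \<open>The key estimate for large values. A level of \<open>n\<close> blocks of width
  \<open>h\<close> has length at most about \<open>n * h * k * K = x * k * K\<close>, whatever
  \<open>h\<close> is, and \<open>x * k \<le> u\<close> together with \<open>K \<le> 4 * k\<close>
  turns this into \<open>4 * (u * k)\<close>. Lifting and slack obey the same estimate, summed over
  the blocks.\<close>

lemma level_bounds:
  assumes "x = n * h" "0 < h" "0 < n" "x \<le> u" "K = 2 * (u div x) + 2"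
  defines "k \<equiv> u div x"
  shows "total (level f K k y h n) \<le> 5 * (u * k)"
    "k * (h * K) + (k - 1) * K \<le> 8 * (u * k)"
    "cost (k * (h * K) + (k - 1) * K) (level f K k y h n) \<le> 13 * (u * k)"
proof -
  have x: "0 < x" using assms by simp
  have k: "1 \<le> k" using assms(4) x by (simp add: k_def One_nat_def Suc_le_eq div_greater_zero_iff)
  have xk: "x * k \<le> u" by (simp add: k_def)
  have K4: "K \<le> 4 * k" using k assms(5) unfolding k_def by linarith
  have xkK: "x * k * K \<le> u * (4 * k)" using mult_le_mono[OF xk K4] .
  have uk: "u * (4 * k) = 4 * (u * k)" by simp
  have h1: "k * (h - 1) + 1 \<le> k * h"
  proof -
    obtain h' where "h = Suc h'" using assms(2) by (cases h) auto
    then show ?thesis using k by (simp add: One_nat_def)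
  qed
  have nx: "n \<le> x" using assms(1,2) by simp
  have xu: "x \<le> u * k" using assms(4) k mult_le_mono[of x u 1 k] by simp
  have "n * ((k * (h - 1) + 1) * K) \<le> n * ((k * h) * K)" using h1 by (intro mult_le_mono mult_le_mono1) auto
  also have "\<dots> = x * k * K" by (simp add: assms(1) mult_ac)
  finally have "n * ((k * (h - 1) + 1) * K) \<le> 4 * (u * k)" using xkK uk by linarith
  then show tot: "total (level f K k y h n) \<le> 5 * (u * k)"
    using nx xu by (simp add: total_level)
  have kK: "(k - 1) * K \<le> k * (h * K)"
  proof -
    have "(k - 1) * K \<le> k * K" by (intro mult_le_mono1) simp
    also have "\<dots> \<le> k * (h * K)" using assms(2) by (intro mult_le_mono2) simp
    finally show ?thesis .
  qed
  have nw: "n * (k * (h * K)) = x * k * K" by (simp add: assms(1) mult_ac)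
  have "n * (k * (h * K) + (k - 1) * K) \<le> n * (2 * (k * (h * K)))" using kK by (intro mult_le_mono2) linarith
  also have "\<dots> = 2 * (x * k * K)" using nw by simp
  finally have c: "n * (k * (h * K) + (k - 1) * K) \<le> 8 * (u * k)" using xkK uk by linarith
  have "1 * (k * (h * K) + (k - 1) * K) \<le> n * (k * (h * K) + (k - 1) * K)"
    using assms(3) by (intro mult_le_mono1) (simp add: One_nat_def)
  then show "k * (h * K) + (k - 1) * K \<le> 8 * (u * k)" using le_trans[OF _ c] by (simp only: mult_1)
  show "cost (k * (h * K) + (k - 1) * K) (level f K k y h n) \<le> 13 * (u * k)"
    using tot c unfolding cost_def by (simp add: level_def[of f K k y h n, THEN arg_cong[where f = length]])
qed

text \<open>Linear bookkeeping for one interval of large values, with the products kept as opaque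
  variables \<open>V\<close> and \<open>W\<close>.\<close>

lemma step_budget:
  fixes t u :: nat
  assumes "t5 \<le> t4 + 2 + 3 * (u + 1)" "t4 \<le> t3 + 9 + c" "t3 \<le> t2 + 10 + 3 * u + 8 * l" "t2 \<le> t1 + 1 + b"
    "t1 \<le> t + 4 + 10 + a" "b \<le> 5202 * W" "a \<le> 50 * V" "c \<le> 800 * W" "l \<le> 5 * V" "u \<le> V"
  shows "t5 + 1 \<le> t + 100 + 10 * V + 50 * V + 5202 * W + 40 * V + 800 * W"
  using assms by (simp add: distrib_left)

text \<open>\<open>u * (u div x)\<close> is the integer form of \<open>u\<^sup>2 / x\<close>. One
  factor \<open>J + 1\<close> bounds the passes of the tree, the other the levels of a
  transform.\<close>

lemma LARGE_STEP_spec: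
  assumes c: "consts_ok R" "R 2 = u" "R 6 = x" and tab: "table_ok M"
    and x: "x = 2 ^ a" "x \<le> u"
    and f: "\<And>i. i < 2 * x \<Longrightarrow> M (13 * Q + i) = f i" "\<And>i. i < 2 * x \<Longrightarrow> f i < G"
    and acc: "bits M (14 * Q) (u + 1) (ssum f {1..<x})" and Nb68: "68 * u * u \<le> Nb" "68 * u * u * u < G"
  shows "wp G LARGE_STEP (\<lambda>R' M' t'. bits M' (14 * Q) (u + 1) (ssum f {1..<2 * x}) \<and> R' 6 = 2 * x \<and>
    same ({6} \<union> {13..<17} \<union> {21..<120}) R' R \<and> same ({3 * Q..<13 * Q} \<union> {14 * Q..<17 * Q}) M' M \<and>
    t' \<le> t + 7000 * (J + 1) * (J + 1) * (u * (u div x))) R M t"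
proof -
  define k where "k = u div x"
  define K where "K = 2 * k + 2"
  define e where "e = (k - 1) * K"
  have x0: "0 < x" using x by simp
  have k: "1 \<le> k" using x x0 by (simp add: k_def One_nat_def Suc_le_eq div_greater_zero_iff)
  have ku: "k \<le> u" by (simp add: k_def)
  have u1: "1 \<le> u" using x0 x(2) by linarith
  define V where "V = u * k"
  have uV: "u \<le> V" "k \<le> V" "1 \<le> V"
    using k u1 mult_le_mono[of u u 1 k] mult_le_mono[of 1 u k k] mult_le_mono[of 1 u 1 k] by (simp_all add: V_def)
  have VN: "68 * V \<le> Nb"
  proof -
    have "68 * u * k \<le> 68 * u * u" using ku by (rule mult_le_mono2)
    then show ?thesis unfolding V_def mult.assoc[symmetric] using Nb68(1) by (rule le_trans)
  qed
  have VuG: "10 * V * u < G"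
  proof -
    have "10 * V * u \<le> 68 * (u * u) * u"
      unfolding V_def using ku by (intro mult_le_mono) auto
    also have "\<dots> = 68 * u * u * u" by (simp only: mult.assoc)
    finally show ?thesis using Nb68(2) by (rule le_less_trans)
  qed
  have QG: "40 * Q < G" "1 < G" "68 * V \<le> Q" using Q_G G1 VN Nb_Q by auto
  have a_J: "a \<le> J"
  proof (rule J)
    have "u \<le> Nb" using uV VN by linarith
    then show "2 ^ a \<le> Nb" using x by simp
  qed
  have lb: "total (level g K k y h n) \<le> 5 * V \<and> k * (h * K) + e \<le> 8 * V \<and>
      cost (k * (h * K) + e) (level g K k y h n) \<le> 13 * V" if "x = n * h" "0 < h" "0 < n" for g y h n
    using level_bounds[OF that x(2) refl] unfolding K_def k_def V_def e_def by blast
  have KV: "K \<le> 4 * V" using k uV(2) unfolding K_def by linarith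
  have "k * K + e \<le> 8 * V" using lb[of x 1 f x] x0 by simp
  then have eG: "e \<le> 8 * V" by linarith
  have xK: "x * Suc K \<le> 5 * V" using lb[of x 1 f x] x0 by (simp add: total_level)
  have r: "R 10 = S" "R 11 = B" "R 12 = Q" using c by (auto simp: consts_ok_def)
  let ?R = "R(14 := k, 13 := K, 15 := 1, 16 := e)"
  have t4: "t + 1 + 1 + 1 + 1 = t + 4" by simp
  let ?copy = "For 22 (Rg 2 [+] Nm 1) (Sto (area 14 [+] Rg 22) (Ld (area 16 [+] Rg 22)))"
  let ?X = "offsets f K k x x" and ?l = "(k * (x - 1) + 1) * K"
  let ?E = "{i mod K * x + i div K | i. i \<in> ?X}"
  define Z where "Z = 7000 * (J + 1) * (J + 1) * V"
  let ?post = "\<lambda>R' M' t'. bits M' (14 * Q) (u + 1) (ssum f {1..<2 * x}) \<and> R' 6 = 2 * x \<and>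
    same ({6} \<union> {13..<17} \<union> {21..<120}) R' R \<and> same ({3 * Q..<13 * Q} \<union> {14 * Q..<17 * Q}) M' M \<and>
    t' \<le> t + Z"
  have leaves: "wp G LARGE_LEAVES (\<lambda>R' M' t'. blks M' (11 * Q) (level f K k x 1 x) \<and>
    R' 40 = x \<and> same ({21..<30} \<union> {40}) R' ?R \<and> same {11 * Q..<12 * Q} M' M \<and>
    t' \<le> t + 4 + 10 + x * (20 + 6 * K)) ?R M (t + 4)"
  proof (rule LARGE_LEAVES_spec)
    show "consts_ok ?R" using r by (simp add: consts_ok_def)
    show "x * Suc K \<le> Q" using xK QG by linarith
    show "2 * x \<le> Q" "k < G" using x uV QG by linarith+
    show "f i < G" if "i < 2 * x" for i using f(2)[OF that] .
    show "M (13 * Q + i) = f i" if "i < 2 * x" for i using f(1)[OF that] .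
  qed (use c x0 in \<open>simp_all add: K_def\<close>)
  have main: "wp G (LARGE_LEAVES ;; TREE ;; EXTRACT ;;
    Asg 13 (Nm 1) ;; Asg 14 (Nm 1) ;; Asg 15 (Nm 0) ;; Asg 16 (Nm 0) ;;
    Asg 61 (area 14) ;; Asg 62 (Rg 2 [+] Nm 1) ;; Asg 63 (area 15) ;; Asg 64 (Rg 2 [+] Nm 1) ;;
    Asg 65 (area 16) ;; COMBINE ;; ?copy ;; Asg 6 (Rg 6 [+] Rg 6)) ?post ?R M (t + 4)"
  proof (rule wp_SqI[OF leaves], elim conjE, goal_cases)
    case A: (1 R1 M1 t1)
    have r1: "R1 10 = S" "R1 11 = B" "R1 12 = Q" "R1 2 = u" "R1 6 = x" "R1 13 = K" "R1 14 = k" "R1 15 = 1" "R1 16 = e"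
      using r c by (simp_all add: same_eq[OF A(3)])
    have tab1: "table_ok M1" by (rule table_ok_same[OF tab A(4)]) auto
    define inv where "inv = (\<lambda>h bs. \<exists>j\<le>a. h = (2::nat) ^ j \<and> bs = level f K k x h (2 ^ (a - j)))"
    have inv_x: "2 ^ (a - j) * 2 ^ j = x" if "j \<le> a" for j
      using that unfolding x(1) by (simp flip: power_add)
    have tree: "wp G TREE (\<lambda>R' M' t'. \<exists>h b. inv h [b] \<and> blks M' (11 * Q) [b] \<and>
      same ({15} \<union> {40..<120}) R' R1 \<and> same {3 * Q..<13 * Q} M' M1 \<and>
      t' \<le> t1 + 1 + a * (2 + 400 * (J + 1) * (13 * V))) R1 M1 t1"
    proof (rule TREE_spec[where K = K and k = k and ?h0.0 = 1 and e = e and T = "8 * V" and ?bs0.0 = "level f K k x 1 x"])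
      show "consts_ok R1" using r1 by (simp add: consts_ok_def)
      show "inv 1 (level f K k x 1 x)" unfolding inv_def by (intro exI[of _ 0]) (simp add: x(1))
      show "inv (2 * h) (merge (join K k e h) bs)" if iv: "inv h bs" and len: "1 < length bs" for h bs
      proof -
        obtain j where j: "j \<le> a" "h = 2 ^ j" "bs = level f K k x h (2 ^ (a - j))" using iv unfolding inv_def by blast
        have "j < a"
        proof (rule ccontr)
          assume "\<not> j < a"
          then show False using len j by (simp add: level_def)
        qed
        then have "2 ^ (a - j) = 2 * (2::nat) ^ (a - Suc j)" by (simp add: Suc_diff_Suc flip: power_Suc)
        then have "merge (join K k e h) bs = level f K k x (2 * h) (2 ^ (a - Suc j))"
          unfolding j(3) e_def using merge_level[of k K h f x "2 ^ (a - Suc j)"] k j(2) by (simp add: K_def)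
        then show ?thesis unfolding inv_def using \<open>j < a\<close> j(2) by (intro exI[of _ "Suc j"]) simp
      qed
      show "total bs \<le> 8 * V \<and> k * (h * K) + e \<le> 8 * V \<and> (\<forall>b\<in>set bs. wf_block K k b) \<and>
          cost (k * (h * K) + e) bs \<le> 13 * V" if iv: "inv h bs" for h bs
      proof -
        obtain j where j: "j \<le> a" "h = 2 ^ j" "bs = level f K k x h (2 ^ (a - j))" using iv unfolding inv_def by blast
        have h0: "0 < h" "x = 2 ^ (a - j) * h" using inv_x[OF j(1)] j(2) by simp_all
        have "\<forall>b\<in>set bs. wf_block K k b" unfolding j(3) using h0(1) by (auto intro: wf_level simp: K_def)
        moreover have "total bs \<le> 5 * V \<and> k * (h * K) + e \<le> 8 * V \<and> cost (k * (h * K) + e) bs \<le> 13 * V"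
          unfolding j(3) by (rule lb[OF h0(2,1)]) simp
        ultimately show ?thesis by linarith
      qed
      show "4 * (8 * V) \<le> Nb" using VN by linarith
      show "level f K k x 1 x \<noteq> []" using x0 by (simp add: level_def)
      show "length (level f K k x 1 x) \<le> 2 ^ a" by (simp add: level_def x(1))
      show "R1 40 = length (level f K k x 1 x)" using A(2) by (simp add: level_def)
    qed (use A r1 tab1 k in \<open>simp_all add: K_def\<close>)
    show ?case
    proof (rule wp_SqI[OF tree], elim exE conjE, goal_cases)
      case B: (1 R2 M2 t2 h b)
      obtain j where j: "j \<le> a" "h = 2 ^ j" "[b] = level f K k x h (2 ^ (a - j))"
        using B(1) unfolding inv_def by blast
      have "length [b] = 2 ^ (a - j)" unfolding j(3) by (simp add: level_def)
      then have "(2::nat) ^ (a - j) = 1" by simp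
      then have "j = a" using j(1) by (simp add: One_nat_def)
      then have "[b] = level f K k x x 1" unfolding j(3) j(2) by (simp only: x(1)[symmetric] diff_self_eq_0 power_0)
      then have b: "b = (?l, ?X)" by (simp add: level_def One_nat_def)
      have r2: "R2 10 = S" "R2 11 = B" "R2 12 = Q" "R2 2 = u" "R2 6 = x" "R2 13 = K"
        using r1 by (simp_all add: same_eq[OF B(3)])
      have c2: "consts_ok R2" using r2 by (simp add: consts_ok_def)
      have M2: "M2 (11 * Q) = ?l" "bits M2 (11 * Q + 1) ?l ?X" using B(2) by (simp_all add: b)
      have Xl: "?X \<subseteq> {..<?l}" by (rule offsets_subset) (use x0 in \<open>simp_all add: K_def One_nat_def\<close>)
      have lV: "?l \<le> 5 * V"
      proof -
        have "total (level f K k x x 1) \<le> 5 * V" using lb[of 1 x f x] x0 by simp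
        then show ?thesis by (simp add: total_level)
      qed
      have lx: "?l * x + ?l < G"
      proof -
        have "?l * x + ?l = ?l * (x + 1)" by (simp only: distrib_left mult_1_right)
        also have "\<dots> \<le> 5 * V * (2 * u)" by (rule mult_le_mono[OF lV]) (use x(2) u1 in linarith)
        also have "\<dots> = 10 * V * u" by simp
        finally show ?thesis using VuG by linarith
      qed
      have ext: "wp G EXTRACT (\<lambda>R' M' t'. bits M' (15 * Q) (u + 1) ?E \<and>
          same {22..<25} R' R2 \<and> same {15 * Q..<16 * Q} M' M2 \<and> t' \<le> t2 + 10 + 3 * u + 8 * ?l) R2 M2 t2"
        by (rule EXTRACT_spec[OF c2 r2(4-6) M2 Xl _ _ lx]) (use uV QG lV in linarith)+
      show ?case
      proof (rule wp_SqI[OF ext], elim conjE, goal_cases)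
        case E: (1 R3 M3 t3)
        have r3: "R3 10 = S" "R3 11 = B" "R3 12 = Q" "R3 2 = u" "R3 6 = x"
          using r2 by (simp_all add: same_eq[OF E(2)])
        let ?R3 = "R3(13 := 1, 14 := 1, 15 := 0, 16 := 0, 61 := 14 * Q, 62 := u + 1, 63 := 15 * Q,
          64 := u + 1, 65 := 16 * Q)"
        have t9: "t3 + 1 + 1 + 1 + 1 + 1 + 1 + 1 + 1 + 1 = t3 + 9" by simp
        have acc3: "bits M3 (14 * Q) (u + 1) (ssum f {1..<x})"
        proof -
          have "bits M1 (14 * Q) (u + 1) (ssum f {1..<x})" by (rule bits_same[OF acc A(4)]) auto
          then have "bits M2 (14 * Q) (u + 1) (ssum f {1..<x})" by (rule bits_same[OF _ B(4)]) auto
          then show ?thesis by (rule bits_same[OF _ E(3)]) (use uV QG in auto)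
        qed
        let ?P = "ssum f {1..<x} \<inter> {..<u + 1}" and ?F = "?E \<inter> {..<u + 1}"
        have tab3: "table_ok M3"
          by (rule table_ok_same[OF table_ok_same[OF tab1 B(4)] E(3)]) auto
        have comb: "wp G COMBINE (\<lambda>R' M' t'. bits M' (16 * Q) (u + 1 + (u + 1) + 0) (sumset 1 1 0 ?P ?F) \<and>
            R' 66 = u + 1 + (u + 1) + 0 \<and> same ({60} \<union> {66..<120}) R' ?R3 \<and>
            same ({3 * Q..<11 * Q} \<union> {16 * Q..<16 * Q + (u + 1 + (u + 1) + 0)}) M' M3 \<and>
            t' \<le> t3 + 9 + 200 * (2 * (u + 1)) * (J + 1)) ?R3 M3 (t3 + 9)"
        proof (rule COMBINE_spec)
          show "consts_ok ?R3" using r3 by (simp add: consts_ok_def)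
          show "bits M3 (14 * Q) (u + 1) ?P" "bits M3 (15 * Q) (u + 1) ?F"
            using acc3 E(1) by (simp_all only: bits_Int)
          have "2 * (2 * (u + 1)) \<le> 2 * (2 * (2 * V))" by (intro mult_le_mono2) (use uV in linarith)
          also have "\<dots> \<le> Nb" using VN by linarith
          finally show "2 * (2 * (u + 1)) \<le> Nb" .
          show "16 * Q + (u + 1 + (u + 1) + 0) < G" using uV VN QG by linarith
        qed (use tab3 in \<open>simp_all\<close>)
        have "wp G (COMBINE ;; ?copy ;; Asg 6 (Rg 6 [+] Rg 6)) ?post ?R3 M3 (t3 + 9)"
        proof (rule wp_SqI[OF comb], elim conjE, goal_cases)
          case C: (1 R4 M4 t4)
          have r4: "R4 12 = Q" "R4 2 = u" "R4 6 = x" using r3 by (simp_all add: same_eq[OF C(3)])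
          have cp: "wp G ?copy (\<lambda>R' M' t'. (\<forall>j<u + 1. M' (14 * Q + j) = M4 (16 * Q + j)) \<and>
              same {14 * Q..<14 * Q + (u + 1)} M' M4 \<and> same {22} R' R4 \<and> t' \<le> t4 + 2 + 3 * (u + 1)) R4 M4 t4"
          proof (rule wp_copy)
            show "M4 (16 * Q + j) < G" if "j < u + 1" for j
              using C(1) that QG by (simp add: bits_def)
            show "ev (area 14) R' M' = 14 * Q \<and> ev (area 16) R' M' = 16 * Q \<and> ev (Rg 2 [+] Nm 1) R' M' = u + 1"
              if "same {22} R' R4" for R' M'
              using r4 by (simp add: same_eq[OF that])
          qed (use uV QG in auto)
          show ?case
          proof (rule wp_SqI[OF cp], elim conjE, goal_cases)
            case D: (1 R5 M5 t5)
            have r5: "R5 6 = x" using r4 by (simp add: same_eq[OF D(3)])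
            have EF: "?F = ssum f {x..<2 * x} \<inter> {..u}"
            proof -
              have "?F = ?E \<inter> {..u}" by auto
              then show ?thesis unfolding k_def
                using offsets_ssum[OF x0, of u K f] by (simp add: K_def k_def)
            qed
            have un: "{1..<2 * x} = {1..<x} \<union> {x..<2 * x}" using x0 by auto
            \<comment> \<open>A sum of at most \<open>u\<close> has both parts at most
              \<open>u\<close>, so cutting off the operands at \<open>u + 1\<close> loses
              nothing.\<close>
            have ss: "i \<in> sumset 1 1 0 ?P ?F \<longleftrightarrow> i \<in> ssum f {1..<2 * x}" if "i < u + 1" for i
            proof -
              have "i \<in> sumset 1 1 0 ?P ?F \<longleftrightarrow> (\<exists>p q. p \<in> ?P \<and> q \<in> ?F \<and> p + q = i)"
                by (auto simp: sumset_def lift_def)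
              also have "\<dots> \<longleftrightarrow> (\<exists>p q. p \<in> ssum f {1..<x} \<and> q \<in> ssum f {x..<2 * x} \<and> p + q = i)"
                unfolding EF using that by auto
              also have "\<dots> \<longleftrightarrow> i \<in> ssum f {1..<2 * x}"
                unfolding un by (subst ssum_Un) auto
              finally show ?thesis .
            qed
            have "bits M5 (14 * Q) (u + 1) (ssum f {1..<2 * x})"
              unfolding bits_def
            proof (intro allI impI)
              fix i assume i: "i < u + 1"
              then have "M5 (14 * Q + i) = of_bool (i \<in> sumset 1 1 0 ?P ?F)"
                using D(1) C(1) by (simp add: bits_def)
              then show "M5 (14 * Q + i) = of_bool (i \<in> ssum f {1..<2 * x})" using ss[OF i] by simp
            qed
            moreover have "same ({6} \<union> {13..<17} \<union> {21..<120}) (R5(6 := 2 * x)) R"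
              unfolding same_def
              by (auto simp: same_eq[OF D(3)] same_eq[OF C(3)] same_eq[OF E(2)] same_eq[OF B(3)] same_eq[OF A(3)])
            moreover have "same ({3 * Q..<13 * Q} \<union> {14 * Q..<17 * Q}) M5 M"
              unfolding same_def using uV QG
              by (auto simp: same_eq[OF D(2)] same_eq[OF C(4)] same_eq[OF E(3)] same_eq[OF B(4)] same_eq[OF A(4)])
            moreover have "t5 + 1 \<le> t + Z"
            proof -
              define W where "W = (J + 1) * (J + 1) * V"
              have W: "V \<le> W" "(J + 1) * V \<le> W" by (simp_all add: W_def)
              have "a * (2 + 400 * (J + 1) * (13 * V)) \<le> (J + 1) * (2 * ((J + 1) * V) + 5200 * ((J + 1) * V))"
              proof (rule mult_le_mono)
                show "a \<le> J + 1" using a_J by simp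
                have "1 * 1 \<le> (J + 1) * V" using uV(3) by (intro mult_le_mono) auto
                moreover have "400 * (J + 1) * (13 * V) = 5200 * ((J + 1) * V)" by (simp add: algebra_simps)
                ultimately show "2 + 400 * (J + 1) * (13 * V) \<le> 2 * ((J + 1) * V) + 5200 * ((J + 1) * V)" by presburger
              qed
              also have "\<dots> = 5202 * W" by (simp add: W_def algebra_simps)
              finally have T: "a * (2 + 400 * (J + 1) * (13 * V)) \<le> 5202 * W" .
              have L: "x * (20 + 6 * K) \<le> 50 * V"
              proof -
                have "x * (20 + 6 * K) = 14 * x + 6 * (x * Suc K)" by (simp add: algebra_simps)
                then show ?thesis using xK x uV by linarith
              qed
              have Cc: "200 * (2 * (u + 1)) * (J + 1) \<le> 800 * W"
              proof -
                have "200 * (2 * (u + 1)) * (J + 1) \<le> 200 * (2 * (2 * V)) * (J + 1)"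
                  using uV by (intro mult_le_mono1 mult_le_mono2) linarith
                also have "\<dots> = 800 * ((J + 1) * V)" by simp
                also have "\<dots> \<le> 800 * W" using W(2) by (rule mult_le_mono2)
                finally show ?thesis .
              qed
              have "t5 + 1 \<le> t + 100 + 10 * V + 50 * V + 5202 * W + 40 * V + 800 * W"
                by (rule step_budget[OF D(4) C(5) E(4) B(5) A(5) T L Cc lV uV(1)])
              also have "\<dots> \<le> t + 7000 * W" using W(1) uV(3) by linarith
              also have "\<dots> = t + Z" by (simp add: Z_def W_def mult_ac)
              finally show ?thesis .
            qed
            moreover have "2 * x < G" using x uV QG by linarith
            ultimately show ?case using r5 by (simp add: wp_Asg mult_2)
          qed
        qed
        then show ?case using r3 uV QG G1 by (simp add: wp_Sq wp_Asg t9)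
      qed
    qed
  qed
  then have main': "wp G (LARGE_LEAVES ;; TREE ;; EXTRACT ;;
    Asg 13 (Nm 1) ;; Asg 14 (Nm 1) ;; Asg 15 (Nm 0) ;; Asg 16 (Nm 0) ;;
    Asg 61 (area 14) ;; Asg 62 (Rg 2 [+] Nm 1) ;; Asg 63 (area 15) ;; Asg 64 (Rg 2 [+] Nm 1) ;;
    Asg 65 (area 16) ;; COMBINE ;; ?copy ;; Asg 6 (Rg 6 [+] Rg 6)) ?post ?R M (t + 1 + 1 + 1 + 1)"
    unfolding t4 .
  have G': "k < G" "K < G" "e < G" using uV QG KV eG by linarith+
  show ?thesis
    unfolding LARGE_STEP_def
  proof (rule wp_Asg_SqI, goal_cases)
    case 1 show ?case using c G' by (simp add: k_def)
  next
    case 2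
    have e1: "ev (Rg 2 [div] Rg 6) R M = k" using c by (simp add: k_def)
    show ?case unfolding e1
    proof (rule wp_Asg_SqI, goal_cases)
      case 1 show ?case using G' by (simp add: K_def)
    next
      case 2
      have e2: "ev (Nm 2 [*] Rg 14 [+] Nm 2) (R(14 := k)) M = K" by (simp add: K_def)
      show ?case unfolding e2
      proof (rule wp_Asg_SqI, goal_cases)
        case 1 show ?case using G1 by simp
      next
        case 2
        show ?case
        proof (rule wp_Asg_SqI, goal_cases)
          case 1 show ?case using G' by (simp add: e_def)
        next
          case 2
          have e3: "ev ((Rg 14 [-] Nm 1) [*] Rg 13) (R(14 := k, 13 := K, 15 := ev (Nm 1) (R(14 := k, 13 := K)) M)) M = e"
            by (simp add: e_def)
          show ?case unfolding e3 using main' by (simp only: ev.simps Z_def V_def k_def[symmetric])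
        qed
      qed
    qed
  qed
qed

text \<open>The geometric series as a potential: \<open>u div 2 ^ Suc a\<close> is at most half of
  \<open>u div 2 ^ a\<close>, so twice the current cost pays for the current interval and all later
  ones. The surplus of 7001 over 7000 pays for the loop test.\<close>

lemma LARGE_LOOP_spec:
  assumes c: "consts_ok R" "R 2 = u" "R 5 = 2 ^ a0" and tab: "table_ok M" and u1: "1 \<le> u"
    and f: "\<And>i. i < 2 * u + 2 \<Longrightarrow> M (13 * Q + i) = f i" "\<And>i. i < 2 * u + 2 \<Longrightarrow> f i < G"
      "\<And>i. u < i \<Longrightarrow> f i = 0"
    and acc: "bits M (14 * Q) (u + 1) (ssum f {1..<2 ^ a0})"
    and Nb68: "68 * u * u \<le> Nb" "68 * u * u * u < G" and r: "2 ^ a0 < G"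
  shows "wp G LARGE_LOOP (\<lambda>R' M' t'. bits M' (14 * Q) (u + 1) (ssum f {1..u}) \<and>
    same ({6} \<union> {13..<17} \<union> {21..<120}) R' R \<and> same ({3 * Q..<13 * Q} \<union> {14 * Q..<17 * Q}) M' M \<and>
    t' \<le> t + 2 + 7001 * (J + 1) * (J + 1) * (2 * (u * (u div 2 ^ a0)))) R M t"
proof -
  define D where "D = 7001 * (J + 1) * (J + 1)"
  define E where "E = D * (2 * (u * (u div 2 ^ a0)))"
  have uG: "u + 1 < G"
  proof -
    have "68 * u * 1 * 1 \<le> 68 * u * u * u" using u1 by (intro mult_le_mono) auto
    then show ?thesis using Nb68(2) u1 by linarith
  qed
  define inv where "inv = (\<lambda>R' M' t'. \<exists>a. R' 6 = 2 ^ a \<and> bits M' (14 * Q) (u + 1) (ssum f {1..<2 ^ a}) \<and>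
    same ({6} \<union> {13..<17} \<union> {21..<120}) R' R \<and> same ({3 * Q..<13 * Q} \<union> {14 * Q..<17 * Q}) M' M \<and>
    t' + D * (2 * (u * (u div 2 ^ a))) \<le> t + 1 + E)"
  show ?thesis
    unfolding LARGE_LOOP_def
  proof (rule wp_Asg_SqI, goal_cases)
    case 1 show ?case using c r by simp
  next
    case 2
    show ?case
    proof (rule wp_Wh[where I = inv and f = "\<lambda>R' M'. u + 1 - R' 6"])
      show "inv (R(6 := ev (Rg 5) R M)) M (t + 1)"
        unfolding inv_def using c acc by (intro exI[of _ a0]) (simp add: same_upd E_def)
    next
      fix R' M' t'
      assume I: "inv R' M' t'" and less: "ev (Rg 6) R' M' < ev (Rg 2 [+] Nm 1) R' M'"
      obtain a where a: "R' 6 = 2 ^ a" "bits M' (14 * Q) (u + 1) (ssum f {1..<2 ^ a})"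
        "same ({6} \<union> {13..<17} \<union> {21..<120}) R' R" "same ({3 * Q..<13 * Q} \<union> {14 * Q..<17 * Q}) M' M"
        "t' + D * (2 * (u * (u div 2 ^ a))) \<le> t + 1 + E" using I unfolding inv_def by blast
      have r': "R' 2 = u" "consts_ok R'" using c by (simp_all add: same_eq[OF a(3)] consts_ok_def)
      have xu: "2 ^ a \<le> u" using less a(1) r' by simp
      have uQ: "68 * u \<le> Q"
      proof -
        have "68 * u * 1 \<le> 68 * u * u" using u1 by (intro mult_le_mono2)
        then show ?thesis using Nb68(1) Nb_Q by linarith
      qed
      have m: "M' (13 * Q + i) = f i" if "i < 2 * 2 ^ a" for i
        using f(1)[of i] that xu uQ by (simp add: same_eq[OF a(4)])
      have tab': "table_ok M'" by (rule table_ok_same[OF tab a(4)]) auto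
      have step: "wp G LARGE_STEP (\<lambda>R'' M'' t''. bits M'' (14 * Q) (u + 1) (ssum f {1..<2 * 2 ^ a}) \<and>
          R'' 6 = 2 * 2 ^ a \<and> same ({6} \<union> {13..<17} \<union> {21..<120}) R'' R' \<and>
          same ({3 * Q..<13 * Q} \<union> {14 * Q..<17 * Q}) M'' M' \<and>
          t'' \<le> t' + 1 + 7000 * (J + 1) * (J + 1) * (u * (u div 2 ^ a))) R' M' (t' + 1)"
        by (rule LARGE_STEP_spec[OF r'(2,1) a(1) tab' refl xu m f(2) a(2) Nb68]) (use xu in auto)
      show "wp G LARGE_STEP (\<lambda>R'' M'' t''. inv R'' M'' t'' \<and> u + 1 - R'' 6 < u + 1 - R' 6) R' M' (t' + 1)"
      proof (rule wp_mono[OF step], elim conjE)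
        fix R'' M'' t''
        assume b: "bits M'' (14 * Q) (u + 1) (ssum f {1..<2 * 2 ^ a})" "R'' 6 = 2 * 2 ^ a"
          "same ({6} \<union> {13..<17} \<union> {21..<120}) R'' R'" "same ({3 * Q..<13 * Q} \<union> {14 * Q..<17 * Q}) M'' M'"
          "t'' \<le> t' + 1 + 7000 * (J + 1) * (J + 1) * (u * (u div 2 ^ a))"
        have "same ({6} \<union> {13..<17} \<union> {21..<120}) R'' R" by (rule same_trans[OF b(3) a(3)]) auto
        moreover have "same ({3 * Q..<13 * Q} \<union> {14 * Q..<17 * Q}) M'' M" by (rule same_trans[OF b(4) a(4)]) auto
        moreover have "t'' + D * (2 * (u * (u div 2 ^ Suc a))) \<le> t + 1 + E"
        proof -
          define P where "P = (J + 1) * (J + 1) * (u * (u div 2 ^ a))"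
          have "1 \<le> u div 2 ^ a" using xu by (simp add: One_nat_def Suc_le_eq div_greater_zero_iff)
          then have "1 * 1 * (1 * 1) \<le> P" unfolding P_def using u1 by (intro mult_le_mono) auto
          then have P: "1 \<le> P" by simp
          have "2 * (u div 2 ^ Suc a) \<le> u div 2 ^ a"
            by (simp only: power_Suc2 div_mult2_eq)
          then have "u * (2 * (u div 2 ^ Suc a)) \<le> u * (u div 2 ^ a)" by (rule mult_le_mono2)
          then have "D * (u * (2 * (u div 2 ^ Suc a))) \<le> D * (u * (u div 2 ^ a))" by (rule mult_le_mono2)
          moreover have "D * (u * (2 * (u div 2 ^ Suc a))) = D * (2 * (u * (u div 2 ^ Suc a)))" by simp
          moreover have "D * (u * (u div 2 ^ a)) = 7001 * P" by (simp add: D_def P_def mult_ac)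
          moreover have "D * (2 * (u * (u div 2 ^ a))) = 2 * (7001 * P)" by (simp add: D_def P_def mult_ac)
          moreover have "7000 * (J + 1) * (J + 1) * (u * (u div 2 ^ a)) = 7000 * P" by (simp add: P_def mult_ac)
          ultimately show ?thesis using a(5) b(5) P by linarith
        qed
        ultimately have "inv R'' M'' t''" unfolding inv_def using b(1,2) by (intro exI[of _ "Suc a"]) simp
        moreover have "u + 1 - R'' 6 < u + 1 - R' 6"
        proof -
          have "0 < (2::nat) ^ a" by simp
          then show ?thesis using a(1) b(2) xu by linarith
        qed
        ultimately show "inv R'' M'' t'' \<and> u + 1 - R'' 6 < u + 1 - R' 6" by blast
      qed
    next
      fix R' M' t'
      assume I: "inv R' M' t'" and ge: "\<not> ev (Rg 6) R' M' < ev (Rg 2 [+] Nm 1) R' M'"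
      obtain a where a: "R' 6 = 2 ^ a" "bits M' (14 * Q) (u + 1) (ssum f {1..<2 ^ a})"
        "same ({6} \<union> {13..<17} \<union> {21..<120}) R' R" "same ({3 * Q..<13 * Q} \<union> {14 * Q..<17 * Q}) M' M"
        "t' + D * (2 * (u * (u div 2 ^ a))) \<le> t + 1 + E" using I unfolding inv_def by blast
      have "R' 2 = u" using c by (simp add: same_eq[OF a(3)])
      then have xu: "u < 2 ^ a" using ge a(1) by simp
      have "ssum f {1..<2 ^ a} = ssum f {v \<in> {1..<2 ^ a}. 0 < f v}" by (rule ssum_support[symmetric]) simp
      also have "{v \<in> {1..<2 ^ a}. 0 < f v} = {v \<in> {1..u}. 0 < f v}" using xu f(3) by (auto intro: leI)
      also have "ssum f \<dots> = ssum f {1..u}" by (rule ssum_support) simp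
      finally have "bits M' (14 * Q) (u + 1) (ssum f {1..u})" using a(2) by simp
      moreover have "t' + 1 \<le> t + 2 + 7001 * (J + 1) * (J + 1) * (2 * (u * (u div 2 ^ a0)))"
        using a(5) by (simp add: E_def D_def)
      ultimately show "bits M' (14 * Q) (u + 1) (ssum f {1..u}) \<and>
          same ({6} \<union> {13..<17} \<union> {21..<120}) R' R \<and> same ({3 * Q..<13 * Q} \<union> {14 * Q..<17 * Q}) M' M \<and>
          t' + 1 \<le> t + 2 + 7001 * (J + 1) * (J + 1) * (2 * (u * (u div 2 ^ a0)))" using a by blast
    qed
  qed
qed

end

section \<open>Initialisation\<close>

text \<open>Register 0 keeps the given \<open>u\<close>, register 2 the smaller bound \<open>max 1 (min u \<sigma>)\<close>, register 3
  holds \<open>\<sigma>\<close>.  With \<open>z\<close> two more than register 2, the area length is \<open>z ^ 6\<close>, the fixed-point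
  scale \<open>z ^ 120\<close> and the offset \<open>z ^ 150\<close>.\<close>

definition SIZES :: st where
  "SIZES = Asg 3 (Nm 0) ;;
    For 20 (Rg 1) (Asg 3 (Rg 3 [+] Ld (Rg 20 [+] Rg 20) [*] Ld (Rg 20 [+] Rg 20 [+] Nm 1))) ;;
    Cond (Rg 3) (Rg 0) (Asg 2 (Rg 3)) (Asg 2 (Rg 0)) ;;
    Cond (Rg 2) (Nm 1) (Asg 2 (Nm 1)) (Asg 2 (Rg 2)) ;;
    Asg 7 (Rg 2 [+] Nm 2) ;; Asg 12 (Rg 7 [*] Rg 7 [*] Rg 7) ;; Asg 12 (Rg 12 [*] Rg 12) ;;
    Asg 18 (Rg 12 [*] Rg 12) ;; Asg 19 (Rg 18 [*] Rg 18 [*] Rg 12) ;; Asg 10 (Rg 19 [*] Rg 19) ;;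
    Asg 10 (Rg 10 [*] Rg 10) ;; Asg 11 (Rg 10 [*] Rg 19)"

definition BITLEN :: "nat \<Rightarrow> nat \<Rightarrow> nat \<Rightarrow> st" where
  "BITLEN d e n = Asg d (Nm 0) ;; Asg e (Nm 1) ;;
    Wh (Rg e) (Rg n [+] Nm 1) (Asg e (Rg e [+] Rg e) ;; Asg d (Rg d [+] Nm 1))"

definition COUNTS :: st where
  "COUNTS =
    For 20 (Rg 1) (Sto (area 13 [+] Ld (Rg 20 [+] Rg 20)) (Ld (Rg 20 [+] Rg 20 [+] Nm 1))) ;;
    For 20 (Rg 2) (
      Asg 22 (Rg 20 [+] Nm 1) ;;
      Asg 21 ((Ld (area 13 [+] Rg 22) [-] Nm 1) [div] Nm 2) ;;
      Sto (area 13 [+] Rg 22) (Ld (area 13 [+] Rg 22) [-] Nm 2 [*] Rg 21) ;;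
      Cond (Rg 2) (Nm 2 [*] Rg 22) (Asg 21 (Nm 0))
        (Sto (area 13 [+] Nm 2 [*] Rg 22) (Ld (area 13 [+] Nm 2 [*] Rg 22) [+] Rg 21))) ;;
    Asg 18 (Nm 0) ;;
    For 20 (Rg 2) (Asg 18 (Rg 18 [+] Ld (area 13 [+] (Rg 20 [+] Nm 1)) [*] (Rg 20 [+] Nm 1)))"

definition UNTIL :: "nat \<Rightarrow> st" where
  "UNTIL e = Wh (Rg 5 [*] Rg 5 [*] Rg e) (Rg 2 [*] Rg 2) (Asg 5 (Rg 5 [+] Rg 5))"

text \<open>The threshold is the least power of two \<open>r\<close> with \<open>u\<^sup>2 \<le> r\<^sup>2 * m\<close> and \<open>u\<^sup>2 \<le> r\<^sup>3\<close>, where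
  \<open>m\<close> bounds the number of values with nonzero multiplicity; it is raised above \<open>u\<close>
  whenever treating all values as small is cheaper.\<close>

definition CHOOSE :: st where
  "CHOOSE = BITLEN 4 19 2 ;; Asg 9 (Rg 1 [*] Rg 4 [+] Nm 1) ;; BITLEN 20 21 9 ;;
    Asg 5 (Nm 1) ;; UNTIL 9 ;; UNTIL 5 ;;
    Cond (Rg 18 [*] Rg 20) (Rg 2 [*] Rg 2 [div] Rg 5 [*] Rg 4 [+] Nm 1) (Asg 5 (Rg 19)) (Asg 5 (Rg 5))"

lemma wp_BITLEN:
  assumes "R n = N" "d \<noteq> e" "d \<noteq> n" "e \<noteq> n" and G: "2 * N + 2 \<le> G"
  shows "wp G (BITLEN d e n) (\<lambda>R' M' t'. M' = M \<and> same {d, e} R' R \<and> R' e = 2 ^ R' d \<and>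
    N < 2 ^ R' d \<and> 2 ^ R' d \<le> 2 * N + 1 \<and> t' \<le> t + 3 + 3 * R' d) R M t"
proof -
  let ?I = "\<lambda>R' M' t'. M' = M \<and> same {d, e} R' R \<and> R' e = 2 ^ R' d \<and> 2 ^ R' d \<le> 2 * N + 1 \<and>
    t' \<le> t + 2 + 3 * R' d"
  have G2: "1 < G" using G by linarith
  have "wp G (Wh (Rg e) (Rg n [+] Nm 1) (Asg e (Rg e [+] Rg e) ;; Asg d (Rg d [+] Nm 1)))
    (\<lambda>R' M' t'. M' = M \<and> same {d, e} R' R \<and> R' e = 2 ^ R' d \<and>
      N < 2 ^ R' d \<and> 2 ^ R' d \<le> 2 * N + 1 \<and> t' \<le> t + 3 + 3 * R' d) (R(d := 0, e := 1)) M (t + 2)"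
  proof (rule wp_Wh[where I = ?I and f = "\<lambda>R' M'. N + 1 - R' e"])
    show "?I (R(d := 0, e := 1)) M (t + 2)" using assms(2) by (simp add: same_def)
  next
    fix R' M' t' assume I: "?I R' M' t'" and less: "ev (Rg e) R' M' < ev (Rg n [+] Nm 1) R' M'"
    then have s: "same {d, e} R' R" by blast
    have "R' n = N" using assms by (simp add: same_eq[OF s])
    then have eN: "R' e \<le> N" using less by simp
    have dG: "R' d + 1 \<le> R' e + R' e"
    proof -
      have "R' d < 2 ^ R' d" by (rule less_exp)
      then show ?thesis using I by linarith
    qed
    have pw: "2 ^ (R' d + 1) = 2 ^ R' d + (2::nat) ^ R' d" by (simp only: power_add power_one_right mult_2_right)
    have "0 < R' e" using I by simp
    then have "N + 1 - (R' e + R' e) < N + 1 - R' e" using eN by linarith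
    moreover have "R' e + R' e < G" using eN G by linarith
    moreover have "R' d + 1 < G" using dG eN G by linarith
    ultimately show "wp G (Asg e (Rg e [+] Rg e) ;; Asg d (Rg d [+] Nm 1))
      (\<lambda>R'' M'' t''. ?I R'' M'' t'' \<and> N + 1 - R'' e < N + 1 - R' e) R' M' (t' + 1)"
      using I eN assms(2) by (simp add: wp_simps same_upd pw)
  next
    fix R' M' t' assume I: "?I R' M' t'" and less: "\<not> ev (Rg e) R' M' < ev (Rg n [+] Nm 1) R' M'"
    then have s: "same {d, e} R' R" by blast
    have "R' n = N" using assms by (simp add: same_eq[OF s])
    then show "M' = M \<and> same {d, e} R' R \<and> R' e = 2 ^ R' d \<and>
      N < 2 ^ R' d \<and> 2 ^ R' d \<le> 2 * N + 1 \<and> t' + 1 \<le> t + 3 + 3 * R' d" using I less by simp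
  qed
  moreover have t2: "t + 2 = t + 1 + 1" by simp
  ultimately show ?thesis unfolding BITLEN_def t2 using G2 by (simp add: wp_Sq wp_Asg)
qed

text \<open>\<open>P\<close> records what a doubling certifies: the inequality failed at
  \<open>r\<close>, so \<open>2 * r\<close> overshoots by a bounded factor only. The register
  \<open>e\<close> may be register 5 itself, hence its value is a function \<open>g\<close> of the
  current threshold.\<close>

lemma wp_UNTIL:
  assumes r: "R 5 = 2 ^ a" "R 2 = u" "e \<noteq> 2"
    and g: "\<And>R'. same {5} R' R \<Longrightarrow> R' e = g (R' 5)" "\<And>r. 0 < r \<Longrightarrow> 0 < g r"
    and G: "2 * u \<le> G" and a0: "a = 0 \<or> P (2 ^ a)"
    and P: "\<And>r. r * r * g r < u * u \<Longrightarrow> P (2 * r)"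
  shows "wp G (UNTIL e) (\<lambda>R' M' t'. M' = M \<and> same {5} R' R \<and>
    (\<exists>b\<ge>a. R' 5 = 2 ^ b \<and> u * u \<le> 2 ^ b * 2 ^ b * g (2 ^ b) \<and> (b = 0 \<or> P (2 ^ b)) \<and> t' \<le> t + 1 + 2 * b)) R M t"
  unfolding UNTIL_def
proof (rule wp_Wh[where I = "\<lambda>R' M' t'. M' = M \<and> same {5} R' R \<and> (\<exists>b\<ge>a. R' 5 = 2 ^ b \<and>
      (b = 0 \<or> P (2 ^ b)) \<and> t' \<le> t + 2 * b)" and f = "\<lambda>R' M'. u - R' 5"], goal_cases)
  case 1 show ?case using r a0 by auto
next
  case (2 R' M' t')
  then obtain b where b: "b \<ge> a" "R' 5 = 2 ^ b" "b = 0 \<or> P (2 ^ b)" "t' \<le> t + 2 * b" and s: "same {5} R' R"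
    and M: "M' = M" by blast
  have r': "R' 2 = u" "R' e = g (2 ^ b)" using r g(1)[OF s] by (simp_all add: same_eq[OF s] b(2))
  have lt: "2 ^ b * 2 ^ b * g (2 ^ b) < u * u" using 2(2) by (simp add: r' b(2))
  have "2 ^ b < u"
  proof (rule ccontr)
    assume "\<not> 2 ^ b < u"
    then have "u * u * 1 \<le> 2 ^ b * 2 ^ b * g (2 ^ b)"
      using g(2)[of "2 ^ b"] by (intro mult_le_mono) (auto simp: One_nat_def Suc_le_eq)
    then show False using lt by linarith
  qed
  moreover have "0 < (2::nat) ^ b" by simp
  ultimately have "2 ^ b + 2 ^ b < G" "u - 2 * 2 ^ b < u - 2 ^ b" using G by linarith+
  then show ?case using b s M P[OF lt] by (auto simp: wp_Asg same_upd mult_2[symmetric] intro!: exI[of _ "Suc b"])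
next
  case (3 R' M' t')
  then obtain b where b: "b \<ge> a" "R' 5 = 2 ^ b" "b = 0 \<or> P (2 ^ b)" "t' \<le> t + 2 * b" and s: "same {5} R' R"
    and M: "M' = M" by blast
  have r': "R' 2 = u" "R' e = g (2 ^ b)" using r g(1)[OF s] by (simp_all add: same_eq[OF s] b(2))
  show ?case using b s M 3(2) by (auto simp: r' intro!: exI[of _ b])
qed

text \<open>The last clause makes small values no more expensive than large ones, up to a constant.
  For \<open>r > 1\<close> it reflects minimality: one of the two inequalities failed at
  \<open>r / 2\<close>, and doubling then costs a factor 4 or 8.\<close>

definition threshold :: "nat \<Rightarrow> nat \<Rightarrow> nat \<Rightarrow> bool" where
  "threshold u m r \<longleftrightarrow> (\<exists>b. r = 2 ^ b) \<and> r \<le> 2 * u \<and> u * u \<le> r * r * m \<and> u * u \<le> r * r * r \<and>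
    r * r * min m r \<le> 8 * (u * u)"

text \<open>\<open>n * L + 1\<close> exceeds the number of values after carrying, and its bit length
  \<open>L'\<close> bounds the depth of the tree of small values. The alternative threshold
  \<open>2 ^ L\<close> lies above \<open>u\<close> and leaves no large values.\<close>

lemma CHOOSE_spec:
  assumes R: "R 1 = n" "R 2 = u" "R 18 = s" and u: "1 \<le> u" "n \<le> u"
    and G: "16 * u * u + 100 \<le> G" "2 * u + 2 \<le> G"
  shows "wp G CHOOSE (\<lambda>R' M' t'. M' = M \<and> same {4, 5, 9, 19, 20, 21} R' R \<and>
    (\<exists>L L' r. u < 2 ^ L \<and> 2 ^ L \<le> 2 * u + 1 \<and> n * L + 1 < 2 ^ L' \<and> 2 ^ L' \<le> 2 * (n * L + 1) + 1 \<and>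
      threshold u (n * L + 1) r \<and> R' 5 = (if s * L' \<le> u * u div r * L then 2 ^ L else r) \<and>
      t' \<le> t + 100 + 30 * u + 3 * L')) R M t"
  unfolding CHOOSE_def
proof (rule wp_SqI[OF wp_BITLEN[where N = u]], goal_cases)
  case (6 R1 M1 t1)
  define L where "L = R1 4"
  have uu: "u \<le> u * u" by simp
  have A: "M1 = M" "same {4, 19} R1 R" "R1 19 = 2 ^ L" "u < 2 ^ L" "2 ^ L \<le> 2 * u + 1" "t1 \<le> t + 3 + 3 * L"
    using 6 unfolding L_def R by blast+
  have r1: "R1 1 = n" "R1 2 = u" "R1 18 = s" "R1 4 = L" using R by (simp_all add: same_eq[OF A(2)] L_def)
  have Lu: "L \<le> 2 * u" using A(5) less_exp[of L] by linarith
  let ?m = "n * L + 1"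
  have m: "?m \<le> 2 * (u * u) + 1"
    using mult_le_mono[OF u(2) Lu] by simp
  have mG: "2 * ?m + 2 \<le> G" using m G by simp
  have e: "ev (Rg 1 [*] Rg 4 [+] Nm 1) R1 M1 = ?m" using r1 by simp
  show ?case
  proof (rule wp_Asg_SqI, goal_cases)
    case 1 show ?case unfolding e using mG by (simp add: distrib_left)
  next
    case 2
    show ?case unfolding e
    proof (rule wp_SqI[OF wp_BITLEN[where N = ?m]], goal_cases)
      case (6 R2 M2 t2)
      define L' where "L' = R2 20"
      have B: "M2 = M" "same {20, 21} R2 (R1(9 := ?m))" "?m < 2 ^ L'" "2 ^ L' \<le> 2 * ?m + 1"
        "t2 \<le> t1 + 1 + 3 + 3 * L'"
        using 6 A(1) unfolding L'_def by blast+
      have r2: "R2 1 = n" "R2 2 = u" "R2 18 = s" "R2 4 = L" "R2 9 = ?m" "R2 20 = L'" "R2 19 = 2 ^ L"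
        using r1 A(3) by (simp_all add: same_eq[OF B(2)] L'_def)
      define P where "P = (\<lambda>r. r \<le> 2 * u \<and> r * r * min ?m r \<le> 8 * (u * u))"
      have P1: "P (2 * r)" if "r * r * ?m < u * u" for r
      proof -
        have "r * r * 1 \<le> r * r * ?m" by (intro mult_le_mono2) simp
        then have "r * r < u * u" using that by linarith
        then have "r < u" using mult_le_mono[of u r u r] by linarith
        moreover have "2 * r * (2 * r) * min ?m (2 * r) \<le> 2 * r * (2 * r) * ?m" by (intro mult_le_mono2) simp
        moreover have "2 * r * (2 * r) * ?m = 4 * (r * r * ?m)" by simp
        ultimately show ?thesis using that unfolding P_def by linarith
      qed
      have P2: "P (2 * r)" if lt: "r * r * r < u * u" for r
      proof -
        have "r * r * 1 \<le> r * r * r" by (cases "r = 0") (auto intro!: mult_le_mono2 simp: One_nat_def)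
        then have "r * r < u * u" using lt by linarith
        then have "r < u" using mult_le_mono[of u r u r] by linarith
        moreover have "2 * r * (2 * r) * min ?m (2 * r) \<le> 2 * r * (2 * r) * (2 * r)" by (intro mult_le_mono2) simp
        moreover have "2 * r * (2 * r) * (2 * r) = 8 * (r * r * r)" by simp
        ultimately show ?thesis using lt unfolding P_def by linarith
      qed
      have u2G: "2 * u \<le> G" using uu G by linarith
      show ?case
      proof (rule wp_Asg_SqI, goal_cases)
        case 1 show ?case using G by simp
      next
        case 2
        show ?case
        proof (rule wp_SqI[OF wp_UNTIL[where a = 0 and g = "\<lambda>r. ?m" and u = u and P = P]], goal_cases)
          case (4 R') then show ?case using r2 by (simp add: same_eq[OF 4])
        next
          case (9 R3 M3 t3)
          then obtain b where C: "M3 = M2" "same {5} R3 (R2(5 := ev (Nm 1) R2 M2))" "R3 5 = 2 ^ b"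
            "u * u \<le> 2 ^ b * 2 ^ b * ?m" "b = 0 \<or> P (2 ^ b)" "t3 \<le> t2 + 1 + 1 + 2 * b" by blast
          have r3: "R3 2 = u" "R3 18 = s" "R3 4 = L" "R3 20 = L'" "R3 19 = 2 ^ L"
            using r2 by (simp_all add: same_eq[OF C(2)])
          show ?case
          proof (rule wp_SqI[OF wp_UNTIL[where a = b and g = "\<lambda>r. r" and u = u and P = P]], goal_cases)
            case (9 R4 M4 t4)
            then obtain b' where D: "M4 = M3" "same {5} R4 R3" "b \<le> b'" "R4 5 = 2 ^ b'"
              "u * u \<le> 2 ^ b' * 2 ^ b' * 2 ^ b'" "b' = 0 \<or> P (2 ^ b')" "t4 \<le> t3 + 1 + 2 * b'" by blast
            define r where "r = (2::nat) ^ b'"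
            have r4: "R4 2 = u" "R4 18 = s" "R4 4 = L" "R4 20 = L'" "R4 19 = 2 ^ L" "R4 5 = r"
              using r3 D(4) by (simp_all add: same_eq[OF D(2)] r_def)
            have Pr: "P r"
            proof (cases "b' = 0")
              case True
              then have "r = 1" by (simp add: r_def)
              moreover have "1 * 1 \<le> u * u" using u by (intro mult_le_mono)
              then have "1 \<le> 8 * (u * u)" by linarith
              ultimately show ?thesis using u unfolding P_def by simp
            qed (use D(6) r_def in blast)
            have "2 ^ b \<le> r" unfolding r_def using D(3) by (rule power_increasing) simp
            \<comment> \<open>The inequality reached at \<open>2 ^ b\<close> survives the further
              doublings made for the cubic one.\<close>
            then have "2 ^ b * 2 ^ b * ?m \<le> r * r * ?m" by (intro mult_le_mono) auto
            then have "u * u \<le> r * r * ?m" using C(4) by (rule le_trans[rotated])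
            then have thr: "threshold u ?m r"
              unfolding threshold_def using D(5) Pr by (auto simp: P_def r_def)
            have b': "b' \<le> 2 * u" "b \<le> b'" using Pr less_exp[of b'] D(3) unfolding P_def r_def by linarith+
            have T: "t4 + 1 + 1 \<le> t + 100 + 30 * u + 3 * L'"
              using A(6) B(5) C(6) D(7) b' Lu by linarith
            have LG: "2 ^ L < G" "r < G" using A(5) Pr uu G unfolding P_def by linarith+
            have sm: "same {4, 5, 9, 19, 20, 21} (R4(5 := x)) R" for x
              unfolding same_def by (auto simp: same_eq[OF D(2)] same_eq[OF C(2)] same_eq[OF B(2)] same_eq[OF A(2)])
            have M: "M4 = M" using D(1) C(1) B(1) by simp
            show ?case
            proof (cases "s * L' \<le> u * u div r * L")
              case True
              then have "wp G (Cond (Rg 18 [*] Rg 20) (Rg 2 [*] Rg 2 [div] Rg 5 [*] Rg 4 [+] Nm 1) (Asg 5 (Rg 19)) (Asg 5 (Rg 5)))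
                (\<lambda>R' M' t'. R' = R4(5 := 2 ^ L) \<and> M' = M \<and> t' = t4 + 1 + 1) R4 M4 t4"
                using LG M by (simp add: wp_simps r4)
              then show ?thesis
              proof (rule wp_mono, goal_cases)
                case (1 R' M' t')
                then have e: "R' = R4(5 := 2 ^ L)" "M' = M" "t' = t4 + 1 + 1" by blast+
                show ?case
                  unfolding e
                  by (intro conjI refl sm, rule exI[of _ L], rule exI[of _ L'], rule exI[of _ r])
                    (use True T thr A(4,5) B(3,4) in simp)
              qed
            next
              case False
              then have "wp G (Cond (Rg 18 [*] Rg 20) (Rg 2 [*] Rg 2 [div] Rg 5 [*] Rg 4 [+] Nm 1) (Asg 5 (Rg 19)) (Asg 5 (Rg 5)))
                (\<lambda>R' M' t'. R' = R4(5 := r) \<and> M' = M \<and> t' = t4 + 1 + 1) R4 M4 t4"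
                using LG M by (simp add: wp_simps r4)
              then show ?thesis
              proof (rule wp_mono, goal_cases)
                case (1 R' M' t')
                then have e: "R' = R4(5 := r)" "M' = M" "t' = t4 + 1 + 1" by blast+
                show ?case
                  unfolding e
                  by (intro conjI refl sm, rule exI[of _ L], rule exI[of _ L'], rule exI[of _ r])
                    (use False T thr A(4,5) B(3,4) in simp)
              qed
            qed
          qed (use C r3 u2G P2 in \<open>auto\<close>)
        qed (use r2 u2G P1 in \<open>auto\<close>)
      qed
    qed (use mG in auto)
  qed
qed (use R G in \<open>auto\<close>)

lemma represents_sum:
  assumes "represents ps S"
  shows "(\<Sum>i<length ps. fst (ps ! i) * snd (ps ! i)) = sum_mset S" "length ps = card (set_mset S)"
    "\<And>i. i < length ps \<Longrightarrow> fst (ps ! i) \<in># S \<and> snd (ps ! i) = count S (fst (ps ! i))"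
    "\<And>x. x \<in># S \<Longrightarrow> \<exists>i<length ps. fst (ps ! i) = x"
proof -
  have d: "distinct ps" and s: "set ps = (\<lambda>x. (x, count S x)) ` set_mset S"
    using assms unfolding represents_def by auto
  have inj: "inj_on (\<lambda>x. (x, count S x)) (set_mset S)" by (auto intro: inj_onI)
  have "(\<Sum>i<length ps. fst (ps ! i) * snd (ps ! i)) = sum_list (map (\<lambda>p. fst p * snd p) ps)"
    by (simp add: sum_list_sum_nth atLeast0LessThan)
  also have "\<dots> = (\<Sum>p\<in>set ps. fst p * snd p)" using d by (simp add: sum_list_distinct_conv_sum_set)
  also have "\<dots> = (\<Sum>x\<in>set_mset S. x * count S x)" unfolding s using inj by (simp add: sum.reindex)
  also have "\<dots> = sum_mset S" by (simp add: sum_mset_eq_sum_count[of "set_mset S" S] mult.commute)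
  finally show "(\<Sum>i<length ps. fst (ps ! i) * snd (ps ! i)) = sum_mset S" .
  have "card (set ps) = card (set_mset S)" unfolding s using inj by (rule card_image)
  then show "length ps = card (set_mset S)" using d by (simp add: distinct_card)
  show "fst (ps ! i) \<in># S \<and> snd (ps ! i) = count S (fst (ps ! i))" if "i < length ps" for i
    using nth_mem[OF that] unfolding s by auto
  show "\<exists>i<length ps. fst (ps ! i) = x" if "x \<in># S" for x
  proof -
    have "(x, count S x) \<in> set ps" unfolding s using that by blast
    then show ?thesis by (metis fst_conv in_set_conv_nth)
  qed
qed

lemma SIZES_spec:
  assumes R: "R 0 = u" "R 1 = n" and sum: "(\<Sum>i<n. M (2 * i) * M (2 * i + 1)) = s"
    and G: "(max 1 (min u s) + 2) ^ 150 < G" "u < G" "s < G" "n < G"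
  defines "z \<equiv> max 1 (min u s) + 2"
  shows "wp G SIZES (\<lambda>R' M' t'. M' = M \<and> same {2, 3, 7, 10, 11, 12, 18, 19, 20} R' R \<and>
    R' 2 = max 1 (min u s) \<and> R' 3 = s \<and> R' 12 = z ^ 6 \<and> R' 10 = z ^ 120 \<and> R' 11 = z ^ 150 \<and>
    t' \<le> t + 20 + 3 * n) R M t"
proof -
  have zpos: "1 \<le> z" by (simp add: z_def)
  have pw: "z ^ k < G" if "k \<le> 150" for k
    using power_increasing[OF that zpos] G(1) unfolding z_def by linarith
  have eqs: "z * z * z = z ^ 3" by (simp add: power3_eq_cube)
  have eqs': "z ^ 3 * z ^ 3 = z ^ 6" "z ^ 6 * z ^ 6 = z ^ 12"
    "z ^ 12 * z ^ 12 * z ^ 6 = z ^ 30" "z ^ 30 * z ^ 30 = z ^ 60" "z ^ 60 * z ^ 60 = z ^ 120"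
    "z ^ 120 * z ^ 30 = z ^ 150"
    by (simp_all flip: power_add)
  have loop: "wp G (For 20 (Rg 1) (Asg 3 (Rg 3 [+] Ld (Rg 20 [+] Rg 20) [*] Ld (Rg 20 [+] Rg 20 [+] Nm 1))))
    (\<lambda>R' M' t'. M' = M \<and> same {3, 20} R' R \<and> R' 3 = s \<and> t' \<le> t + 1 + 2 + 3 * n) (R(3 := 0)) M (t + 1)"
  proof (rule wp_For[where n = n and I = "\<lambda>j R' M' t'. M' = M \<and> same {3, 20} R' R \<and> R' 20 = j \<and>
      R' 3 = (\<Sum>i<j. M (2 * i) * M (2 * i + 1)) \<and> t' \<le> t + 1 + 1 + 3 * j"], goal_cases)
    case (4 j R' M' t')
    then have s: "same {3, 20} R' R" by blast
    show ?case using 4 R by (simp add: same_eq[OF s])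
  next
    case (5 j R' M' t')
    have "(\<Sum>i<Suc j. M (2 * i) * M (2 * i + 1)) \<le> (\<Sum>i<n. M (2 * i) * M (2 * i + 1))"
      by (rule sum_mono2) (use 5 in auto)
    then have "(\<Sum>i<Suc j. M (2 * i) * M (2 * i + 1)) < G" using sum G by linarith
    moreover have jj: "j + j = 2 * j" by simp
    ultimately show ?case using 5 by (simp add: wp_simps same_upd jj)
  qed (use G sum in \<open>auto simp: same_def\<close>)
  show ?thesis
    unfolding SIZES_def
  proof (rule wp_Asg_SqI, goal_cases)
    case 1 show ?case using G by simp
  next
    case 2
    have e0: "ev (Nm 0) R M = 0" by simp
    show ?case unfolding e0
    proof (rule wp_SqI[OF loop], elim conjE, goal_cases)
      case A: (1 R1 M1 t1)
      have r: "R1 0 = u" "R1 3 = s" using R A(3) by (simp_all add: same_eq[OF A(2)])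
      define w where "w = max 1 (min u s)"
      have w: "(if s < u then s else u) < G" "w < G" "1 < G" using G pw[of 1] pw[of 0] by (auto simp: w_def z_def)
      have zw: "Suc (Suc w) = z" "w + 2 = z" by (simp_all add: z_def w_def)
      have wdef: "(if (if s < u then s else u) < 1 then 1 else (if s < u then s else u)) = w" by (auto simp: w_def)
      have wp1: "wp G (Cond (Rg 3) (Rg 0) (Asg 2 (Rg 3)) (Asg 2 (Rg 0))) (\<lambda>R' M' t'. R' = R1(2 := if s < u then s else u) \<and> M' = M \<and> t' = t1 + 2) R1 M1 t1"
        using A(1) G by (simp add: wp_simps r)
      show ?case
      proof (rule wp_SqI[OF wp1], elim conjE, goal_cases)
        case B: (1 R2 M2 t2)
        have wp2: "wp G (Cond (Rg 2) (Nm 1) (Asg 2 (Nm 1)) (Asg 2 (Rg 2))) (\<lambda>R' M' t'. R' = R1(2 := w) \<and> M' = M \<and> t' = t1 + 4) R2 M2 t2"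
          using B w wdef by (auto simp: wp_simps)
        show ?case
        proof (rule wp_SqI[OF wp2], elim conjE, goal_cases)
          case C: (1 R3 M3 t3)
          have sm: "same {2, 3, 7, 10, 11, 12, 18, 19, 20} R1 R" by (rule same_mono[OF A(2)]) auto
          show ?case unfolding C using pw[of 1] pw[of 3] pw[of 6] pw[of 12] pw[of 30] pw[of 60] pw[of 120] pw[of 150] A(4) r sm
            by (simp add: wp_simps zw eqs eqs' same_upd w_def[symmetric])
        qed
      qed
    qed
  qed
qed

context fixpoint_table
begin

text \<open>The table is specified on \<open>2 * u + 2\<close> cells because the intervals
  \<open>{x..<2 * x}\<close> with \<open>x \<le> u\<close> reach beyond \<open>u\<close>; there all
  multiplicities are 0.\<close>

lemma COUNTS_spec:
  assumes R: "R 1 = n" "R 2 = u" "R 12 = Q" and u: "2 * n \<le> Q" "2 * u + 2 \<le> Q"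
    and inp: "\<And>i. i < n \<Longrightarrow> M (2 * i) = x i \<and> M (2 * i + 1) = f (x i) \<and> x i \<le> u"
    and supp: "\<And>v. 0 < f v \<Longrightarrow> \<exists>i<n. x i = v" and f0: "f 0 = 0"
    and zero: "\<And>v. v < 2 * u + 2 \<Longrightarrow> M (13 * Q + v) = 0"
    and s: "(\<Sum>v\<in>{1..u}. f v * v) = s" "s < G"
  defines "h \<equiv> carried u (Suc u) f"
  shows "wp G COUNTS (\<lambda>R' M' t'. (\<forall>v<2 * u + 2. M' (13 * Q + v) = h v) \<and>
    same {13 * Q..<14 * Q} M' M \<and> same {18, 20, 21, 22} R' R \<and>
    R' 18 = (\<Sum>v\<in>{1..u}. h v * v) \<and> t' \<le> t + 20 + 12 * (n + u)) R M t"
proof -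
  have QG: "40 * Q < G" "1 < G" using Q_G G1 by auto
  have nu: "n < G" "u < G" using u QG by linarith+
  \<comment> \<open>A single multiplicity is at most the weighted total, which carrying never
    increases, so all intermediate counts fit into a word.\<close>
  have bound: "carried u m f v < G" if "1 \<le> m" "m \<le> Suc u" "1 \<le> v" "v \<le> u" for m v
  proof -
    have "carried u m f v * 1 \<le> carried u m f v * v" using that(3) by (rule mult_le_mono2)
    also have "\<dots> \<le> (\<Sum>x\<in>{1..u}. carried u m f x * x)"
      by (rule member_le_sum) (use that in auto)
    also have "\<dots> \<le> s" using carried_sum_le[OF that(1,2), of f] s(1) by simp
    finally show ?thesis using s(2) by simp
  qed
  have fb: "f v < G" if "v \<le> u" for v
    using bound[of 1 v, unfolded carried_1] that f0 QG by (cases "v = 0") (auto simp: One_nat_def)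
  have fill: "wp G (For 20 (Rg 1) (Sto (area 13 [+] Ld (Rg 20 [+] Rg 20)) (Ld (Rg 20 [+] Rg 20 [+] Nm 1))))
    (\<lambda>R' M' t'. (\<forall>v<2 * u + 2. M' (13 * Q + v) = f v) \<and> same {13 * Q..<14 * Q} M' M \<and>
      same {20} R' R \<and> t' \<le> t + 2 + 3 * n) R M t"
  proof (rule wp_For[where n = n and I = "\<lambda>j R' M' t'. (\<forall>v<2 * u + 2. M' (13 * Q + v) =
      (if \<exists>i<j. x i = v then f v else 0)) \<and> same {13 * Q..<14 * Q} M' M \<and>
      same {20} R' R \<and> R' 20 = j \<and> t' \<le> t + 1 + 3 * j"], goal_cases)
    case (4 j R' M' t')
    then have s: "same {20} R' R" by blast
    show ?case using 4 R by (simp add: same_eq[OF s])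
  next
    case (5 j R' M' t')
    then have s: "same {20} R' R" and sm: "same {13 * Q..<14 * Q} M' M" by blast+
    have m: "M' (2 * j) = x j" "M' (2 * j + 1) = f (x j)" "x j \<le> u"
      using inp[OF 5(2)] 5(2) u by (simp_all add: same_eq[OF sm])
    have j2: "j + j = 2 * j" "R' 12 = Q" "R' 20 = j" using R 5 by (simp_all add: same_eq[OF s])
    have xG: "13 * Q + x j < G" using m u QG by linarith
    have upd: "\<forall>v<2 * u + 2. (M'(13 * Q + x j := f (x j))) (13 * Q + v) = (if \<exists>i<Suc j. x i = v then f v else 0)"
      using 5(1) by (auto simp: less_Suc_eq)
    have "same {13 * Q..<14 * Q} (M'(13 * Q + x j := f (x j))) M" using sm m u by (simp add: same_upd)
    then show ?case using 5 upd xG fb[OF m(3)] by (simp add: wp_simps same_upd j2 m)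
  next
    case (6 R' M' t')
    have "(if \<exists>i<n. x i = v then f v else 0) = f v" for v using supp[of v] by auto
    then show ?case using 6 by auto
  qed (use nu zero in \<open>auto simp: same_def\<close>)
  let ?body = "Asg 22 (Rg 20 [+] Nm 1) ;;
      Asg 21 ((Ld (area 13 [+] Rg 22) [-] Nm 1) [div] Nm 2) ;;
      Sto (area 13 [+] Rg 22) (Ld (area 13 [+] Rg 22) [-] Nm 2 [*] Rg 21) ;;
      Cond (Rg 2) (Nm 2 [*] Rg 22) (Asg 21 (Nm 0))
        (Sto (area 13 [+] Nm 2 [*] Rg 22) (Ld (area 13 [+] Nm 2 [*] Rg 22) [+] Rg 21))"
  have car: "wp G (For 20 (Rg 2) ?body)
    (\<lambda>R' M' t'. (\<forall>v<2 * u + 2. M' (13 * Q + v) = h v) \<and> same {13 * Q..<14 * Q} M' M \<and>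
      same {20, 21, 22} R' R \<and> t' \<le> t1 + 2 + 7 * u) R1 M1 t1"
    if a1: "\<forall>v<2 * u + 2. M1 (13 * Q + v) = f v" and a2: "same {13 * Q..<14 * Q} M1 M" and a3: "same {20} R1 R"
    for R1 M1 t1
  proof (rule wp_For[where n = u and I = "\<lambda>j R' M' t'. (\<forall>v<2 * u + 2. M' (13 * Q + v) =
      carried u (Suc j) f v) \<and> same {13 * Q..<14 * Q} M' M \<and>
      same {20, 21, 22} R' R \<and> R' 20 = j \<and> t' \<le> t1 + 1 + 7 * j"], goal_cases)
    case 3
    have "same {20, 21, 22} R1 R" by (rule same_mono[OF a3]) auto
    then show ?case using a1 a2 by (simp add: same_upd carried_1[unfolded One_nat_def])
  next
    case (4 j R' M' t')
    then have s: "same {20, 21, 22} R' R" by blast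
    show ?case using 4 R by (simp add: same_eq[OF s])
  next
    case (5 j R' M' t')
    define v where "v = Suc j"
    define g where "g = carried u v f"
    define q where "q = (g v - 1) div 2"
    have s: "same {20, 21, 22} R' R" and sm: "same {13 * Q..<14 * Q} M' M"
      and m: "\<And>v. v < 2 * u + 2 \<Longrightarrow> M' (13 * Q + v) = g v" using 5(1) by (auto simp: g_def v_def)
    have v: "1 \<le> v" "v \<le> u" "v < 2 * u + 2" using 5(2) by (auto simp: v_def One_nat_def)
    have r: "R' 2 = u" "R' 12 = Q" "R' 20 = j" using R 5 by (simp_all add: same_eq[OF s])
    have nxt: "carried u (Suc v) f = carry u v g" using v by (simp add: carried_Suc g_def)
    have gv: "g v < G" unfolding g_def by (rule bound) (use v in auto)
    have qg: "q < G" "g v - 2 * q < G" using gv by (auto simp: q_def)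
    have vG: "v < G" "13 * Q + v < G" "13 * Q + 2 * v < G" using v u QG by linarith+
    have ev2: "j + 1 = v" by (simp add: v_def)
    have sm1: "same {13 * Q..<14 * Q} (M'(13 * Q + v := y)) M" for y using sm v u by (simp add: same_upd)
    have sm2: "same {13 * Q..<14 * Q} (M'(13 * Q + v := y, 13 * Q + 2 * v := y')) M" for y y'
      using sm v u by (simp add: same_upd)
    have tt: "t' + 1 + 1 + 1 + 1 + 1 + 1 \<le> t1 + 7 * v" using 5(1) unfolding v_def by simp
    have mv: "M' (13 * Q + v) = g v" using m v by simp
    show ?case
    proof (cases "u < 2 * v")
      case True
      have "\<forall>w<2 * u + 2. (M'(13 * Q + v := g v - 2 * q)) (13 * Q + w) = carried u (Suc v) f w"
        unfolding nxt using True m by (auto simp: carry_def Let_def q_def)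
      then show ?thesis using 5 True vG qg QG sm1 tt
        by (simp add: wp_simps r ev2 mv q_def[symmetric] same_upd v_def[symmetric])
    next
      case False
      have m2: "M' (13 * Q + 2 * v) = g (2 * v)" using m False by simp
      have c2: "carried u (Suc v) f (2 * v) = g (2 * v) + q"
        unfolding nxt using False v by (simp add: carry_def Let_def q_def)
      have "g (2 * v) + q < G" unfolding c2[symmetric] by (rule bound) (use v False in auto)
      moreover have "\<forall>w<2 * u + 2. (M'(13 * Q + v := g v - 2 * q, 13 * Q + 2 * v := g (2 * v) + q)) (13 * Q + w)
          = carried u (Suc v) f w"
        unfolding nxt using False m by (auto simp: carry_def Let_def q_def)
      ultimately show ?thesis using 5 False vG qg QG sm2 v tt
        by (simp add: wp_simps r ev2 mv m2 q_def[symmetric] same_upd v_def[symmetric])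
    qed
  qed (use nu in \<open>auto simp: h_def\<close>)
  have sum: "wp G (For 20 (Rg 2) (Asg 18 (Rg 18 [+] Ld (area 13 [+] (Rg 20 [+] Nm 1)) [*] (Rg 20 [+] Nm 1))))
    (\<lambda>R' M' t'. M' = M2 \<and> same {18, 20, 21, 22} R' R \<and> R' 18 = (\<Sum>v\<in>{1..u}. h v * v) \<and> t' \<le> t2 + 2 + 3 * u)
    (R2(18 := 0)) M2 t2"
    if a1: "\<forall>v<2 * u + 2. M2 (13 * Q + v) = h v" and a3: "same {20, 21, 22} R2 R"
    for R2 M2 t2
  proof (rule wp_For[where n = u and I = "\<lambda>j R' M' t'. M' = M2 \<and>
      same {18, 20, 21, 22} R' R \<and> R' 20 = j \<and> R' 18 = (\<Sum>v\<in>{1..j}. h v * v) \<and> t' \<le> t2 + 1 + 3 * j"], goal_cases)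
    case 3
    have "same {18, 20, 21, 22} R2 R" by (rule same_mono[OF a3]) auto
    then show ?case by (simp add: same_upd One_nat_def)
  next
    case (4 j R' M' t')
    then have s: "same {18, 20, 21, 22} R' R" by blast
    show ?case using 4 R by (simp add: same_eq[OF s])
  next
    case (5 j R' M' t')
    have sR: "same {18, 20, 21, 22} R' R" using 5 by blast
    have r: "R' 12 = Q" "R' 20 = j" using R 5 by (simp_all add: same_eq[OF sR])
    have m: "M2 (13 * Q + Suc j) = h (Suc j)" using a1[rule_format, of "Suc j"] 5(2) by simp
    then have m': "M2 (13 * Q + (j + 1)) = h (Suc j)" by (simp only: Suc_eq_plus1)
    have "(\<Sum>v\<in>{1..Suc j}. h v * v) \<le> (\<Sum>v\<in>{1..u}. h v * v)" by (rule sum_mono2) (use 5(2) in auto)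
    also have "\<dots> \<le> s" using carried_sum_le[of "Suc u" u f] unfolding s(1) h_def by (simp add: One_nat_def)
    finally have "(\<Sum>v\<in>{1..Suc j}. h v * v) < G" using s(2) by linarith
    moreover have sS: "(\<Sum>v\<in>{1..Suc j}. h v * v) = (\<Sum>v\<in>{1..j}. h v * v) + h (Suc j) * (j + 1)"
      by (simp add: One_nat_def)
    ultimately have "(\<Sum>v\<in>{1..j}. h v * v) + h (Suc j) * (j + 1) < G" by (simp only:)
    then show ?case using 5 unfolding sS by (simp add: wp_simps r m' same_upd)
  qed (use nu in \<open>auto simp: h_def\<close>)
  show ?thesis
    unfolding COUNTS_def
  proof (rule wp_SqI[OF fill], elim conjE, goal_cases)
    case A: (1 R1 M1 t1)
    show ?case
    proof (rule wp_SqI[OF car[OF A(1-3)]], elim conjE, goal_cases)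
      case B: (1 R2 M2 t2)
      show ?case
      proof (rule wp_Asg_SqI, goal_cases)
        case 1 show ?case using QG by simp
      next
        case 2
        have e: "ev (Nm 0) R2 M2 = 0" by simp
        show ?case unfolding e
          by (rule wp_mono[OF sum[OF B(1,3)]]) (use A B in auto)
      qed
    qed
  qed
qed

end

subsection \<open>Roots of unity\<close>

definition ISQRT :: st where
  "ISQRT = Asg 23 (Nm 0) ;; Asg 24 (Rg 10 [+] Nm 1) ;;
    Wh (Rg 23 [+] Nm 1) (Rg 24) (
      Asg 25 ((Rg 23 [+] Rg 24) [div] Nm 2) ;;
      Cond (Rg 22) (Rg 25 [*] Rg 25) (Asg 24 (Rg 25)) (Asg 23 (Rg 25)))"

text \<open>The half-angle formulas \<open>2 cos\<^sup>2 \<theta> = 1 + cos 2\<theta>\<close> and \<open>2 sin\<^sup>2 \<theta> = 1 - cos 2\<theta>\<close>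
  are iterated in fixed point.\<close>

definition TABLE :: st where
  "TABLE = Sto (area 1) (Rg 11 [-] Rg 10) ;; Sto (area 2) (Rg 11) ;;
    Asg 18 (Nm 0) ;; Asg 19 (Rg 10) ;; Asg 20 (Nm 1) ;;
    Wh (Rg 20) (Rg 8) (
      Sto (area 1 [+] Rg 20) (Rg 11 [+] Rg 18) ;; Sto (area 2 [+] Rg 20) (Rg 11 [+] Rg 19) ;;
      Asg 22 ((Rg 10 [*] Rg 10 [+] Rg 10 [*] Rg 18) [div] Nm 2) ;;
      Asg 26 ((Rg 10 [*] Rg 10 [-] Rg 10 [*] Rg 18) [div] Nm 2) ;;
      ISQRT ;; Asg 18 (Rg 23) ;; Asg 22 (Rg 26) ;; ISQRT ;; Asg 19 (Rg 23) ;; Asg 20 (Rg 20 [+] Nm 1))"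

text \<open>Bisection between \<open>l * l \<le> X\<close> and \<open>X < h * h\<close>. Halving a
  gap of at most \<open>2 ^ k\<close> leaves at most \<open>2 ^ (k - 1)\<close> even with rounding,
  so \<open>K\<close> rounds suffice for the initial gap \<open>S + 1\<close>.\<close>

lemma wp_ISQRT:
  assumes R: "R 10 = S" "R 22 = X" and X: "X < (S + 1) * (S + 1)" and K: "S + 1 \<le> 2 ^ K" and G: "2 * S + 2 < G"
  shows "wp G ISQRT (\<lambda>R' M' t'. M' = M \<and> same {23, 24, 25} R' R \<and> R' 23 * R' 23 \<le> X \<and>
    X < (R' 23 + 1) * (R' 23 + 1) \<and> t' \<le> t + 3 + 4 * K) R M t"
proof -
  let ?I = "\<lambda>R' M' t'. M' = M \<and> same {23, 24, 25} R' R \<and> R' 23 * R' 23 \<le> X \<and> X < R' 24 * R' 24 \<and>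
    R' 23 < R' 24 \<and> R' 24 \<le> S + 1 \<and> (\<exists>k. R' 24 - R' 23 \<le> 2 ^ k \<and> t' + 4 * k \<le> t + 2 + 4 * K)"
  have "wp G (Wh (Rg 23 [+] Nm 1) (Rg 24) (
      Asg 25 ((Rg 23 [+] Rg 24) [div] Nm 2) ;;
      Cond (Rg 22) (Rg 25 [*] Rg 25) (Asg 24 (Rg 25)) (Asg 23 (Rg 25))))
    (\<lambda>R' M' t'. M' = M \<and> same {23, 24, 25} R' R \<and> R' 23 * R' 23 \<le> X \<and>
    X < (R' 23 + 1) * (R' 23 + 1) \<and> t' \<le> t + 3 + 4 * K) (R(23 := 0, 24 := S + 1)) M (t + 1 + 1)"
  proof (rule wp_Wh[where I = ?I and f = "\<lambda>R' M'. R' 24 - R' 23"], goal_cases)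
    case 1
    show ?case using X K by (auto simp: same_def intro!: exI[of _ K])
  next
    case (2 R' M' t')
    define l h where lh: "l = R' 23" "h = R' 24"
    define m where "m = (l + h) div 2"
    obtain k where k: "h - l \<le> 2 ^ k" "t' + 4 * k \<le> t + 2 + 4 * K" using 2 unfolding lh by blast
    have I: "M' = M" "same {23, 24, 25} R' R" "l * l \<le> X" "X < h * h" "l < h" "h \<le> S + 1"
      using 2 unfolding lh by blast+
    have lt: "l + 1 < h" using 2(2) by (simp add: lh)
    then have "k \<noteq> 0" using k(1) by (intro notI) simp
    then obtain k' where k': "k = Suc k'" by (cases k) auto
    have r: "R' 22 = X" using R by (simp add: same_eq[OF I(2)])
    have m: "l < m" "m < h" using lt by (auto simp: m_def)
    have mk: "h - m \<le> 2 ^ k'" "m - l \<le> 2 ^ k'" using k(1) unfolding k' m_def by auto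
    have mG: "m < G" using m I G by linarith
    have tk: "t' + 1 + 1 + 1 + 1 + 4 * k' \<le> t + 2 + 4 * K" using k(2) k' by simp
    show ?case
    proof (cases "X < m * m")
      case True
      then have "?I (R'(25 := m, 24 := m)) M' (t' + 1 + 1 + 1 + 1)"
        using I m mk tk by (auto simp: same_upd lh[symmetric] intro!: exI[of _ k'])
      moreover have "m - l < h - l" using m by linarith
      ultimately show ?thesis using True mG by (simp add: wp_simps r lh[symmetric] m_def[symmetric])
    next
      case False
      then have "?I (R'(25 := m, 23 := m)) M' (t' + 1 + 1 + 1 + 1)"
        using I m mk tk by (auto simp: same_upd lh[symmetric] intro!: exI[of _ k'])
      moreover have "h - m < h - l" using m by linarith
      ultimately show ?thesis using False mG by (simp add: wp_simps r lh[symmetric] m_def[symmetric])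
    qed
  next
    case (3 R' M' t')
    then obtain k where k: "t' + 4 * k \<le> t + 2 + 4 * K" by blast
    have "R' 24 = R' 23 + 1" using 3 by simp
    then show ?case using 3 k by simp
  qed
  then show ?thesis unfolding ISQRT_def using R G by (simp add: wp_Sq wp_Asg)
qed

text \<open>The cosine is numerically stable: it is at least 1/2 on this range, so the square root
  damps the inherited error and the bound 4 reproduces itself, rounding included. The sine may be
  close to 0, where a square root turns an error of order \<open>S\<close> into one of order
  \<open>sqrt S\<close>. It is therefore always derived from the cosine and never fed back.\<close>

lemma half_angle:
  fixes S c a b :: nat and \<theta> :: real
  assumes c: "\<bar>real c - real S * cos (2 * \<theta>)\<bar> \<le> 4" "c \<le> S" and \<theta>: "0 \<le> \<theta>" "\<theta> \<le> pi / 4" and S: "9 \<le> S"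
    and a: "a * a \<le> (S * S + S * c) div 2" "(S * S + S * c) div 2 < (a + 1) * (a + 1)"
    and b: "b * b \<le> (S * S - S * c) div 2" "(S * S - S * c) div 2 < (b + 1) * (b + 1)"
  shows "a \<le> S" "b \<le> S" "\<bar>real a - real S * cos \<theta>\<bar> \<le> 4" "\<bar>real b - real S * sin \<theta>\<bar> \<le> sqrt (2 * real S) + 1"
proof -
  define s where "s = real S"
  define T where "T = s * cos \<theta>"
  define U where "U = s * sin \<theta>"
  have s9: "9 \<le> s" using S by (simp add: s_def)
  have cS: "S * c \<le> S * S" using c(2) by simp
  have a1: "2 * (a * a) \<le> S * S + S * c" "S * S + S * c < 2 * ((a + 1) * (a + 1))" using a by linarith+
  have b1: "2 * (b * b) + S * c \<le> S * S" "S * S < 2 * ((b + 1) * (b + 1)) + S * c" using b cS by linarith+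
  have "real (2 * (a * a)) \<le> real (S * S + S * c)" "real (S * S + S * c) < real (2 * ((a + 1) * (a + 1)))"
    "real (2 * (b * b) + S * c) \<le> real (S * S)" "real (S * S) < real (2 * ((b + 1) * (b + 1)) + S * c)"
    using a1 b1 by (simp_all only: of_nat_le_iff of_nat_less_iff)
  then have ar: "2 * (real a * real a) \<le> s * s + s * real c" "s * s + s * real c < 2 * ((real a + 1) * (real a + 1))"
    "2 * (real b * real b) + s * real c \<le> s * s" "s * s < 2 * ((real b + 1) * (real b + 1)) + s * real c"
    unfolding s_def by simp_all
  have "a * a \<le> S * S" "b * b \<le> S * S" using a1(1) b1(1) cS by linarith+
  then show "a \<le> S" "b \<le> S" by (simp_all flip: power2_eq_square)
  have "s * (real c - s * cos (2 * \<theta>)) \<le> s * 4" "s * (s * cos (2 * \<theta>) - real c) \<le> s * 4"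
    using c(1) s9 unfolding s_def by (intro mult_left_mono; linarith)+
  then have sc: "s * real c \<le> s * (s * cos (2 * \<theta>)) + 4 * s" "s * (s * cos (2 * \<theta>)) - 4 * s \<le> s * real c"
    by (simp_all add: right_diff_distrib)
  have TT: "s * s + s * (s * cos (2 * \<theta>)) = 2 * (T * T)"
    unfolding T_def cos_double_cos by (simp add: algebra_simps power2_eq_square)
  have UU: "s * s - s * (s * cos (2 * \<theta>)) = 2 * (U * U)"
    unfolding U_def cos_double_sin by (simp add: algebra_simps power2_eq_square)
  have "cos (pi / 3) \<le> cos \<theta>" by (rule cos_monotone_0_pi_le) (use \<theta> in auto)
  then have "s * (1 / 2) \<le> T" unfolding T_def using s9 by (intro mult_left_mono) (auto simp: cos_60)
  then have T: "s \<le> 2 * T" by simp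
  have U: "0 \<le> U" unfolding U_def using s9 \<theta> by (intro mult_nonneg_nonneg sin_ge_zero) auto
  have "real a \<le> T + 4"
  proof (rule ccontr)
    assume "\<not> real a \<le> T + 4"
    then have "(T + 4) * (T + 4) \<le> real a * real a" using T s9 by (intro mult_mono) auto
    then have "T * T + 8 * T + 16 \<le> real a * real a" by (simp add: algebra_simps)
    then show False using ar(1) sc(1) TT T s9 by linarith
  qed
  moreover have "T - 4 \<le> real a"
  proof (rule ccontr)
    assume "\<not> T - 4 \<le> real a"
    then have "(real a + 1) * (real a + 1) \<le> (T - 3) * (T - 3)" by (intro mult_mono) auto
    then have "(real a + 1) * (real a + 1) \<le> T * T - 6 * T + 9" by (simp add: algebra_simps)
    then show False using ar(2) sc(2) TT T s9 by linarith
  qed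
  ultimately show "\<bar>real a - real S * cos \<theta>\<bar> \<le> 4" unfolding T_def s_def by linarith
  define q where "q = sqrt (2 * s)"
  have q: "0 \<le> q" "q * q = 2 * s" using s9 by (simp_all add: q_def)
  have "real b \<le> U + q"
  proof (rule ccontr)
    assume "\<not> real b \<le> U + q"
    then have "(U + q) * (U + q) < real b * real b" using U q by (intro mult_strict_mono) auto
    moreover have "(U + q) * (U + q) = U * U + 2 * (U * q) + q * q" by (simp add: algebra_simps)
    moreover have "0 \<le> U * q" using U q by simp
    ultimately show False using ar(3) sc(2) UU q by linarith
  qed
  moreover have "U \<le> real b + 1 + q"
  proof (rule ccontr)
    assume "\<not> U \<le> real b + 1 + q"
    then have "(real b + 1 + q) * (real b + 1 + q) < U * U" using q by (intro mult_strict_mono) auto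
    moreover have "(real b + 1 + q) * (real b + 1 + q) = (real b + 1) * (real b + 1) + 2 * ((real b + 1) * q) + q * q"
      by (simp add: algebra_simps)
    moreover have "0 \<le> (real b + 1) * q" using q by simp
    ultimately show False using ar(4) sc(1) UU q by linarith
  qed
  ultimately show "\<bar>real b - real S * sin \<theta>\<bar> \<le> sqrt (2 * real S) + 1" unfolding U_def s_def q_def by linarith
qed

context fixpoint_table
begin

text \<open>Entries 0 and 1 are exact: \<open>cis pi = -1\<close> is written directly, and the
  recursion starts from \<open>cis (pi / 2)\<close> with cosine 0 and sine \<open>S\<close>, because
  from there on all half angles are at most \<open>pi / 4\<close>. The hypothesis on
  \<open>e0\<close> makes room for the sine error of order \<open>sqrt S\<close>.\<close>

lemma TABLE_spec:
  assumes c: "consts_ok R" "R 8 = J" and S: "9 \<le> S" "S + 1 \<le> 2 ^ K" "2 * (S * S) < G" "S \<le> B"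
    and e0: "sqrt (2 * real S) + 5 \<le> e0 * real S" and J1: "1 \<le> J"
  shows "wp G TABLE (\<lambda>R' M' t'. table_ok M' \<and> same {Q..<3 * Q} M' M \<and>
    same {18, 19, 20, 22, 23, 24, 25, 26} R' R \<and> t' \<le> t + 6 + J * (15 + 8 * K)) R M t"
proof -
  have r: "R 10 = S" "R 11 = B" "R 12 = Q" using c by (auto simp: consts_ok_def)
  have QG: "40 * Q < G" "1 < G" using Q_G G1 by auto
  have SS: "9 * S \<le> S * S" using S(1) by simp
  have SG: "2 * S + 2 < G" using S(1,3) SS by linarith
  have BG: "B + S < G" using B_G S by linarith
  define C where "C = (\<lambda>j. real S * cos (pi / 2 ^ j))"
  define D where "D = (\<lambda>j. real S * sin (pi / 2 ^ j))"
  let ?E = "sqrt (2 * real S) + 1"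
  define entry where "entry = (\<lambda>M' p. norm (cv (M' (Q + p)) (M' (2 * Q + p)) - cis (pi / 2 ^ p)) \<le> e0)"
  have entryI: "entry M' p" if "M' (Q + p) = B + x" "M' (2 * Q + p) = B + y" "\<bar>real x - C p\<bar> \<le> 4" "\<bar>real y - D p\<bar> \<le> ?E"
    for M' p x y
  proof -
    let ?z = "cv (M' (Q + p)) (M' (2 * Q + p)) - cis (pi / 2 ^ p)"
    have S0: "0 < real S" using S(1) by simp
    have "Re ?z = (real x - C p) / real S" "Im ?z = (real y - D p) / real S"
      using S0 that by (simp_all add: cv_def C_def D_def field_simps)
    then have "norm ?z \<le> \<bar>(real x - C p) / real S\<bar> + \<bar>(real y - D p) / real S\<bar>" using cmod_le[of ?z] by simp
    also have "\<dots> = (\<bar>real x - C p\<bar> + \<bar>real y - D p\<bar>) / real S" using S0 by (simp add: add_divide_distrib)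
    also have "\<dots> \<le> (e0 * real S) / real S" using that e0 S0 by (intro divide_right_mono) auto
    also have "\<dots> = e0" using S0 by simp
    finally show ?thesis by (simp add: entry_def)
  qed
  let ?I = "\<lambda>R' M' t'. \<exists>j\<ge>1. R' 20 = j \<and> j \<le> J \<and> same {Q..<3 * Q} M' M \<and>
    same {18, 19, 20, 22, 23, 24, 25, 26} R' R \<and> (\<forall>p<j. entry M' p) \<and>
    R' 18 \<le> S \<and> R' 19 \<le> S \<and> \<bar>real (R' 18) - C j\<bar> \<le> 4 \<and> \<bar>real (R' 19) - D j\<bar> \<le> ?E \<and>
    t' \<le> t + 5 + j * (15 + 8 * K)"
  let ?R0 = "R(18 := 0, 19 := S, 20 := 1)" and ?M0 = "M(Q := B - S, 2 * Q := B)"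
  let ?body = "Sto (area 1 [+] Rg 20) (Rg 11 [+] Rg 18) ;; Sto (area 2 [+] Rg 20) (Rg 11 [+] Rg 19) ;;
      Asg 22 ((Rg 10 [*] Rg 10 [+] Rg 10 [*] Rg 18) [div] Nm 2) ;;
      Asg 26 ((Rg 10 [*] Rg 10 [-] Rg 10 [*] Rg 18) [div] Nm 2) ;;
      ISQRT ;; Asg 18 (Rg 23) ;; Asg 22 (Rg 26) ;; ISQRT ;; Asg 19 (Rg 23) ;; Asg 20 (Rg 20 [+] Nm 1)"
  have Q0: "0 < Q" using Nb Nb_Q by linarith
  have loop: "wp G (Wh (Rg 20) (Rg 8) ?body) (\<lambda>R' M' t'. table_ok M' \<and> same {Q..<3 * Q} M' M \<and>
    same {18, 19, 20, 22, 23, 24, 25, 26} R' R \<and> t' \<le> t + 6 + J * (15 + 8 * K)) ?R0 ?M0 (t + 1 + 1 + 1 + 1 + 1)"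
  proof (rule wp_Wh[where I = ?I and f = "\<lambda>R' M'. J - R' 20"], goal_cases)
    case 1
    have "entry ?M0 0"
    proof -
      have "real (B - S) - real B = - real S" using S(4) by simp
      then have "cv (B - S) B = cis pi"
        using S(1) by (simp add: cv_def complex_eq_iff)
      moreover have "0 \<le> e0"
      proof -
        have "0 \<le> e0 * real S" using e0 real_sqrt_ge_zero[of "2 * real S"] by linarith
        then show ?thesis using S(1) by (simp add: zero_le_mult_iff)
      qed
      ultimately show ?thesis using Q0 by (simp add: entry_def)
    qed
    then show ?case using J1 Q0
      by (intro exI[of _ 1]) (auto simp: same_def C_def D_def One_nat_def)
  next
    case (2 R' M' t')
    then obtain j where j: "1 \<le> j" "R' 20 = j" "j \<le> J" "same {Q..<3 * Q} M' M"
      "same {18, 19, 20, 22, 23, 24, 25, 26} R' R" "\<forall>p<j. entry M' p" "R' 18 \<le> S" "R' 19 \<le> S"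
      "\<bar>real (R' 18) - C j\<bar> \<le> 4" "\<bar>real (R' 19) - D j\<bar> \<le> ?E" "t' \<le> t + 5 + j * (15 + 8 * K)" by blast
    define x y where xy: "x = R' 18" "y = R' 19"
    have r': "R' 10 = S" "R' 11 = B" "R' 12 = Q" "R' 8 = J" using r c by (simp_all add: same_eq[OF j(5)])
    have jJ: "j < J" using 2(2) j(2) r' by simp
    then have jQ: "j < Q" using J_Q by linarith
    let ?X = "(S * S + S * x) div 2" and ?Y = "(S * S - S * x) div 2"
    let ?M' = "M'(Q + j := B + x, 2 * Q + j := B + y)"
    let ?R1 = "R'(22 := ?X, 26 := ?Y)"
    have Sx: "S * x \<le> S * S" using j(7) by (simp add: xy)
    have XY: "?X \<le> S * S" "?Y \<le> S * S" using Sx by linarith+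
    have SS1: "S * S < (S + 1) * (S + 1)" by (intro mult_strict_mono) simp_all
    have XG: "?X < G" "?Y < G" using XY S(3) by linarith+
    have ent: "entry ?M' j" by (rule entryI[where x = x and y = y]) (use jQ j in \<open>simp_all add: xy\<close>)
    have ent': "entry ?M' p" if "p < j" for p
      using j(6) that jQ by (simp add: entry_def)
    have smM: "same {Q..<3 * Q} ?M' M" using j(4) jQ by (simp add: same_upd)
    have th: "pi / 2 ^ j = 2 * (pi / 2 ^ Suc j)" by simp
    have th4: "pi / 2 ^ Suc j \<le> pi / 4"
    proof -
      have "(2::real) ^ 2 \<le> 2 ^ Suc j" using j(1) by (intro power_increasing) (auto simp: One_nat_def)
      then show ?thesis by (intro divide_left_mono) auto
    qed
    have isq1: "wp G ISQRT (\<lambda>R'' M'' t''. M'' = ?M' \<and> same {23, 24, 25} R'' ?R1 \<and> R'' 23 * R'' 23 \<le> ?X \<and>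
      ?X < (R'' 23 + 1) * (R'' 23 + 1) \<and> t'' \<le> t' + 5 + 3 + 4 * K) ?R1 ?M' (t' + 5)"
      by (rule wp_ISQRT[OF _ _ _ S(2) SG]) (use r' XY SS1 in \<open>auto intro: le_less_trans\<close>)
    have rest: "wp G (ISQRT ;; Asg 18 (Rg 23) ;; Asg 22 (Rg 26) ;; ISQRT ;; Asg 19 (Rg 23) ;; Asg 20 (Rg 20 [+] Nm 1))
      (\<lambda>R'' M'' t''. ?I R'' M'' t'' \<and> J - R'' 20 < J - R' 20) ?R1 ?M' (t' + 5)"
    proof (rule wp_SqI[OF isq1], elim conjE, goal_cases)
      case A: (1 R1 M1 t1)
      define a where "a = R1 23"
      have r1: "R1 10 = S" "R1 26 = ?Y" "R1 20 = j" using r' j(2) by (simp_all add: same_eq[OF A(2)])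
      have aS: "a \<le> S"
      proof -
        have "a * a \<le> S * S" using A(3) XY(1) unfolding a_def by linarith
        then show ?thesis by (simp flip: power2_eq_square)
      qed
      let ?R2 = "R1(18 := a, 22 := ?Y)"
      have isq2: "wp G ISQRT (\<lambda>R'' M'' t''. M'' = M1 \<and> same {23, 24, 25} R'' ?R2 \<and> R'' 23 * R'' 23 \<le> ?Y \<and>
        ?Y < (R'' 23 + 1) * (R'' 23 + 1) \<and> t'' \<le> t1 + 1 + 1 + 3 + 4 * K) ?R2 M1 (t1 + 1 + 1)"
        by (rule wp_ISQRT[OF _ _ _ S(2) SG]) (use r1 XY SS1 in \<open>auto intro: le_less_trans\<close>)
      have "wp G (ISQRT ;; Asg 19 (Rg 23) ;; Asg 20 (Rg 20 [+] Nm 1))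
        (\<lambda>R'' M'' t''. ?I R'' M'' t'' \<and> J - R'' 20 < J - R' 20) ?R2 M1 (t1 + 1 + 1)"
      proof (rule wp_SqI[OF isq2], elim conjE, goal_cases)
        case B: (1 R2 M2 t2)
        define b where "b = R2 23"
        have r2: "R2 20 = j" "R2 18 = a" using r1 by (simp_all add: same_eq[OF B(2)])
        have "\<bar>real x - real S * cos (2 * (pi / 2 ^ Suc j))\<bar> \<le> 4"
          using j(9) unfolding xy C_def th .
        note ab = half_angle[OF this j(7)[folded xy] _ th4 S(1) A(3,4)[folded a_def] B(3,4)[folded b_def]]
        have ab': "a \<le> S" "b \<le> S" "\<bar>real a - C (Suc j)\<bar> \<le> 4" "\<bar>real b - D (Suc j)\<bar> \<le> ?E"
          unfolding C_def D_def using ab by (auto simp del: power_Suc)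
        have sR: "same {18, 19, 20, 22, 23, 24, 25, 26} (R2(19 := b, 20 := j + 1)) R"
          unfolding same_def by (auto simp: same_eq[OF B(2)] same_eq[OF A(2)] same_eq[OF j(5)])
        have tb: "t2 + 1 + 1 \<le> t + 5 + Suc j * (15 + 8 * K)" using B(5) A(5) j(11) by simp
        have "?I (R2(19 := b, 20 := j + 1)) M2 (t2 + 1 + 1)"
          by (intro exI[of _ "Suc j"] conjI)
            (use sR tb ab' ent ent' smM jJ r2 A(1) B(1) in \<open>auto simp: less_Suc_eq One_nat_def\<close>)
        moreover have "J - (j + 1) < J - j" using jJ by linarith
        moreover have "b < G" "j + 1 < G" using ab'(2) SG jQ QG by linarith+
        ultimately show ?case using j(2) r2 by (simp add: wp_simps b_def[symmetric])
      qed
      then show ?case using aS SG XG r1 by (simp add: wp_simps a_def[symmetric])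
    qed
    have "Q + j < G" "2 * Q + j < G" "B + x < G" "B + y < G" using jQ QG BG j(7,8) unfolding xy by linarith+
    moreover have "t' + 5 = t' + 1 + 1 + 1 + 1 + 1" by simp
    ultimately show ?case using rest XG by (simp only: wp_Sq wp_Sto wp_Asg) (simp add: r' j(2) xy[symmetric])
  next
    case (3 R' M' t')
    then obtain j where j: "1 \<le> j" "R' 20 = j" "j \<le> J" "same {Q..<3 * Q} M' M"
      "same {18, 19, 20, 22, 23, 24, 25, 26} R' R" "\<forall>p<j. entry M' p" "t' \<le> t + 5 + j * (15 + 8 * K)" by blast
    have "R' 8 = J" using c by (simp add: same_eq[OF j(5)])
    then have "j = J" using 3(2) j(2,3) by simp
    then show ?case using j by (simp add: table_ok_def approx_def entry_def mult_2 add.assoc[symmetric])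
  qed
  have "Q < G" "2 * Q < G" "B - S < G" "B < G" using QG BG by linarith+
  then show ?thesis unfolding TABLE_def using loop S SG QG Q0 r by (simp add: wp_simps)
qed

end

section \<open>The algorithm and its cost\<close>

definition MAIN :: st where
  "MAIN = SIZES ;; BITLEN 8 9 12 ;; TABLE ;; COUNTS ;; CHOOSE ;; SMALL_SUMS ;; LARGE_LOOP ;; OUTPUT"

text \<open>The 2 per value are the position of the sum 0 and the length word; the leading 2 belongs
  to the neutral block.\<close>

lemma total_small_blocks:
  "total (small_blocks f r) = 2 + (\<Sum>v\<in>{v. v < r \<and> 0 < f v}. f v * v + 2)"
proof (induction r)
  case (Suc r)
  have "{v. v < Suc r \<and> 0 < f v} = (if 0 < f r then insert r {v. v < r \<and> 0 < f v} else {v. v < r \<and> 0 < f v})"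
    by (auto simp: less_Suc_eq)
  then show ?case using Suc by (simp add: small_blocks_Suc leaf_def)
qed (simp add: small_blocks_0)

lemma length_small_blocks: "length (small_blocks f r) = 1 + card {v. v < r \<and> 0 < f v}"
proof -
  have "{v. v < r \<and> 0 < f v} = set (filter (\<lambda>v. 0 < f v) [0..<r])" by auto
  then have "card {v. v < r \<and> 0 < f v} = length (filter (\<lambda>v. 0 < f v) [0..<r])"
    by (simp only: distinct_card[OF distinct_filter[OF distinct_upt]])
  then show ?thesis by (simp add: small_blocks_def)
qed

text \<open>With multiplicities of at most 2 a leaf below \<open>r\<close> takes at most
  \<open>2 * r\<close> cells, and there are at most \<open>min m r\<close> of them.\<close>

lemma total_small_blocks_le:
  assumes f: "f 0 = 0" "\<And>v. f v \<le> 2" and m: "card {v. 0 < f v} < m" "finite {v. 0 < f v}"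
  shows "total (small_blocks f r) \<le> 2 + 2 * (r * min m r)"
proof -
  let ?V = "{v. v < r \<and> 0 < f v}"
  have V: "?V \<subseteq> {v. 0 < f v}" "?V \<subseteq> {1..<r}" using f(1) by (auto simp: One_nat_def Suc_le_eq) (metis gr0I less_irrefl)
  have "card ?V \<le> m" using card_mono[OF m(2) V(1)] m(1) by linarith
  moreover have "card ?V \<le> r" using card_mono[OF _ V(2)] by simp
  ultimately have cV: "card ?V \<le> min m r" by simp
  have "f v * v + 2 \<le> 2 * r" if "v \<in> ?V" for v
  proof -
    have "f v * v \<le> 2 * v" using f(2) by (rule mult_le_mono1)
    then show ?thesis using that unfolding mem_Collect_eq by linarith
  qed
  then have "(\<Sum>v\<in>?V. f v * v + 2) \<le> card ?V * (2 * r)"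
    using sum_bounded_above[of ?V "\<lambda>v. f v * v + 2" "2 * r"] by simp
  also have "\<dots> \<le> min m r * (2 * r)" using cV by (rule mult_le_mono1)
  finally show ?thesis unfolding total_small_blocks by (simp add: mult_ac)
qed

text \<open>Every occurring value contributes at least 1 to the total, which pays for its two
  additional cells.\<close>

lemma total_small_blocks_le_sum:
  assumes "f 0 = 0" "\<And>v. u < v \<Longrightarrow> f v = 0"
  shows "total (small_blocks f r) \<le> 2 + 3 * (\<Sum>v\<in>{1..u}. f v * v)"
proof -
  let ?V = "{v. v < r \<and> 0 < f v}"
  have V: "?V \<subseteq> {1..u}"
  proof
    fix v assume "v \<in> ?V"
    then have "0 < f v" by simp
    then have "v \<noteq> 0" "\<not> u < v" using assms by (auto intro: ccontr)
    then show "v \<in> {1..u}" by (simp add: One_nat_def)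
  qed
  have "(\<Sum>v\<in>?V. f v * v + 2) \<le> (\<Sum>v\<in>?V. 3 * (f v * v))"
  proof (rule sum_mono)
    fix v assume v: "v \<in> ?V"
    then have "1 \<le> v" using V by auto
    then have "1 * 1 \<le> f v * v" using v by (intro mult_le_mono) (auto simp: One_nat_def)
    then show "f v * v + 2 \<le> 3 * (f v * v)" by linarith
  qed
  also have "\<dots> = 3 * (\<Sum>v\<in>?V. f v * v)" by (simp add: sum_distrib_left)
  also have "\<dots> \<le> 3 * (\<Sum>v\<in>{1..u}. f v * v)" by (intro mult_le_mono2 sum_mono2 V) auto
  finally show ?thesis unfolding total_small_blocks by simp
qed

text \<open>Makes squared logarithms, such as the cost of the root table, at most linear, as the
  third bound requires.\<close>

lemma sq_le_exp: "n * n \<le> 2 * 2 ^ n" for n :: nat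
proof -
  have "n * n \<le> 2 ^ n" if "4 \<le> n" using that
  proof (induction n rule: dec_induct)
    case (step n)
    have "4 * n \<le> n * n" using step(1) by (rule mult_le_mono1)
    moreover have "Suc n * Suc n = n * n + 2 * n + 1" "(2::nat) ^ Suc n = 2 * 2 ^ n" by simp_all
    ultimately show ?case using step by linarith
  qed simp
  moreover have "n = 0 \<or> n = 1 \<or> n = 2 \<or> n = 3" if "n < 4" using that by auto
  ultimately show ?thesis by (cases "4 \<le> n") auto
qed

text \<open>Reduces all logarithms to \<open>L\<close>: the number of roots \<open>J\<close> belongs
  to \<open>(m + 2) ^ 6\<close>, and \<open>n * L + 1\<close> is at most the square of
  \<open>2 ^ L\<close>.\<close>

lemma length_bounds:
  fixes m n J L L' :: nat
  assumes m: "1 \<le> m" "n \<le> m" and L: "m < 2 ^ L" "2 ^ L \<le> 2 * m + 1" and L': "2 ^ L' \<le> 2 * (n * L + 1) + 1"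
    and J: "2 ^ J \<le> 2 * (m + 2) ^ 6 + 1"
  shows "1 \<le> L" "L * L \<le> 6 * m" "J + 1 \<le> 14 * L" "L' \<le> 3 * L"
proof -
  show L1: "1 \<le> L"
  proof (rule ccontr)
    assume "\<not> 1 \<le> L"
    then have "L = 0" by (simp add: One_nat_def)
    then show False using L(1) m(1) by simp
  qed
  show "L * L \<le> 6 * m" using sq_le_exp[of L] L(2) m(1) by linarith
  have "2 ^ 1 \<le> (2::nat) ^ L" using L1 by (intro power_increasing) auto
  moreover have "2 ^ (L + 1) = 2 ^ L * (2::nat)" by (simp only: power_add power_one_right)
  ultimately have "m + 2 \<le> 2 ^ (L + 1)" using L(1) by linarith
  then have "(m + 2) ^ 6 \<le> (2 ^ (L + 1)) ^ 6" by (intro power_mono) auto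
  also have "\<dots> = 2 ^ (6 * L + 6)" by (simp add: algebra_simps flip: power_mult)
  finally have "2 ^ J \<le> 2 * (2::nat) ^ (6 * L + 6) + 1" using J by linarith
  also have "\<dots> < 4 * 2 ^ (6 * L + 6)"
  proof -
    have "(1::nat) \<le> 2 ^ (6 * L + 6)" by simp
    then show ?thesis by linarith
  qed
  also have "\<dots> = 2 ^ (6 * L + 8)" by (simp add: power_add)
  finally have "J < 6 * L + 8" by (rule power_less_imp_less_exp[rotated]) simp
  then show "J + 1 \<le> 14 * L" using L1 by linarith
  have "n * L + 1 \<le> m * 2 ^ L + 1" using mult_le_mono[OF m(2) less_imp_le[OF less_exp[of L]]] by simp
  also have "\<dots> \<le> (m + 1) * 2 ^ L" by (simp add: distrib_right)
  also have "\<dots> \<le> 2 ^ L * 2 ^ L" using L(1) by (intro mult_le_mono1) simp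
  also have "\<dots> = 2 ^ (2 * L)" by (simp add: mult_2 power_add)
  finally have F: "n * L + 1 \<le> 2 ^ (2 * L)" .
  have "2 ^ L' \<le> 2 * (2::nat) ^ (2 * L) + 1" by (rule le_trans[OF L' add_le_mono1[OF mult_le_mono2[OF F]]])
  also have "\<dots> < 4 * 2 ^ (2 * L)"
  proof -
    have "(1::nat) \<le> 2 ^ (2 * L)" by simp
    then show ?thesis by linarith
  qed
  also have "\<dots> = 2 ^ (2 * L + 2)" by (simp add: power_add)
  finally have "L' < 2 * L + 2" by (rule power_less_imp_less_exp[rotated]) simp
  then show "L' \<le> 3 * L" using L1 by linarith
qed

lemma less_div_plus1_mult:
  fixes k r :: nat
  assumes "0 < r"
  shows "k < (k div r + 1) * r"
proof -
  have "k div r * r + k mod r = k" by (rule div_mult_mod_eq)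
  moreover have "k mod r < r" using assms by simp
  moreover have "(k div r + 1) * r = k div r * r + r" by (simp add: distrib_right)
  ultimately show ?thesis by linarith
qed

text \<open>\<open>A\<close> is the space for the small values, \<open>\<rho>\<close> the threshold actually used.  In the first case
  there are no large values, and \<open>A\<close> is governed by the total \<open>s'\<close> of the reduced multiset.\<close>

lemma cost_bounds:
  fixes m n J L L' A r \<rho> s s' t :: nat
  assumes m: "1 \<le> m" "n \<le> m" and L: "m < 2 ^ L" "2 ^ L \<le> 2 * m + 1"
    and L': "n * L + 1 < 2 ^ L'" "2 ^ L' \<le> 2 * (n * L + 1) + 1"
    and J: "2 ^ J \<le> 2 * (m + 2) ^ 6 + 1"
    and thr: "threshold m (n * L + 1) r" and s: "s' \<le> s" "m \<le> s + 1"
    and \<rho>: "\<rho> = (if s' * L' \<le> m * m div r * L then 2 ^ L else r)"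
    and A: "A \<le> 2 + 3 * s'" "A \<le> 2 + 2 * (\<rho> * min (n * L + 1) \<rho>)"
    and t: "t \<le> 500 + 100 * m + 3 * L' + 500 * ((J + 1) * (J + 1)) + 20 * A + L' * (2 + 400 * (J + 1) * A) +
      14002 * ((J + 1) * (J + 1)) * (m * (m div \<rho>))"
  shows "t \<le> 10 ^ 8 * (L * L * (m * m div r + 1))" "t \<le> 10 ^ 8 * ((s + 1) * L' * L)"
proof -
  define Y where "Y = m * m div r"
  note lb = length_bounds[OF m L L'(2) J]
  have L'1: "1 \<le> L'"
  proof (rule ccontr)
    assume "\<not> 1 \<le> L'"
    then have "L' = 0" by (simp add: One_nat_def)
    then show False using L'(1) by simp
  qed
  have r: "0 < r" "r \<le> 2 * m" "r * r * min (n * L + 1) r \<le> 8 * (m * m)" using thr by (auto simp: threshold_def)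
  \<comment> \<open>Since \<open>r \<le> 2 * m\<close>, terms linear in \<open>m\<close> are
    absorbed by \<open>m * m div r\<close>.\<close>
  have mY: "m \<le> 2 * (Y + 1)"
  proof -
    have "m * m < (Y + 1) * r" unfolding Y_def using r(1) by (rule less_div_plus1_mult)
    also have "\<dots> \<le> (Y + 1) * (2 * m)" using r(2) by (rule mult_le_mono2)
    finally have "m * m < m * (2 * (Y + 1))" by (simp add: mult_ac)
    then have "m < 2 * (Y + 1)" by (simp only: mult_less_cancel1)
    then show ?thesis by (rule less_imp_le)
  qed
  define V W where "V = L * L * (Y + 1)" and "W = (s + 1) * L' * L"
  have JJ: "(J + 1) * (J + 1) \<le> 196 * (L * L)" using mult_le_mono[OF lb(3,3)] by (simp add: mult_ac)
  have LL1: "1 \<le> L * L" using mult_le_mono[OF lb(1,1)] by simp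
  have LV: "L * L \<le> V" "Y + 1 \<le> V" unfolding V_def using LL1 mult_le_mono1[OF LL1, of "Y + 1"] by simp_all
  have "L \<le> L * L" using mult_le_mono1[OF lb(1), of L] by (simp only: mult_1)
  then have L'V: "L' \<le> 3 * V" using lb(4) LV(1) by linarith
  have LW: "s + 1 \<le> W" "L' * L \<le> W" "L' \<le> W"
  proof -
    have "(s + 1) * (1 * 1) \<le> (s + 1) * (L' * L)" using lb(1) L'1 by (intro mult_le_mono2 mult_le_mono)
    then show "s + 1 \<le> W" by (simp add: W_def mult_ac)
    have "1 * (L' * L) \<le> (s + 1) * (L' * L)" by (intro mult_le_mono1) simp
    then show L'L: "L' * L \<le> W" by (simp add: W_def mult_ac)
    show "L' \<le> W" using le_trans[OF mult_le_mono2[OF lb(1), of L'] L'L] by (simp only: mult_1_right)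
  qed
  have LLW: "L * L \<le> 6 * W" using lb(2) s(2) LW(1) by linarith
  have AA: "L' * (2 + 400 * (J + 1) * A) \<le> 2 * L' + 5600 * (L' * L * A)"
  proof -
    have "L' * (400 * (J + 1) * A) \<le> L' * (400 * (14 * L) * A)"
      using lb(3) by (intro mult_le_mono2 mult_le_mono1) auto
    then show ?thesis by (simp add: distrib_left mult_ac)
  qed
  have A_LA: "A \<le> L' * L * A" using mult_le_mono1[OF mult_le_mono[OF L'1 lb(1)], of A] by simp
  define Z where "Z = L * L * (m * (m div \<rho>))"
  have "14002 * ((J + 1) * (J + 1)) * (m * (m div \<rho>)) \<le> 14002 * (196 * (L * L)) * (m * (m div \<rho>))"
    using JJ by (intro mult_le_mono1 mult_le_mono2)
  also have "\<dots> = 2744392 * Z" by (simp add: Z_def)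
  finally have ZZ: "14002 * ((J + 1) * (J + 1)) * (m * (m div \<rho>)) \<le> 2744392 * Z" .
  have main: "t \<le> 600 * m + 5 * L' + 98000 * (L * L) + 5620 * (L' * L * A) + 2744392 * Z"
    using t AA A_LA ZZ JJ m(1) by linarith
  have "t \<le> 10 ^ 8 * V \<and> t \<le> 10 ^ 8 * W"
  proof (cases "s' * L' \<le> Y * L")
    case True
    then have "\<rho> = 2 ^ L" using \<rho> by (simp add: Y_def)
    \<comment> \<open>The threshold exceeds \<open>m\<close>, so \<open>m div \<rho>\<close> is 0
      and large values cost nothing.\<close>
    then have Z0: "Z = 0" using L(1) by (simp add: Z_def)
    have "L' * L * A \<le> L' * L * (2 + 3 * s')" using A(1) by (rule mult_le_mono2)
    also have "\<dots> = 2 * (L' * L) + 3 * (s' * L' * L)" by (simp add: algebra_simps)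
    finally have LA: "L' * L * A \<le> 2 * (L' * L) + 3 * (s' * L' * L)" .
    have "s' * L' * L \<le> Y * L * L" using True by (rule mult_le_mono1)
    also have "\<dots> \<le> V" by (simp add: V_def algebra_simps)
    finally have sV: "s' * L' * L \<le> V" .
    have LLV: "L' * L \<le> 3 * V" using mult_le_mono1[OF lb(4), of L] LV(1) by linarith
    have sW: "s' * L' * L \<le> W" unfolding W_def using s(1) by (intro mult_le_mono1) simp
    show ?thesis
    proof
      show "t \<le> 10 ^ 8 * V" using main Z0 LA sV LLV LV L'V mY by simp
      show "t \<le> 10 ^ 8 * W" using main Z0 LA sW LW LLW s(2) by simp
    qed
  next
    case False
    then have \<rho>r: "\<rho> = r" using \<rho> by (simp add: Y_def)
    \<comment> \<open>Here the last clause of \<open>threshold\<close> bounds the space for small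
      values by the cost of large ones.\<close>
    have "r * (r * min (n * L + 1) r) < r * (8 * (Y + 1))"
    proof -
      have "m * m < (Y + 1) * r" unfolding Y_def using r(1) by (rule less_div_plus1_mult)
      then have "8 * (m * m) < 8 * ((Y + 1) * r)" by simp
      from le_less_trans[OF r(3) this] show ?thesis by (simp only: mult_ac)
    qed
    then have "r * min (n * L + 1) r < 8 * (Y + 1)" by (simp only: mult_less_cancel1)
    then have A18: "A \<le> 18 * (Y + 1)" using A(2) unfolding \<rho>r by linarith
    have "m * (m div r) \<le> Y"
    proof -
      have "m * (m div r) * r \<le> m * m" by (simp add: mult.assoc)
      then show ?thesis unfolding Y_def using r(1) by (simp add: less_eq_div_iff_mult_less_eq)
    qed
    then have ZY: "Z \<le> L * L * Y" unfolding Z_def \<rho>r by (rule mult_le_mono2)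
    then have ZV: "Z \<le> V" unfolding V_def by (rule le_trans) (intro mult_le_mono2, simp)
    have "L' * L * A \<le> 3 * L * L * (18 * (Y + 1))" using A18 lb(4) by (intro mult_le_mono mult_le_mono1)
    also have "\<dots> = 54 * V" by (simp add: V_def)
    finally have LA: "L' * L * A \<le> 54 * V" .
    have tV: "t \<le> 600 * (2 * V) + 15 * V + 98000 * V + 5620 * (54 * V) + 2744392 * V"
      using main LA ZV LV(1) L'V le_trans[OF mY mult_le_mono2[OF LV(2)]] by linarith
    \<comment> \<open>Treating all values as small was not cheaper, so
      \<open>Y * L < s' * L'\<close>. Hence the bound just obtained also implies the third
      one.\<close>
    have "L * Y * L \<le> s' * L' * L" using False by (intro mult_le_mono1) (simp add: mult.commute)
    also have "\<dots> \<le> W" unfolding W_def using s(1) by (intro mult_le_mono1) simp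
    finally have "V \<le> 7 * W" using LLW by (simp add: V_def algebra_simps)
    then show ?thesis using tV by simp
  qed
  then show "t \<le> 10 ^ 8 * (L * L * (m * m div r + 1))" "t \<le> 10 ^ 8 * ((s + 1) * L' * L)"
    by (simp_all add: V_def W_def Y_def)
qed

section \<open>Choice of the fixed-point parameters\<close>

lemma power_absorb:
  assumes "3 \<le> z" "c \<le> 3 ^ k"
  shows "c * z ^ a \<le> (z::nat) ^ (a + k)"
proof -
  have "c \<le> z ^ k" using assms power_mono[of 3 z k] by linarith
  then have "c * z ^ a \<le> z ^ k * z ^ a" by (rule mult_le_mono1)
  then show ?thesis by (simp add: power_add mult.commute)
qed

text \<open>Origin of the exponents: lengths are at most \<open>z ^ 6\<close>, so
  \<open>64 * (z ^ 6) ^ 8 * e0 \<le> 1\<close> leads to \<open>e0 = 1 / z ^ 52\<close>, where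
  \<open>z ^ 4\<close> absorbs the constant. The scale has to exceed \<open>1 / e0\<^sup>2\<close>
  because sines are accurate to order \<open>sqrt S\<close> only, whence \<open>z ^ 120\<close>.
  Finally \<open>16 * z ^ 24 * z ^ 120\<close> has to lie below the offset
  \<open>z ^ 150\<close>.\<close>

lemma fixpoint_parameters:
  assumes z: "3 \<le> z" and G: "50 * z ^ 150 \<le> G" and J: "z ^ 6 < 2 ^ J" "2 ^ J \<le> 2 * z ^ 6 + 1"
  shows "fixpoint_table G (z ^ 120) (z ^ 150) (z ^ 6) (z ^ 6) (1 / real z ^ 52) J"
proof unfold_locales
  have z0: "0 < real z" using z by simp
  have zp: "0 < z ^ k" for k using z by simp
  show "0 < z ^ 120" by (rule zp)
  have "real (2 * z ^ 52) \<le> real (z ^ 120)" using power_absorb[OF z, of 2 68 52] by (simp only: of_nat_le_iff) simp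
  then show "2 / real (z ^ 120) \<le> 1 / real z ^ 52" using z0 by (simp add: field_simps)
  have "real (64 * z ^ 48) \<le> real (z ^ 52)" using power_absorb[OF z, of 64 4 48] by (simp only: of_nat_le_iff) simp
  then show "64 * real (z ^ 6) ^ 8 * (1 / real z ^ 52) \<le> 1" using z0 by (simp add: field_simps flip: power_mult)
  have eq: "16 * (z ^ 6) ^ 4 * z ^ 120 = 16 * z ^ 144" by (simp flip: power_mult power_add)
  show "16 * (z ^ 6) ^ 4 * z ^ 120 \<le> z ^ 150" unfolding eq using power_absorb[OF z, of 16 6 144] by simp
  show "4 * z ^ 150 < G" using G zp[of 150] by linarith
  have "z ^ 6 \<le> z ^ 150" using z by (intro power_increasing) auto
  then show "40 * z ^ 6 < G" using G zp[of 150] by linarith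
  show "2 \<le> z ^ 6" using power_absorb[OF z, of 2 6 0] by simp
  show "z ^ 6 \<le> z ^ 6" by simp
  show "L \<le> J" if "2 ^ L \<le> z ^ 6" for L
  proof -
    have "(2::nat) ^ L < 2 ^ J" using that J(1) by linarith
    then show ?thesis by (simp add: less_imp_le)
  qed
  show "J \<le> z ^ 6"
  proof (rule ccontr)
    assume "\<not> J \<le> z ^ 6"
    then have "2 ^ (z ^ 6 + 1) \<le> (2::nat) ^ J" by (intro power_increasing) auto
    moreover have "2 ^ (z ^ 6 + 1) = 2 ^ (z ^ 6) * (2::nat)" by (simp only: power_add power_one_right)
    ultimately have "2 * 2 ^ (z ^ 6) \<le> 2 * z ^ 6 + 1" using J(2) by linarith
    moreover have "z ^ 6 < 2 ^ (z ^ 6)" by (rule less_exp)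
    ultimately show False by linarith
  qed
qed

text \<open>The bound \<open>card (set_mset S) * L + 1\<close> is strict, so it also leaves room for
  the neutral block in the list of leaves.\<close>

lemma carried_facts:
  fixes S :: "nat multiset"
  assumes m: "set_mset S \<subseteq> {1..m}" and L: "m < 2 ^ L"
  defines "h \<equiv> carried m (Suc m) (count S)"
  shows "h 0 = 0" "\<And>v. m < v \<Longrightarrow> h v = 0" "\<And>v. h v \<le> 2" "finite {v. 0 < h v}"
    "card {v. 0 < h v} < card (set_mset S) * L + 1" "(\<Sum>v\<in>{1..m}. h v * v) \<le> sum_mset S"
    "ssum h {1..m} \<inter> {..m} = ssum (count S) {1..m} \<inter> {..m}"
proof -
  have out: "count S v = 0" if "v \<notin> {1..m}" for v using m that by (auto simp: count_eq_zero_iff)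
  have sm: "1 \<le> Suc m" by (simp add: One_nat_def)
  show h0: "h 0 = 0"
  proof (rule ccontr)
    assume "h 0 \<noteq> 0"
    then have "0 < carried m (Suc m) (count S) 0" by (simp add: h_def)
    then obtain x i where x: "0 < count S x" "0 = x * 2 ^ i" using carried_support[OF sm] by blast
    have "x = 0" using x(2) by simp
    moreover have "count S 0 = 0" by (rule out) (simp add: One_nat_def)
    ultimately show False using x(1) by (metis less_irrefl)
  qed
  show hm: "h v = 0" if "m < v" for v
    unfolding h_def using carried_outside[OF sm order_refl that] out[of v] that by simp
  show "h v \<le> 2" for v
  proof (cases "1 \<le> v \<and> v < Suc m")
    case True
    then show ?thesis unfolding h_def using carried_le2[OF sm] by blast
  next
    case False
    then have "v = 0 \<or> m < v" by (auto simp: One_nat_def)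
    then show ?thesis using h0 hm by auto
  qed
  have eq: "{v. 0 < h v} = {v \<in> {1..m}. 0 < h v}"
  proof (intro equalityI subsetI)
    fix v assume "v \<in> {v. 0 < h v}"
    then have "v \<noteq> 0" "\<not> m < v" using h0 hm[of v] by (auto intro: ccontr)
    then show "v \<in> {v \<in> {1..m}. 0 < h v}" using \<open>v \<in> {v. 0 < h v}\<close> by (simp add: One_nat_def)
  qed auto
  show "finite {v. 0 < h v}" unfolding eq by simp
  have S: "{x. 0 < count S x} = set_mset S" by (simp only: count_greater_zero_iff Collect_mem_eq)
  have "card {v \<in> {1..m}. 0 < h v} \<le> card {x. 0 < count S x} * L"
    unfolding h_def by (rule carried_card[OF L]) (use out in \<open>simp_all add: S One_nat_def\<close>)
  then show "card {v. 0 < h v} < card (set_mset S) * L + 1" unfolding eq S by simp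
  show "(\<Sum>v\<in>{1..m}. h v * v) \<le> sum_mset S"
    unfolding h_def sum_mset_eq_sum_count[OF finite_atLeastAtMost m] by (rule carried_sum_le[OF sm order_refl])
  show "ssum h {1..m} \<inter> {..m} = ssum (count S) {1..m} \<inter> {..m}"
    unfolding h_def by (rule carried_ssum[OF sm order_refl])
qed

lemma time_budget:
  fixes n m J L' A \<rho> E F :: nat
  assumes "t1 \<le> 0 + 20 + 3 * n" "t2 \<le> t1 + 3 + 3 * J" "t3 \<le> t2 + 6 + J * (15 + 8 * (20 * J))"
    "t4 \<le> t3 + 20 + 12 * (n + m)" "t5 \<le> t4 + 100 + 30 * m + 3 * L'"
    "t6 \<le> t5 + 30 + 8 * \<rho> + 4 * m + 20 * A + E" "t7 \<le> t6 + 2 + F" "t8 \<le> t7 + 5 + 6 * (m + 1)"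
    "n \<le> m" "\<rho> \<le> 2 * m + 1"
  shows "t8 \<le> 500 + 100 * m + 3 * L' + 500 * ((J + 1) * (J + 1)) + 20 * A + E + F"
proof -
  have "J * (15 + 8 * (20 * J)) = 15 * J + 160 * (J * J)" by (simp add: distrib_left)
  moreover have "(J + 1) * (J + 1) = J * J + 2 * J + 1" by (simp add: distrib_left distrib_right)
  ultimately show ?thesis using assms by (simp add: distrib_left)
qed

section \<open>Correctness and cost of the whole program\<close>

lemma MAIN_spec:
  fixes u :: nat and S :: "nat multiset"
  assumes u: "0 < u" and S: "set_mset S \<subseteq> {1..u}" and ps: "represents ps S"
  defines "m \<equiv> max 1 (min u (sum_mset S))" and "n \<equiv> card (set_mset S)"
  shows "wp ((u + sum_mset S + 2) ^ 300) MAIN (\<lambda>R' M' t'. outputs_set (R', M') (subset_sums_upto u S) \<and>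
    (\<exists>L L' r. m < 2 ^ L \<and> 2 ^ L \<le> 2 * m + 1 \<and> 2 ^ L' \<le> 2 * (n * L + 1) + 1 \<and> threshold m (n * L + 1) r \<and>
      t' \<le> 10 ^ 8 * (L * L * (m * m div r + 1)) \<and> t' \<le> 10 ^ 8 * ((sum_mset S + 1) * L' * L)))
    (fst (initial_state u ps)) (snd (initial_state u ps)) 0"
proof -
  define s where "s = sum_mset S"
  define g where "g = u + s + 2"
  \<comment> \<open>The dominant stored values are of order \<open>z ^ 240\<close>, the squares of
    the scale whose roots are taken; the exponent 300 leaves room for constants.\<close>
  define G where "G = g ^ 300"
  define z where "z = m + 2"
  define R where "R = fst (initial_state u ps)"
  define M where "M = snd (initial_state u ps)"
  have m1: "1 \<le> m" by (simp add: m_def)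
  have ms: "m \<le> s + 1" "m \<le> u" using u by (auto simp: m_def s_def One_nat_def)
  have g3: "3 \<le> g" using u by (simp add: g_def)
  have z3: "3 \<le> z" using m1 by (simp add: z_def)
  have zg: "z \<le> g" using ms by (simp add: z_def g_def)
  note rep = represents_sum[OF ps]
  have n: "length ps = n" by (simp add: rep(2) n_def)
  note su = subset_sums_upto_eq[OF S u, folded m_def]
  have nm: "n \<le> m" using card_mono[OF _ su(2)] by (simp add: n_def)
  \<comment> \<open>\<open>59049 = 3 ^ 10\<close>: the ten powers of \<open>g\<close> between 290
    and 300 absorb any constant up to this one.\<close>
  have zG: "59049 * z ^ k \<le> G" if "k \<le> 290" for k
  proof -
    have "59049 * z ^ k \<le> 59049 * g ^ 290"
      using zg g3 that power_mono[of z g k] power_increasing[of k 290 g] by (intro mult_le_mono2) linarith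
    also have "\<dots> \<le> g ^ (290 + 10)" by (rule power_absorb[OF g3]) simp
    finally show ?thesis by (simp add: G_def)
  qed
  have gG: "g < G" using power_absorb[OF g3, of 2 299 1] g3 by (simp add: G_def)
  have M: "M (2 * i) = fst (ps ! i) \<and> M (2 * i + 1) = snd (ps ! i)" if "i < n" for i
    using that n by (auto simp: M_def initial_state_def One_nat_def)
  have M0: "M a = 0" if "2 * n \<le> a" for a using that n by (simp add: M_def initial_state_def)
  have R: "R 0 = u" "R 1 = n" using n by (simp_all add: R_def initial_state_def)
  have zz: "z \<le> z ^ 6" "z ^ 1 = z" using z3 self_le_power[of z 6] by simp_all
  have Q2: "2 * z \<le> z ^ 6" using power_absorb[OF z3, of 2 5 1] by simp
  define post where "post = (\<lambda>(R'::nat\<Rightarrow>nat) (M'::nat\<Rightarrow>nat) t'. outputs_set (R', M') (subset_sums_upto u S) \<and>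
    (\<exists>L L' r. m < 2 ^ L \<and> 2 ^ L \<le> 2 * m + 1 \<and> 2 ^ L' \<le> 2 * (n * L + 1) + 1 \<and> threshold m (n * L + 1) r \<and>
      t' \<le> 10 ^ 8 * (L * L * (m * m div r + 1)) \<and> t' \<le> 10 ^ 8 * ((sum_mset S + 1) * L' * L)))"
  have sizes: "wp G SIZES (\<lambda>R' M' t'. M' = M \<and> same {2, 3, 7, 10, 11, 12, 18, 19, 20} R' R \<and>
    R' 2 = m \<and> R' 3 = s \<and> R' 12 = z ^ 6 \<and> R' 10 = z ^ 120 \<and> R' 11 = z ^ 150 \<and>
    t' \<le> 0 + 20 + 3 * n) R M 0"
    unfolding z_def m_def s_def
  proof (rule SIZES_spec[OF R])
    show "(\<Sum>i<n. M (2 * i) * M (2 * i + 1)) = sum_mset S" using rep(1) M n by simp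
    show "(max 1 (min u (sum_mset S)) + 2) ^ 150 < G"
      using zG[of 150] z3 unfolding z_def m_def by (simp add: less_le_trans[rotated])
    show "u < G" "sum_mset S < G" "n < G" using gG nm ms unfolding g_def s_def by linarith+
  qed
  have "wp G MAIN post R M 0"
    unfolding MAIN_def
  proof (rule wp_SqI[OF sizes], elim conjE, goal_cases)
    case A: (1 R1 M1 t1)
    have r1: "R1 0 = u" "R1 1 = n" "R1 8 = R 8" using R by (simp_all add: same_eq[OF A(2)])
    have bl: "2 * z ^ 6 + 2 \<le> G" using zG[of 6] z3 Q2 by linarith
    show ?case
    proof (rule wp_SqI[OF wp_BITLEN[where N = "z ^ 6"]], goal_cases)
      case (6 R2 M2 t2)
      define J where "J = R2 8"
      have B: "M2 = M" "same {8, 9} R2 R1" "z ^ 6 < 2 ^ J" "2 ^ J \<le> 2 * z ^ 6 + 1" "t2 \<le> t1 + 3 + 3 * J"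
        using 6 A(1) unfolding J_def by blast+
      interpret fixpoint_table G "z ^ 120" "z ^ 150" "z ^ 6" "z ^ 6" "1 / real z ^ 52" J
        by (rule fixpoint_parameters[OF z3 _ B(3,4)]) (use zG[of 150] in linarith)
      define Q where "Q = z ^ 6"
      have r2: "R2 1 = n" "R2 2 = m" "R2 12 = Q" "R2 8 = J"
        using r1 A by (simp_all add: same_eq[OF B(2)] Q_def J_def)
      have c2: "consts_ok R2" using A by (simp add: consts_ok_def same_eq[OF B(2)])
      have table: "wp G TABLE (\<lambda>R' M' t'. table_ok M' \<and> same {Q..<3 * Q} M' M2 \<and>
        same {18, 19, 20, 22, 23, 24, 25, 26} R' R2 \<and> t' \<le> t2 + 6 + J * (15 + 8 * (20 * J))) R2 M2 t2"
        unfolding Q_def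
      proof (rule TABLE_spec[OF c2 r2(4)])
        show "9 \<le> z ^ 120" using power_absorb[OF z3, of 9 120 0] by simp
        \<comment> \<open>The scale \<open>z ^ 120\<close> is the 20th power of
          \<open>z ^ 6 < 2 ^ J\<close>, hence \<open>20 * J\<close> rounds of bisection.\<close>
        have "(z ^ 6) ^ 20 < (2 ^ J) ^ 20" using B(3) by (rule power_strict_mono) auto
        then have "z ^ 120 < 2 ^ (20 * J)" by (simp add: mult.commute flip: power_mult)
        then show "z ^ 120 + 1 \<le> 2 ^ (20 * J)" by linarith
        have "z ^ 120 * z ^ 120 = z ^ 240" by (simp flip: power_add)
        moreover have "0 < z ^ 240" using z3 by simp
        ultimately show "2 * (z ^ 120 * z ^ 120) < G" using zG[of 240] by linarith
        show "z ^ 120 \<le> z ^ 150" using z3 by (intro power_increasing) auto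
        have "sqrt (2 * real (z ^ 120)) \<le> 2 * real z ^ 60"
          by (rule real_le_lsqrt) (auto simp: power_mult_distrib simp flip: power_mult)
        moreover have "real (7 * z ^ 60) \<le> real (z ^ 68)"
          using power_absorb[OF z3, of 7 8 60] by (simp only: of_nat_le_iff) simp
        moreover have "1 \<le> real z ^ 60" using z3 by (intro one_le_power) auto
        moreover have "1 / real z ^ 52 * real (z ^ 120) = real z ^ 68"
          using z3 by (simp add: field_simps flip: power_add)
        ultimately show "sqrt (2 * real (z ^ 120)) + 5 \<le> 1 / real z ^ 52 * real (z ^ 120)" by simp
        show "1 \<le> J"
        proof (rule ccontr)
          assume "\<not> 1 \<le> J"
          then have "J = 0" by linarith
          then show False using B(3) zz(1) z3 by simp
        qed
      qed
      show ?case
      proof (rule wp_SqI[OF table], elim conjE, goal_cases)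
        case C: (1 R3 M3 t3)
        have r3: "R3 1 = n" "R3 2 = m" "R3 12 = Q" using r2 by (simp_all add: same_eq[OF C(3)])
        have c3: "consts_ok R3" using c2 by (simp add: consts_ok_def same_eq[OF C(3)])
        have nQ: "2 * n \<le> Q" "2 * m + 2 \<le> Q" using nm Q2 by (simp_all add: Q_def z_def)
        have M3: "M3 a = M a" if "a < Q \<or> 3 * Q \<le> a" for a
          using that B(1) by (auto simp: same_eq[OF C(2)])
        define f where "f = carried m (Suc m) (count S)"
        define s' where "s' = (\<Sum>v\<in>{1..m}. f v * v)"
        have counts: "wp G COUNTS (\<lambda>R' M' t'. (\<forall>v<2 * m + 2. M' (13 * Q + v) = f v) \<and>
          same {13 * Q..<14 * Q} M' M3 \<and> same {18, 20, 21, 22} R' R3 \<and>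
          R' 18 = s' \<and> t' \<le> t3 + 20 + 12 * (n + m)) R3 M3 t3"
          unfolding Q_def f_def s'_def
        proof (rule COUNTS_spec[OF r3[unfolded Q_def] nQ[unfolded Q_def], where x = "\<lambda>i. fst (ps ! i)" and s = s])
          fix i assume i: "i < n"
          then have "2 * i + 1 < Q" using nQ by linarith
          moreover have "fst (ps ! i) \<in> {1..m}" using rep(3)[of i] i n su(2) by auto
          ultimately show "M3 (2 * i) = fst (ps ! i) \<and> M3 (2 * i + 1) = count S (fst (ps ! i)) \<and> fst (ps ! i) \<le> m"
            using M[OF i] M3 rep(3)[of i] i n by simp
        next
          fix v assume "0 < count S v"
          then show "\<exists>i<n. fst (ps ! i) = v" using rep(4)[of v] n by simp
        next
          show "count S 0 = 0" using su(2) by (auto simp: count_eq_zero_iff One_nat_def)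
          show "M3 (13 * z ^ 6 + v) = 0" if "v < 2 * m + 2" for v
            using M3[of "13 * Q + v"] M0[of "13 * Q + v"] nQ by (simp add: Q_def)
          show "(\<Sum>v\<in>{1..m}. count S v * v) = s"
            unfolding s_def by (rule sum_mset_eq_sum_count[symmetric]) (use su(2) in auto)
          show "s < G" using gG by (simp add: g_def)
        qed
        show ?case
        proof (rule wp_SqI[OF counts], elim conjE, goal_cases)
          case D: (1 R4 M4 t4)
          have r4: "R4 1 = n" "R4 2 = m" using r3 by (simp_all add: same_eq[OF D(3)])
          have c4: "consts_ok R4" using c3 by (simp add: consts_ok_def same_eq[OF D(3)])
          have mm: "m * m \<le> z ^ 2" by (simp add: z_def power2_eq_square)
          have mmG: "16 * m * m + 100 \<le> G"
          proof -
            have "1 \<le> z ^ 2" using z3 by simp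
            then have "16 * (m * m) + 100 * 1 \<le> 116 * z ^ 2" using mm by linarith
            then show ?thesis using zG[of 2] by (simp add: mult.assoc)
          qed
          have m2G: "2 * m + 2 \<le> G" using zG[of 1] by (simp add: z_def)
          show ?case
          proof (rule wp_SqI[OF CHOOSE_spec[OF r4 D(4) m1 nm mmG m2G]], elim conjE exE, goal_cases)
            case E: (1 R5 M5 t5 L L' r)
            define \<rho> where "\<rho> = R5 5"
            define A where "A = total (small_blocks f \<rho>)"
            note cf = carried_facts[OF su(2) E(3), folded f_def n_def s_def s'_def]
            have r5: "R5 5 = \<rho>" "R5 2 = m" using r4 by (simp_all add: same_eq[OF E(2)] \<rho>_def)
            have c5: "consts_ok R5" using c4 by (simp add: consts_ok_def same_eq[OF E(2)])
            have \<rho>: "\<rho> = (if s' * L' \<le> m * m div r * L then 2 ^ L else r)" using E(8) by (simp add: \<rho>_def)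
            obtain b where b: "r = 2 ^ b" "r \<le> 2 * m" using E(7) by (auto simp: threshold_def)
            obtain a0 where a0: "\<rho> = 2 ^ a0" using \<rho> b(1) by (cases "s' * L' \<le> m * m div r * L") auto
            have \<rho>m: "\<rho> \<le> 2 * m + 1" using \<rho> b(2) E(4) by (auto split: if_splits)
            have A1: "A \<le> 2 + 3 * s'" unfolding A_def s'_def by (rule total_small_blocks_le_sum) (use cf(1,2) in auto)
            have A2: "A \<le> 2 + 2 * (\<rho> * min (n * L + 1) \<rho>)"
              unfolding A_def by (rule total_small_blocks_le[OF cf(1,3,5,4)])
            have AQ: "4 * A \<le> Q"
            proof -
              have "\<rho> * min (n * L + 1) \<rho> \<le> (2 * z) * (2 * z)" using \<rho>m by (intro mult_le_mono) (simp_all add: z_def)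
              then have "A \<le> 2 + 8 * z ^ 2" using A2 by (simp add: power2_eq_square)
              moreover have "1 \<le> z ^ 2" using z3 by simp
              moreover have "40 * z ^ 2 \<le> z ^ (2 + 4)" by (rule power_absorb[OF z3]) simp
              ultimately show ?thesis by (simp add: Q_def)
            qed
            have \<rho>Q: "\<rho> \<le> Q" "m + 1 \<le> Q" using \<rho>m nQ m1 by linarith+
            have tab5: "table_ok M5"
              unfolding E(1) by (rule table_ok_same[OF C(1) D(2)[unfolded Q_def]]) auto
            have M5: "M5 (13 * Q + i) = f i" if "i < 2 * m + 2" for i using D(1) E(1) that by simp
            have len: "length (small_blocks f \<rho>) \<le> 2 ^ L'"
            proof -
              have "card {v. v < \<rho> \<and> 0 < f v} \<le> card {v. 0 < f v}" by (rule card_mono[OF cf(4)]) auto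
              then show ?thesis unfolding length_small_blocks using cf(5) E(5) by linarith
            qed
            have small: "wp G SMALL_SUMS (\<lambda>R' M' t'. bits M' (14 * Q) (m + 1) (ssum f {1..<\<rho>}) \<and>
              same ({13..<17} \<union> {21..<120}) R' R5 \<and> same ({3 * Q..<13 * Q} \<union> {14 * Q..<15 * Q}) M' M5 \<and>
              t' \<le> t5 + 30 + 8 * \<rho> + 4 * m + 20 * A + L' * (2 + 400 * (J + 1) * A)) R5 M5 t5"
              unfolding Q_def
              by (rule SMALL_SUMS_spec[OF c5 r5 tab5 _ cf(1) A_def[symmetric] AQ[unfolded Q_def] \<rho>Q[unfolded Q_def] len])
                (use M5 \<rho>m in \<open>simp add: Q_def\<close>)
            show ?case
            proof (rule wp_SqI[OF small], elim conjE, goal_cases)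
              case F: (1 R6 M6 t6)
              have r6: "R6 5 = 2 ^ a0" "R6 2 = m" using r5 a0 by (simp_all add: same_eq[OF F(2)])
              have c6: "consts_ok R6" using c5 by (simp add: consts_ok_def same_eq[OF F(2)])
              have tab6: "table_ok M6"
                by (rule table_ok_same[OF tab5 F(3)[unfolded Q_def]]) auto
              have M6: "M6 (13 * Q + i) = f i" if "i < 2 * m + 2" for i
                using M5[OF that] that nQ by (simp add: same_eq[OF F(3)])
              have large: "wp G LARGE_LOOP (\<lambda>R' M' t'. bits M' (14 * Q) (m + 1) (ssum f {1..m}) \<and>
                same ({6} \<union> {13..<17} \<union> {21..<120}) R' R6 \<and> same ({3 * Q..<13 * Q} \<union> {14 * Q..<17 * Q}) M' M6 \<and>
                t' \<le> t6 + 2 + 7001 * (J + 1) * (J + 1) * (2 * (m * (m div 2 ^ a0)))) R6 M6 t6"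
                unfolding Q_def
              proof (rule LARGE_LOOP_spec[OF c6 r6(2,1) tab6 m1])
                show "M6 (13 * z ^ 6 + i) = f i" if "i < 2 * m + 2" for i using M6[OF that] by (simp add: Q_def)
                show "f i < G" for i using cf(3)[of i] g3 gG by linarith
                show "f i = 0" if "m < i" for i using cf(2)[OF that] .
                show "bits M6 (14 * z ^ 6) (m + 1) (ssum f {1..<2 ^ a0})" using F(1) a0 by (simp add: Q_def)
                have "68 * z ^ 2 \<le> z ^ (2 + 4)" by (rule power_absorb[OF z3]) simp
                then show "68 * m * m \<le> z ^ 6" using mm by simp
                have "m * m * m \<le> z * z * z" by (intro mult_le_mono) (simp_all add: z_def)
                then have "m * m * m \<le> z ^ 3" by (simp only: power3_eq_cube)
                moreover have "0 < z ^ 3" using z3 by simp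
                ultimately have "68 * (m * m * m) < G" using zG[of 3] by linarith
                then show "68 * m * m * m < G" by (simp add: mult.assoc)
                show "2 ^ a0 < G" using \<rho>m m2G a0 by linarith
              qed
              show ?case
              proof (rule wp_SqI[OF large], elim conjE, goal_cases)
                case H: (1 R7 M7 t7)
                have r7: "R7 2 = m" using r6 by (simp add: same_eq[OF H(2)])
                have c7: "consts_ok R7" using c6 by (simp add: consts_ok_def same_eq[OF H(2)])
                have X: "subset_sums_upto u S = ssum f {1..m} \<inter> {..<m + 1}"
                proof -
                  have "{..<m + 1} = {..m}" by auto
                  then show ?thesis using su(1) cf(7) by simp
                qed
                have Xm: "subset_sums_upto u S \<subseteq> {..m}" unfolding X by auto
                have bs: "bits M7 (14 * z ^ 6) (m + 1) (subset_sums_upto u S)"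
                  unfolding X using H(1) by (simp only: bits_Int Q_def)
                have out: "wp G OUTPUT (\<lambda>R' M' t'. outputs_set (R', M') (subset_sums_upto u S) \<and>
                    t' \<le> t7 + 5 + 6 * (m + 1)) R7 M7 t7"
                  by (rule OUTPUT_spec[OF c7 r7 bs Xm \<rho>Q(2)[unfolded Q_def]])
                show ?case
                proof (rule wp_mono[OF out], elim conjE)
                  fix R8 M8 t8
                  assume o: "outputs_set (R8, M8) (subset_sums_upto u S)" and t8: "t8 \<le> t7 + 5 + 6 * (m + 1)"
                  have "7001 * (J + 1) * (J + 1) * (2 * (m * (m div 2 ^ a0))) =
                      14002 * ((J + 1) * (J + 1)) * (m * (m div \<rho>))" by (simp add: a0 mult_ac)
                  note H4 = H(4)[unfolded this]
                  note tb = time_budget[OF A(8) B(5) C(4) D(5) E(9) F(4) H4 t8 nm \<rho>m]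
                  have J6: "2 ^ J \<le> 2 * (m + 2) ^ 6 + 1" using B(4) by (simp add: z_def)
                  note cb = cost_bounds[OF m1 nm E(3-6) J6 E(7) cf(6)[folded s'_def] ms(1) \<rho> A1 A2 tb]
                  show "post R8 M8 t8"
                    unfolding post_def
                    by (intro conjI o, rule exI[of _ L], rule exI[of _ L'], rule exI[of _ r])
                      (use E(3,4,6,7) cb in \<open>simp add: s_def\<close>)
                qed
              qed
            qed
          qed
        qed
      qed
    qed (use A bl in auto)
  qed
  then show ?thesis unfolding post_def R_def M_def G_def g_def s_def .
qed

section \<open>Comparison with the time bound\<close>

lemma time_bound_eq:
  "time_bound u S = min (sqrt (card (set_mset S)) * real u * log 2 u powr (5/2))
    (min (real u powr (4/3) * (log 2 u)\<^sup>2)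
      (real (sum_mset S) * log 2 (sum_mset S) * log 2 (card (set_mset S) * log 2 u)))"
  unfolding time_bound_def Let_def by simp

text \<open>Rests on the convention \<open>log 2 0 = 0\<close>: for \<open>u = 1\<close> or without
  elements the argument of the outermost logarithm is 0; otherwise it is at least 1.\<close>

lemma time_bound_nonneg:
  assumes "0 < u"
  shows "0 \<le> time_bound u S"
proof -
  have "0 \<le> log 2 (real n)" for n :: nat
    by (cases "n = 0") (auto simp: log_def)
  moreover have "0 \<le> log 2 (real n * log 2 (real u))" for n :: nat
  proof (cases "n = 0 \<or> u = 1")
    case False
    then have "1 \<le> real n" "log 2 2 \<le> log 2 (real u)" using assms by (auto simp: One_nat_def)
    then have "1 * 1 \<le> real n * log 2 (real u)" by (intro mult_mono) auto
    then show ?thesis by simp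
  qed (auto simp: log_def)
  moreover define s where "s = sum_mset S"
  ultimately show ?thesis
    unfolding time_bound_eq s_def[symmetric] by (intro min.boundedI mult_nonneg_nonneg) auto
qed

text \<open>With \<open>Y = m\<^sup>2 / r\<close> the first integer bound is of order
  \<open>lu\<^sup>2 * Y\<close>. The condition \<open>m\<^sup>2 \<le> r ^ 3\<close> bounds
  \<open>Y\<close> by \<open>u powr (4/3)\<close>, and
  \<open>m\<^sup>2 \<le> r\<^sup>2 * (n * L + 1)\<close> bounds it by a multiple of
  \<open>u * sqrt (n * lu)\<close>. The hypotheses \<open>3 \<le> u\<close> and
  \<open>2 \<le> s\<close> keep all logarithms away from 0, so that additive constants can be
  absorbed.\<close>

lemma real_time_bounds:
  fixes u s n m L L' r t :: nat and c :: real
  assumes u: "3 \<le> u" and s: "2 \<le> s" and n: "1 \<le> n" and m: "m = max 1 (min u s)"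
    and L: "m < 2 ^ L" "2 ^ L \<le> 2 * m + 1" and L': "2 ^ L' \<le> 2 * (n * L + 1) + 1"
    and thr: "threshold m (n * L + 1) r" and c: "0 \<le> c"
    and t: "real t \<le> c * real (L * L * (m * m div r + 1))" "real t \<le> c * real ((s + 1) * L' * L)"
  shows "real t \<le> 81 * c * (sqrt n * real u * log 2 u powr (5/2))"
    "real t \<le> 81 * c * (real u powr (4/3) * (log 2 u)\<^sup>2)"
    "real t \<le> 81 * c * (real s * log 2 s * log 2 (n * log 2 u))"
proof -
  define lu where "lu = log 2 (real u)"
  define ls where "ls = log 2 (real s)"
  define x where "x = real n * lu"
  have mus: "1 \<le> m" "m \<le> u" "m \<le> s" using u s unfolding m by auto
  have log_exp: "log 2 (2 ^ k) = real k" for k by (simp add: log_nat_power)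
  \<comment> \<open>From \<open>2 ^ 3 \<le> 3 ^ 2\<close> the logarithm of \<open>u\<close> is at
    least 3/2. It has to exceed 1 by a fixed amount, since otherwise the outer logarithm
    \<open>log 2 x\<close> could not absorb constants.\<close>
  have "2 ^ 3 \<le> (real u) ^ 2" using power_mono[of 3 "real u" 2] u by simp
  then have "log 2 (2 ^ 3) \<le> log 2 ((real u) ^ 2)" using u by (subst log_le_cancel_iff) auto
  moreover have "log 2 (real u ^ 2) = real 2 * log 2 (real u)" by (rule log_nat_power) (use u in simp)
  ultimately have lu: "3 / 2 \<le> lu" unfolding log_exp lu_def by simp
  have ls: "1 \<le> ls" using s unfolding ls_def by (simp add: le_log_iff)
  have LL: "real L \<le> 2 + log 2 (real m)"
  proof -
    have "real (2 ^ L) \<le> real (4 * m)" using L(2) mus(1) by (intro of_nat_mono) linarith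
    then have "log 2 (2 ^ L) \<le> log 2 (4 * real m)" using mus(1) by (subst log_le_cancel_iff) auto
    also have "log 2 (4 * real m) = log 2 (2 ^ 2) + log 2 (real m)" using mus(1) by (subst log_mult) auto
    finally show ?thesis unfolding log_exp by simp
  qed
  have "log 2 (real m) \<le> lu" "log 2 (real m) \<le> ls" using mus unfolding lu_def ls_def by auto
  then have Lb: "real L \<le> 3 * lu" "real L \<le> 3 * ls" using LL lu ls by linarith+
  have L1: "1 \<le> L"
  proof (rule ccontr)
    assume "\<not> 1 \<le> L"
    then have "L = 0" by simp
    then show False using L(1) mus(1) by simp
  qed
  have "1 * 1 \<le> n * L" using n L1 by (intro mult_le_mono)
  then have nL: "1 \<le> n * L" by simp
  have nLx: "real (n * L) \<le> 3 * x" using mult_left_mono[OF Lb(1), of "real n"] by (simp add: x_def)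
  have "1 * (3 / 2) \<le> real n * lu" using n lu by (intro mult_mono) auto
  then have x: "3 / 2 \<le> x" by (simp add: x_def)
  have lx: "1 \<le> 2 * log 2 x"
  proof -
    have "(3 / 2) ^ 2 \<le> x ^ 2" using x by (intro power_mono) auto
    then have "2 \<le> x ^ 2" by (simp add: power2_eq_square)
    then have "log 2 2 \<le> log 2 (x ^ 2)" using x by (subst log_le_cancel_iff) auto
    then show ?thesis using x by (simp add: log_nat_power)
  qed
  have L'b: "real L' \<le> 9 * log 2 x"
  proof -
    have "2 * (n * L + 1) + 1 = 2 * (n * L) + 3" by simp
    then have "2 ^ L' \<le> 5 * (n * L)" using L' nL by linarith
    then have "real (2 ^ L') \<le> real (5 * (n * L))" by (simp only: of_nat_le_iff)
    then have "2 ^ L' \<le> 16 * x" using nLx x by simp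
    then have "log 2 (2 ^ L') \<le> log 2 (16 * x)" using x by (subst log_le_cancel_iff) auto
    also have "log 2 (16 * x) = log 2 (2 ^ 4) + log 2 x" using x by (subst log_mult) auto
    finally show ?thesis unfolding log_exp using lx by simp
  qed
  have "c * real ((s + 1) * L' * L) \<le> c * ((2 * real s) * (9 * log 2 x) * (3 * ls))"
    using c s L'b Lb(2) ls lx unfolding of_nat_mult by (intro mult_left_mono mult_mono) auto
  also have "\<dots> = 54 * c * (real s * ls * log 2 x)" by (simp add: algebra_simps)
  also have "\<dots> \<le> 81 * c * (real s * ls * log 2 x)"
    using c ls lx by (intro mult_right_mono) auto
  finally show "real t \<le> 81 * c * (real s * log 2 s * log 2 (n * log 2 u))"
    using t(2) unfolding ls_def x_def lu_def by linarith
  have r: "0 < r" "r \<le> 2 * m" "m * m \<le> r * r * (n * L + 1)" "m * m \<le> r * r * r" using thr by (auto simp: threshold_def)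
  define Y where "Y = real m * real m / real r"
  have Yn: "real (m * m div r + 1) \<le> 3 * Y"
  proof -
    have "real (m * m div r) \<le> real (m * m) / real r" by (rule of_nat_div_le_of_nat)
    moreover have "1 \<le> 2 * Y"
    proof -
      have "real r \<le> 2 * real m" using r(2) by simp
      also have "\<dots> \<le> 2 * (real m * real m)" using mus(1) by simp
      finally show ?thesis using r(1) by (simp add: Y_def field_simps)
    qed
    ultimately show ?thesis by (simp add: Y_def)
  qed
  have Y0: "0 \<le> Y" by (simp add: Y_def)
  have tY: "real t \<le> 27 * c * (lu\<^sup>2 * Y)"
  proof -
    have "c * real (L * L * (m * m div r + 1)) \<le> c * ((3 * lu) * (3 * lu) * (3 * Y))"
      unfolding of_nat_mult using c Yn Lb(1) lu Y0 by (intro mult_left_mono mult_mono) auto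
    also have "\<dots> = 27 * c * (lu\<^sup>2 * Y)" by (simp add: power2_eq_square)
    finally show ?thesis using t(1) by linarith
  qed
  have "Y \<le> real u powr (4 / 3)"
  proof -
    have "real (m * m) \<le> real (r * r * r)" using r(4) by (simp only: of_nat_le_iff)
    then have "real m powr 2 \<le> real r powr 3" using mus(1) r(1) by (simp add: powr_numeral power2_eq_square power3_eq_cube)
    then have "(real m powr 2) powr (1 / 3) \<le> (real r powr 3) powr (1 / 3)" by (intro powr_mono2) auto
    then have le: "real m powr (2 / 3) \<le> real r" unfolding powr_powr by simp
    have "real m * real m = real m powr (4 / 3) * real m powr (2 / 3)"
      using mus(1) by (simp add: powr_numeral power2_eq_square flip: powr_add)
    also have "\<dots> \<le> real m powr (4 / 3) * real r" using le by (intro mult_left_mono) auto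
    finally have "Y \<le> real m powr (4 / 3)" using r(1) by (simp add: Y_def field_simps)
    also have "\<dots> \<le> real u powr (4 / 3)" using mus by (intro powr_mono2) auto
    finally show ?thesis .
  qed
  then have "27 * c * (lu\<^sup>2 * Y) \<le> 81 * c * (lu\<^sup>2 * real u powr (4 / 3))"
    using c Y0 by (intro mult_mono) auto
  then show "real t \<le> 81 * c * (real u powr (4/3) * (log 2 u)\<^sup>2)"
    using tY unfolding lu_def by (simp only: mult.commute[of "real u powr (4/3)"])
  have "Y \<le> real u * (sqrt n * (3 * sqrt lu))"
  proof -
    have "real (m * m) \<le> real (r * r * (n * L + 1))" using r(3) by (simp only: of_nat_le_iff)
    also have "\<dots> \<le> real r * real r * (6 * x)"
    proof -
      have "real (n * L + 1) \<le> 6 * x" using nLx nL x by simp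
      then show ?thesis unfolding of_nat_mult by (intro mult_left_mono) auto
    qed
    finally have "sqrt (real (m * m)) \<le> sqrt (real r * real r * (6 * x))" by (rule real_sqrt_le_mono)
    then have "real m \<le> real r * sqrt (6 * x)" by (simp add: real_sqrt_mult)
    then have "real m * real m \<le> real m * (real r * sqrt (6 * x))" by (intro mult_left_mono) auto
    then have "Y \<le> real m * sqrt (6 * x)" using r(1) by (simp add: Y_def field_simps)
    also have "\<dots> \<le> real u * sqrt (9 * x)" using mus x by (intro mult_mono real_sqrt_le_mono) auto
    also have "sqrt (9 * x) = sqrt n * (3 * sqrt lu)"
    proof -
      have "sqrt 9 = (3::real)" by (rule real_sqrt_unique) auto
      then show ?thesis by (simp add: x_def real_sqrt_mult)
    qed
    finally show ?thesis .
  qed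
  then have "27 * c * (lu\<^sup>2 * Y) \<le> 27 * c * (lu\<^sup>2 * (real u * (sqrt n * (3 * sqrt lu))))"
    using c by (intro mult_left_mono) auto
  also have "\<dots> = 81 * c * (sqrt n * real u * (lu\<^sup>2 * sqrt lu))" by (simp add: algebra_simps)
  also have "lu\<^sup>2 * sqrt lu = lu powr (5 / 2)"
  proof -
    have "lu powr (5 / 2) = lu powr (2 + 1 / 2)" by simp
    also have "\<dots> = lu powr 2 * lu powr (1 / 2)" by (rule powr_add)
    also have "\<dots> = lu\<^sup>2 * sqrt lu" using lu by (simp add: powr_half_sqrt powr_numeral)
    finally show ?thesis by simp
  qed
  finally show "real t \<le> 81 * c * (sqrt n * real u * log 2 u powr (5/2))" using tY unfolding lu_def by linarith
qed

text \<open>Covers the degenerate inputs for which the time bound may vanish: with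
  \<open>m \<le> 2\<close> the cost is an absolute constant.\<close>

lemma small_time:
  fixes m L r t :: nat
  assumes "m \<le> 2" "2 ^ L \<le> 2 * m + 1" "t \<le> 10 ^ 8 * (L * L * (m * m div r + 1))"
  shows "t \<le> 10 ^ 10"
proof -
  have "L < 3"
  proof (rule ccontr)
    assume "\<not> L < 3"
    then have "2 ^ 3 \<le> (2::nat) ^ L" by (intro power_increasing) auto
    then show False using assms(1,2) by simp
  qed
  moreover have "m * m div r + 1 \<le> 5"
  proof -
    have "m * m div r \<le> m * m" by (rule div_le_dividend)
    also have "\<dots> \<le> 2 * 2" using assms(1) by (intro mult_le_mono)
    finally show ?thesis by simp
  qed
  ultimately have "L * L * (m * m div r + 1) \<le> 2 * 2 * 5" by (intro mult_le_mono) auto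
  from le_trans[OF assms(3) mult_le_mono2[OF this]] show ?thesis by simp
qed

section \<open>Transfer to the RAM and the final estimate\<close>

lemma wf_st_For [simp]: "wf_st (For i e c) \<longleftrightarrow> i < temp \<and> wf_ex e \<and> wf_st c"
  by (auto simp: For_def temp_def)

lemmas program_defs = MAIN_def SIZES_def BITLEN_def TABLE_def ISQRT_def COUNTS_def CHOOSE_def UNTIL_def
  SMALL_SUMS_def SMALL_LEAVES_def LEAF_def LARGE_LOOP_def LARGE_STEP_def LARGE_LEAVES_def EXTRACT_def OUTPUT_def
  TREE_def PASS_def PASS_LOOP_def LEFTOVER_def COMBINE_def SIZE_def CLEAR_def LOAD_FIRST_def LOAD_SECOND_def EMIT_def
  CONVOLVE_def TWIDDLES_def TWIDDLE_STEP_def CMUL_def FORWARD_def FORWARD_STEP_def COPY_BACK_def POINTWISE_def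
  BACKWARD_def BACKWARD_STEP_def

lemma wf_MAIN: "wf_st MAIN"
  unfolding program_defs by (simp add: temp_def)

text \<open>Multiplicities are bounded by the total because all values are at least 1, and the
  number of pairs by \<open>u\<close> because the values are distinct.\<close>

lemma initial_bounded:
  assumes S: "set_mset S \<subseteq> {1..u}" and ps: "represents ps S"
  shows "fst (initial_state u ps) i < u + sum_mset S + 2" "snd (initial_state u ps) i < u + sum_mset S + 2"
proof -
  note rep = represents_sum[OF ps]
  have "length ps \<le> u" unfolding rep(2) using card_mono[OF _ S] by simp
  then show "fst (initial_state u ps) i < u + sum_mset S + 2" by (simp add: initial_state_def)
  show "snd (initial_state u ps) i < u + sum_mset S + 2"
  proof (cases "i < 2 * length ps")
    case True
    let ?p = "ps ! (i div 2)"
    have i: "i div 2 < length ps" using True by simp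
    have p: "fst ?p \<in># S" "snd ?p = count S (fst ?p)" using rep(3)[OF i] by auto
    have "1 \<le> fst ?p" "fst ?p \<le> u" using p(1) S by auto
    moreover have "1 * snd ?p \<le> fst ?p * snd ?p" using \<open>1 \<le> fst ?p\<close> by (rule mult_le_mono1)
    moreover have "fst ?p * snd ?p \<le> sum_mset S"
      unfolding rep(1)[symmetric] by (rule member_le_sum) (use i in auto)
    ultimately have "fst ?p \<le> u" "snd ?p \<le> sum_mset S" by linarith+
    then show ?thesis using True by (simp add: initial_state_def)
  qed (simp add: initial_state_def)
qed

theorem mainTheorem1:
  "\<exists>(c :: com) (k :: nat) (C :: real).
     \<forall>(u :: nat) (S :: nat multiset) (ps :: (nat \<times> nat) list).
       u > 0 \<longrightarrow> set_mset S \<subseteq> {1..u} \<longrightarrow> represents ps S \<longrightarrow>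
       (\<exists>t s'. exec (word_capacity k u S) c (initial_state u ps) t s'
             \<and> outputs_set s' (subset_sums_upto u S)
             \<and> real t \<le> C * (1 + time_bound u S))"
proof (rule exI[of _ "cst MAIN"], rule exI[of _ "300 * width MAIN"],
    rule exI[of _ "real (cst_time MAIN) * 10 ^ 10"], intro allI impI)
  fix u :: nat and S :: "nat multiset" and ps :: "(nat \<times> nat) list"
  assume u: "u > 0" and S: "set_mset S \<subseteq> {1..u}" and ps: "represents ps S"
  define s n m where "s = sum_mset S" and "n = card (set_mset S)" and "m = max 1 (min u s)"
  define g where "g = u + s + 2"
  obtain t1 R' M' where run: "run (g ^ 300) MAIN (initial_state u ps) t1 (R', M')"
    and out: "outputs_set (R', M') (subset_sums_upto u S)"
    and t1: "\<exists>L L' r. m < 2 ^ L \<and> 2 ^ L \<le> 2 * m + 1 \<and> 2 ^ L' \<le> 2 * (n * L + 1) + 1 \<and>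
      threshold m (n * L + 1) r \<and> t1 \<le> 10 ^ 8 * (L * L * (m * m div r + 1)) \<and> t1 \<le> 10 ^ 8 * ((s + 1) * L' * L)"
    using MAIN_spec[OF u S ps] unfolding wp_def g_def s_def n_def m_def prod.collapse add_0 by blast
  then obtain L L' r where b: "m < 2 ^ L" "2 ^ L \<le> 2 * m + 1" "2 ^ L' \<le> 2 * (n * L + 1) + 1"
    "threshold m (n * L + 1) r" "t1 \<le> 10 ^ 8 * (L * L * (m * m div r + 1))" "t1 \<le> 10 ^ 8 * ((s + 1) * L' * L)"
    by blast
  have g3: "3 \<le> g" using u by (simp add: g_def)
  have G: "100 \<le> g ^ 300" "g \<le> g ^ 300"
    using power_absorb[OF g3, of 100 300 0] self_le_power[of g 300] g3 by simp_all
  obtain R2 t2 where ex: "exec (word_capacity (300 * width MAIN) u S) (cst MAIN) (initial_state u ps) t2 (R2, M')"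
    and t2: "t2 \<le> cst_time MAIN * t1" and R2: "\<forall>r<temp. R2 r = R' r"
  proof -
    have "\<exists>R2 t2. exec (word_capacity (300 * width MAIN) u S) (cst MAIN)
        (fst (initial_state u ps), snd (initial_state u ps)) t2 (R2, snd (R', M')) \<and> t2 \<le> cst_time MAIN * t1 \<and>
        (\<forall>r<temp. R2 r = fst (R', M') r) \<and> (\<forall>r<temp. fst (R', M') r < g ^ 300) \<and> (\<forall>a. snd (R', M') a < g ^ 300)"
    proof (rule cst_correct[OF run wf_MAIN])
      show "2 \<le> g ^ 300" "100 \<le> g ^ 300" using G(1) by simp_all
      \<comment> \<open>Origin of the capacity exponent: 300 for stored values, times the largest
        number of leaves in an expression of the program.\<close>
      show "(g ^ 300) ^ width MAIN \<le> word_capacity (300 * width MAIN) u S"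
        by (simp add: word_capacity_def g_def s_def power_mult)
      show "fst (initial_state u ps) i < g ^ 300" for i
        using initial_bounded(1)[OF S ps, of i] G(2) unfolding g_def s_def by linarith
      show "snd (initial_state u ps) i < g ^ 300" for i
        using initial_bounded(2)[OF S ps, of i] G(2) unfolding g_def s_def by linarith
    qed simp
    then show ?thesis using that by auto
  qed
  have out2: "outputs_set (R2, M') (subset_sums_upto u S)"
    using out R2 by (simp add: outputs_set_def temp_def)
  have time: "real t1 \<le> 10 ^ 10 * (1 + time_bound u S)"
  \<comment> \<open>Outside this case \<open>m \<le> 2\<close>, and the summand 1 next to the time
    bound alone covers the cost. The constant \<open>10 ^ 10\<close> serves both cases, as it also
    exceeds \<open>81 * 10 ^ 8\<close>.\<close>
  proof (cases "3 \<le> u \<and> 2 \<le> s")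
    case True
    then have "S \<noteq> {#}" by (auto simp: s_def)
    then have n1: "1 \<le> n" by (simp add: n_def One_nat_def Suc_le_eq card_gt_0_iff)
    have "real t1 \<le> real (10 ^ 8 * (L * L * (m * m div r + 1)))" "real t1 \<le> real (10 ^ 8 * ((s + 1) * L' * L))"
      using b(5,6) by (simp_all only: of_nat_le_iff)
    then have "real t1 \<le> 10 ^ 8 * real (L * L * (m * m div r + 1))" "real t1 \<le> 10 ^ 8 * real ((s + 1) * L' * L)"
      by simp_all
    note rt = real_time_bounds[OF _ _ n1 m_def b(1-4) _ this]
    have "real t1 \<le> 81 * 10 ^ 8 * time_bound u S"
      unfolding time_bound_eq n_def[symmetric] s_def[symmetric] min_def using True rt by auto
    also have "\<dots> \<le> 10 ^ 10 * time_bound u S" using time_bound_nonneg[OF u, of S] by (intro mult_right_mono) auto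
    finally show ?thesis by simp
  next
    case False
    then have "m \<le> 2" using u by (auto simp: m_def)
    then have "real t1 \<le> real (10 ^ 10)" using small_time[OF _ b(2,5)] by (simp only: of_nat_le_iff)
    moreover have "10 ^ 10 * 1 \<le> 10 ^ 10 * (1 + time_bound u S)"
      using time_bound_nonneg[OF u, of S] by (intro mult_left_mono) auto
    ultimately show ?thesis by simp
  qed
  have "real t2 \<le> real (cst_time MAIN) * real t1" using t2 by (simp flip: of_nat_mult)
  also have "\<dots> \<le> real (cst_time MAIN) * (10 ^ 10 * (1 + time_bound u S))" using time by (rule mult_left_mono) simp
  finally have "real t2 \<le> (real (cst_time MAIN) * 10 ^ 10) * (1 + time_bound u S)" by (simp add: mult.assoc)
  then show "\<exists>t s'. exec (word_capacity (300 * width MAIN) u S) (cst MAIN) (initial_state u ps) t s'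
             \<and> outputs_set s' (subset_sums_upto u S)
             \<and> real t \<le> (real (cst_time MAIN) * 10 ^ 10) * (1 + time_bound u S)"
    using ex out2 by blast
qed

end
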